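(* Assume that $C\in L^1(\mathbb{R}^2)$ and $C(\mathbf 0)<\infty$. For $\varepsilon>0$ let $\tilde\mu^\varepsilon$ be the rescaled transformed fourth-order moment defined in the context, and let $$K(z):=(2\pi)^8\exp\Big(-\frac{k_0^2}{2}C(\mathbf 0)z\Big),$$ $$A(z,\xi,\zeta):=\frac{1}{2(2\pi)^2}\int_{\mathbb{R}^2}\Big[\exp\Big(\frac{k_0^2}{4}\int_0^z C\big(x+\frac{\zeta}{k_0}z'\big)dz'\Big)-1\Big]\exp(-i\xi\cdot x)\,dx .$$ Then $\tilde\mu^\varepsilon$ can be expanded as $$\begin{aligned} \tilde\mu^\varepsilon(z,\xi_1,\xi_2,\zeta_1,\zeta_2)&=K(z)\,\phi^\varepsilon(\xi_1)\phi^\varepsilon(\xi_2)\phi^\varepsilon(\zeta_1)\phi^\varepsilon(\zeta_2)\\ &+K(z)\,\phi^\varepsilon\big(\tfrac{\xi_1-\xi_2}{\sqrt2}\big)\phi^\varepsilon(\zeta_1)\phi^\varepsilon(\zeta_2)A\big(z,\tfrac{\xi_2+\xi_1}{2},\tfrac{\zeta_2+\zeta_1}{\varepsilon}\big)\\ &+K(z)\,\phi^\varepsilon\big(\tfrac{\xi_1+\xi_2}{\sqrt2}\big)\phi^\varepsilon(\zeta_1)\phi^\varepsilon(\zeta_2)A\big(z,\tfrac{\xi_2-\xi_1}{2},\tfrac{\zeta_2-\zeta_1}{\varepsilon}\big)\\ &+K(z)\,\phi^\varepsilon\big(\tfrac{\xi_1-\zeta_2}{\sqrt2}\big)\phi^\varepsilon(\zeta_1)\phi^\varepsilon(\xi_2)A\big(z,\tfrac{\zeta_2+\xi_1}{2},\tfrac{\xi_2+\zeta_1}{\varepsilon}\big)\\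 &+K(z)\,\phi^\varepsilon\big(\tfrac{\xi_1+\zeta_2}{\sqrt2}\big)\phi^\varepsilon(\zeta_1)\phi^\varepsilon(\xi_2)A\big(z,\tfrac{\zeta_2-\xi_1}{2},\tfrac{\xi_2-\zeta_1}{\varepsilon}\big)\\ &+K(z)\,\phi^\varepsilon(\zeta_1)\phi^\varepsilon(\zeta_2)A\big(z,\tfrac{\xi_2+\xi_1}{2},\tfrac{\zeta_2+\zeta_1}{\varepsilon}\big)A\big(z,\tfrac{\xi_2-\xi_1}{2},\tfrac{\zeta_2-\zeta_1}{\varepsilon}\big)\\ &+K(z)\,\phi^\varepsilon(\zeta_1)\phi^\varepsilon(\xi_2)A\big(z,\tfrac{\zeta_2+\xi_1}{2},\tfrac{\xi_2+\zeta_1}{\varepsilon}\big)A\big(z,\tfrac{\zeta_2-\xi_1}{2},\tfrac{\xi_2-\zeta_1}{\varepsilon}\big)\\ &+R^\varepsilon(z,\xi_1,\xi_2,\zeta_1,\zeta_2), \end{aligned}$$ where, for every $Z>0$, $$\sup_{z\in[0,Z]}\|R^\varepsilon(z,\cdot,\cdot,\cdot,\cdot)\|_{L^1(\mathbb{R}^2\times\mathbb{R}^2\times\mathbb{R}^2\times\mathbb{R}^2)}\longrightarrow 0\quad\text{as }\varepsilon\to0 .$$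
   Context: Fix $k_0>0$ and $r_0>0$. $C:\mathbb{R}^2\to\mathbb{R}$ is a covariance function of a real stationary field (real, even, positive definite). Its Fourier transform is $\hat C(k)=\int_{\mathbb{R}^2}C(x)e^{-ik\cdot x}dx$. Under the assumption $C\in L^1(\mathbb{R}^2)$, $C(\mathbf 0)<\infty$, the function $\hat C$ is continuous, bounded, nonnegative and in $L^1(\mathbb{R}^2)$, with $\int\hat C(k)\,dk=(2\pi)^2C(\mathbf 0)$, and $C$ is continuous and bounded. For $\varepsilon>0$ let $$\phi^\varepsilon(\xi):=\frac{r_0^2}{2\pi\varepsilon^2}\exp\Big(-\frac{r_0^2}{2\varepsilon^2}|\xi|^2\Big),\qquad \xi\in\mathbb{R}^2 .$$ For $z\ge0$ define the operator $\mathcal L^\varepsilon_z$ acting on functions $\psi(\xi_1,\xi_2,\zeta_1,\zeta_2)$ of four variables in $\mathbb{R}^2$ by $$\begin{aligned} \mathcal L^\varepsilon_z\psi(\xi_1,\xi_2,\zeta_1,\zeta_2):=\frac{k_0^2}{4(2\pi)^2}\int_{\mathbb{R}^2}\hat C(k)\Big[&-2\psi(\xi_1,\xi_2,\zeta_1,\zeta_2)\\ &+\psi(\xi_1-k,\xi_2-k,\zeta_1,\zeta_2)e^{i\frac{z}{\varepsilon k_0}k\cdot(\zeta_2+\zeta_1)}\\ &+\psi(\xi_1-k,\xi_2,\zeta_1,\zeta_2-k)e^{i\frac{z}{\varepsilon k_0}k\cdot(\xi_2+\zeta_1)}\\ &+\psi(\xi_1+k,\xi_2-k,\zeta_1,\zeta_2)e^{i\frac{z}{\varepsilon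 k_0}k\cdot(\zeta_2-\zeta_1)}\\ &+\psi(\xi_1+k,\xi_2,\zeta_1,\zeta_2-k)e^{i\frac{z}{\varepsilon k_0}k\cdot(\xi_2-\zeta_1)}\\ &-\psi(\xi_1,\xi_2-k,\zeta_1,\zeta_2-k)e^{i\frac{z}{\varepsilon k_0}(k\cdot(\zeta_2+\xi_2)-|k|^2)}\\ &-\psi(\xi_1,\xi_2-k,\zeta_1,\zeta_2+k)e^{i\frac{z}{\varepsilon k_0}(k\cdot(\zeta_2-\xi_2)+|k|^2)}\Big]dk . \end{aligned}$$ $\tilde\mu^\varepsilon(z,\cdot)$ is the unique solution in $L^2((\mathbb{R}^2)^4)$ (it also belongs to $L^1((\mathbb{R}^2)^4)$) of $$\partial_z\tilde\mu^\varepsilon=\mathcal L^\varepsilon_z\tilde\mu^\varepsilon,\qquad \tilde\mu^\varepsilon(0,\xi_1,\xi_2,\zeta_1,\zeta_2)=(2\pi)^8\phi^\varepsilon(\xi_1)\phi^\varepsilon(\xi_2)\phi^\varepsilon(\zeta_1)\phi^\varepsilon(\zeta_2).$$ Interpretation: let $u$ solve the Itô–Schrödinger equation $du=\frac{i}{2k_0}\Delta_x u\,dz+\frac{ik_0}{2}u\circ dB^\varepsilon(z,x)$ (Stratonovich) with $u(0,x)=\exp(-\varepsilon^2|x|^2/(2r_0^2))$, where $B^\varepsilon$ is a real Brownian field with covariance $\mathbb E[B^\varepsilon(z,x)B^\varepsilon(z',x')]=\min\{z,z'\}\,\varepsilon C(x-x')$. Let $\mu(z,q_1,q_2,r_1,r_2)=\mathbb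 E[u(z,x_1)u(z,x_2)\overline{u(z,y_1)u(z,y_2)}]$ with $x_1=\frac{r_1+r_2+q_1+q_2}{2}$, $y_1=\frac{r_1+r_2-q_1-q_2}{2}$, $x_2=\frac{r_1-r_2+q_1-q_2}{2}$, $y_2=\frac{r_1-r_2-q_1+q_2}{2}$, and let $\hat\mu(z,\xi_1,\xi_2,\zeta_1,\zeta_2)$ be its Fourier transform, with $\xi_j$ dual to $q_j$ and $\zeta_j$ dual to $r_j$ (kernel $e^{-i(\cdot)}$, no prefactor). Then $\tilde\mu^\varepsilon(z,\xi_1,\xi_2,\zeta_1,\zeta_2)=\hat\mu(z/\varepsilon,\xi_1,\xi_2,\zeta_1,\zeta_2)\exp\big(\frac{iz}{\varepsilon k_0}(\xi_2\cdot\zeta_2+\xi_1\cdot\zeta_1)\big)$. *)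

theory Defs
  imports "HOL-Analysis.Analysis"
begin

type_synonym vec2 = "real ^ 2"

text \<open>Phase space: a point is \<open>(\<xi>1, \<xi>2, \<zeta>1, \<zeta>2)\<close>.\<close>
type_synonym phase = "vec2 \<times> vec2 \<times> vec2 \<times> vec2"

text \<open>Covariance functions of real stationary random fields. Real coefficients suffice because
  the function is real and even. Continuity is part of the notion (mean-square continuous field):
  without it the everywhere-defined value \<open>C 0\<close> need not be the inverse Fourier
  transform of \<open>C_hat C\<close> at the origin, as the indicator function of the origin shows.\<close>
definition covariance_function :: "(vec2 \<Rightarrow> real) \<Rightarrow> bool" where
  "covariance_function C \<longleftrightarrow>
     (\<forall>x. C (- x) = C x) \<and>
     (\<forall>(S :: vec2 set) (a :: vec2 \<Rightarrow> real). finite S \<longrightarrow>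
        0 \<le> (\<Sum>x\<in>S. \<Sum>y\<in>S. a x * a y * C (x - y))) \<and>
     continuous_on UNIV C"

definition C_hat :: "(vec2 \<Rightarrow> real) \<Rightarrow> vec2 \<Rightarrow> complex" where
  "C_hat C k = (LINT x|lborel. complex_of_real (C x) * cis (- (k \<bullet> x)))"

definition phi :: "real \<Rightarrow> real \<Rightarrow> vec2 \<Rightarrow> real" where
  "phi r0 \<epsilon> \<xi> = r0\<^sup>2 / (2 * pi * \<epsilon>\<^sup>2) * exp (- (r0\<^sup>2 / (2 * \<epsilon>\<^sup>2)) * (norm \<xi>)\<^sup>2)"

definition moment_operator ::
  "real \<Rightarrow> (vec2 \<Rightarrow> real) \<Rightarrow> real \<Rightarrow> real \<Rightarrow> (phase \<Rightarrow> complex) \<Rightarrow> phase \<Rightarrow> complex" where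
  "moment_operator k0 C \<epsilon> z \<psi> = (\<lambda>(\<xi>1, \<xi>2, \<zeta>1, \<zeta>2).
     complex_of_real (k0\<^sup>2 / (4 * (2 * pi)\<^sup>2)) *
     (LINT k|lborel. C_hat C k *
       (- 2 * \<psi> (\<xi>1, \<xi>2, \<zeta>1, \<zeta>2)
        + \<psi> (\<xi>1 - k, \<xi>2 - k, \<zeta>1, \<zeta>2) * cis (z / (\<epsilon> * k0) * (k \<bullet> (\<zeta>2 + \<zeta>1)))
        + \<psi> (\<xi>1 - k, \<xi>2, \<zeta>1, \<zeta>2 - k) * cis (z / (\<epsilon> * k0) * (k \<bullet> (\<xi>2 + \<zeta>1)))
        + \<psi> (\<xi>1 + k, \<xi>2 - k, \<zeta>1, \<zeta>2) * cis (z / (\<epsilon> * k0) * (k \<bullet> (\<zeta>2 - \<zeta>1)))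
        + \<psi> (\<xi>1 + k, \<xi>2, \<zeta>1, \<zeta>2 - k) * cis (z / (\<epsilon> * k0) * (k \<bullet> (\<xi>2 - \<zeta>1)))
        - \<psi> (\<xi>1, \<xi>2 - k, \<zeta>1, \<zeta>2 - k)
            * cis (z / (\<epsilon> * k0) * (k \<bullet> (\<zeta>2 + \<xi>2) - (norm k)\<^sup>2))
        - \<psi> (\<xi>1, \<xi>2 - k, \<zeta>1, \<zeta>2 + k)
            * cis (z / (\<epsilon> * k0) * (k \<bullet> (\<zeta>2 - \<xi>2) + (norm k)\<^sup>2)))))"

definition square_integrable :: "(phase \<Rightarrow> complex) \<Rightarrow> bool" where
  "square_integrable f \<longleftrightarrow>
     f \<in> borel_measurable lborel \<and> integrable lborel (\<lambda>p. (cmod (f p))\<^sup>2)"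

text \<open>Solution of the Cauchy problem as an evolution equation in $L^2$: the values are (representatives
  of) square integrable functions, the initial condition holds almost everywhere, and the
  derivative in \<open>z\<close> is the limit of difference quotients in the $L^2$ norm
  (one-sided at \<open>z = 0\<close>).\<close>
definition fourth_moment_solution ::
  "real \<Rightarrow> real \<Rightarrow> (vec2 \<Rightarrow> real) \<Rightarrow> real \<Rightarrow> (real \<Rightarrow> phase \<Rightarrow> complex) \<Rightarrow> bool" where
  "fourth_moment_solution k0 r0 C \<epsilon> \<mu> \<longleftrightarrow>
     (\<forall>z\<ge>0. square_integrable (\<mu> z)) \<and>
     (AE (\<xi>1, \<xi>2, \<zeta>1, \<zeta>2) in lborel. \<mu> 0 (\<xi>1, \<xi>2, \<zeta>1, \<zeta>2) =
        complex_of_real ((2 * pi) ^ 8 * phi r0 \<epsilon> \<xi>1 * phi r0 \<epsilon> \<xi>2 * phi r0 \<epsilon> \<zeta>1 * phi r0 \<epsilon> \<zeta>2)) \<and>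
     (\<forall>z\<ge>0. ((\<lambda>s. \<integral>\<^sup>+p. ennreal ((cmod ((\<mu> s p - \<mu> z p) /\<^sub>R (s - z)
                       - moment_operator k0 C \<epsilon> z (\<mu> z) p))\<^sup>2) \<partial>lborel)
               \<longlongrightarrow> 0) (at z within {0..}))"

definition K :: "real \<Rightarrow> (vec2 \<Rightarrow> real) \<Rightarrow> real \<Rightarrow> real" where
  "K k0 C z = (2 * pi) ^ 8 * exp (- (k0\<^sup>2 / 2) * C 0 * z)"

definition A :: "real \<Rightarrow> (vec2 \<Rightarrow> real) \<Rightarrow> real \<Rightarrow> vec2 \<Rightarrow> vec2 \<Rightarrow> complex" where
  "A k0 C z \<xi> \<zeta> = complex_of_real (1 / (2 * (2 * pi)\<^sup>2)) *
     (LINT x|lborel.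
        complex_of_real (exp (k0\<^sup>2 / 4 * (LINT s:{0..z}|lborel. C (x + (s / k0) *\<^sub>R \<zeta>))) - 1)
        * cis (- (\<xi> \<bullet> x)))"

end

theory Submission
  imports Defs "HOL-Probability.Probability"
begin

text \<open>
  Every term of the moment operator shifts its argument by a jump that is linear in \<open>k\<close> and multiplies it
  by a unimodular phase. As \<open>c_hat\<close> is nonnegative and integrable (\<open>c_hat_nonneg\<close>, \<open>integrable_c_hat\<close>),
  the operator is an integral over a finite measure of jumps (\<open>jump_evolution\<close>). It is therefore bounded,
  solutions in \<open>L2\<close> are unique (\<open>evolves_unique\<close>), and the solution agrees almost everywhere with a
  Picard series, which lies in \<open>L1\<close> and satisfies the integral equation at every point. By Gronwall in
  \<open>L1\<close> (\<open>error_L1\<close>), the remainder is controlled by the defect of the explicit approximation in the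
  equation, integrated in time.

  The approximation is \<open>K\<close> times the sum of two products, one for the pairing of \<open>\<xi>1\<close> with \<open>\<xi>2\<close> and one for
  the pairing of \<open>\<xi>1\<close> with \<open>\<zeta>2\<close>, minus the initial Gaussian, which is counted twice. In the coordinates
  \<open>x = (\<xi>2 + \<xi>1) / 2\<close> and \<open>y = (\<xi>2 - \<xi>1) / 2\<close> the first product has one factor in \<open>x\<close> and one in \<open>y\<close>, each of the
  form \<open>gg + A\<close>, where \<open>gg\<close> is a Gaussian of mass one half and width \<open>\<epsilon>\<close>. The amplitude \<open>A\<close> solves a
  convolution equation in which half a Dirac mass is the source (\<open>A_integral_equation\<close>), so
  \<open>gg + A\<close> solves that equation up to an error that measures how well \<open>gg\<close> approximates the Dirac
  mass (\<open>smoothing_bound_limit\<close>). The two jumps that act inside the pairing are precisely these two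
  convolutions (\<open>jump_term_1_Pf\<close>); the second product is the image of the first under the exchange of
  \<open>\<xi>2\<close> and \<open>\<zeta>2\<close>. The term \<open>-2 \<psi>\<close> produces the decay of \<open>K\<close>.

  All other combinations of a jump with a term of the approximation carry a phase of frequency
  \<open>\<rho> / \<epsilon> + \<kappa>\<close> in time, where \<open>\<rho>\<close> and \<open>\<kappa>\<close> do not depend on \<open>\<epsilon>\<close> in suitably scaled variables and \<open>\<rho>\<close> is nonzero
  almost everywhere. Riemann--Lebesgue at almost every point and dominated convergence show that
  their time integrals vanish in \<open>L1\<close> (\<open>W_limit\<close>), uniformly on bounded intervals since these
  integrals are Lipschitz in the upper limit (\<open>W_uniform_limit\<close>).
\<close>

section \<open>Affine substitutions\<close>

abbreviation nn_integral_lborel :: "('a::euclidean_space \<Rightarrow> ennreal) \<Rightarrow> ennreal" (binder "NNINT " 10)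
  where "nn_integral_lborel f \<equiv> nn_integral lborel f"

lemma nn_integral_lborel_affine:
  fixes f :: "'a::euclidean_space \<Rightarrow> ennreal"
  assumes [measurable]: "f \<in> borel_measurable borel" and "c \<noteq> 0"
  shows "(NNINT x. f (t + c *\<^sub>R x)) = ennreal ((1 / \<bar>c\<bar>) ^ DIM('a)) * (NNINT x. f x)"
proof -
  have "(NNINT x. f x) = ennreal (\<bar>c\<bar> ^ DIM('a)) * (NNINT x. f (t + c *\<^sub>R x))"
    by (subst lborel_affine[OF \<open>c \<noteq> 0\<close>, of t])
       (simp add: nn_integral_density nn_integral_distr nn_integral_cmult)
  then have "ennreal ((1 / \<bar>c\<bar>) ^ DIM('a)) * (NNINT x. f x)
      = ennreal ((1 / \<bar>c\<bar>) ^ DIM('a) * \<bar>c\<bar> ^ DIM('a)) * (NNINT x. f (t + c *\<^sub>R x))"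
    by (simp add: ennreal_mult mult.assoc)
  also have "(1 / \<bar>c\<bar>) ^ DIM('a) * \<bar>c\<bar> ^ DIM('a) = 1"
    using \<open>c \<noteq> 0\<close> by (simp add: power_mult_distrib[symmetric])
  finally show ?thesis by simp
qed

lemma nn_integral_lborel_translate:
  fixes f :: "'a::euclidean_space \<Rightarrow> ennreal"
  assumes "f \<in> borel_measurable borel"
  shows "(NNINT x. f (x + t)) = (NNINT x. f x)"
    and "(NNINT x. f (x - t)) = (NNINT x. f x)"
    and "(NNINT x. f (t - x)) = (NNINT x. f x)"
    and "(NNINT x. f (- x)) = (NNINT x. f x)"
proof -
  show "(NNINT x. f (x + t)) = (NNINT x. f x)"
    using nn_integral_lborel_affine[OF assms, of 1 t] by (simp add: add.commute)
  show "(NNINT x. f (x - t)) = (NNINT x. f x)"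
    using nn_integral_lborel_affine[OF assms, of 1 "-t"] by simp
  show "(NNINT x. f (t - x)) = (NNINT x. f x)"
    using nn_integral_lborel_affine[OF assms, of "-1" t] by simp
  show "(NNINT x. f (- x)) = (NNINT x. f x)"
    using nn_integral_lborel_affine[OF assms, of "-1" 0] by simp
qed

lemma has_bochner_integral_lborel_affine:
  fixes f :: "'a::euclidean_space \<Rightarrow> 'b::{banach, second_countable_topology}"
  assumes "has_bochner_integral lborel f I" and "c \<noteq> 0"
  shows "has_bochner_integral lborel (\<lambda>x. f (t + c *\<^sub>R x)) ((1 / \<bar>c\<bar>) ^ DIM('a) *\<^sub>R I)"
proof -
  have f: "integrable lborel f" and I: "I = integral\<^sup>L lborel f"
    using assms by (auto simp: has_bochner_integral_iff)
  have [measurable]: "f \<in> borel_measurable borel" using f by auto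
  have int: "integrable lborel (\<lambda>x. f (t + c *\<^sub>R x))"
  proof (rule integrableI_bounded)
    show "(NNINT x. ennreal (norm (f (t + c *\<^sub>R x)))) < \<infinity>"
      using f \<open>c \<noteq> 0\<close> nn_integral_lborel_affine[of "\<lambda>x. ennreal (norm (f x))" c t]
      by (simp add: integrable_iff_bounded ennreal_mult_less_top)
  qed measurable
  have "I = \<bar>c\<bar> ^ DIM('a) *\<^sub>R integral\<^sup>L lborel (\<lambda>x. f (t + c *\<^sub>R x))"
    unfolding I using \<open>c \<noteq> 0\<close> int
    by (subst lborel_affine[OF \<open>c \<noteq> 0\<close>, of t])
       (simp add: integral_density integral_distr)
  then have "(1 / \<bar>c\<bar>) ^ DIM('a) *\<^sub>R I = integral\<^sup>L lborel (\<lambda>x. f (t + c *\<^sub>R x))"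
    using \<open>c \<noteq> 0\<close> by (simp add: power_mult_distrib[symmetric])
  then show ?thesis using int by (simp add: has_bochner_integral_iff)
qed

lemma integrable_lborel_affine_iff:
  fixes f :: "'a::euclidean_space \<Rightarrow> 'b::{banach, second_countable_topology}"
  assumes "c \<noteq> 0"
  shows "integrable lborel (\<lambda>x. f (t + c *\<^sub>R x)) \<longleftrightarrow> integrable lborel f"
proof
  have *: "integrable lborel (\<lambda>x. g (t + c *\<^sub>R x))"
    if "integrable lborel g" "c \<noteq> 0" for g :: "'a \<Rightarrow> 'b" and t c
    using has_bochner_integral_lborel_affine[OF has_bochner_integral_integrable[OF that(1)] that(2)]
    unfolding has_bochner_integral_iff by blast
  show "integrable lborel (\<lambda>x. f (t + c *\<^sub>R x))" if "integrable lborel f"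
    by (rule *[OF that assms])
  assume "integrable lborel (\<lambda>x. f (t + c *\<^sub>R x))"
  from *[OF this, of "1/c" "- (1/c) *\<^sub>R t"] assms
  have "integrable lborel (\<lambda>x. f (t + c *\<^sub>R (- (1/c) *\<^sub>R t + (1/c) *\<^sub>R x)))"
    by simp
  moreover have "t + c *\<^sub>R (- (1/c) *\<^sub>R t + (1/c) *\<^sub>R x) = x" for x
    using assms by (simp add: scaleR_diff_right)
  ultimately show "integrable lborel f" by simp
qed

lemma integral_lborel_affine:
  fixes f :: "'a::euclidean_space \<Rightarrow> 'b::{banach, second_countable_topology}"
  assumes "c \<noteq> 0"
  shows "(LINT x|lborel. f (t + c *\<^sub>R x)) = (1 / \<bar>c\<bar>) ^ DIM('a) *\<^sub>R (LINT x|lborel. f x)"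
proof (cases "integrable lborel f")
  case True
  show ?thesis
    using has_bochner_integral_lborel_affine[OF has_bochner_integral_integrable[OF True] assms]
    unfolding has_bochner_integral_iff by blast
next
  case False
  then show ?thesis using assms by (simp add: not_integrable_integral_eq integrable_lborel_affine_iff)
qed

lemma integral_lborel_translate:
  fixes f :: "'a::euclidean_space \<Rightarrow> 'b::{banach, second_countable_topology}"
  shows "(LINT x|lborel. f (x + t)) = (LINT x|lborel. f x)"
    and "(LINT x|lborel. f (x - t)) = (LINT x|lborel. f x)"
    and "(LINT x|lborel. f (t - x)) = (LINT x|lborel. f x)"
    and "(LINT x|lborel. f (- x)) = (LINT x|lborel. f x)"
proof -
  show "(LINT x|lborel. f (x + t)) = (LINT x|lborel. f x)"
    using integral_lborel_affine[of 1 f t] by (simp add: add.commute)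
  show "(LINT x|lborel. f (x - t)) = (LINT x|lborel. f x)"
    using integral_lborel_affine[of 1 f "-t"] by simp
  show "(LINT x|lborel. f (t - x)) = (LINT x|lborel. f x)"
    using integral_lborel_affine[of "-1" f t] by simp
  show "(LINT x|lborel. f (- x)) = (LINT x|lborel. f x)"
    using integral_lborel_affine[of "-1" f 0] by simp
qed

lemma integrable_lborel_translate:
  fixes f :: "'a::euclidean_space \<Rightarrow> 'b::{banach, second_countable_topology}"
  assumes "integrable lborel f"
  shows "integrable lborel (\<lambda>x. f (x + t))"
    and "integrable lborel (\<lambda>x. f (x - t))"
    and "integrable lborel (\<lambda>x. f (t - x))"
    and "integrable lborel (\<lambda>x. f (- x))"
proof -
  show "integrable lborel (\<lambda>x. f (x + t))"
    using integrable_lborel_affine_iff[of 1 f t] assms by (simp add: add.commute)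
  show "integrable lborel (\<lambda>x. f (x - t))"
    using integrable_lborel_affine_iff[of 1 f "-t"] assms by simp
  show "integrable lborel (\<lambda>x. f (t - x))"
    using integrable_lborel_affine_iff[of "-1" f t] assms by simp
  show "integrable lborel (\<lambda>x. f (- x))"
    using integrable_lborel_affine_iff[of "-1" f 0] assms by simp
qed

section \<open>Gaussians\<close>

lemma cis_measurable [measurable]: "cis \<in> borel_measurable borel"
  by (intro borel_measurable_continuous_onI continuous_intros)

text \<open>Rescaling the characteristic function of the standard normal distribution.\<close>
lemma has_bochner_integral_gaussian_cis_real:
  fixes y a :: real
  assumes "a > 0"
  shows "has_bochner_integral lborel (\<lambda>t. exp (- a * t\<^sup>2) *\<^sub>R cis (t * y))
           (complex_of_real (sqrt (pi / a) * exp (- y\<^sup>2 / (4 * a))))"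
proof -
  define c where "c = sqrt (2 * a)"
  have c: "c > 0" "c\<^sup>2 = 2 * a" using assms by (auto simp: c_def)
  have int: "integrable lborel (\<lambda>t. std_normal_density t *\<^sub>R cis (u * t))" for u
  proof (rule Bochner_Integration.integrable_bound[of _ "\<lambda>t. std_normal_density t"])
    show "(\<lambda>t. std_normal_density t *\<^sub>R cis (u * t)) \<in> borel_measurable lborel" by measurable
  qed auto
  have "complex_of_real (exp (- (u\<^sup>2) / 2)) = (LINT t|lborel. std_normal_density t *\<^sub>R cis (u * t))" for u
  proof -
    have "char std_normal_distribution u = (LINT t|lborel. std_normal_density t *\<^sub>R iexp (u * t))"
      unfolding char_def by (subst integral_density) auto
    then show ?thesis by (simp add: char_std_normal_distribution cis_conv_exp)
  qed
  then have "has_bochner_integral lborel (\<lambda>t. std_normal_density t *\<^sub>R cis (u * t))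
      (complex_of_real (exp (- (u\<^sup>2) / 2)))" for u
    using int by (simp add: has_bochner_integral_iff)
  from has_bochner_integral_lborel_affine[OF this[of "y / c"], of c 0]
  have "has_bochner_integral lborel (\<lambda>t. std_normal_density (c * t) *\<^sub>R cis ((y / c) * (c * t)))
      ((1 / c) *\<^sub>R complex_of_real (exp (- ((y / c)\<^sup>2) / 2)))"
    using c by simp
  then have "has_bochner_integral lborel (\<lambda>t. sqrt (2 * pi) *\<^sub>R (std_normal_density (c * t) *\<^sub>R cis ((y / c) * (c * t))))
      (sqrt (2 * pi) *\<^sub>R ((1 / c) *\<^sub>R complex_of_real (exp (- ((y / c)\<^sup>2) / 2))))"
    by (intro has_bochner_integral_scaleR_right)
  also have "(\<lambda>t. sqrt (2 * pi) *\<^sub>R (std_normal_density (c * t) *\<^sub>R cis ((y / c) * (c * t))))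
      = (\<lambda>t. exp (- a * t\<^sup>2) *\<^sub>R cis (t * y))"
    using c by (auto simp: std_normal_density_def power_mult_distrib mult.commute)
  also have "sqrt (2 * pi) *\<^sub>R ((1 / c) *\<^sub>R complex_of_real (exp (- ((y / c)\<^sup>2) / 2)))
      = complex_of_real (sqrt (pi / a) * exp (- y\<^sup>2 / (4 * a)))"
  proof -
    have "sqrt (2 * pi) * (1 / c) = sqrt (pi / a)"
      using assms by (simp add: c_def real_sqrt_divide real_sqrt_mult field_simps)
    moreover have "- ((y / c)\<^sup>2) / 2 = - y\<^sup>2 / (4 * a)"
      using c by (simp add: power_divide)
    ultimately have "sqrt (2 * pi) * ((1 / c) * exp (- ((y / c)\<^sup>2) / 2)) = sqrt (pi / a) * exp (- y\<^sup>2 / (4 * a))"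
      by (simp only: mult.assoc[symmetric])
    then show ?thesis by (simp only: scaleR_conv_of_real of_real_mult[symmetric])
  qed
  finally show ?thesis .
qed

lemma cis_sum: "finite S \<Longrightarrow> cis (\<Sum>b\<in>S. f b) = (\<Prod>b\<in>S. cis (f b))"
  by (induction S rule: finite_induct) (auto simp: cis_mult[symmetric])

text \<open>In an orthonormal basis the integrand is a product of functions of one coordinate.\<close>
lemma has_bochner_integral_gaussian_cis:
  fixes y :: "'a::euclidean_space"
  assumes "a > 0"
  shows "has_bochner_integral lborel (\<lambda>x::'a. exp (- a * (norm x)\<^sup>2) *\<^sub>R cis (x \<bullet> y))
           (complex_of_real (sqrt (pi / a) ^ DIM('a) * exp (- (norm y)\<^sup>2 / (4 * a))))"
proof -
  interpret product_sigma_finite "\<lambda>b::'a. lborel :: real measure" ..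
  let ?S = "\<lambda>f::'a \<Rightarrow> real. \<Sum>b\<in>Basis. f b *\<^sub>R b"
  have S: "?S \<in> measurable (Pi\<^sub>M Basis (\<lambda>b. lborel)) borel" by measurable
  let ?h = "\<lambda>b t. exp (- a * t\<^sup>2) *\<^sub>R cis (t * (y \<bullet> b))"
  have norm2: "(norm (?S f))\<^sup>2 = (\<Sum>b\<in>Basis. (f b)\<^sup>2)" for f
    unfolding power2_norm_eq_inner by (subst euclidean_inner) (simp add: power2_eq_square inner_sum_left_Basis)
  have eq: "exp (- a * (norm (?S f))\<^sup>2) *\<^sub>R cis (?S f \<bullet> y) = (\<Prod>b\<in>Basis. ?h b (f b))" for f
  proof -
    have "?S f \<bullet> y = (\<Sum>b\<in>Basis. f b * (y \<bullet> b))"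
      by (simp add: inner_sum_left inner_commute[of y])
    then show ?thesis
      unfolding norm2 by (simp add: cis_sum sum_distrib_left sum_negf[symmetric] exp_sum prod.distrib scaleR_conv_of_real)
  qed
  have h: "has_bochner_integral lborel (?h b) (complex_of_real (sqrt (pi / a) * exp (- (y \<bullet> b)\<^sup>2 / (4 * a))))" for b
    by (rule has_bochner_integral_gaussian_cis_real[OF assms])
  have hi: "integrable lborel (?h b)" for b using h by (auto simp: has_bochner_integral_iff)
  have m: "(\<lambda>x::'a. exp (- a * (norm x)\<^sup>2) *\<^sub>R cis (x \<bullet> y)) \<in> borel_measurable borel" by measurable
  have "integrable (Pi\<^sub>M Basis (\<lambda>b::'a. lborel)) (\<lambda>f. \<Prod>b\<in>Basis. ?h b (f b))"
    using hi by (intro product_integrable_prod) auto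
  then have "integrable (Pi\<^sub>M Basis (\<lambda>b::'a. lborel)) (\<lambda>f. exp (- a * (norm (?S f))\<^sup>2) *\<^sub>R cis (?S f \<bullet> y))"
    unfolding eq .
  then have 1: "integrable lborel (\<lambda>x::'a. exp (- a * (norm x)\<^sup>2) *\<^sub>R cis (x \<bullet> y))"
    unfolding lborel_eq[where 'a='a] integrable_distr_eq[OF S m] .
  have "(LINT x|lborel. exp (- a * (norm (x::'a))\<^sup>2) *\<^sub>R cis (x \<bullet> y)) =
     (LINT f|Pi\<^sub>M Basis (\<lambda>b::'a. lborel). exp (- a * (norm (?S f))\<^sup>2) *\<^sub>R cis (?S f \<bullet> y))"
    unfolding lborel_eq[where 'a='a] integral_distr[OF S m] ..
  also have "\<dots> = (LINT f|Pi\<^sub>M Basis (\<lambda>b::'a. lborel). (\<Prod>b\<in>Basis. ?h b (f b)))"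
    unfolding eq ..
  also have "\<dots> = (\<Prod>b\<in>Basis. integral\<^sup>L lborel (?h b))"
    using hi by (intro product_integral_prod) auto
  also have "\<dots> = (\<Prod>b\<in>(Basis::'a set). complex_of_real (sqrt (pi / a) * exp (- (y \<bullet> b)\<^sup>2 / (4 * a))))"
    by (intro prod.cong refl has_bochner_integral_integral_eq h)
  also have "\<dots> = complex_of_real (sqrt (pi / a) ^ DIM('a) * (\<Prod>b\<in>(Basis::'a set). exp (- (y \<bullet> b)\<^sup>2 / (4 * a))))"
    by (simp add: prod.distrib flip: of_real_prod)
  also have "(\<Prod>b\<in>(Basis::'a set). exp (- (y \<bullet> b)\<^sup>2 / (4 * a))) = exp (- (norm y)\<^sup>2 / (4 * a))"
  proof -
    have "(norm y)\<^sup>2 = (\<Sum>b\<in>Basis. (y \<bullet> b)\<^sup>2)"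
      unfolding power2_norm_eq_inner by (subst euclidean_inner) (simp add: power2_eq_square)
    then show ?thesis by (simp add: exp_sum[symmetric] sum_divide_distrib sum_negf)
  qed
  finally show ?thesis using 1 by (simp add: has_bochner_integral_iff)
qed

lemma has_bochner_integral_gaussian:
  assumes "a > 0"
  shows "has_bochner_integral lborel (\<lambda>x::'a::euclidean_space. exp (- a * (norm x)\<^sup>2)) (sqrt (pi / a) ^ DIM('a))"
proof -
  have "has_bochner_integral lborel (\<lambda>x::'a. complex_of_real (exp (- a * (norm x)\<^sup>2)))
     (complex_of_real (sqrt (pi / a) ^ DIM('a)))"
    using has_bochner_integral_gaussian_cis[OF assms, of "0::'a"] by (simp add: scaleR_conv_of_real)
  then show ?thesis by (simp add: has_bochner_integral_iff complex_of_real_integrable_eq flip: of_real_power)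
qed

section \<open>Fourier transform of a covariance function\<close>

lemma norm_integral_le_nn_integral:
  fixes f :: "'b \<Rightarrow> 'c::{banach, second_countable_topology}"
  shows "ennreal (norm (LINT x|M. f x)) \<le> (\<integral>\<^sup>+x. ennreal (norm (f x)) \<partial>M)"
proof (cases "integrable M f")
  case True
  then show ?thesis by (rule integral_norm_bound_ennreal)
next
  case False
  then show ?thesis by (simp add: not_integrable_integral_eq)
qed

lemma norm_lebesgue_integral_le:
  fixes f :: "'b \<Rightarrow> 'c::{banach, second_countable_topology}"
  assumes "integrable M g" and "\<And>x. norm (f x) \<le> g x"
  shows "norm (LINT x|M. f x) \<le> (LINT x|M. g x)"
proof -
  have g: "0 \<le> g x" for x using assms(2) norm_ge_zero order_trans by blast
  have "ennreal (norm (LINT x|M. f x)) \<le> (\<integral>\<^sup>+x. ennreal (norm (f x)) \<partial>M)"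
    by (rule norm_integral_le_nn_integral)
  also have "\<dots> \<le> (\<integral>\<^sup>+x. ennreal (g x) \<partial>M)"
    by (intro nn_integral_mono ennreal_leI assms)
  also have "\<dots> = ennreal (LINT x|M. g x)"
    by (intro nn_integral_eq_integral assms always_eventually allI g)
  finally show ?thesis using Bochner_Integration.integral_nonneg[of M g] g by (simp add: ennreal_le_iff)
qed

lemma has_bochner_integral_std_gaussian:
  "has_bochner_integral lborel (\<lambda>t::vec2. exp (- (norm t)\<^sup>2)) pi"
proof -
  have "has_bochner_integral lborel (\<lambda>t::vec2. exp (- 1 * (norm t)\<^sup>2)) (sqrt (pi / 1) ^ DIM(vec2))"
    by (rule has_bochner_integral_gaussian) simp
  moreover have "sqrt (pi / 1) ^ DIM(vec2) = pi" by simp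
  ultimately show ?thesis by simp
qed

lemma integral_of_simple_function:
  fixes h :: "'b \<Rightarrow> real"
  assumes "finite_measure M" and s: "simple_function M s"
  shows "(LINT y|M. h (s y)) = (\<Sum>b\<in>s ` space M. h b * measure M (s -` {b} \<inter> space M))"
proof -
  interpret finite_measure M by fact
  have fin: "finite (s ` space M)" and m: "\<And>b. s -` {b} \<inter> space M \<in> sets M"
    by (rule simple_functionD[OF s])+
  have "(LINT y|M. h (s y)) = (LINT y|M. (\<Sum>b\<in>s ` space M. h b * indicator (s -` {b} \<inter> space M) y))"
  proof (intro Bochner_Integration.integral_cong refl)
    fix y assume y: "y \<in> space M"
    have "(\<Sum>b\<in>s ` space M. h b * indicator (s -` {b} \<inter> space M) y)
        = (\<Sum>b\<in>s ` space M. if b = s y then h b else 0)"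
      using y by (intro sum.cong) (auto simp: indicator_def)
    also have "\<dots> = h (s y)" using fin y by (simp add: sum.delta)
    finally show "h (s y) = (\<Sum>b\<in>s ` space M. h b * indicator (s -` {b} \<inter> space M) y)" by simp
  qed
  also have "\<dots> = (\<Sum>b\<in>s ` space M. LINT y|M. h b * indicator (s -` {b} \<inter> space M) y)"
    using m by (intro Bochner_Integration.integral_sum integrable_mult_right integrable_real_indicator)
               (auto simp: emeasure_eq_measure)
  also have "\<dots> = (\<Sum>b\<in>s ` space M. h b * measure M (s -` {b} \<inter> space M))"
    by (simp add: m)
  finally show ?thesis .
qed

text \<open>Approximating the identity by simple functions turns the double integral into a limit of the finite
  sums in the definition of positive definiteness; \<open>F\<close> is bounded and \<open>M\<close> finite, so the limit may
  be taken under the integral.\<close>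
lemma positive_definite_double_integral:
  fixes F :: "'a::euclidean_space \<Rightarrow> real"
  assumes pd: "\<And>(S :: 'a set) (w :: 'a \<Rightarrow> real). finite S \<Longrightarrow>
       0 \<le> (\<Sum>x\<in>S. \<Sum>y\<in>S. w x * w y * F (x - y))"
    and cont: "continuous_on UNIV F" and bound: "\<And>x. \<bar>F x\<bar> \<le> B"
    and fin: "finite_measure M" and M: "sets M = sets borel"
  shows "0 \<le> (LINT x|M. LINT y|M. F (x - y))"
proof -
  interpret finite_measure M by fact
  interpret MM: pair_sigma_finite M M ..
  interpret PM: finite_measure "M \<Otimes>\<^sub>M M" by (rule finite_measure_pair_measure[OF fin fin])
  have [measurable_cong]: "sets M = sets borel" by fact
  have [measurable]: "F \<in> borel_measurable borel" using cont by (rule borel_measurable_continuous_onI)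
  have "(\<lambda>x. x) \<in> borel_measurable M" by simp
  from borel_measurable_implies_sequence_metric[OF this, of 0]
  obtain s :: "nat \<Rightarrow> 'a \<Rightarrow> 'a" where s: "\<And>i. simple_function M (s i)"
    and lim: "\<And>x. (\<lambda>i. s i x) \<longlonglongrightarrow> x"
    using sets_eq_imp_space_eq[OF M] by (metis UNIV_I space_borel)
  have [measurable]: "s i \<in> borel_measurable M" for i by (rule borel_measurable_simple_function[OF s])
  have pos: "0 \<le> (LINT p|(M \<Otimes>\<^sub>M M). F (s i (fst p) - s i (snd p)))" for i
  proof -
    let ?m = "\<lambda>a. measure M (s i -` {a} \<inter> space M)"
    have "integrable (M \<Otimes>\<^sub>M M) (\<lambda>p. F (s i (fst p) - s i (snd p)))"
      by (rule PM.integrable_const_bound[where B=B]) (use bound in auto)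
    then have "(LINT p|(M \<Otimes>\<^sub>M M). F (s i (fst p) - s i (snd p)))
       = (LINT x|M. LINT y|M. F (s i x - s i y))"
      by (subst MM.integral_fst'[symmetric]) auto
    also have "\<dots> = (\<Sum>a\<in>s i ` space M. (\<Sum>b\<in>s i ` space M. F (a - b) * ?m b) * ?m a)"
      by (simp only: integral_of_simple_function[OF fin s, of "\<lambda>b. F (a - b)" i for a]
            integral_of_simple_function[OF fin s, of "\<lambda>x. \<Sum>b\<in>s i ` space M. F (x - b) * ?m b" i])
    also have "\<dots> = (\<Sum>a\<in>s i ` space M. \<Sum>b\<in>s i ` space M. ?m a * ?m b * F (a - b))"
      by (simp add: sum_distrib_left sum_distrib_right mult_ac)
    also have "\<dots> \<ge> 0" using s by (intro pd) (auto simp: simple_function_def)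
    finally show ?thesis .
  qed
  have "(\<lambda>i. LINT p|(M \<Otimes>\<^sub>M M). F (s i (fst p) - s i (snd p))) \<longlonglongrightarrow> (LINT p|(M \<Otimes>\<^sub>M M). F (fst p - snd p))"
  proof (rule integral_dominated_convergence[where w="\<lambda>_. B"])
    show "AE x in M \<Otimes>\<^sub>M M. (\<lambda>i. F (s i (fst x) - s i (snd x))) \<longlonglongrightarrow> F (fst x - snd x)"
      by (intro always_eventually allI continuous_on_tendsto_compose[OF cont] tendsto_diff lim) auto
  qed (use bound in auto)
  then have "0 \<le> (LINT p|(M \<Otimes>\<^sub>M M). F (fst p - snd p))"
    by (rule LIMSEQ_le_const) (use pos in auto)
  also have "\<dots> = (LINT x|M. LINT y|M. F (x - y))"
  proof -
    have "integrable (M \<Otimes>\<^sub>M M) (\<lambda>p. F (fst p - snd p))"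
      by (rule PM.integrable_const_bound[where B=B]) (use bound in auto)
    then show ?thesis by (subst MM.integral_fst'[symmetric]) auto
  qed
  finally show ?thesis .
qed

text \<open>Testing positive definiteness against a Gaussian weight makes the double integral a
  convolution, whose kernel is again Gaussian; widening the Gaussian exhausts the integral.\<close>
lemma positive_definite_integral_nonneg:
  fixes F :: "'a::euclidean_space \<Rightarrow> real"
  assumes pd: "\<And>(S :: 'a set) (w :: 'a \<Rightarrow> real). finite S \<Longrightarrow>
       0 \<le> (\<Sum>x\<in>S. \<Sum>y\<in>S. w x * w y * F (x - y))"
    and cont: "continuous_on UNIV F" and bound: "\<And>x. \<bar>F x\<bar> \<le> B" and int: "integrable lborel F"
  shows "0 \<le> (LINT x|lborel. F x)"
proof -
  have [measurable]: "F \<in> borel_measurable borel" using cont by (rule borel_measurable_continuous_onI)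
  have boundB: "\<bar>F x\<bar> \<le> \<bar>B\<bar>" for x using bound[of x] by linarith
  have pos: "0 \<le> (LINT u|lborel. exp (- (a/2) * (norm u)\<^sup>2) * F u)" if "a > 0" for a :: real
  proof -
    let ?g = "\<lambda>x::'a. exp (- a * (norm x)\<^sup>2)"
    define M where "M = density lborel (\<lambda>x. ennreal (?g x))"
    have g: "integrable lborel ?g" using has_bochner_integral_gaussian[OF that] by (auto simp: has_bochner_integral_iff)
    have "finite_measure M"
    proof
      have "emeasure M (space M) = (NNINT x. ennreal (?g x))"
        by (simp add: M_def emeasure_density)
      also have "\<dots> = ennreal (LINT x|lborel. ?g x)" by (rule nn_integral_eq_integral[OF g]) auto
      finally show "emeasure M (space M) \<noteq> \<infinity>" by simp
    qed
    then have "0 \<le> (LINT x|M. LINT y|M. F (x - y))"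
      by (intro positive_definite_double_integral[where B=B] pd cont bound) (auto simp: M_def)
    also have "\<dots> = (LINT x|lborel. LINT y|lborel. ?g x * ?g y * F (x - y))"
      unfolding M_def by (simp add: integral_density mult.assoc)
    also have "\<dots> = (LINT y|lborel. LINT x|lborel. ?g x * ?g y * F (x - y))"
    proof -
      have i0: "integrable lborel (\<lambda>x. ?g x * ?g y * F (x - y))" for y
        by (rule Bochner_Integration.integrable_bound[OF integrable_mult_right[OF g, of "?g y * B"]])
           (use boundB in \<open>auto simp: abs_mult mult.assoc intro!: mult_left_mono always_eventually\<close>)
      have "integrable (lborel \<Otimes>\<^sub>M lborel) (\<lambda>(x, y). ?g x * ?g y * F (x - y))"
      proof (rule Bochner_Integration.integrable_bound[where f="\<lambda>(x,y). B * (?g x * ?g y)"])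
        show "integrable (lborel \<Otimes>\<^sub>M lborel) (\<lambda>(x,y). B * (?g x * ?g y))"
          using g by (intro lborel_pair.Fubini_integrable) (auto simp: abs_mult)
        show "AE p in lborel \<Otimes>\<^sub>M lborel. norm (case p of (x, y) \<Rightarrow> ?g x * ?g y * F (x - y)) \<le> norm (case p of (x, y) \<Rightarrow> B * (?g x * ?g y))"
          using boundB by (auto simp: abs_mult mult.commute[of "\<bar>B\<bar>"] intro!: mult_left_mono always_eventually)
      qed simp
      then show ?thesis by (rule lborel_pair.Fubini_integral[symmetric])
    qed
    also have "\<dots> = (LINT y|lborel. LINT u|lborel. ?g (u + y) * ?g y * F u)"
    proof (rule Bochner_Integration.integral_cong[OF refl])
      fix y :: 'a
      show "(LINT x|lborel. ?g x * ?g y * F (x - y)) = (LINT u|lborel. ?g (u + y) * ?g y * F u)"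
        using integral_lborel_translate(1)[of "\<lambda>x. ?g x * ?g y * F (x - y)" y] by simp
    qed
    also have "\<dots> = (LINT u|lborel. LINT y|lborel. ?g (u + y) * ?g y * F u)"
    proof (rule lborel_pair.Fubini_integral[symmetric])
      show "integrable (lborel \<Otimes>\<^sub>M lborel) (\<lambda>(y, u). ?g (u + y) * ?g y * F u)"
      proof (rule Bochner_Integration.integrable_bound[where f="\<lambda>(y,u). ?g y * F u"])
        show "integrable (lborel \<Otimes>\<^sub>M lborel) (\<lambda>(y,u). ?g y * F u)"
          using g int by (intro lborel_pair.Fubini_integrable) (auto simp: abs_mult)
        show "AE x in lborel \<Otimes>\<^sub>M lborel. norm (case x of (y, u) \<Rightarrow> ?g (u + y) * ?g y * F u) \<le> norm (case x of (y, u) \<Rightarrow> ?g y * F u)"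
          using that by (auto simp: abs_mult mult.assoc intro!: mult_left_le_one_le always_eventually)
      qed simp
    qed
    also have "\<dots> = (LINT u|lborel. (exp (- (a/2) * (norm u)\<^sup>2) * F u) * (LINT y|lborel. exp (- (2*a) * (norm (y::'a))\<^sup>2)))"
    proof (rule Bochner_Integration.integral_cong[OF refl])
      fix u :: 'a
      have "?g (u + y) * ?g y = exp (- (a/2) * (norm u)\<^sup>2) * exp (- (2*a) * (norm (y + (1/2) *\<^sub>R u))\<^sup>2)" for y
        by (simp add: exp_add[symmetric] power2_norm_eq_inner inner_add_left inner_add_right inner_commute algebra_simps)
      then have "(LINT y|lborel. ?g (u + y) * ?g y * F u)
         = (LINT y|lborel. (exp (- (a/2) * (norm u)\<^sup>2) * F u) * exp (- (2*a) * (norm (y + (1/2) *\<^sub>R u))\<^sup>2))"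
        by (simp add: mult_ac)
      also have "\<dots> = (exp (- (a/2) * (norm u)\<^sup>2) * F u) * (LINT y|lborel. exp (- (2*a) * (norm (y + (1/2) *\<^sub>R u))\<^sup>2))"
        by (rule integral_mult_right_zero)
      finally show "(LINT y|lborel. ?g (u + y) * ?g y * F u) = (exp (- (a/2) * (norm u)\<^sup>2) * F u) * (LINT y|lborel. exp (- (2*a) * (norm (y::'a))\<^sup>2))"
        using integral_lborel_translate(1)[of "\<lambda>y::'a. exp (- (2*a) * (norm y)\<^sup>2)"] by simp
    qed
    also have "\<dots> = (LINT u|lborel. (exp (- (a/2) * (norm u)\<^sup>2) * F u)) * (LINT y|lborel. exp (- (2*a) * (norm (y::'a))\<^sup>2))"
      by (rule integral_mult_left_zero)
    finally have "0 \<le> (LINT u|lborel. (exp (- (a/2) * (norm u)\<^sup>2) * F u)) * (LINT y|lborel. exp (- (2*a) * (norm (y::'a))\<^sup>2))" .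
    moreover have "(LINT y|lborel. exp (- (2*a) * (norm (y::'a))\<^sup>2)) > 0"
      using has_bochner_integral_integral_eq[OF has_bochner_integral_gaussian[of "2 * a", where 'a='a]] that
      by (simp only:) simp
    ultimately show ?thesis by (meson mult_less_0_iff not_le)
  qed
  have "(\<lambda>n. LINT u|lborel. exp (- (inverse (Suc n)/2) * (norm u)\<^sup>2) * F u) \<longlonglongrightarrow> (LINT u|lborel. F u)"
  proof (rule integral_dominated_convergence[where w="\<lambda>x. \<bar>F x\<bar>"])
    show "AE x in lborel. (\<lambda>i. exp (- (inverse (Suc i)/2) * (norm x)\<^sup>2) * F x) \<longlonglongrightarrow> F x"
    proof (intro always_eventually allI)
      fix x :: 'a
      have "(\<lambda>i. exp (- (inverse (Suc i)/2) * (norm x)\<^sup>2) * F x) \<longlonglongrightarrow> exp (- (0/2) * (norm x)\<^sup>2) * F x"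
        by (intro tendsto_intros LIMSEQ_inverse_real_of_nat) auto
      then show "(\<lambda>i. exp (- (inverse (Suc i)/2) * (norm x)\<^sup>2) * F x) \<longlonglongrightarrow> F x" by simp
    qed
  qed (use int in \<open>auto simp: abs_mult intro!: mult_left_le_one_le\<close>)
  then show ?thesis by (rule LIMSEQ_le_const) (use pos in auto)
qed

locale stationary_covariance =
  fixes C :: "vec2 \<Rightarrow> real"
  assumes cov: "covariance_function C" and integrable_C: "integrable lborel C"
begin

lemma C_even: "C (- x) = C x" using cov by (simp add: covariance_function_def)

lemma C_continuous: "continuous_on UNIV C" using cov by (simp add: covariance_function_def)

lemma C_measurable [measurable]: "C \<in> borel_measurable borel"
  using C_continuous by (rule borel_measurable_continuous_onI)

lemma C_positive_definite:
  fixes S :: "vec2 set"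
  shows "finite S \<Longrightarrow> 0 \<le> (\<Sum>x\<in>S. \<Sum>y\<in>S. w x * w y * C (x - y))"
  using cov by (simp add: covariance_function_def)

lemma C_0_nonneg: "0 \<le> C 0"
  using C_positive_definite[of "{0}" "\<lambda>_. 1"] by simp

text \<open>Positive definiteness on the two points \<open>0\<close> and \<open>x\<close>, with weights \<open>(1, 1)\<close> and \<open>(1, -1)\<close>.\<close>
lemma C_bound: "\<bar>C x\<bar> \<le> C 0"
proof (cases "x = 0")
  case True
  then show ?thesis using C_0_nonneg by simp
next
  case False
  have "0 \<le> 2 * C 0 + 2 * s * C x" if "s = 1 \<or> s = -1" for s :: real
    using C_positive_definite[of "{0, x}" "\<lambda>u. if u = 0 then 1 else s"] False that C_even[of x]
    by auto
  from this[of 1] this[of "-1"] show ?thesis by auto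
qed

text \<open>The Fourier transform in a manifestly real form; the sine part of the transform of an even function
  vanishes.\<close>
definition c_hat :: "vec2 \<Rightarrow> real" where "c_hat k = (LINT x|lborel. C x * cos (k \<bullet> x))"

lemma integrable_C_bounded:
  assumes "\<And>x. \<bar>f x\<bar> \<le> 1" "f \<in> borel_measurable borel"
  shows "integrable lborel (\<lambda>x. C x * f x)"
  by (rule Bochner_Integration.integrable_bound[OF integrable_C])
     (use assms in \<open>auto simp: abs_mult mult_left_le\<close>)

lemma C_hat_eq: "C_hat C k = complex_of_real (c_hat k)"
proof -
  have int: "integrable lborel (\<lambda>x. complex_of_real (C x) * cis (- (k \<bullet> x)))"
    by (rule Bochner_Integration.integrable_bound[OF integrable_C]) (auto simp: norm_mult)
  have "Re (C_hat C k) = c_hat k"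
    unfolding C_hat_def c_hat_def by (subst integral_Re[OF int, symmetric]) simp
  moreover have "Im (C_hat C k) = (LINT x|lborel. - (C x * sin (k \<bullet> x)))"
    unfolding C_hat_def by (subst integral_Im[OF int, symmetric]) simp
  moreover have "(LINT x|lborel. - (C x * sin (k \<bullet> x))) = 0"
  proof -
    have "(LINT x|lborel. - (C x * sin (k \<bullet> x))) = (LINT x|lborel. C x * sin (k \<bullet> x))"
      using integral_lborel_translate(4)[of "\<lambda>x. C x * sin (k \<bullet> x)"] by (simp only: C_even inner_minus_right sin_minus mult_minus_right)
    then show ?thesis unfolding Bochner_Integration.integral_minus by linarith
  qed
  ultimately show ?thesis by (simp add: complex_eq_iff)
qed

text \<open>Multiplying a positive definite function by a cosine preserves positive definiteness, and a positive
  definite integrable function has a nonnegative integral.\<close>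
lemma c_hat_nonneg: "0 \<le> c_hat k"
  unfolding c_hat_def
proof (rule positive_definite_integral_nonneg[where B="C 0"])
  fix S :: "vec2 set" and w :: "vec2 \<Rightarrow> real" assume S: "finite S"
  have "(\<Sum>x\<in>S. \<Sum>y\<in>S. w x * w y * (C (x - y) * cos (k \<bullet> (x - y))))
      = (\<Sum>x\<in>S. \<Sum>y\<in>S. (w x * cos (k \<bullet> x)) * (w y * cos (k \<bullet> y)) * C (x - y))
      + (\<Sum>x\<in>S. \<Sum>y\<in>S. (w x * sin (k \<bullet> x)) * (w y * sin (k \<bullet> y)) * C (x - y))"
    unfolding sum.distrib[symmetric]
    by (intro sum.cong refl) (simp add: inner_diff_right cos_diff algebra_simps)
  also have "\<dots> \<ge> 0" using S by (intro add_nonneg_nonneg C_positive_definite)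
  finally show "0 \<le> (\<Sum>x\<in>S. \<Sum>y\<in>S. w x * w y * (C (x - y) * cos (k \<bullet> (x - y))))" .
next
  show "continuous_on UNIV (\<lambda>x. C x * cos (k \<bullet> x))"
    by (intro continuous_intros C_continuous)
  show "\<bar>C x * cos (k \<bullet> x)\<bar> \<le> C 0" for x
    using mult_mono[OF C_bound[of x] abs_cos_le_one[of "k \<bullet> x"]] C_0_nonneg by (simp add: abs_mult)
  show "integrable lborel (\<lambda>x. C x * cos (k \<bullet> x))" by (rule integrable_C_bounded) auto
qed

lemma c_hat_continuous: "continuous_on UNIV c_hat"
proof (rule continuous_at_imp_continuous_on, safe)
  fix k :: vec2
  show "isCont c_hat k"
  proof (rule continuous_at_sequentiallyI)
    fix u assume u: "u \<longlonglongrightarrow> k"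
    show "(\<lambda>n. c_hat (u n)) \<longlonglongrightarrow> c_hat k"
      unfolding c_hat_def
    proof (rule integral_dominated_convergence[where w="\<lambda>x. \<bar>C x\<bar>"])
      show "AE x in lborel. (\<lambda>i. C x * cos (u i \<bullet> x)) \<longlonglongrightarrow> C x * cos (k \<bullet> x)"
        by (intro always_eventually allI tendsto_intros u)
      show "AE x in lborel. norm (C x * cos (u i \<bullet> x)) \<le> \<bar>C x\<bar>" for i
        by (auto simp: abs_mult mult_left_le)
    qed (use integrable_C in auto)
  qed
qed

lemma c_hat_measurable [measurable]: "c_hat \<in> borel_measurable borel"
  using c_hat_continuous by (rule borel_measurable_continuous_onI)

lemma c_hat_bound: "c_hat k \<le> (LINT x|lborel. \<bar>C x\<bar>)"
  unfolding c_hat_def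
proof (rule integral_mono)
  show "integrable lborel (\<lambda>x. C x * cos (k \<bullet> x))" by (rule integrable_C_bounded) auto
  show "integrable lborel (\<lambda>x. \<bar>C x\<bar>)" using integrable_C by simp
  show "C x * cos (k \<bullet> x) \<le> \<bar>C x\<bar>" for x
    using mult_left_le[of "\<bar>cos (k \<bullet> x)\<bar>" "\<bar>C x\<bar>"] abs_ge_self[of "C x * cos (k \<bullet> x)"]
    by (simp add: abs_mult)
qed

text \<open>Multiplying \<open>c_hat\<close> by a Gaussian makes Fourier inversion an application of Fubini; the
  Gaussian is removed afterwards.\<close>
lemma gaussian_regularized_inversion:
  assumes a: "a > 0"
  shows "has_bochner_integral lborel (\<lambda>k. (c_hat k * exp (- a * (norm k)\<^sup>2)) *\<^sub>R cis (k \<bullet> y))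
    (complex_of_real (4 * pi * (LINT t|lborel. C (y - (2 * sqrt a) *\<^sub>R t) * exp (- (norm t)\<^sup>2))))"
proof -
  let ?g = "\<lambda>k::vec2. exp (- a * (norm k)\<^sup>2)"
  have g: "integrable lborel ?g" using has_bochner_integral_gaussian[OF a, where 'a=vec2] by (auto simp: has_bochner_integral_iff)
  have int: "integrable (lborel \<Otimes>\<^sub>M lborel) (\<lambda>(k, x). (?g k * C x) *\<^sub>R (cis (k \<bullet> (y - x))))"
  proof (rule Bochner_Integration.integrable_bound[where f="\<lambda>(k,x). ?g k * C x"])
    show "integrable (lborel \<Otimes>\<^sub>M lborel) (\<lambda>(k,x). ?g k * C x)"
      using g integrable_C by (intro lborel_pair.Fubini_integrable) (auto simp: abs_mult)
  qed auto
  have int2: "integrable lborel (\<lambda>k. (c_hat k * ?g k) *\<^sub>R cis (k \<bullet> y))"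
  proof (rule Bochner_Integration.integrable_bound[OF integrable_mult_right[OF g, of "LINT x|lborel. \<bar>C x\<bar>"]])
    have "norm ((c_hat k * ?g k) *\<^sub>R cis (k \<bullet> y)) \<le> norm ((LINT x|lborel. \<bar>C x\<bar>) * ?g k)" for k
      using mult_right_mono[OF c_hat_bound[of k], of "?g k"] c_hat_nonneg[of k]
      by (simp add: abs_mult)
    then show "AE k in lborel. norm ((c_hat k * ?g k) *\<^sub>R cis (k \<bullet> y)) \<le> norm ((LINT x|lborel. \<bar>C x\<bar>) * ?g k)"
      by (intro always_eventually allI)
  qed measurable
  have "(LINT k|lborel. (c_hat k * ?g k) *\<^sub>R cis (k \<bullet> y))
      = (LINT k|lborel. LINT x|lborel. (?g k * C x) *\<^sub>R cis (k \<bullet> (y - x)))"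
  proof (rule Bochner_Integration.integral_cong[OF refl])
    fix k
    have "(c_hat k * ?g k) *\<^sub>R cis (k \<bullet> y) = (of_real (?g k) * cis (k \<bullet> y)) * C_hat C k"
      by (simp add: C_hat_eq scaleR_conv_of_real)
    also have "\<dots> = (LINT x|lborel. (of_real (?g k) * cis (k \<bullet> y)) * (complex_of_real (C x) * cis (- (k \<bullet> x))))"
      unfolding C_hat_def by (rule integral_mult_right_zero[symmetric])
    also have "\<dots> = (LINT x|lborel. (?g k * C x) *\<^sub>R cis (k \<bullet> (y - x)))"
    proof (rule Bochner_Integration.integral_cong[OF refl])
      fix x
      have "cis (k \<bullet> (y - x)) = cis (k \<bullet> y) * cis (- (k \<bullet> x))"
        by (simp add: cis_mult inner_diff_right)
      then show "(of_real (?g k) * cis (k \<bullet> y)) * (complex_of_real (C x) * cis (- (k \<bullet> x)))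
          = (?g k * C x) *\<^sub>R cis (k \<bullet> (y - x))"
        by (simp only: scaleR_conv_of_real of_real_mult mult_ac)
    qed
    finally show "(c_hat k * ?g k) *\<^sub>R cis (k \<bullet> y) = (LINT x|lborel. (?g k * C x) *\<^sub>R cis (k \<bullet> (y - x)))" .
  qed
  also have "\<dots> = (LINT x|lborel. LINT k|lborel. (?g k * C x) *\<^sub>R cis (k \<bullet> (y - x)))"
    by (rule lborel_pair.Fubini_integral[symmetric, OF int])
  also have "\<dots> = (LINT x|lborel. complex_of_real (C x * (pi / a * exp (- (norm (y - x))\<^sup>2 / (4 * a)))))"
  proof (rule Bochner_Integration.integral_cong[OF refl])
    fix x
    have "(LINT k|lborel. (?g k * C x) *\<^sub>R cis (k \<bullet> (y - x))) = (LINT k|lborel. C x *\<^sub>R (?g k *\<^sub>R cis (k \<bullet> (y - x))))"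
      by (simp add: mult.commute)
    also have "\<dots> = C x *\<^sub>R (LINT k|lborel. ?g k *\<^sub>R cis (k \<bullet> (y - x)))"
      by (rule integral_scaleR_right)
    also have "(LINT k|lborel. ?g k *\<^sub>R cis (k \<bullet> (y - x))) = complex_of_real (pi / a * exp (- (norm (y - x))\<^sup>2 / (4 * a)))"
      using has_bochner_integral_integral_eq[OF has_bochner_integral_gaussian_cis[OF a, of "y - x"]] a by simp
    finally show "(LINT k|lborel. (?g k * C x) *\<^sub>R cis (k \<bullet> (y - x))) = complex_of_real (C x * (pi / a * exp (- (norm (y - x))\<^sup>2 / (4 * a))))"
      by (simp add: scaleR_conv_of_real)
  qed
  also have "\<dots> = complex_of_real (LINT x|lborel. C x * (pi / a * exp (- (norm (y - x))\<^sup>2 / (4 * a))))"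
    by (rule integral_complex_of_real)
  also have "(LINT x|lborel. C x * (pi / a * exp (- (norm (y - x))\<^sup>2 / (4 * a)))) =
     4 * pi * (LINT t|lborel. C (y - (2 * sqrt a) *\<^sub>R t) * exp (- (norm t)\<^sup>2))"
  proof -
    let ?f = "\<lambda>x. C x * (pi / a * exp (- (norm (y - x))\<^sup>2 / (4 * a)))"
    have "(LINT x|lborel. ?f x) = 4 * a * (LINT t|lborel. ?f (y + (- (2 * sqrt a)) *\<^sub>R t))"
      using a by (subst integral_lborel_affine) (auto simp: power2_eq_square)
    also have "\<dots> = 4 * a * (LINT t|lborel. pi / a * (C (y - (2 * sqrt a) *\<^sub>R t) * exp (- (norm t)\<^sup>2)))"
      using a by (simp add: power_mult_distrib mult_ac)
    also have "\<dots> = 4 * a * (pi / a * (LINT t|lborel. C (y - (2 * sqrt a) *\<^sub>R t) * exp (- (norm t)\<^sup>2)))"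
      by (subst integral_mult_right_zero) simp
    finally show ?thesis using a by simp
  qed
  finally show ?thesis using int2 by (simp add: has_bochner_integral_iff)
qed

lemma gaussian_average_bound:
  "\<bar>LINT t|lborel. C (y - s *\<^sub>R t) * exp (- (norm t)\<^sup>2)\<bar> \<le> C 0 * pi"
proof -
  have g: "has_bochner_integral lborel (\<lambda>t::vec2. exp (- (norm t)\<^sup>2)) pi"
    by (rule has_bochner_integral_std_gaussian)
  then have gi: "integrable lborel (\<lambda>t::vec2. exp (- (norm t)\<^sup>2))" by (simp add: has_bochner_integral_iff)
  have "\<bar>LINT t|lborel. C (y - s *\<^sub>R t) * exp (- (norm t)\<^sup>2)\<bar> \<le> (LINT t|lborel. C 0 * exp (- (norm (t::vec2))\<^sup>2))"
    unfolding real_norm_def[symmetric]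
  proof (rule norm_lebesgue_integral_le)
    show "integrable lborel (\<lambda>t::vec2. C 0 * exp (- (norm t)\<^sup>2))" using gi by simp
    show "norm (C (y - s *\<^sub>R t) * exp (- (norm t)\<^sup>2)) \<le> C 0 * exp (- (norm t)\<^sup>2)" for t
      using mult_right_mono[OF C_bound[of "y - s *\<^sub>R t"], of "exp (- (norm t)\<^sup>2)"] by (simp add: abs_mult)
  qed
  also have "\<dots> = C 0 * pi"
    by (simp only: integral_mult_right_zero has_bochner_integral_integral_eq[OF g])
  finally show ?thesis .
qed

text \<open>The Gaussian regularizations have integrals bounded by a multiple of \<open>C 0\<close>, and nonnegativity of
  \<open>c_hat\<close> lets Fatou remove the Gaussian.\<close>
lemma integrable_c_hat: "integrable lborel c_hat"
proof (rule integrableI_bounded)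
  let ?g = "\<lambda>n k::vec2. exp (- inverse (real (Suc n)) * (norm k)\<^sup>2)"
  have lim: "(\<lambda>n. ?g n k) \<longlonglongrightarrow> 1" for k
  proof -
    have "(\<lambda>n. ?g n k) \<longlonglongrightarrow> exp (- 0 * (norm k)\<^sup>2)"
      by (intro tendsto_intros LIMSEQ_inverse_real_of_nat)
    then show ?thesis by simp
  qed
  have bnd: "(NNINT k. ennreal (c_hat k * ?g n k)) \<le> ennreal (4 * pi * (C 0 * pi))" for n
  proof -
    have h: "has_bochner_integral lborel (\<lambda>k. c_hat k * ?g n k)
      (4 * pi * (LINT t|lborel. C (0 - (2 * sqrt (inverse (real (Suc n)))) *\<^sub>R t) * exp (- (norm t)\<^sup>2)))"
    proof -
      have "has_bochner_integral lborel (\<lambda>k. complex_of_real (c_hat k * ?g n k))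
        (complex_of_real (4 * pi * (LINT t|lborel. C (0 - (2 * sqrt (inverse (real (Suc n)))) *\<^sub>R t) * exp (- (norm t)\<^sup>2))))"
        using gaussian_regularized_inversion[of "inverse (real (Suc n))" 0] by (simp add: scaleR_conv_of_real)
      then show ?thesis
        unfolding has_bochner_integral_iff complex_of_real_integrable_eq integral_complex_of_real of_real_eq_iff .
    qed
    have "(NNINT k. ennreal (c_hat k * ?g n k)) = ennreal (LINT k|lborel. c_hat k * ?g n k)"
      using h by (intro nn_integral_eq_integral) (auto simp: has_bochner_integral_iff c_hat_nonneg)
    also have "\<dots> \<le> ennreal (4 * pi * (C 0 * pi))"
      unfolding has_bochner_integral_integral_eq[OF h]
      by (intro ennreal_leI mult_left_mono order_trans[OF abs_ge_self gaussian_average_bound]) auto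
    finally show ?thesis .
  qed
  have "(NNINT k. ennreal (norm (c_hat k))) = (NNINT k. liminf (\<lambda>n. ennreal (c_hat k * ?g n k)))"
  proof (rule nn_integral_cong)
    fix k
    have "(\<lambda>n. ennreal (c_hat k * ?g n k)) \<longlonglongrightarrow> ennreal (c_hat k * 1)"
      by (intro tendsto_ennrealI tendsto_intros lim)
    then have "liminf (\<lambda>n. ennreal (c_hat k * ?g n k)) = ennreal (c_hat k)"
      using lim_imp_Liminf[OF sequentially_bot] by fastforce
    then show "ennreal (norm (c_hat k)) = liminf (\<lambda>n. ennreal (c_hat k * ?g n k))" using c_hat_nonneg by simp
  qed
  also have "\<dots> \<le> liminf (\<lambda>n. NNINT k. ennreal (c_hat k * ?g n k))"
    by (rule nn_integral_liminf) measurable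
  also have "\<dots> \<le> ennreal (4 * pi * (C 0 * pi))"
    by (rule order_trans[OF Liminf_mono[OF always_eventually] eq_refl[OF Liminf_const]]) (use bnd in auto)
  finally show "(NNINT k. ennreal (norm (c_hat k))) < \<infinity>"
    using ennreal_less_top order.strict_trans1 by fastforce
qed measurable

text \<open>Fourier inversion: with integrability known, dominated convergence removes the Gaussian.\<close>
lemma integral_c_hat_cis: "(LINT k|lborel. c_hat k *\<^sub>R cis (k \<bullet> y)) = complex_of_real ((2 * pi)\<^sup>2 * C y)"
proof -
  let ?e = "\<lambda>n. inverse (real (Suc n))"
  let ?g = "\<lambda>n k::vec2. exp (- ?e n * (norm k)\<^sup>2)"
  have lim: "(\<lambda>n. ?g n k) \<longlonglongrightarrow> 1" for k
  proof -
    have "(\<lambda>n. ?g n k) \<longlonglongrightarrow> exp (- 0 * (norm k)\<^sup>2)"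
      by (intro tendsto_intros LIMSEQ_inverse_real_of_nat)
    then show ?thesis by simp
  qed
  have gi: "has_bochner_integral lborel (\<lambda>t::vec2. exp (- (norm t)\<^sup>2)) pi"
    by (rule has_bochner_integral_std_gaussian)
  have 1: "(\<lambda>n. LINT k|lborel. (c_hat k * ?g n k) *\<^sub>R cis (k \<bullet> y)) \<longlonglongrightarrow> (LINT k|lborel. c_hat k *\<^sub>R cis (k \<bullet> y))"
  proof (rule integral_dominated_convergence[where w="c_hat"])
    show "AE k in lborel. (\<lambda>n. (c_hat k * ?g n k) *\<^sub>R cis (k \<bullet> y)) \<longlonglongrightarrow> c_hat k *\<^sub>R cis (k \<bullet> y)"
    proof (intro always_eventually allI)
      fix k
      have "(\<lambda>n. (c_hat k * ?g n k) *\<^sub>R cis (k \<bullet> y)) \<longlonglongrightarrow> (c_hat k * 1) *\<^sub>R cis (k \<bullet> y)"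
        by (intro tendsto_intros lim)
      then show "(\<lambda>n. (c_hat k * ?g n k) *\<^sub>R cis (k \<bullet> y)) \<longlonglongrightarrow> c_hat k *\<^sub>R cis (k \<bullet> y)" by simp
    qed
    show "AE x in lborel. norm ((c_hat x * ?g i x) *\<^sub>R cis (x \<bullet> y)) \<le> c_hat x" for i
      using c_hat_nonneg by (auto simp: abs_mult intro!: always_eventually mult_left_le)
  qed (use integrable_c_hat in auto)
  have 2: "(LINT k|lborel. (c_hat k * ?g n k) *\<^sub>R cis (k \<bullet> y))
     = complex_of_real (4 * pi * (LINT t|lborel. C (y - (2 * sqrt (?e n)) *\<^sub>R t) * exp (- (norm t)\<^sup>2)))" for n
    by (rule has_bochner_integral_integral_eq[OF gaussian_regularized_inversion]) simp
  have "(\<lambda>n. LINT t|lborel. C (y - (2 * sqrt (?e n)) *\<^sub>R t) * exp (- (norm t)\<^sup>2)) \<longlonglongrightarrow> (LINT t|lborel. C y * exp (- (norm (t::vec2))\<^sup>2))"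
  proof (rule integral_dominated_convergence[where w="\<lambda>t. C 0 * exp (- (norm (t::vec2))\<^sup>2)"])
    show "AE t in lborel. (\<lambda>n. C (y - (2 * sqrt (?e n)) *\<^sub>R t) * exp (- (norm t)\<^sup>2)) \<longlonglongrightarrow> C y * exp (- (norm t)\<^sup>2)"
    proof (intro always_eventually allI)
      fix t :: vec2
      have "(\<lambda>n. y - (2 * sqrt (?e n)) *\<^sub>R t) \<longlonglongrightarrow> y - (2 * sqrt 0) *\<^sub>R t"
        by (intro tendsto_intros LIMSEQ_inverse_real_of_nat)
      then have "(\<lambda>n. y - (2 * sqrt (?e n)) *\<^sub>R t) \<longlonglongrightarrow> y" by simp
      from continuous_on_tendsto_compose[OF C_continuous this]
      show "(\<lambda>n. C (y - (2 * sqrt (?e n)) *\<^sub>R t) * exp (- (norm t)\<^sup>2)) \<longlonglongrightarrow> C y * exp (- (norm t)\<^sup>2)"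
        by (intro tendsto_intros) auto
    qed
    show "integrable lborel (\<lambda>t. C 0 * exp (- (norm (t::vec2))\<^sup>2))"
      using gi by (auto simp: has_bochner_integral_iff)
    show "AE x in lborel. norm (C (y - (2 * sqrt (?e i)) *\<^sub>R x) * exp (- (norm x)\<^sup>2)) \<le> C 0 * exp (- (norm x)\<^sup>2)" for i
      using C_bound by (auto simp: abs_mult intro!: mult_right_mono always_eventually)
  qed auto
  moreover have "(LINT t|lborel. C y * exp (- (norm (t::vec2))\<^sup>2)) = C y * pi"
    using has_bochner_integral_integral_eq[OF gi] by simp
  ultimately have "(\<lambda>n. LINT k|lborel. (c_hat k * ?g n k) *\<^sub>R cis (k \<bullet> y)) \<longlonglongrightarrow> complex_of_real (4 * pi * (C y * pi))"
    unfolding 2 by (intro tendsto_of_real tendsto_mult_left) (simp only:)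
  from LIMSEQ_unique[OF 1 this] show ?thesis by (simp add: power2_eq_square mult_ac)
qed

end

section \<open>Evolution equations with a bounded convolution-type generator\<close>

lemma integral_power_Icc:
  fixes b :: real assumes "0 \<le> b"
  shows "(NNINT r. ennreal (r ^ n) * indicator {0..b} r) = ennreal (b ^ Suc n / Suc n)"
proof -
  have h: "has_bochner_integral lborel (\<lambda>r. r ^ n * indicator {0..b} r) (b ^ Suc n / Suc n - 0 ^ Suc n / Suc n)"
  proof (rule has_bochner_integral_FTC_Icc_real[OF assms])
    show "DERIV (\<lambda>x. x ^ Suc n / Suc n) x :> x ^ n" for x :: real
      by (intro derivative_eq_intros) auto
  qed auto
  have "(NNINT r. ennreal (r ^ n) * indicator {0..b} r) = (NNINT r. ennreal (r ^ n * indicator {0..b} r))"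
    by (intro nn_integral_cong) (auto simp: indicator_def)
  also have "\<dots> = ennreal (LINT r|lborel. r ^ n * indicator {0..b} r)"
    using h by (intro nn_integral_eq_integral) (auto simp: has_bochner_integral_iff indicator_def)
  also have "(LINT r|lborel. r ^ n * indicator {0..b} r) = b ^ Suc n / Suc n"
    using has_bochner_integral_integral_eq[OF h] by simp
  finally show ?thesis .
qed

lemma tendsto_0_ennrealI:
  fixes f :: "'b \<Rightarrow> ennreal"
  assumes "\<And>e. e > 0 \<Longrightarrow> eventually (\<lambda>x. f x \<le> ennreal e) F"
  shows "(f \<longlongrightarrow> 0) F"
proof (rule order_tendstoI)
  fix a :: ennreal assume "0 < a"
  then obtain e where e: "0 < ennreal e" "ennreal e < a" "e > 0"
    by (metis dense ennreal_cases ennreal_less_zero_iff less_top not_less_iff_gr_or_eq top_neq_ennreal)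
  from assms[OF e(3)] show "eventually (\<lambda>x. f x < a) F"
    by eventually_elim (use e(2) in auto)
qed auto

text \<open>A generator that adds up shifted copies of a function, multiplied by unimodular phases that rotate
  with time. The shifts \<open>J j\<close> are drawn from a finite measure, so that the generator is bounded on
  \<open>L1\<close>, on \<open>L2\<close> and in the supremum norm, by the total mass in each case.\<close>
locale jump_evolution =
  fixes Q :: "'j measure" and J :: "'j \<Rightarrow> 'a::euclidean_space"
    and \<theta> :: "'a \<Rightarrow> 'j \<Rightarrow> real" and c :: "'j \<Rightarrow> complex"
  assumes finite_Q: "finite_measure Q"
    and J_measurable [measurable]: "J \<in> borel_measurable Q"
    and theta_measurable [measurable]: "(\<lambda>(p, j). \<theta> p j) \<in> borel_measurable (borel \<Otimes>\<^sub>M Q)"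
    and c_measurable [measurable]: "c \<in> borel_measurable Q"
    and c_bound: "\<And>j. cmod (c j) \<le> 1"
begin

sublocale Q: finite_measure Q by (rule finite_Q)

sublocale QL: pair_sigma_finite Q "lborel :: 'a measure" ..

definition gen :: "real \<Rightarrow> ('a \<Rightarrow> complex) \<Rightarrow> 'a \<Rightarrow> complex" where
  "gen s \<psi> p = (LINT j|Q. c j * \<psi> (p - J j) * cis (s * \<theta> p j))"

definition mass :: real where "mass = measure Q (space Q)"

lemma mass_nonneg: "0 \<le> mass" by (simp add: mass_def)

lemma theta_measurable' [measurable]:
  assumes [measurable]: "f \<in> borel_measurable N" "g \<in> measurable N Q"
  shows "(\<lambda>x. \<theta> (f x) (g x)) \<in> borel_measurable N"
proof -
  have "(\<lambda>x. (f x, g x)) \<in> measurable N (borel \<Otimes>\<^sub>M Q)" by measurable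
  from measurable_compose[OF this theta_measurable] show ?thesis by simp
qed

lemma gen_measurable [measurable]:
  assumes [measurable]: "(\<lambda>(x, p). \<psi> x p) \<in> borel_measurable (N \<Otimes>\<^sub>M borel)"
    "s \<in> borel_measurable N" "f \<in> borel_measurable N"
  shows "(\<lambda>x. gen (s x) (\<psi> x) (f x)) \<in> borel_measurable N"
proof -
  have [measurable]: "(\<lambda>(x, j). \<psi> x (f x - J j)) \<in> borel_measurable (N \<Otimes>\<^sub>M Q)"
  proof -
    have "(\<lambda>y. (fst y, f (fst y) - J (snd y))) \<in> measurable (N \<Otimes>\<^sub>M Q) (N \<Otimes>\<^sub>M borel)" by measurable
    from measurable_compose[OF this assms(1)] show ?thesis by (simp add: split_beta')
  qed
  have "(\<lambda>(x, j). c j * \<psi> x (f x - J j) * cis (s x * \<theta> (f x) j)) \<in> borel_measurable (N \<Otimes>\<^sub>M Q)"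
    by measurable
  then show ?thesis unfolding gen_def by (rule Q.borel_measurable_lebesgue_integral)
qed

lemma gen_measurable1:
  assumes [measurable]: "\<psi> \<in> borel_measurable borel"
  shows "gen s \<psi> \<in> borel_measurable borel"
  by (rule gen_measurable) measurable

lemma integrand_norm_le: "cmod (c j * \<psi> (p - J j) * cis t) \<le> cmod (\<psi> (p - J j))"
  using mult_left_le[OF c_bound[of j] norm_ge_zero[of "\<psi> (p - J j)"]] by (simp add: norm_mult mult.commute)

lemma integrable_integrand:
  assumes [measurable]: "\<psi> \<in> borel_measurable borel" and "\<And>p. cmod (\<psi> p) \<le> B"
  shows "integrable Q (\<lambda>j. c j * \<psi> (p - J j) * cis (s * \<theta> p j))"
  by (rule Q.integrable_const_bound[where B=B])
     (intro always_eventually allI order_trans[OF integrand_norm_le assms(2)], measurable)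

lemma gen_bound:
  assumes "\<And>p. cmod (\<psi> p) \<le> B"
  shows "cmod (gen s \<psi> p) \<le> mass * B"
proof -
  have B: "0 \<le> B" using assms norm_ge_zero order_trans by blast
  have "ennreal (cmod (gen s \<psi> p)) \<le> (\<integral>\<^sup>+j. ennreal B \<partial>Q)"
    unfolding gen_def
    by (rule order_trans[OF norm_integral_le_nn_integral])
       (intro nn_integral_mono ennreal_leI order_trans[OF integrand_norm_le assms])
  also have "\<dots> = ennreal (mass * B)"
    using B by (simp add: Q.emeasure_eq_measure mass_def ennreal_mult mult.commute)
  finally show ?thesis using B mass_nonneg by (simp add: ennreal_le_iff)
qed

lemma nn_integral_shift:
  fixes f :: "'a \<Rightarrow> ennreal"
  assumes [measurable]: "f \<in> borel_measurable borel"
  shows "(NNINT p. (\<integral>\<^sup>+j. f (p - J j) \<partial>Q)) = ennreal mass * (NNINT p. f p)"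
proof -
  have "(NNINT p. (\<integral>\<^sup>+j. f (p - J j) \<partial>Q)) = (\<integral>\<^sup>+j. (NNINT p. f (p - J j)) \<partial>Q)"
  proof (rule QL.Fubini')
    show "(\<lambda>(j, p). f (p - J j)) \<in> borel_measurable (Q \<Otimes>\<^sub>M lborel)" by measurable
  qed
  also have "\<dots> = (\<integral>\<^sup>+j. (NNINT p. f p) \<partial>Q)"
    by (simp add: nn_integral_lborel_translate)
  also have "\<dots> = ennreal mass * (NNINT p. f p)"
    by (simp add: Q.emeasure_eq_measure mass_def mult.commute)
  finally show ?thesis .
qed

lemma gen_norm_le: "ennreal (cmod (gen s \<psi> p)) \<le> (\<integral>\<^sup>+j. ennreal (cmod (\<psi> (p - J j))) \<partial>Q)"
  unfolding gen_def
  by (rule order_trans[OF norm_integral_le_nn_integral])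
     (intro nn_integral_mono ennreal_leI integrand_norm_le)

lemma gen_L1:
  assumes [measurable]: "\<psi> \<in> borel_measurable borel"
  shows "(NNINT p. ennreal (cmod (gen s \<psi> p))) \<le> ennreal mass * (NNINT p. ennreal (cmod (\<psi> p)))"
  using nn_integral_mono[of lborel "\<lambda>p. ennreal (cmod (gen s \<psi> p))", OF gen_norm_le]
    nn_integral_shift[of "\<lambda>p. ennreal (cmod (\<psi> p))"] by simp

lemma gen_diff:
  assumes "\<psi> \<in> borel_measurable borel" "\<And>p. cmod (\<psi> p) \<le> B"
    and "\<rho> \<in> borel_measurable borel" "\<And>p. cmod (\<rho> p) \<le> B'"
  shows "gen s (\<lambda>p. \<psi> p - \<rho> p) p = gen s \<psi> p - gen s \<rho> p"
proof -
  have "gen s \<psi> p - gen s \<rho> p = (LINT j|Q. c j * \<psi> (p - J j) * cis (s * \<theta> p j) - c j * \<rho> (p - J j) * cis (s * \<theta> p j))"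
    unfolding gen_def
    by (rule Bochner_Integration.integral_diff[symmetric]; rule integrable_integrand; fact)
  then show ?thesis unfolding gen_def by (simp add: algebra_simps)
qed

text \<open>A bounded integrable initial value is propagated by Picard iteration.\<close>

end

text \<open>For a bounded integrable initial value the Picard series converges pointwise and in \<open>L1\<close>, and solves
  the integral equation at every point. This gives a representative with good properties of a solution
  that is otherwise determined only almost everywhere.\<close>
locale jump_cauchy = jump_evolution Q J \<theta> c
  for Q :: "'j measure" and J :: "'j \<Rightarrow> 'a::euclidean_space" and \<theta> c +
  fixes u0 :: "'a \<Rightarrow> complex" and B :: real
  assumes u0_measurable [measurable]: "u0 \<in> borel_measurable borel"
    and u0_bound: "\<And>p. cmod (u0 p) \<le> B"
    and u0_integrable: "integrable lborel u0"
begin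

primrec picard :: "nat \<Rightarrow> real \<Rightarrow> 'a \<Rightarrow> complex" where
  "picard 0 s p = u0 p"
| "picard (Suc n) s p = (LINT r|lborel. indicator {0..s} r *\<^sub>R gen r (picard n r) p)"

lemma B_nonneg: "0 \<le> B" using u0_bound norm_ge_zero order_trans by blast

lemma picard_measurable: "(\<lambda>(s, p). picard n s p) \<in> borel_measurable (borel \<Otimes>\<^sub>M borel)"
proof (induction n)
  case 0
  show ?case by simp
next
  case (Suc n)
  have [measurable]: "(\<lambda>x. picard n (f x) (g x)) \<in> borel_measurable N"
    if [measurable]: "f \<in> borel_measurable N" "g \<in> borel_measurable N" for f :: "'n \<Rightarrow> real" and g and N :: "'n measure"
  proof -
    have "(\<lambda>x. (f x, g x)) \<in> measurable N (borel \<Otimes>\<^sub>M borel)" by measurable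
    from measurable_compose[OF this Suc.IH] show ?thesis by simp
  qed
  have [measurable]: "(\<lambda>y. gen (snd y) (picard n (snd y)) (snd (fst y)))
      \<in> borel_measurable ((borel \<Otimes>\<^sub>M borel) \<Otimes>\<^sub>M (lborel :: real measure))"
    by (rule gen_measurable) measurable
  have [measurable]: "Measurable.pred ((borel \<Otimes>\<^sub>M borel) \<Otimes>\<^sub>M (lborel :: real measure)) (\<lambda>y::((real \<times> 'a) \<times> real). snd y \<in> {0..fst (fst y)})"
    unfolding atLeastAtMost_iff by measurable
  have "(\<lambda>x. LINT r|lborel. indicator {0..fst x} r *\<^sub>R gen r (picard n r) (snd x)) \<in> borel_measurable (borel \<Otimes>\<^sub>M borel)"
  proof (rule lborel.borel_measurable_lebesgue_integral)
    have "(\<lambda>y. indicator {0..fst (fst y)} (snd y) *\<^sub>R gen (snd y) (picard n (snd y)) (snd (fst y)))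
        \<in> borel_measurable ((borel \<Otimes>\<^sub>M borel) \<Otimes>\<^sub>M (lborel :: real measure))"
      unfolding indicator_def by measurable
    then show "(\<lambda>(x, r). indicator {0..fst x} r *\<^sub>R gen r (picard n r) (snd x)) \<in> borel_measurable ((borel \<Otimes>\<^sub>M borel) \<Otimes>\<^sub>M lborel)"
      by (simp add: split_beta')
  qed
  then show ?case by (simp add: split_beta')
qed

lemma picard_measurable' [measurable]:
  assumes [measurable]: "f \<in> borel_measurable N" "g \<in> borel_measurable N"
  shows "(\<lambda>x. picard n (f x) (g x)) \<in> borel_measurable N"
proof -
  have "(\<lambda>x. (f x, g x)) \<in> measurable N (borel \<Otimes>\<^sub>M borel)" by measurable
  from measurable_compose[OF this picard_measurable] show ?thesis by simp
qed

lemma gen_picard_measurable [measurable]: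
  assumes [measurable]: "f \<in> borel_measurable N" "g \<in> borel_measurable N"
  shows "(\<lambda>x. gen (f x) (picard n (f x)) (g x)) \<in> borel_measurable N"
  by (rule gen_measurable) measurable

lemma picard_bound: "s \<ge> 0 \<Longrightarrow> cmod (picard n s p) \<le> B * (mass * s) ^ n / fact n"
proof (induction n arbitrary: s p)
  case 0
  then show ?case using u0_bound by simp
next
  case (Suc n)
  have "ennreal (cmod (picard (Suc n) s p)) \<le> (NNINT r. ennreal (cmod (indicator {0..s} r *\<^sub>R gen r (picard n r) p)))"
    by (simp only: picard.simps norm_integral_le_nn_integral)
  also have "\<dots> \<le> (NNINT r. ennreal (mass * (B * mass ^ n / fact n)) * (ennreal (r ^ n) * indicator {0..s} r))"
  proof (rule nn_integral_mono)
    fix r :: real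
    have "cmod (gen r (picard n r) p) \<le> mass * (B * mass ^ n / fact n) * r ^ n" if "0 \<le> r"
      using gen_bound[of "picard n r" "B * (mass * r) ^ n / fact n" r p] Suc.IH[OF that]
      by (simp add: power_mult_distrib mult_ac)
    then show "ennreal (cmod (indicator {0..s} r *\<^sub>R gen r (picard n r) p)) \<le> ennreal (mass * (B * mass ^ n / fact n)) * (ennreal (r ^ n) * indicator {0..s} r)"
      using B_nonneg mass_nonneg by (auto simp: indicator_def ennreal_mult[symmetric] intro!: ennreal_leI)
  qed
  also have "\<dots> = ennreal (mass * (B * mass ^ n / fact n)) * ennreal (s ^ Suc n / Suc n)"
    by (subst nn_integral_cmult) (auto simp: integral_power_Icc[OF Suc.prems])
  also have "\<dots> = ennreal (B * (mass * s) ^ Suc n / fact (Suc n))"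
    using B_nonneg mass_nonneg Suc.prems
    by (subst ennreal_mult[symmetric]) (auto simp: power_mult_distrib field_simps)
  finally have "ennreal (cmod (picard (Suc n) s p)) \<le> ennreal (B * (mass * s) ^ Suc n / fact (Suc n))" .
  moreover have "0 \<le> B * (mass * s) ^ Suc n / fact (Suc n)"
    using B_nonneg mass_nonneg Suc.prems by (intro divide_nonneg_nonneg mult_nonneg_nonneg zero_le_power) auto
  ultimately show ?case by (rule ennreal_le_iff[THEN iffD1, rotated])
qed

lemma picard_L1:
  "s \<ge> 0 \<Longrightarrow> (NNINT p. ennreal (cmod (picard n s p)))
     \<le> ennreal ((mass * s) ^ n / fact n) * (NNINT p. ennreal (cmod (u0 p)))"
proof (induction n arbitrary: s)
  case 0
  then show ?case by simp
next
  case (Suc n)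
  let ?U = "NNINT p. ennreal (cmod (u0 p))"
  have "(NNINT p. ennreal (cmod (picard (Suc n) s p)))
     \<le> (NNINT p. (NNINT r. ennreal (cmod (gen r (picard n r) p)) * indicator {0..s} r))"
  proof (rule nn_integral_mono)
    fix p
    have "ennreal (cmod (picard (Suc n) s p)) \<le> (NNINT r. ennreal (cmod (indicator {0..s} r *\<^sub>R gen r (picard n r) p)))"
      by (simp only: picard.simps norm_integral_le_nn_integral)
    also have "\<dots> = (NNINT r. ennreal (cmod (gen r (picard n r) p)) * indicator {0..s} r)"
      by (intro nn_integral_cong) (auto simp: indicator_def)
    finally show "ennreal (cmod (picard (Suc n) s p)) \<le> (NNINT r. ennreal (cmod (gen r (picard n r) p)) * indicator {0..s} r)" .
  qed
  also have "\<dots> = (NNINT r. (NNINT p. ennreal (cmod (gen r (picard n r) p)) * indicator {0..s} r))"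
    by (rule lborel_pair.Fubini') measurable
  also have "\<dots> = (NNINT r. (NNINT p. ennreal (cmod (gen r (picard n r) p))) * indicator {0..s} r)"
    by (intro nn_integral_cong nn_integral_multc) measurable
  also have "\<dots> \<le> (NNINT r. ennreal (mass * (mass ^ n / fact n)) * ?U * (ennreal (r ^ n) * indicator {0..s} r))"
  proof (rule nn_integral_mono)
    fix r :: real
    have "(NNINT p. ennreal (cmod (gen r (picard n r) p))) \<le> ennreal (mass * (mass ^ n / fact n)) * ?U * ennreal (r ^ n)"
      if "0 \<le> r"
    proof -
      have "(NNINT p. ennreal (cmod (gen r (picard n r) p))) \<le> ennreal mass * (NNINT p. ennreal (cmod (picard n r p)))"
        by (rule gen_L1) measurable
      also have "\<dots> \<le> ennreal mass * (ennreal ((mass * r) ^ n / fact n) * ?U)"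
        by (rule mult_left_mono[OF Suc.IH[OF that]]) simp
      also have "\<dots> = ennreal (mass * ((mass * r) ^ n / fact n)) * ?U"
        using mass_nonneg that by (subst ennreal_mult) (auto simp: mult.assoc)
      also have "mass * ((mass * r) ^ n / fact n) = mass * (mass ^ n / fact n) * r ^ n"
        by (simp add: power_mult_distrib)
      also have "ennreal (mass * (mass ^ n / fact n) * r ^ n) = ennreal (mass * (mass ^ n / fact n)) * ennreal (r ^ n)"
        using mass_nonneg that by (intro ennreal_mult) auto
      finally show ?thesis by (simp add: mult_ac)
    qed
    then show "(NNINT p. ennreal (cmod (gen r (picard n r) p))) * indicator {0..s} r
        \<le> ennreal (mass * (mass ^ n / fact n)) * ?U * (ennreal (r ^ n) * indicator {0..s} r)"
      by (auto simp: indicator_def)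
  qed
  also have "\<dots> = ennreal (mass * (mass ^ n / fact n)) * ?U * ennreal (s ^ Suc n / Suc n)"
    by (subst nn_integral_cmult) (auto simp: integral_power_Icc[OF Suc.prems])
  also have "\<dots> = (ennreal (mass * (mass ^ n / fact n)) * ennreal (s ^ Suc n / Suc n)) * ?U"
    by (simp only: mult_ac)
  also have "ennreal (mass * (mass ^ n / fact n)) * ennreal (s ^ Suc n / Suc n) = ennreal ((mass * s) ^ Suc n / fact (Suc n))"
    using mass_nonneg Suc.prems
    by (subst ennreal_mult[symmetric]) (auto simp: power_mult_distrib field_simps)
  finally show ?case .
qed

definition sol :: "real \<Rightarrow> 'a \<Rightarrow> complex" where "sol s p = (\<Sum>n. picard n s p)"

lemma exp_sums: "(\<lambda>n. b * x ^ n / fact n) sums (b * exp x)" for b x :: real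
  using sums_mult[OF exp_converges[of x], of b] by (simp add: field_simps)

lemma summable_picard: "s \<ge> 0 \<Longrightarrow> summable (\<lambda>n. cmod (picard n s p))"
  by (rule summable_comparison_test'[OF sums_summable[OF exp_sums[of B "mass * s"]], where N=0])
     (simp only: real_norm_def abs_norm_cancel picard_bound)

lemma sol_measurable [measurable]:
  assumes [measurable]: "f \<in> borel_measurable N" "g \<in> borel_measurable N"
  shows "(\<lambda>x. sol (f x) (g x)) \<in> borel_measurable N"
  unfolding sol_def by measurable

lemma gen_sol_measurable [measurable]:
  assumes [measurable]: "f \<in> borel_measurable N" "g \<in> borel_measurable N"
  shows "(\<lambda>x. gen (f x) (sol (f x)) (g x)) \<in> borel_measurable N"
  by (rule gen_measurable) measurable

lemma sol_bound: "s \<ge> 0 \<Longrightarrow> cmod (sol s p) \<le> B * exp (mass * s)"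
proof -
  assume s: "s \<ge> 0"
  have "cmod (sol s p) \<le> (\<Sum>n. cmod (picard n s p))"
    unfolding sol_def by (rule summable_norm[OF summable_picard[OF s]])
  also have "\<dots> \<le> (\<Sum>n. B * (mass * s) ^ n / fact n)"
    by (rule suminf_le[OF picard_bound[OF s] summable_picard[OF s] sums_summable[OF exp_sums]])
  also have "\<dots> = B * exp (mass * s)" by (rule sums_unique[OF exp_sums, symmetric])
  finally show ?thesis .
qed

lemma sol_L1:
  assumes "s \<ge> 0"
  shows "(NNINT p. ennreal (cmod (sol s p))) \<le> ennreal (exp (mass * s)) * (NNINT p. ennreal (cmod (u0 p)))"
proof -
  let ?U = "NNINT p. ennreal (cmod (u0 p))"
  have "(NNINT p. ennreal (cmod (sol s p))) \<le> (NNINT p. (\<Sum>n. ennreal (cmod (picard n s p))))"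
  proof (rule nn_integral_mono)
    fix p
    have "ennreal (cmod (sol s p)) \<le> ennreal (\<Sum>n. cmod (picard n s p))"
      unfolding sol_def by (intro ennreal_leI summable_norm summable_picard assms)
    also have "\<dots> = (\<Sum>n. ennreal (cmod (picard n s p)))"
      by (rule suminf_ennreal2[symmetric]) (auto intro: summable_picard assms)
    finally show "ennreal (cmod (sol s p)) \<le> (\<Sum>n. ennreal (cmod (picard n s p)))" .
  qed
  also have "\<dots> = (\<Sum>n. NNINT p. ennreal (cmod (picard n s p)))"
    by (rule nn_integral_suminf) measurable
  also have "\<dots> \<le> (\<Sum>n. ennreal ((mass * s) ^ n / fact n) * ?U)"
    by (intro suminf_le picard_L1 assms) auto
  also have "\<dots> = (\<Sum>n. ennreal ((mass * s) ^ n / fact n)) * ?U"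
    by simp
  also have "(\<Sum>n. ennreal ((mass * s) ^ n / fact n)) = ennreal (exp (mass * s))"
    using exp_sums[of 1 "mass * s"] mass_nonneg assms
    by (subst suminf_ennreal2) (auto simp: sums_iff)
  finally show ?thesis .
qed

lemma sol_0: "sol 0 p = u0 p"
proof -
  have "(\<lambda>n. picard n 0 p) sums (\<Sum>n\<in>{0}. picard n 0 p)"
  proof (rule sums_finite)
    fix n assume "n \<notin> {0::nat}"
    then obtain m where n: "n = Suc m" by (cases n) auto
    show "picard n 0 p = 0" using picard_bound[of 0 n p] n by simp
  qed simp
  then show ?thesis by (simp add: sol_def sums_iff)
qed

lemma gen_sol_sums:
  assumes s: "s \<ge> 0"
  shows "(\<lambda>n. gen r (picard n s) p) sums gen r (sol s) p"
proof -
  have "(\<lambda>n. LINT j|Q. c j * picard n s (p - J j) * cis (r * \<theta> p j)) sums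
      (LINT j|Q. (\<Sum>n. c j * picard n s (p - J j) * cis (r * \<theta> p j)))"
  proof (rule sums_integral)
    show "integrable Q (\<lambda>j. c j * picard n s (p - J j) * cis (r * \<theta> p j))" for n
      by (rule integrable_integrand[OF _ picard_bound[OF s]]) measurable
    have le: "norm (c j * picard n s (p - J j) * cis (r * \<theta> p j)) \<le> B * (mass * s) ^ n / fact n" for j n
      by (rule order_trans[OF integrand_norm_le picard_bound[OF s]])
    show "AE j in Q. summable (\<lambda>n. norm (c j * picard n s (p - J j) * cis (r * \<theta> p j)))"
      by (intro always_eventually allI summable_comparison_test'[OF sums_summable[OF exp_sums[of B "mass * s"]], where N=0])
         (use le in auto)
    show "summable (\<lambda>n. LINT j|Q. norm (c j * picard n s (p - J j) * cis (r * \<theta> p j)))"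
    proof (rule summable_comparison_test'[OF summable_mult[OF sums_summable[OF exp_sums[of B "mass * s"]]], where N=0])
      fix n
      have "\<bar>LINT j|Q. norm (c j * picard n s (p - J j) * cis (r * \<theta> p j))\<bar> \<le> (LINT j|Q. B * (mass * s) ^ n / fact n)"
        unfolding real_norm_def[symmetric]
        by (rule norm_lebesgue_integral_le) (auto simp: le)
      then show "norm (LINT j|Q. norm (c j * picard n s (p - J j) * cis (r * \<theta> p j))) \<le> mass * (B * (mass * s) ^ n / fact n)"
        by (simp add: mass_def)
    qed
  qed
  also have "(LINT j|Q. (\<Sum>n. c j * picard n s (p - J j) * cis (r * \<theta> p j))) = gen r (sol s) p"
    unfolding gen_def sol_def
  proof (intro Bochner_Integration.integral_cong refl)
    fix j
    have sm: "summable (\<lambda>n. picard n s (p - J j))" by (rule summable_norm_cancel[OF summable_picard[OF s]])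
    show "(\<Sum>n. c j * picard n s (p - J j) * cis (r * \<theta> p j)) = c j * (\<Sum>n. picard n s (p - J j)) * cis (r * \<theta> p j)"
      using suminf_mult2[OF summable_mult[OF sm, of "c j"], of "cis (r * \<theta> p j)"] suminf_mult[OF sm, of "c j"]
      by simp
  qed
  finally show ?thesis unfolding gen_def .
qed

lemma sol_integral_equation:
  assumes s: "s \<ge> 0"
  shows "sol s p = u0 p + (LINT r|lborel. indicator {0..s} r *\<^sub>R gen r (sol r) p)"
proof -
  let ?b = "\<lambda>n. B * (mass * s) ^ n / fact n"
  have le: "norm (indicator {0..s} r *\<^sub>R gen r (picard n r) p) \<le> (mass * ?b n) * indicator {0..s} r" for r n
  proof -
    have "cmod (gen r (picard n r) p) \<le> mass * ?b n" if "0 \<le> r" "r \<le> s"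
    proof (rule gen_bound)
      fix p
      show "cmod (picard n r p) \<le> ?b n"
        by (rule order_trans[OF picard_bound[OF that(1)]])
           (use that mass_nonneg B_nonneg in \<open>auto intro!: divide_right_mono mult_left_mono power_mono\<close>)
    qed
    then show ?thesis by (auto simp: indicator_def)
  qed
  have ind: "integrable lborel (\<lambda>r. (mass * ?b n) * indicator {0..s} r)" for n
  proof -
    have "integrable lborel (indicat_real {0..s})" by (rule integrable_real_indicator) (simp_all add: emeasure_lborel_Icc_eq)
    then show ?thesis by (rule integrable_mult_right)
  qed
  have "(\<lambda>n. LINT r|lborel. indicator {0..s} r *\<^sub>R gen r (picard n r) p) sums
      (LINT r|lborel. (\<Sum>n. indicator {0..s} r *\<^sub>R gen r (picard n r) p))"
  proof (rule sums_integral)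
    show int: "integrable lborel (\<lambda>r. indicator {0..s} r *\<^sub>R gen r (picard n r) p)" for n
    proof (rule Bochner_Integration.integrable_bound[OF ind[of n]])
      show "AE r in lborel. norm (indicator {0..s} r *\<^sub>R gen r (picard n r) p) \<le> norm ((mass * ?b n) * indicator {0..s} r)"
        unfolding real_norm_def by (intro always_eventually allI order_trans[OF le abs_ge_self])
    qed measurable
    show "AE r in lborel. summable (\<lambda>n. norm (indicator {0..s} r *\<^sub>R gen r (picard n r) p))"
    proof (intro always_eventually allI)
      fix r
      have "summable (\<lambda>n. (mass * ?b n) * indicator {0..s} r)"
        by (intro summable_mult2 summable_mult sums_summable[OF exp_sums])
      from summable_comparison_test'[OF this, of 0 "\<lambda>n. norm (indicator {0..s} r *\<^sub>R gen r (picard n r) p)"] le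
      show "summable (\<lambda>n. norm (indicator {0..s} r *\<^sub>R gen r (picard n r) p))" by simp
    qed
    show "summable (\<lambda>n. LINT r|lborel. norm (indicator {0..s} r *\<^sub>R gen r (picard n r) p))"
    proof (rule summable_comparison_test'[of "\<lambda>n. (mass * ?b n) * s" 0])
      show "summable (\<lambda>n. (mass * ?b n) * s)"
        by (intro summable_mult2 summable_mult sums_summable[OF exp_sums])
      fix n
      have "\<bar>LINT r|lborel. norm (indicator {0..s} r *\<^sub>R gen r (picard n r) p)\<bar> \<le> (LINT r|lborel. (mass * ?b n) * indicator {0..s} r)"
        unfolding real_norm_def[symmetric]
        by (rule norm_lebesgue_integral_le[OF ind]) (use le in auto)
      then show "norm (LINT r|lborel. norm (indicator {0..s} r *\<^sub>R gen r (picard n r) p)) \<le> (mass * ?b n) * s"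
        using s by simp
    qed
  qed
  also have "(LINT r|lborel. (\<Sum>n. indicator {0..s} r *\<^sub>R gen r (picard n r) p)) = (LINT r|lborel. indicator {0..s} r *\<^sub>R gen r (sol r) p)"
  proof (intro Bochner_Integration.integral_cong refl)
    fix r
    show "(\<Sum>n. indicator {0..s} r *\<^sub>R gen r (picard n r) p) = indicator {0..s} r *\<^sub>R gen r (sol r) p"
      using gen_sol_sums[of r r p] by (cases "r \<in> {0..s}") (auto simp: sums_iff)
  qed
  finally have "(\<lambda>n. picard (Suc n) s p) sums (LINT r|lborel. indicator {0..s} r *\<^sub>R gen r (sol r) p)"
    by simp
  from sums_unique[OF sums_Suc[OF this]] show ?thesis unfolding sol_def by (simp only: picard.simps add.commute)
qed

end

context jump_cauchy begin

lemma integrable_cmult_indicator_Ioc: "integrable lborel (\<lambda>t. k * indicat_real {a<..b::real} t)"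
proof -
  have "emeasure lborel {a<..b} \<le> emeasure lborel {a..b}" by (intro emeasure_mono) auto
  then have "emeasure lborel {a<..b} < \<infinity>"
    using emeasure_lborel_Icc_eq[of a b] by (auto simp: less_top[symmetric] top_unique split: if_splits)
  then have "integrable lborel (indicat_real {a<..b})" by (intro integrable_real_indicator) simp_all
  then show ?thesis by (rule integrable_mult_right)
qed

lemma sol_measurable1 [measurable]: "sol t \<in> borel_measurable borel"
  using sol_measurable[of "\<lambda>_. t" borel "\<lambda>p. p"] by simp

lemma integrable_gen_sol:
  assumes a: "0 \<le> a" and b: "a \<le> b"
  shows "integrable lborel (\<lambda>t. indicator {a<..b} t *\<^sub>R gen t (sol t) p)"
proof (rule Bochner_Integration.integrable_bound)
  show "integrable lborel (\<lambda>t. (mass * (B * exp (mass * b))) * indicator {a<..b} t)"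
    by (rule integrable_cmult_indicator_Ioc)
  show "AE t in lborel. norm (indicator {a<..b} t *\<^sub>R gen t (sol t) p) \<le> norm (mass * (B * exp (mass * b)) * indicator {a<..b} t)"
  proof (intro always_eventually allI)
    fix t
    have "cmod (gen t (sol t) p) \<le> mass * (B * exp (mass * b))" if "a < t" "t \<le> b"
    proof (rule gen_bound)
      fix q
      have "cmod (sol t q) \<le> B * exp (mass * t)" using that a by (intro sol_bound) auto
      also have "\<dots> \<le> B * exp (mass * b)" using that B_nonneg mass_nonneg by (intro mult_left_mono) (auto intro: mult_left_mono)
      finally show "cmod (sol t q) \<le> B * exp (mass * b)" .
    qed
    then show "norm (indicator {a<..b} t *\<^sub>R gen t (sol t) p) \<le> norm (mass * (B * exp (mass * b)) * indicator {a<..b} t)"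
      using B_nonneg mass_nonneg by (auto simp: indicator_def)
  qed
qed measurable

lemma sol_increment:
  assumes a: "0 \<le> a" and b: "a \<le> b"
  shows "sol b p - sol a p = (LINT t|lborel. indicator {a<..b} t *\<^sub>R gen t (sol t) p)"
proof -
  have i0: "integrable lborel (\<lambda>t. indicator {0<..c} t *\<^sub>R gen t (sol t) p)" if "0 \<le> c" for c
    by (rule integrable_gen_sol) (use that in auto)
  have eq: "sol c p = u0 p + (LINT t|lborel. indicator {0<..c} t *\<^sub>R gen t (sol t) p)" if "0 \<le> c" for c
  proof -
    have "(LINT t|lborel. indicator {0..c} t *\<^sub>R gen t (sol t) p) = (LINT t|lborel. indicator {0<..c} t *\<^sub>R gen t (sol t) p)"
    proof (rule integral_cong_AE)
      show "AE t in lborel. indicator {0..c} t *\<^sub>R gen t (sol t) p = indicator {0<..c} t *\<^sub>R gen t (sol t) p"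
        using AE_lborel_singleton[of "0::real"] by eventually_elim (auto simp: indicator_def)
    qed measurable
    then show ?thesis using sol_integral_equation[OF that] by simp
  qed
  have "sol b p - sol a p = (LINT t|lborel. indicator {0<..b} t *\<^sub>R gen t (sol t) p) - (LINT t|lborel. indicator {0<..a} t *\<^sub>R gen t (sol t) p)"
    using eq[of a] eq[of b] a b by simp
  also have "\<dots> = (LINT t|lborel. indicator {0<..b} t *\<^sub>R gen t (sol t) p - indicator {0<..a} t *\<^sub>R gen t (sol t) p)"
    using a b by (intro Bochner_Integration.integral_diff[symmetric] i0) auto
  also have "\<dots> = (LINT t|lborel. indicator {a<..b} t *\<^sub>R gen t (sol t) p)"
    using a b by (intro Bochner_Integration.integral_cong refl) (auto simp: indicator_def)
  finally show ?thesis .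
qed

definition u0_norm :: real where "u0_norm = (LINT p|lborel. cmod (u0 p))"

lemma u0_norm: "(NNINT p. ennreal (cmod (u0 p))) = ennreal u0_norm" "0 \<le> u0_norm"
  unfolding u0_norm_def using u0_integrable by (auto intro!: nn_integral_eq_integral)

lemma sol_L1': "s \<ge> 0 \<Longrightarrow> (NNINT p. ennreal (cmod (sol s p))) \<le> ennreal (exp (mass * s) * u0_norm)"
  using sol_L1[of s] u0_norm by (simp add: ennreal_mult)

lemma integrable_sol: "s \<ge> 0 \<Longrightarrow> integrable lborel (sol s)"
proof (rule integrableI_bounded)
  assume "s \<ge> 0"
  then show "(NNINT p. ennreal (norm (sol s p))) < \<infinity>"
    using sol_L1' ennreal_less_top order.strict_trans1 by fastforce
  show "sol s \<in> borel_measurable lborel" using sol_measurable[of "\<lambda>_. s" borel "\<lambda>p. p"] by simp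
qed

lemma gen_sol_L1:
  assumes "0 \<le> t" "t \<le> b"
  shows "(NNINT p. ennreal (cmod (gen r (sol t) p))) \<le> ennreal (mass * (exp (mass * b) * u0_norm))"
proof -
  have "(NNINT p. ennreal (cmod (gen r (sol t) p))) \<le> ennreal mass * (NNINT p. ennreal (cmod (sol t p)))"
    by (rule gen_L1) measurable
  also have "\<dots> \<le> ennreal mass * ennreal (exp (mass * t) * u0_norm)"
    by (intro mult_left_mono sol_L1' assms) auto
  also have "\<dots> = ennreal (mass * (exp (mass * t) * u0_norm))"
    using mass_nonneg u0_norm by (simp add: ennreal_mult)
  also have "\<dots> \<le> ennreal (mass * (exp (mass * b) * u0_norm))"
    using assms mass_nonneg u0_norm by (intro ennreal_leI mult_left_mono mult_right_mono) (auto intro: mult_left_mono)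
  finally show ?thesis .
qed

lemma sol_L1_increment:
  assumes a: "0 \<le> a" and b: "a \<le> b"
  shows "(NNINT p. ennreal (cmod (sol b p - sol a p))) \<le> ennreal (mass * (exp (mass * b) * u0_norm) * (b - a))"
proof -
  have "(NNINT p. ennreal (cmod (sol b p - sol a p)))
     \<le> (NNINT p. (NNINT t. ennreal (cmod (gen t (sol t) p)) * indicator {a<..b} t))"
  proof (rule nn_integral_mono)
    fix p
    have "ennreal (cmod (sol b p - sol a p)) \<le> (NNINT t. ennreal (cmod (indicator {a<..b} t *\<^sub>R gen t (sol t) p)))"
      unfolding sol_increment[OF a b] by (rule norm_integral_le_nn_integral)
    also have "\<dots> = (NNINT t. ennreal (cmod (gen t (sol t) p)) * indicator {a<..b} t)"
      by (intro nn_integral_cong) (auto simp: indicator_def)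
    finally show "ennreal (cmod (sol b p - sol a p)) \<le> (NNINT t. ennreal (cmod (gen t (sol t) p)) * indicator {a<..b} t)" .
  qed
  also have "\<dots> = (NNINT t. (NNINT p. ennreal (cmod (gen t (sol t) p)) * indicator {a<..b} t))"
    by (rule lborel_pair.Fubini') measurable
  also have "\<dots> = (NNINT t. (NNINT p. ennreal (cmod (gen t (sol t) p))) * indicator {a<..b} t)"
    by (intro nn_integral_cong nn_integral_multc) measurable
  also have "\<dots> \<le> (NNINT t. ennreal (mass * (exp (mass * b) * u0_norm)) * indicator {a<..b} t)"
  proof (rule nn_integral_mono)
    fix t
    show "(NNINT p. ennreal (cmod (gen t (sol t) p))) * indicator {a<..b} t
       \<le> ennreal (mass * (exp (mass * b) * u0_norm)) * indicator {a<..b} t"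
      using gen_sol_L1[of t b t] a by (auto simp: indicator_def)
  qed
  also have "\<dots> = ennreal (mass * (exp (mass * b) * u0_norm) * (b - a))"
    using a b mass_nonneg u0_norm by (subst nn_integral_cmult_indicator) (auto simp: ennreal_mult)
  finally show ?thesis .
qed

text \<open>Only the phases depend on the time \<open>r\<close> here. They converge pointwise, without any uniformity, so
  dominated convergence on the product with the jump measure is used.\<close>
lemma gen_sol_time_continuous:
  assumes z: "0 \<le> z"
  shows "((\<lambda>r. NNINT p. ennreal (cmod (gen r (sol z) p - gen z (sol z) p))) \<longlongrightarrow> 0) (at z within {0..})"
  unfolding tendsto_at_iff_sequentially
proof safe
  fix X :: "nat \<Rightarrow> real" assume X: "\<forall>i. X i \<in> {0..} - {z}" "X \<longlonglongrightarrow> z"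
  let ?F = "\<lambda>i x. ennreal (cmod (sol z (fst x - J (snd x))) * cmod (cis (X i * \<theta> (fst x) (snd x)) - cis (z * \<theta> (fst x) (snd x))))"
  have m: "(\<lambda>x. cmod (sol z (fst x - J (snd x)))) \<in> borel_measurable (lborel \<Otimes>\<^sub>M Q)"
    by measurable
  have "(\<lambda>i. \<integral>\<^sup>+x. ?F i x \<partial>(lborel \<Otimes>\<^sub>M Q)) \<longlonglongrightarrow> (\<integral>\<^sup>+x. 0 \<partial>((lborel :: 'a measure) \<Otimes>\<^sub>M Q))"
  proof (rule nn_integral_dominated_convergence[where w="\<lambda>x. ennreal (2 * cmod (sol z (fst x - J (snd x))))"])
    show "(\<integral>\<^sup>+x. ennreal (2 * cmod (sol z (fst x - J (snd x)))) \<partial>(lborel \<Otimes>\<^sub>M Q)) < \<infinity>"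
    proof -
      have "(\<integral>\<^sup>+x. ennreal (2 * cmod (sol z (fst x - J (snd x)))) \<partial>(lborel \<Otimes>\<^sub>M Q))
        = (NNINT p. (\<integral>\<^sup>+j. ennreal (2 * cmod (sol z (p - J j))) \<partial>Q))"
        by (subst Q.nn_integral_fst[symmetric]) auto
      also have "\<dots> = ennreal mass * (NNINT p. ennreal (2 * cmod (sol z p)))"
        by (rule nn_integral_shift) measurable
      also have "\<dots> = ennreal mass * (2 * (NNINT p. ennreal (cmod (sol z p))))"
        by (subst nn_integral_cmult[symmetric]) (auto simp: ennreal_mult)
      also have "\<dots> < \<infinity>" using order.strict_trans1[OF sol_L1'[OF z] ennreal_less_top]
        by (auto simp: ennreal_mult_less_top)
      finally show ?thesis .
    qed
    show "AE x in lborel \<Otimes>\<^sub>M Q. (\<lambda>i. ?F i x) \<longlonglongrightarrow> 0"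
    proof (intro always_eventually allI)
      fix x
      have "(\<lambda>i. cis (X i * \<theta> (fst x) (snd x))) \<longlonglongrightarrow> cis (z * \<theta> (fst x) (snd x))"
        by (intro tendsto_intros X)
      then have "(\<lambda>i. cmod (sol z (fst x - J (snd x))) * cmod (cis (X i * \<theta> (fst x) (snd x)) - cis (z * \<theta> (fst x) (snd x))))
         \<longlonglongrightarrow> cmod (sol z (fst x - J (snd x))) * cmod (cis (z * \<theta> (fst x) (snd x)) - cis (z * \<theta> (fst x) (snd x)))"
        by (intro tendsto_mult[OF tendsto_const] tendsto_norm tendsto_diff[OF _ tendsto_const])
      then have "(\<lambda>i. ?F i x) \<longlonglongrightarrow> ennreal (cmod (sol z (fst x - J (snd x))) * cmod (cis (z * \<theta> (fst x) (snd x)) - cis (z * \<theta> (fst x) (snd x))))"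
        by (rule tendsto_ennrealI)
      then show "(\<lambda>i. ?F i x) \<longlonglongrightarrow> 0" by simp
    qed
    show "AE x in lborel \<Otimes>\<^sub>M Q. ?F i x \<le> ennreal (2 * cmod (sol z (fst x - J (snd x))))" for i
    proof (intro always_eventually allI ennreal_leI)
      fix x
      have "cmod (cis (X i * \<theta> (fst x) (snd x)) - cis (z * \<theta> (fst x) (snd x))) \<le> 1 + 1"
        by (rule order_trans[OF norm_triangle_ineq4]) simp
      then show "cmod (sol z (fst x - J (snd x))) * cmod (cis (X i * \<theta> (fst x) (snd x)) - cis (z * \<theta> (fst x) (snd x))) \<le> 2 * cmod (sol z (fst x - J (snd x)))"
        using mult_left_mono[OF _ norm_ge_zero[of "sol z (fst x - J (snd x))"]] by fastforce
    qed
  qed measurable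
  then have lim: "(\<lambda>i. \<integral>\<^sup>+x. ?F i x \<partial>(lborel \<Otimes>\<^sub>M Q)) \<longlonglongrightarrow> 0" by simp
  have "(\<lambda>i. NNINT p. ennreal (cmod (gen (X i) (sol z) p - gen z (sol z) p))) \<longlonglongrightarrow> 0"
  proof (rule tendsto_sandwich[OF _ _ tendsto_const lim])
    show "\<forall>\<^sub>F i in sequentially. (NNINT p. ennreal (cmod (gen (X i) (sol z) p - gen z (sol z) p))) \<le> (\<integral>\<^sup>+x. ?F i x \<partial>(lborel \<Otimes>\<^sub>M Q))"
    proof (intro always_eventually allI)
      fix i
      have "(NNINT p. ennreal (cmod (gen (X i) (sol z) p - gen z (sol z) p))) \<le> (NNINT p. (\<integral>\<^sup>+j. ?F i (p, j) \<partial>Q))"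
      proof (rule nn_integral_mono)
        fix p
        have "gen (X i) (sol z) p - gen z (sol z) p = (LINT j|Q. c j * sol z (p - J j) * cis (X i * \<theta> p j) - c j * sol z (p - J j) * cis (z * \<theta> p j))"
          unfolding gen_def
          by (rule Bochner_Integration.integral_diff[symmetric]; rule integrable_integrand[OF _ sol_bound[OF z]]; measurable)
        then have "ennreal (cmod (gen (X i) (sol z) p - gen z (sol z) p)) \<le> (\<integral>\<^sup>+j. ennreal (cmod (c j * sol z (p - J j) * cis (X i * \<theta> p j) - c j * sol z (p - J j) * cis (z * \<theta> p j))) \<partial>Q)"
          by (simp only: norm_integral_le_nn_integral)
        also have "\<dots> \<le> (\<integral>\<^sup>+j. ?F i (p, j) \<partial>Q)"
        proof (intro nn_integral_mono ennreal_leI)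
          fix j
          have "cmod (c j * sol z (p - J j) * cis (X i * \<theta> p j) - c j * sol z (p - J j) * cis (z * \<theta> p j))
             = cmod (c j) * (cmod (sol z (p - J j)) * cmod (cis (X i * \<theta> p j) - cis (z * \<theta> p j)))"
            by (simp add: right_diff_distrib[symmetric] norm_mult)
          also have "\<dots> \<le> 1 * (cmod (sol z (p - J j)) * cmod (cis (X i * \<theta> p j) - cis (z * \<theta> p j)))"
            by (intro mult_right_mono c_bound) auto
          finally show "cmod (c j * sol z (p - J j) * cis (X i * \<theta> p j) - c j * sol z (p - J j) * cis (z * \<theta> p j))
            \<le> cmod (sol z (fst (p, j) - J (snd (p, j)))) * cmod (cis (X i * \<theta> (fst (p, j)) (snd (p, j))) - cis (z * \<theta> (fst (p, j)) (snd (p, j))))" by simp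
        qed
        finally show "ennreal (cmod (gen (X i) (sol z) p - gen z (sol z) p)) \<le> (\<integral>\<^sup>+j. ?F i (p, j) \<partial>Q)" .
      qed
      also have "\<dots> = (\<integral>\<^sup>+x. ?F i x \<partial>(lborel \<Otimes>\<^sub>M Q))"
        by (rule Q.nn_integral_fst) measurable
      finally show "(NNINT p. ennreal (cmod (gen (X i) (sol z) p - gen z (sol z) p))) \<le> (\<integral>\<^sup>+x. ?F i x \<partial>(lborel \<Otimes>\<^sub>M Q))" .
    qed
  qed auto
  then show "((\<lambda>r. NNINT p. ennreal (cmod (gen r (sol z) p - gen z (sol z) p))) \<circ> X) \<longlonglongrightarrow> 0"
    by (simp add: o_def)
qed

lemma gen_sol_L1_continuous:
  assumes z: "0 \<le> z" and e: "0 < e"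
  shows "\<exists>d>0. d \<le> 1 \<and> (\<forall>r\<ge>0. \<bar>r - z\<bar> < d \<longrightarrow>
    (NNINT p. ennreal (cmod (gen r (sol r) p - gen z (sol z) p))) \<le> ennreal e)"
proof -
  define c1 where "c1 = mass * (mass * (exp (mass * (z + 1)) * u0_norm))"
  have c1: "0 \<le> c1" using mass_nonneg u0_norm by (simp add: c1_def)
  have "eventually (\<lambda>r. (NNINT p. ennreal (cmod (gen r (sol z) p - gen z (sol z) p))) < ennreal (e / 2)) (at z within {0..})"
    using gen_sol_time_continuous[OF z] e by (intro order_tendstoD(2)) auto
  then obtain d0 where d0: "d0 > 0" and small: "\<And>r. r \<ge> 0 \<Longrightarrow> r \<noteq> z \<Longrightarrow> \<bar>r - z\<bar> < d0 \<Longrightarrow>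
      (NNINT p. ennreal (cmod (gen r (sol z) p - gen z (sol z) p))) < ennreal (e / 2)"
    unfolding eventually_at by (auto simp: dist_real_def)
  define d where "d = min (min d0 1) (e / (2 * (c1 + 1)))"
  have d: "0 < d" "d \<le> 1" "d \<le> d0" "d * c1 \<le> e / 2"
  proof -
    show "0 < d" using d0 e c1 by (auto simp: d_def)
    show "d \<le> 1" "d \<le> d0" by (auto simp: d_def)
    have "d * c1 \<le> (e / (2 * (c1 + 1))) * c1" using c1 by (intro mult_right_mono) (auto simp: d_def)
    also have "\<dots> \<le> e / 2" using c1 e by (simp add: field_simps)
    finally show "d * c1 \<le> e / 2" .
  qed
  show ?thesis
  proof (intro exI[of _ d] conjI allI impI d)
    fix r :: real assume r: "0 \<le> r" "\<bar>r - z\<bar> < d"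
    have rz: "r \<le> z + 1" using r d by auto
    have inc: "(NNINT p. ennreal (cmod (sol r p - sol z p))) \<le> ennreal (mass * (exp (mass * (z + 1)) * u0_norm) * d)"
    proof -
      have *: "(NNINT p. ennreal (cmod (sol r p - sol z p))) \<le> ennreal (mass * (exp (mass * max r z) * u0_norm) * \<bar>r - z\<bar>)"
      proof (cases "r \<le> z")
        case True
        then show ?thesis using sol_L1_increment[of r z] r by (simp add: norm_minus_commute max_def abs_if)
      next
        case False
        then show ?thesis using sol_L1_increment[of z r] z by (simp add: max_def abs_if)
      qed
      have "max r z \<le> z + 1" using rz by auto
      then have "mass * (exp (mass * max r z) * u0_norm) * \<bar>r - z\<bar> \<le> mass * (exp (mass * (z + 1)) * u0_norm) * d"
        using r mass_nonneg u0_norm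
        by (intro mult_mono mult_left_mono mult_right_mono) (auto intro: mult_left_mono)
      with * show ?thesis by (meson ennreal_leI order_trans)
    qed
    have "(NNINT p. ennreal (cmod (gen r (sol r) p - gen z (sol z) p)))
       \<le> (NNINT p. ennreal (cmod (gen r (\<lambda>p. sol r p - sol z p) p)) + ennreal (cmod (gen r (sol z) p - gen z (sol z) p)))"
    proof (rule nn_integral_mono)
      fix p
      have "gen r (sol r) p - gen z (sol z) p = gen r (\<lambda>p. sol r p - sol z p) p + (gen r (sol z) p - gen z (sol z) p)"
        by (subst gen_diff[OF sol_measurable1 sol_bound[OF r(1)] sol_measurable1 sol_bound[OF z]]) simp
      then have "cmod (gen r (sol r) p - gen z (sol z) p) \<le> cmod (gen r (\<lambda>p. sol r p - sol z p) p) + cmod (gen r (sol z) p - gen z (sol z) p)"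
        by (simp only: norm_triangle_ineq)
      then show "ennreal (cmod (gen r (sol r) p - gen z (sol z) p)) \<le> ennreal (cmod (gen r (\<lambda>p. sol r p - sol z p) p)) + ennreal (cmod (gen r (sol z) p - gen z (sol z) p))"
        by (simp add: ennreal_plus[symmetric] ennreal_leI del: ennreal_plus)
    qed
    also have "\<dots> = (NNINT p. ennreal (cmod (gen r (\<lambda>p. sol r p - sol z p) p))) + (NNINT p. ennreal (cmod (gen r (sol z) p - gen z (sol z) p)))"
    proof (rule nn_integral_add)
      have "gen r (\<lambda>p. sol r p - sol z p) \<in> borel_measurable borel" by (rule gen_measurable1) measurable
      then show "(\<lambda>p. ennreal (cmod (gen r (\<lambda>p. sol r p - sol z p) p))) \<in> borel_measurable lborel" by measurable
      have "gen t (sol z) \<in> borel_measurable borel" for t by (rule gen_measurable1) measurable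
      then show "(\<lambda>p. ennreal (cmod (gen r (sol z) p - gen z (sol z) p))) \<in> borel_measurable lborel" by measurable
    qed
    also have "\<dots> \<le> ennreal (e / 2) + ennreal (e / 2)"
    proof (rule add_mono)
      have "(NNINT p. ennreal (cmod (gen r (\<lambda>p. sol r p - sol z p) p))) \<le> ennreal mass * (NNINT p. ennreal (cmod (sol r p - sol z p)))"
        by (rule gen_L1) measurable
      also have "\<dots> \<le> ennreal mass * ennreal (mass * (exp (mass * (z + 1)) * u0_norm) * d)"
        by (intro mult_left_mono inc) auto
      also have "\<dots> = ennreal (d * c1)"
        using mass_nonneg u0_norm d by (subst ennreal_mult[symmetric]) (auto simp: c1_def mult_ac)
      also have "\<dots> \<le> ennreal (e / 2)" by (intro ennreal_leI d)
      finally show "(NNINT p. ennreal (cmod (gen r (\<lambda>p. sol r p - sol z p) p))) \<le> ennreal (e / 2)" .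
      show "(NNINT p. ennreal (cmod (gen r (sol z) p - gen z (sol z) p))) \<le> ennreal (e / 2)"
        using small[of r] r d by (cases "r = z") auto
    qed
    also have "\<dots> = ennreal e" using e by (simp add: ennreal_plus[symmetric] del: ennreal_plus)
    finally show "(NNINT p. ennreal (cmod (gen r (sol r) p - gen z (sol z) p))) \<le> ennreal e" .
  qed
qed

text \<open>The difference quotient minus the generator is bounded, and small in \<open>L1\<close> because the generator is
  continuous in \<open>L1\<close> along the solution; a bounded function that is small in \<open>L1\<close> is small in \<open>L2\<close>.\<close>
lemma sol_L2_derivative:
  assumes z: "0 \<le> z"
  shows "((\<lambda>s. NNINT p. ennreal ((cmod ((sol s p - sol z p) /\<^sub>R (s - z) - gen z (sol z) p))\<^sup>2)) \<longlongrightarrow> 0) (at z within {0..})"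
proof (rule tendsto_0_ennrealI)
  fix e :: real assume e: "0 < e"
  define B2 where "B2 = 2 * (mass * (B * exp (mass * (z + 1))))"
  have B2: "0 \<le> B2" unfolding B2_def by (intro mult_nonneg_nonneg mass_nonneg B_nonneg) auto
  define e1 where "e1 = e / (B2 + 1)"
  have e1: "0 < e1" "B2 * e1 \<le> e" using e B2 by (auto simp: e1_def field_simps)
  from gen_sol_L1_continuous[OF z e1(1)] obtain d where d: "0 < d" "d \<le> 1"
    and small: "\<And>r. 0 \<le> r \<Longrightarrow> \<bar>r - z\<bar> < d \<Longrightarrow> (NNINT p. ennreal (cmod (gen r (sol r) p - gen z (sol z) p))) \<le> ennreal e1"
    by blast
  show "\<forall>\<^sub>F s in at z within {0..}. (NNINT p. ennreal ((cmod ((sol s p - sol z p) /\<^sub>R (s - z) - gen z (sol z) p))\<^sup>2)) \<le> ennreal e"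
    unfolding eventually_at
  proof (intro exI[of _ d] conjI ballI impI d)
    fix s assume s: "s \<in> {0..}" "s \<noteq> z \<and> dist s z < d"
    define a b where "a = min s z" and "b = max s z"
    have ab: "0 \<le> a" "a < b" "b \<le> z + 1" "b - a = \<bar>s - z\<bar>" using s z d by (auto simp: a_def b_def dist_real_def)
    have t: "0 \<le> t \<and> \<bar>t - z\<bar> < d \<and> t \<le> z + 1" if "t \<in> {a<..b}" for t
      using that s z d by (auto simp: a_def b_def dist_real_def)
    let ?D = "\<lambda>p. (sol s p - sol z p) /\<^sub>R (s - z) - gen z (sol z) p"
    have genb: "cmod (gen t (sol t) p) \<le> B2 / 2" if "0 \<le> t" "t \<le> z + 1" for t p
    proof -
      have "cmod (gen t (sol t) p) \<le> mass * (B * exp (mass * (z + 1)))"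
      proof (rule gen_bound)
        fix q
        have "cmod (sol t q) \<le> B * exp (mass * t)" using that by (intro sol_bound) auto
        also have "\<dots> \<le> B * exp (mass * (z + 1))" using that B_nonneg mass_nonneg by (intro mult_left_mono) (auto intro: mult_left_mono)
        finally show "cmod (sol t q) \<le> B * exp (mass * (z + 1))" .
      qed
      then show ?thesis by (simp add: B2_def)
    qed
    have Deq: "?D p = (LINT t|lborel. indicator {a<..b} t *\<^sub>R (gen t (sol t) p - gen z (sol z) p)) /\<^sub>R (b - a)" for p
    proof -
      have "(sol s p - sol z p) /\<^sub>R (s - z) = (sol b p - sol a p) /\<^sub>R (b - a)"
      proof (cases "s \<le> z")
        case True
        then have "(sol b p - sol a p) /\<^sub>R (b - a) = (- (sol s p - sol z p)) /\<^sub>R (- (s - z))" by (simp add: a_def b_def)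
        also have "\<dots> = (sol s p - sol z p) /\<^sub>R (s - z)" by (simp only: inverse_minus_eq scaleR_minus_left scaleR_minus_right minus_minus)
        finally show ?thesis by simp
      qed (simp add: a_def b_def)
      moreover have "(LINT t|lborel. indicator {a<..b} t *\<^sub>R (gen t (sol t) p - gen z (sol z) p))
          = (sol b p - sol a p) - (b - a) *\<^sub>R gen z (sol z) p"
      proof -
        have "(LINT t|lborel. indicator {a<..b} t *\<^sub>R gen t (sol t) p - indicator {a<..b} t *\<^sub>R gen z (sol z) p)
           = (LINT t|lborel. indicator {a<..b} t *\<^sub>R gen t (sol t) p) - (LINT t|lborel. indicator {a<..b} t *\<^sub>R gen z (sol z) p)"
          using ab by (intro Bochner_Integration.integral_diff integrable_gen_sol) auto
        then show ?thesis using ab sol_increment[of a b p] by (simp add: scaleR_diff_right)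
      qed
      ultimately show ?thesis using ab by (simp add: scaleR_diff_right)
    qed
    have Db: "cmod (?D p) \<le> B2" for p
    proof -
      have "cmod (LINT t|lborel. indicator {a<..b} t *\<^sub>R (gen t (sol t) p - gen z (sol z) p)) \<le> (LINT t|lborel. B2 * indicator {a<..b} t)"
      proof (rule norm_lebesgue_integral_le)
        fix t
        have "cmod (gen t (sol t) p - gen z (sol z) p) \<le> B2" if "t \<in> {a<..b}"
          using norm_triangle_ineq4[of "gen t (sol t) p" "gen z (sol z) p"] genb[of t p] genb[of z p] t[OF that] z by simp
        then show "cmod (indicator {a<..b} t *\<^sub>R (gen t (sol t) p - gen z (sol z) p)) \<le> B2 * indicator {a<..b} t"
          by (auto simp: indicator_def)
      qed (rule integrable_cmult_indicator_Ioc)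
      also have "\<dots> = B2 * (b - a)" using ab by simp
      finally show ?thesis unfolding Deq using ab by (simp add: divide_simps mult.commute)
    qed
    have gm [measurable]: "gen z (sol z) \<in> borel_measurable borel" by (rule gen_measurable1) measurable
    have "(NNINT p. ennreal (cmod (?D p)))
       \<le> (NNINT p. ennreal (1 / (b - a)) * (NNINT t. ennreal (cmod (gen t (sol t) p - gen z (sol z) p)) * indicator {a<..b} t))"
    proof (rule nn_integral_mono)
      fix p
      have "ennreal (cmod (?D p)) = ennreal (1 / (b - a)) * ennreal (cmod (LINT t|lborel. indicator {a<..b} t *\<^sub>R (gen t (sol t) p - gen z (sol z) p)))"
        unfolding Deq using ab by (simp add: ennreal_mult[symmetric] divide_inverse)
      also have "\<dots> \<le> ennreal (1 / (b - a)) * (NNINT t. ennreal (cmod (indicator {a<..b} t *\<^sub>R (gen t (sol t) p - gen z (sol z) p))))"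
        by (intro mult_left_mono norm_integral_le_nn_integral) auto
      also have "(NNINT t. ennreal (cmod (indicator {a<..b} t *\<^sub>R (gen t (sol t) p - gen z (sol z) p))))
          = (NNINT t. ennreal (cmod (gen t (sol t) p - gen z (sol z) p)) * indicator {a<..b} t)"
        by (intro nn_integral_cong) (auto simp: indicator_def)
      finally show "ennreal (cmod (?D p)) \<le> ennreal (1 / (b - a)) * (NNINT t. ennreal (cmod (gen t (sol t) p - gen z (sol z) p)) * indicator {a<..b} t)" .
    qed
    also have "\<dots> = ennreal (1 / (b - a)) * (NNINT p. (NNINT t. ennreal (cmod (gen t (sol t) p - gen z (sol z) p)) * indicator {a<..b} t))"
      by (rule nn_integral_cmult) measurable
    also have "(NNINT p. (NNINT t. ennreal (cmod (gen t (sol t) p - gen z (sol z) p)) * indicator {a<..b} t))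
        = (NNINT t. (NNINT p. ennreal (cmod (gen t (sol t) p - gen z (sol z) p)) * indicator {a<..b} t))"
      by (rule lborel_pair.Fubini') measurable
    also have "\<dots> = (NNINT t. (NNINT p. ennreal (cmod (gen t (sol t) p - gen z (sol z) p))) * indicator {a<..b} t)"
      by (intro nn_integral_cong nn_integral_multc) measurable
    also have "\<dots> \<le> (NNINT t. ennreal e1 * indicator {a<..b} t)"
    proof (rule nn_integral_mono)
      fix r show "(NNINT p. ennreal (cmod (gen r (sol r) p - gen z (sol z) p))) * indicator {a<..b} r \<le> ennreal e1 * indicator {a<..b} r"
        using small[of r] t[of r] by (auto simp: indicator_def)
    qed
    also have "\<dots> = ennreal (e1 * (b - a))"
      using ab e1 by (subst nn_integral_cmult_indicator) (auto simp: ennreal_mult)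
    finally have D1: "(NNINT p. ennreal (cmod (?D p))) \<le> ennreal (1 / (b - a)) * ennreal (e1 * (b - a))"
      by (simp add: mult_left_mono)
    have D1': "(NNINT p. ennreal (cmod (?D p))) \<le> ennreal e1"
      using D1 ab e1 by (simp add: ennreal_mult[symmetric])
    have "(NNINT p. ennreal ((cmod (?D p))\<^sup>2)) \<le> (NNINT p. ennreal B2 * ennreal (cmod (?D p)))"
      using Db B2 by (intro nn_integral_mono) (auto simp: ennreal_mult[symmetric] power2_eq_square intro!: ennreal_leI mult_right_mono)
    also have "\<dots> = ennreal B2 * (NNINT p. ennreal (cmod (?D p)))"
      by (rule nn_integral_cmult) measurable
    also have "\<dots> \<le> ennreal B2 * ennreal e1" by (intro mult_left_mono D1') auto
    also have "\<dots> \<le> ennreal e" using e1 B2 by (simp add: ennreal_mult[symmetric] ennreal_leI)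
    finally show "(NNINT p. ennreal ((cmod (?D p))\<^sup>2)) \<le> ennreal e" .
  qed
qed

lemma sol_L2:
  assumes z: "0 \<le> z"
  shows "(NNINT p. ennreal ((cmod (sol z p))\<^sup>2)) < \<infinity>"
proof -
  have "(NNINT p. ennreal ((cmod (sol z p))\<^sup>2)) \<le> (NNINT p. ennreal (B * exp (mass * z)) * ennreal (cmod (sol z p)))"
    using sol_bound[OF z] B_nonneg by (intro nn_integral_mono) (auto simp: ennreal_mult[symmetric] power2_eq_square intro!: ennreal_leI mult_right_mono)
  also have "\<dots> = ennreal (B * exp (mass * z)) * (NNINT p. ennreal (cmod (sol z p)))"
    by (rule nn_integral_cmult) measurable
  also have "\<dots> < \<infinity>" using order.strict_trans1[OF sol_L1'[OF z] ennreal_less_top]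
    by (auto simp: ennreal_mult_less_top)
  finally show ?thesis .
qed

end

definition L2 :: "('a::euclidean_space \<Rightarrow> complex) \<Rightarrow> bool" where
  "L2 f \<longleftrightarrow> f \<in> borel_measurable borel \<and> integrable lborel (\<lambda>p. (cmod (f p))\<^sup>2)"

lemma L2_measurable: "L2 f \<Longrightarrow> f \<in> borel_measurable borel" by (simp add: L2_def)

lemma L2_integrable: "L2 f \<Longrightarrow> integrable lborel (\<lambda>p. (cmod (f p))\<^sup>2)" by (simp add: L2_def)

lemma L2_nn_integral: "L2 f \<Longrightarrow> (NNINT p. ennreal ((cmod (f p))\<^sup>2)) = ennreal (LINT p|lborel. (cmod (f p))\<^sup>2)"
  by (intro nn_integral_eq_integral L2_integrable) auto

lemma L2I: "f \<in> borel_measurable borel \<Longrightarrow> (NNINT p. ennreal ((cmod (f p))\<^sup>2)) < \<infinity> \<Longrightarrow> L2 f"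
  unfolding L2_def by (auto intro!: integrableI_bounded)

lemma cmod_add_square: "(cmod (x + y))\<^sup>2 \<le> 2 * (cmod x)\<^sup>2 + 2 * (cmod y)\<^sup>2"
proof -
  have "(cmod (x + y))\<^sup>2 \<le> (cmod x + cmod y)\<^sup>2" by (intro power_mono norm_triangle_ineq) auto
  also have "\<dots> \<le> 2 * (cmod x)\<^sup>2 + 2 * (cmod y)\<^sup>2"
    using zero_le_power2[of "cmod x - cmod y"] by (simp add: power2_eq_square algebra_simps)
  finally show ?thesis .
qed

lemma L2_add:
  assumes f: "L2 f" and g: "L2 g"
  shows "L2 (\<lambda>p. f p + g p)"
    and "(LINT p|lborel. (cmod (f p + g p))\<^sup>2) \<le> 2 * (LINT p|lborel. (cmod (f p))\<^sup>2) + 2 * (LINT p|lborel. (cmod (g p))\<^sup>2)"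
proof -
  note [measurable] = L2_measurable[OF f] L2_measurable[OF g]
  have i: "integrable lborel (\<lambda>p. 2 * (cmod (f p))\<^sup>2 + 2 * (cmod (g p))\<^sup>2)"
    by (intro Bochner_Integration.integrable_add integrable_mult_right L2_integrable f g)
  have j: "integrable lborel (\<lambda>p. (cmod (f p + g p))\<^sup>2)"
    by (rule Bochner_Integration.integrable_bound[OF i]) (auto intro!: always_eventually cmod_add_square)
  have "(\<lambda>p. f p + g p) \<in> borel_measurable borel" by measurable
  with j show "L2 (\<lambda>p. f p + g p)" by (simp add: L2_def)
  have "(LINT p|lborel. (cmod (f p + g p))\<^sup>2) \<le> (LINT p|lborel. 2 * (cmod (f p))\<^sup>2 + 2 * (cmod (g p))\<^sup>2)"
    by (intro Bochner_Integration.integral_mono i j cmod_add_square)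
  also have "\<dots> = 2 * (LINT p|lborel. (cmod (f p))\<^sup>2) + 2 * (LINT p|lborel. (cmod (g p))\<^sup>2)"
    by (subst Bochner_Integration.integral_add) (auto intro!: integrable_mult_right L2_integrable f g)
  finally show "(LINT p|lborel. (cmod (f p + g p))\<^sup>2) \<le> 2 * (LINT p|lborel. (cmod (f p))\<^sup>2) + 2 * (LINT p|lborel. (cmod (g p))\<^sup>2)" .
qed

lemma L2_scaleR: "L2 f \<Longrightarrow> L2 (\<lambda>p. a *\<^sub>R f p)"
  unfolding L2_def by (auto simp: power_mult_distrib)

lemma L2_diff: "L2 f \<Longrightarrow> L2 g \<Longrightarrow> L2 (\<lambda>p. f p - g p)"
  using L2_add(1)[of f "\<lambda>p. (-1) *\<^sub>R g p"] L2_scaleR[of g "-1"] by simp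

lemma L2_inner:
  assumes f: "L2 f" and g: "L2 g"
  shows "integrable lborel (\<lambda>p. f p \<bullet> g p)"
    and "\<bar>LINT p|lborel. f p \<bullet> g p\<bar> \<le> sqrt (LINT p|lborel. (cmod (f p))\<^sup>2) * sqrt (LINT p|lborel. (cmod (g p))\<^sup>2)"
proof -
  note [measurable] = L2_measurable[OF f] L2_measurable[OF g]
  let ?F = "LINT p|lborel. (cmod (f p))\<^sup>2" and ?G = "LINT p|lborel. (cmod (g p))\<^sup>2"
  have FG: "0 \<le> ?F" "0 \<le> ?G" by simp_all
  have "integrable lborel (\<lambda>p. (cmod (f p))\<^sup>2 + (cmod (g p))\<^sup>2)"
    by (intro Bochner_Integration.integrable_add L2_integrable f g)
  then show i: "integrable lborel (\<lambda>p. f p \<bullet> g p)"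
  proof (rule Bochner_Integration.integrable_bound)
    have "\<bar>f p \<bullet> g p\<bar> \<le> (cmod (f p))\<^sup>2 + (cmod (g p))\<^sup>2" for p
      using Cauchy_Schwarz_ineq2[of "f p" "g p"] sum_squares_bound[of "cmod (f p)" "cmod (g p)"]
        mult_nonneg_nonneg[OF norm_ge_zero[of "f p"] norm_ge_zero[of "g p"]] by linarith
    then show "AE p in lborel. norm (f p \<bullet> g p) \<le> norm ((cmod (f p))\<^sup>2 + (cmod (g p))\<^sup>2)"
      by (intro always_eventually allI) simp
  qed measurable
  have "(ennreal \<bar>LINT p|lborel. f p \<bullet> g p\<bar>)\<^sup>2 \<le> (NNINT p. ennreal (cmod (f p)) * ennreal (cmod (g p)))\<^sup>2"
  proof (rule power_mono)
    have "ennreal \<bar>LINT p|lborel. f p \<bullet> g p\<bar> \<le> (NNINT p. ennreal \<bar>f p \<bullet> g p\<bar>)"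
      using norm_integral_le_nn_integral[of lborel "\<lambda>p. f p \<bullet> g p"] by simp
    also have "\<dots> \<le> (NNINT p. ennreal (cmod (f p)) * ennreal (cmod (g p)))"
      by (intro nn_integral_mono) (simp add: ennreal_mult[symmetric] ennreal_leI Cauchy_Schwarz_ineq2)
    finally show "ennreal \<bar>LINT p|lborel. f p \<bullet> g p\<bar> \<le> (NNINT p. ennreal (cmod (f p)) * ennreal (cmod (g p)))" .
  qed simp
  also have "\<dots> \<le> (NNINT p. (ennreal (cmod (f p)))\<^sup>2) * (NNINT p. (ennreal (cmod (g p)))\<^sup>2)"
    by (rule Cauchy_Schwarz_nn_integral) measurable
  also have "\<dots> = ennreal (?F * ?G)"
    using FG by (simp add: ennreal_power L2_nn_integral f g ennreal_mult)
  finally have "\<bar>LINT p|lborel. f p \<bullet> g p\<bar>\<^sup>2 \<le> ?F * ?G"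
    using FG by (simp add: ennreal_power ennreal_le_iff)
  then show "\<bar>LINT p|lborel. f p \<bullet> g p\<bar> \<le> sqrt ?F * sqrt ?G"
    unfolding real_sqrt_mult[symmetric] by (rule real_le_rsqrt)
qed

context jump_evolution begin

text \<open>Integrating over \<open>p\<close> first, the square of the shifted function is integrable on the product with the
  finite jump measure, hence so is the function itself for almost every \<open>p\<close>.\<close>
lemma AE_integrable_integrand:
  assumes "L2 \<psi>"
  shows "AE p in lborel. integrable Q (\<lambda>j. c j * \<psi> (p - J j) * cis (s * \<theta> p j))"
proof -
  note [measurable] = L2_measurable[OF assms]
  have "(NNINT p. (\<integral>\<^sup>+j. ennreal ((cmod (\<psi> (p - J j)))\<^sup>2) \<partial>Q)) \<noteq> \<infinity>"
    by (subst nn_integral_shift) (auto simp: L2_nn_integral[OF assms] ennreal_mult_eq_top_iff)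
  then have "AE p in lborel. (\<integral>\<^sup>+j. ennreal ((cmod (\<psi> (p - J j)))\<^sup>2) \<partial>Q) \<noteq> \<infinity>"
    by (intro nn_integral_PInf_AE) measurable
  then show ?thesis
  proof eventually_elim
    case (elim p)
    have "integrable Q (\<lambda>j. 1 + (cmod (\<psi> (p - J j)))\<^sup>2)"
      using elim by (intro Bochner_Integration.integrable_add Q.integrable_const integrableI_bounded) (auto simp: less_top)
    then show ?case
    proof (rule Bochner_Integration.integrable_bound)
      have "cmod (c j * \<psi> (p - J j) * cis (s * \<theta> p j)) \<le> norm (1 + (cmod (\<psi> (p - J j)))\<^sup>2)" for j
      proof -
        have "cmod (\<psi> (p - J j)) \<le> 1 + (cmod (\<psi> (p - J j)))\<^sup>2"
          using sum_squares_bound[of 1 "cmod (\<psi> (p - J j))"] norm_ge_zero[of "\<psi> (p - J j)"]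
            unfolding power_one mult_1_right by linarith
        then show ?thesis using integrand_norm_le[of j \<psi> p "s * \<theta> p j"] by simp
      qed
      then show "AE j in Q. cmod (c j * \<psi> (p - J j) * cis (s * \<theta> p j)) \<le> norm (1 + (cmod (\<psi> (p - J j)))\<^sup>2)"
        by (intro always_eventually allI)
    qed measurable
  qed
qed

text \<open>A square integrable function need not be integrable along the jumps at every point, so linearity of
  the generator holds only almost everywhere; Cauchy--Schwarz and Fubini give the bound.\<close>
lemma gen_L2_diff:
  assumes f: "L2 \<psi>" and g: "L2 \<rho>"
  shows "L2 (\<lambda>p. gen s \<psi> p - gen s \<rho> p)"
    and "(LINT p|lborel. (cmod (gen s \<psi> p - gen s \<rho> p))\<^sup>2) \<le> mass\<^sup>2 * (LINT p|lborel. (cmod (\<psi> p - \<rho> p))\<^sup>2)"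
proof -
  note [measurable] = L2_measurable[OF f] L2_measurable[OF g]
  have d: "L2 (\<lambda>p. \<psi> p - \<rho> p)" by (rule L2_diff[OF f g])
  let ?N = "LINT p|lborel. (cmod (\<psi> p - \<rho> p))\<^sup>2"
  have [measurable]: "gen s \<psi> \<in> borel_measurable borel" "gen s \<rho> \<in> borel_measurable borel"
    by (rule gen_measurable1; measurable)+
  have "(NNINT p. ennreal ((cmod (gen s \<psi> p - gen s \<rho> p))\<^sup>2))
      \<le> (NNINT p. ennreal mass * (\<integral>\<^sup>+j. ennreal ((cmod (\<psi> (p - J j) - \<rho> (p - J j)))\<^sup>2) \<partial>Q))"
  proof (rule nn_integral_mono_AE)
    show "AE p in lborel. ennreal ((cmod (gen s \<psi> p - gen s \<rho> p))\<^sup>2)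
       \<le> ennreal mass * (\<integral>\<^sup>+j. ennreal ((cmod (\<psi> (p - J j) - \<rho> (p - J j)))\<^sup>2) \<partial>Q)"
      using AE_integrable_integrand[OF f, of s] AE_integrable_integrand[OF g, of s]
    proof eventually_elim
      case (elim p)
      have "gen s \<psi> p - gen s \<rho> p = (LINT j|Q. c j * \<psi> (p - J j) * cis (s * \<theta> p j) - c j * \<rho> (p - J j) * cis (s * \<theta> p j))"
        unfolding gen_def by (rule Bochner_Integration.integral_diff[symmetric]; fact)
      also have "\<dots> = gen s (\<lambda>p. \<psi> p - \<rho> p) p"
        unfolding gen_def by (simp add: algebra_simps)
      finally have "ennreal (cmod (gen s \<psi> p - gen s \<rho> p)) \<le> (\<integral>\<^sup>+j. ennreal (cmod (\<psi> (p - J j) - \<rho> (p - J j))) \<partial>Q)"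
        using gen_norm_le[of s "\<lambda>p. \<psi> p - \<rho> p" p] by simp
      then have "(ennreal (cmod (gen s \<psi> p - gen s \<rho> p)))\<^sup>2 \<le> (\<integral>\<^sup>+j. 1 * ennreal (cmod (\<psi> (p - J j) - \<rho> (p - J j))) \<partial>Q)\<^sup>2"
        by (intro power_mono) auto
      also have "\<dots> \<le> (\<integral>\<^sup>+j. 1\<^sup>2 \<partial>Q) * (\<integral>\<^sup>+j. (ennreal (cmod (\<psi> (p - J j) - \<rho> (p - J j))))\<^sup>2 \<partial>Q)"
        by (rule Cauchy_Schwarz_nn_integral) measurable
      finally show ?case
        by (simp add: ennreal_power Q.emeasure_eq_measure mass_def)
    qed
  qed
  also have "\<dots> = ennreal mass * (NNINT p. (\<integral>\<^sup>+j. ennreal ((cmod (\<psi> (p - J j) - \<rho> (p - J j)))\<^sup>2) \<partial>Q))"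
    by (rule nn_integral_cmult) measurable
  also have "\<dots> = ennreal mass * (ennreal mass * ennreal ?N)"
    by (subst nn_integral_shift[of "\<lambda>p. ennreal ((cmod (\<psi> p - \<rho> p))\<^sup>2)"]) (auto simp: L2_nn_integral[OF d])
  also have "\<dots> = ennreal (mass\<^sup>2 * ?N)"
    using mass_nonneg by (simp add: ennreal_mult power2_eq_square mult.assoc)
  finally have le: "(NNINT p. ennreal ((cmod (gen s \<psi> p - gen s \<rho> p))\<^sup>2)) \<le> ennreal (mass\<^sup>2 * ?N)" .
  then show L: "L2 (\<lambda>p. gen s \<psi> p - gen s \<rho> p)"
    by (intro L2I) (auto intro: order.strict_trans1[OF _ ennreal_less_top])
  show "(LINT p|lborel. (cmod (gen s \<psi> p - gen s \<rho> p))\<^sup>2) \<le> mass\<^sup>2 * ?N"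
    using le unfolding L2_nn_integral[OF L] by (subst (asm) ennreal_le_iff) auto
qed

definition evolves :: "(real \<Rightarrow> 'a \<Rightarrow> complex) \<Rightarrow> bool" where
  "evolves \<mu> \<longleftrightarrow> (\<forall>z\<ge>0. L2 (\<mu> z)) \<and>
     (\<forall>z\<ge>0. ((\<lambda>s. NNINT p. ennreal ((cmod ((\<mu> s p - \<mu> z p) /\<^sub>R (s - z) - gen z (\<mu> z) p))\<^sup>2))
        \<longlongrightarrow> 0) (at z within {0..}))"

text \<open>The squared \<open>L2\<close> distance of two solutions satisfies a linear differential inequality.\<close>
lemma evolves_distance_derivative:
  assumes mu: "evolves \<mu>" and nu: "evolves \<nu>" and z: "0 \<le> z"
  defines "f \<equiv> \<lambda>s. LINT p|lborel. (cmod (\<mu> s p - \<nu> s p))\<^sup>2"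
  obtains D where "(f has_real_derivative D) (at z within {0..})" "\<bar>D\<bar> \<le> 2 * mass * f z"
proof
  define d where "d s p = \<mu> s p - \<nu> s p" for s p
  define l where "l p = gen z (\<mu> z) p - gen z (\<nu> z) p" for p
  define e1 where "e1 s p = (\<mu> s p - \<mu> z p) /\<^sub>R (s - z) - gen z (\<mu> z) p" for s p
  define e2 where "e2 s p = (\<nu> s p - \<nu> z p) /\<^sub>R (s - z) - gen z (\<nu> z) p" for s p
  define e where "e s p = (d s p - d z p) /\<^sub>R (s - z) - l p" for s p
  define E where "E s = (LINT p|lborel. (cmod (e s p))\<^sup>2)" for s
  define N where "N s = (NNINT p. ennreal ((cmod (e1 s p))\<^sup>2))" for s
  define N' where "N' s = (NNINT p. ennreal ((cmod (e2 s p))\<^sup>2))" for s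
  have L2mu: "L2 (\<mu> s)" and L2nu: "L2 (\<nu> s)" if "0 \<le> s" for s using mu nu that by (auto simp: evolves_def)
  have L2d: "L2 (d s)" if "0 \<le> s" for s unfolding d_def by (intro L2_diff L2mu L2nu that)
  have L2l: "L2 l" unfolding l_def by (intro gen_L2_diff L2mu L2nu z)
  have L2e: "L2 (e s)" if "0 \<le> s" for s
    unfolding e_def by (intro L2_diff L2_scaleR L2d L2l that z)
  have ll: "(LINT p|lborel. (cmod (l p))\<^sup>2) \<le> mass\<^sup>2 * f z"
    unfolding l_def f_def by (intro gen_L2_diff L2mu L2nu z)
  have f_eq: "f s = (LINT p|lborel. (cmod (d s p))\<^sup>2)" for s by (simp add: f_def d_def)
  have f_nonneg: "0 \<le> f s" for s unfolding f_eq by simp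
  have E_nonneg: "0 \<le> E s" for s unfolding E_def by simp
  have N: "(N \<longlongrightarrow> 0) (at z within {0..})" using mu z unfolding N_def e1_def evolves_def by blast
  have N': "(N' \<longlongrightarrow> 0) (at z within {0..})" using nu z unfolding N'_def e2_def evolves_def by blast
  have gm [measurable]: "gen z (\<mu> z) \<in> borel_measurable borel" "gen z (\<nu> z) \<in> borel_measurable borel"
    by (rule gen_measurable1, rule L2_measurable, rule L2mu L2nu, rule z)+
  have E_le: "ennreal (E s) \<le> 2 * N s + 2 * N' s" if "0 \<le> s" for s
  proof -
    note [measurable] = L2_measurable[OF L2mu[OF that]] L2_measurable[OF L2nu[OF that]]
      L2_measurable[OF L2mu[OF z]] L2_measurable[OF L2nu[OF z]]
    have [measurable]: "e1 s \<in> borel_measurable borel" "e2 s \<in> borel_measurable borel"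
      unfolding e1_def e2_def by measurable
    have "e s p = e1 s p + - e2 s p" for p
      by (simp add: e_def e1_def e2_def d_def l_def algebra_simps)
    then have "ennreal (E s) \<le> (NNINT p. 2 * ennreal ((cmod (e1 s p))\<^sup>2) + 2 * ennreal ((cmod (e2 s p))\<^sup>2))"
      unfolding E_def L2_nn_integral[OF L2e[OF that], symmetric]
      using cmod_add_square[of "e1 s _" "- e2 s _"]
      by (intro nn_integral_mono) (simp add: ennreal_mult'[symmetric] ennreal_plus[symmetric] ennreal_leI ennreal_numeral[symmetric] del: ennreal_plus ennreal_numeral)
    also have "\<dots> = 2 * N s + 2 * N' s"
      unfolding N_def N'_def by (subst nn_integral_add) (auto simp: nn_integral_cmult)
    finally show ?thesis .
  qed
  have E0: "(E \<longlongrightarrow> 0) (at z within {0..})"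
  proof -
    have "((\<lambda>s. 2 * N s + 2 * N' s) \<longlongrightarrow> 2 * 0 + 2 * 0) (at z within {0..})"
      by (intro tendsto_add ennreal_tendsto_cmult N N') auto
    then have lim: "((\<lambda>s. 2 * N s + 2 * N' s) \<longlongrightarrow> 0) (at z within {0..})" by simp
    have "((\<lambda>s. ennreal (E s)) \<longlongrightarrow> 0) (at z within {0..})"
      by (rule tendsto_sandwich[OF _ _ tendsto_const lim])
         (auto simp: eventually_at intro!: exI[of _ 1] E_le)
    then show ?thesis
      using E_nonneg by (subst (asm) ennreal_0[symmetric], subst (asm) tendsto_ennreal_iff) auto
  qed
  define D where "D = 2 * (LINT p|lborel. d z p \<bullet> l p)"
  have quotient: "\<bar>(f s - f z) / (s - z) - D\<bar> \<le> 2 * (sqrt (f z) * sqrt (E s)) + \<bar>s - z\<bar> * (2 * (mass\<^sup>2 * f z) + 2 * E s)"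
    if s: "0 \<le> s" "s \<noteq> z" for s
  proof -
    define h where "h = s - z"
    have h: "h \<noteq> 0" using s by (simp add: h_def)
    have ds: "d s p = d z p + h *\<^sub>R (l p + e s p)" for p
      using h by (simp add: e_def h_def)
    have L2le: "L2 (\<lambda>p. l p + e s p)" by (intro L2_add L2l L2e s)
    have "(cmod (d s p))\<^sup>2 = (cmod (d z p))\<^sup>2 + (2 * h * (d z p \<bullet> l p) + (2 * h * (d z p \<bullet> e s p) + h\<^sup>2 * (cmod (l p + e s p))\<^sup>2))" for p
      unfolding ds by (simp only: power2_norm_eq_inner inner_add_left inner_add_right inner_scaleR_left inner_scaleR_right inner_commute[of "l p" "d z p"] inner_commute[of "e s p" "d z p"])
        (simp add: power2_eq_square algebra_simps)
    then have "f s = (LINT p|lborel. (cmod (d z p))\<^sup>2 + (2 * h * (d z p \<bullet> l p) + (2 * h * (d z p \<bullet> e s p) + h\<^sup>2 * (cmod (l p + e s p))\<^sup>2)))"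
      unfolding f_eq by simp
    also have "\<dots> = f z + (2 * h * (LINT p|lborel. d z p \<bullet> l p) + (2 * h * (LINT p|lborel. d z p \<bullet> e s p) + h\<^sup>2 * (LINT p|lborel. (cmod (l p + e s p))\<^sup>2)))"
      unfolding f_eq
      by (simp add: L2_integrable[OF L2d[OF z]] L2_inner(1)[OF L2d[OF z] L2l] L2_inner(1)[OF L2d[OF z] L2e[OF s(1)]] L2_integrable[OF L2le])
    finally have "(f s - f z) / h - D = 2 * (LINT p|lborel. d z p \<bullet> e s p) + h * (LINT p|lborel. (cmod (l p + e s p))\<^sup>2)"
      using h by (simp add: D_def field_simps power2_eq_square)
    also have "\<bar>\<dots>\<bar> \<le> 2 * \<bar>LINT p|lborel. d z p \<bullet> e s p\<bar> + \<bar>h\<bar> * (LINT p|lborel. (cmod (l p + e s p))\<^sup>2)"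
      by (rule order_trans[OF abs_triangle_ineq]) (simp add: abs_mult)
    also have "\<dots> \<le> 2 * (sqrt (f z) * sqrt (E s)) + \<bar>h\<bar> * (2 * (mass\<^sup>2 * f z) + 2 * E s)"
    proof (intro add_mono mult_left_mono)
      show "\<bar>LINT p|lborel. d z p \<bullet> e s p\<bar> \<le> sqrt (f z) * sqrt (E s)"
        unfolding f_eq E_def by (rule L2_inner(2)[OF L2d[OF z] L2e[OF s(1)]])
      show "(LINT p|lborel. (cmod (l p + e s p))\<^sup>2) \<le> 2 * (mass\<^sup>2 * f z) + 2 * E s"
        using L2_add(2)[OF L2l L2e[OF s(1)]] ll unfolding E_def by linarith
    qed auto
    finally show ?thesis by (simp add: h_def)
  qed
  show "(f has_real_derivative D) (at z within {0..})"
    unfolding has_field_derivative_iff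
  proof (rule LIM_zero_cancel, rule Lim_null_comparison)
    show "\<forall>\<^sub>F s in at z within {0..}. norm ((f s - f z) / (s - z) - D) \<le> 2 * (sqrt (f z) * sqrt (E s)) + \<bar>s - z\<bar> * (2 * (mass\<^sup>2 * f z) + 2 * E s)"
      by (auto simp: eventually_at intro!: exI[of _ 1] quotient)
    have "((\<lambda>s. 2 * (sqrt (f z) * sqrt (E s)) + \<bar>s - z\<bar> * (2 * (mass\<^sup>2 * f z) + 2 * E s)) \<longlongrightarrow> 2 * (sqrt (f z) * sqrt 0) + \<bar>z - z\<bar> * (2 * (mass\<^sup>2 * f z) + 2 * 0)) (at z within {0..})"
      by (intro tendsto_intros E0)
    then show "((\<lambda>s. 2 * (sqrt (f z) * sqrt (E s)) + \<bar>s - z\<bar> * (2 * (mass\<^sup>2 * f z) + 2 * E s)) \<longlongrightarrow> 0) (at z within {0..})" by simp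
  qed
  have "\<bar>D\<bar> \<le> 2 * (sqrt (f z) * sqrt (mass\<^sup>2 * f z))"
    unfolding D_def abs_mult
    using order_trans[OF L2_inner(2)[OF L2d[OF z] L2l] mult_left_mono[OF real_sqrt_le_mono[OF ll]]] f_nonneg[of z]
    by (simp add: f_eq)
  also have "\<dots> = 2 * mass * f z" using mass_nonneg f_nonneg[of z] by (simp add: real_sqrt_mult)
  finally show "\<bar>D\<bar> \<le> 2 * mass * f z" .
qed

text \<open>The squared distance is differentiable with derivative at most a multiple of itself, so after
  multiplication by a decaying exponential it is nonincreasing, and it starts at zero.\<close>
lemma evolves_unique:
  assumes mu: "evolves \<mu>" and nu: "evolves \<nu>" and init: "AE p in lborel. \<mu> 0 p = \<nu> 0 p" and z: "0 \<le> z"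
  shows "AE p in lborel. \<mu> z p = \<nu> z p"
proof -
  define f where "f s = (LINT p|lborel. (cmod (\<mu> s p - \<nu> s p))\<^sup>2)" for s
  have f_nonneg: "0 \<le> f s" for s unfolding f_def by simp
  have L2d: "L2 (\<lambda>p. \<mu> s p - \<nu> s p)" if "0 \<le> s" for s
    using mu nu that by (intro L2_diff) (auto simp: evolves_def)
  have "\<exists>D. (f has_real_derivative D) (at s within {0..}) \<and> \<bar>D\<bar> \<le> 2 * mass * f s" if s: "0 \<le> s" for s
  proof -
    obtain D where "((\<lambda>s. LINT p|lborel. (cmod (\<mu> s p - \<nu> s p))\<^sup>2) has_real_derivative D) (at s within {0..})"
        "\<bar>D\<bar> \<le> 2 * mass * (LINT p|lborel. (cmod (\<mu> s p - \<nu> s p))\<^sup>2)"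
      by (rule evolves_distance_derivative[OF mu nu s])
    then show ?thesis unfolding f_def by blast
  qed
  then obtain D where D: "\<And>s. 0 \<le> s \<Longrightarrow> (f has_real_derivative D s) (at s within {0..})"
      "\<And>s. 0 \<le> s \<Longrightarrow> \<bar>D s\<bar> \<le> 2 * mass * f s" by metis
  define g where "g s = f s * exp (- (2 * mass) * s)" for s
  have "g z \<le> g 0"
  proof (rule DERIV_nonpos_imp_decreasing_open[OF z])
    show "\<exists>y. (g has_real_derivative y) (at s) \<and> y \<le> 0" if "0 < s" "s < z" for s
    proof (intro exI conjI)
      have "at s within {0..} = at s" using that by (intro at_within_interior) (auto simp: interior_real_atLeast)
      then have "(f has_real_derivative D s) (at s)" using D(1)[of s] that by simp
      then show "(g has_real_derivative (D s - 2 * mass * f s) * exp (- (2 * mass) * s)) (at s)"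
        unfolding g_def by (auto intro!: derivative_eq_intros simp: algebra_simps)
      show "(D s - 2 * mass * f s) * exp (- (2 * mass) * s) \<le> 0"
        using D(2)[of s] that by (intro mult_nonpos_nonneg) auto
    qed
    have "continuous_on {0..} f"
      using D(1) by (intro DERIV_continuous_on) auto
    then show "continuous_on {0..z} g"
      unfolding g_def by (intro continuous_intros) (auto intro: continuous_on_subset)
  qed
  moreover have "f 0 = 0"
  proof -
    have "f 0 = (LINT p|(lborel :: 'a measure). (0::real))"
      unfolding f_def
    proof (rule integral_cong_AE)
      show "AE p in lborel. (cmod (\<mu> 0 p - \<nu> 0 p))\<^sup>2 = 0" using init by eventually_elim simp
      show "(\<lambda>p. (cmod (\<mu> 0 p - \<nu> 0 p))\<^sup>2) \<in> borel_measurable lborel"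
        using L2_integrable[OF L2d[of 0]] by auto
    qed auto
    then show ?thesis by simp
  qed
  ultimately have "f z \<le> 0" by (simp add: g_def mult_le_0_iff)
  then have "f z = 0" using f_nonneg[of z] by simp
  then have "AE p in lborel. (cmod (\<mu> z p - \<nu> z p))\<^sup>2 = 0"
    unfolding f_def using integral_nonneg_eq_0_iff_AE[OF L2_integrable[OF L2d[OF z]]] by simp
  then show ?thesis by eventually_elim simp
qed

end

lemma (in jump_cauchy) sol_evolves: "evolves sol"
  unfolding evolves_def
proof safe
  fix z :: real assume z: "0 \<le> z"
  have "sol z \<in> borel_measurable borel" using sol_measurable[of "\<lambda>_. z" borel "\<lambda>p. p"] by simp
  then show "L2 (sol z)" by (rule L2I[OF _ sol_L2[OF z]])
qed (rule sol_L2_derivative)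

section \<open>Gronwall's inequality without continuity\<close>

lemma nn_integral_exp_le:
  assumes "0 < \<kappa>" "0 \<le> z"
  shows "(NNINT s. ennreal (exp (\<kappa> * s)) * indicator {0..z} s) \<le> ennreal (exp (\<kappa> * z) / \<kappa>)"
proof -
  have h: "has_bochner_integral lborel (\<lambda>s. exp (\<kappa> * s) * indicator {0..z} s) (exp (\<kappa> * z) / \<kappa> - exp (\<kappa> * 0) / \<kappa>)"
  proof (rule has_bochner_integral_FTC_Icc_real[OF assms(2)])
    show "DERIV (\<lambda>x. exp (\<kappa> * x) / \<kappa>) x :> exp (\<kappa> * x)" for x
      using assms(1) by (auto intro!: derivative_eq_intros)
    show "isCont (\<lambda>s. exp (\<kappa> * s)) x" for x by (intro continuous_intros)
  qed
  have "(NNINT s. ennreal (exp (\<kappa> * s)) * indicator {0..z} s) = (NNINT s. ennreal (exp (\<kappa> * s) * indicator {0..z} s))"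
    by (intro nn_integral_cong) (auto simp: indicator_def)
  also have "\<dots> = ennreal (LINT s|lborel. exp (\<kappa> * s) * indicator {0..z} s)"
    using h by (intro nn_integral_eq_integral) (auto simp: has_bochner_integral_iff indicator_def)
  also have "\<dots> \<le> ennreal (exp (\<kappa> * z) / \<kappa>)"
    unfolding has_bochner_integral_integral_eq[OF h] using assms by (intro ennreal_leI) auto
  finally show ?thesis .
qed

text \<open>If \<open>D\<close> is an admissible constant then so is \<open>\<gamma> + D / 2\<close>, because the weight \<open>exp ((2 M + 1) s)\<close> makes
  the integral term at most half of \<open>D\<close>. Starting from the a priori bound \<open>W\<close>, the iteration decreases
  to \<open>2 \<gamma>\<close>. Boundedness replaces continuity of \<open>w\<close>, and the common constant for the whole family allows
  a step in which one member is controlled by the others.\<close>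
lemma gronwall_family:
  fixes w :: "'i \<Rightarrow> real \<Rightarrow> ennreal"
  assumes M: "0 \<le> M" and g: "0 \<le> \<gamma>"
    and bounded: "\<And>i z. 0 \<le> z \<Longrightarrow> z \<le> Z \<Longrightarrow> w i z \<le> ennreal W" and W: "0 \<le> W"
    and step: "\<And>D i z. 0 \<le> D \<Longrightarrow> (\<And>i s. 0 \<le> s \<Longrightarrow> s \<le> Z \<Longrightarrow> w i s \<le> ennreal (D * exp ((2 * M + 1) * s))) \<Longrightarrow>
       0 \<le> z \<Longrightarrow> z \<le> Z \<Longrightarrow>
       w i z \<le> ennreal \<gamma> + ennreal M * (NNINT s. ennreal (D * exp ((2 * M + 1) * s)) * indicator {0..z} s)"
    and z: "0 \<le> z" "z \<le> Z"
  shows "w i z \<le> ennreal (2 * \<gamma> * exp ((2 * M + 1) * z))"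
proof -
  let ?k = "2 * M + 1"
  have k: "0 < ?k" using M by simp
  have approx: "w i z \<le> ennreal ((2 * \<gamma> + W / 2 ^ n) * exp (?k * z))" if "0 \<le> z" "z \<le> Z" for i z n
    using that
  proof (induction n arbitrary: i z)
    case 0
    have "W * 1 \<le> (2 * \<gamma> + W) * exp (?k * z)" using g W M 0 by (intro mult_mono) auto
    then show ?case using bounded[OF 0, of i] by (auto intro: order_trans[OF _ ennreal_leI])
  next
    case (Suc n)
    let ?D = "2 * \<gamma> + W / 2 ^ n"
    have D: "0 \<le> ?D" using g W by simp
    have "w i z \<le> ennreal \<gamma> + ennreal M * (NNINT s. ennreal (?D * exp (?k * s)) * indicator {0..z} s)"
      by (rule step[OF D Suc.IH Suc.prems])
    also have "(NNINT s. ennreal (?D * exp (?k * s)) * indicator {0..z} s)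
       = (NNINT s. ennreal ?D * (ennreal (exp (?k * s)) * indicator {0..z} s))"
      using D by (intro nn_integral_cong) (simp add: ennreal_mult mult.assoc)
    also have "\<dots> = ennreal ?D * (NNINT s. ennreal (exp (?k * s)) * indicator {0..z} s)"
      by (rule nn_integral_cmult) measurable
    also have "ennreal \<gamma> + ennreal M * \<dots> \<le> ennreal \<gamma> + ennreal M * (ennreal ?D * ennreal (exp (?k * z) / ?k))"
      by (intro add_left_mono mult_left_mono nn_integral_exp_le k Suc.prems) auto
    also have "\<dots> = ennreal (\<gamma> + M * (?D * (exp (?k * z) / ?k)))"
      using M g D k by (simp add: ennreal_mult[symmetric] ennreal_plus[symmetric] del: ennreal_plus)
    also have "\<dots> \<le> ennreal ((2 * \<gamma> + W / 2 ^ Suc n) * exp (?k * z))"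
    proof (rule ennreal_leI)
      have "M / ?k \<le> 1 / 2" using M by (simp add: field_simps)
      then have "(M / ?k) * (?D * exp (?k * z)) \<le> (1 / 2) * (?D * exp (?k * z))" using D by (intro mult_right_mono) auto
      then have 1: "M * (?D * (exp (?k * z) / ?k)) \<le> (\<gamma> + W / 2 ^ Suc n) * exp (?k * z)"
        by (simp add: field_simps)
      have 2: "\<gamma> * 1 \<le> \<gamma> * exp (?k * z)" using g M Suc.prems by (intro mult_left_mono) auto
      show "\<gamma> + M * (?D * (exp (?k * z) / ?k)) \<le> (2 * \<gamma> + W / 2 ^ Suc n) * exp (?k * z)"
        using 1 2 by (simp add: algebra_simps)
    qed
    finally show ?case .
  qed
  have "(\<lambda>n. (2 * \<gamma> + W * (1 / 2) ^ n) * exp (?k * z)) \<longlonglongrightarrow> (2 * \<gamma> + W * 0) * exp (?k * z)"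
    by (intro tendsto_intros LIMSEQ_power_zero) auto
  moreover have "W * (1 / 2) ^ n = W / 2 ^ n" for n by (simp add: power_one_over)
  ultimately have "(\<lambda>n. (2 * \<gamma> + W / 2 ^ n) * exp (?k * z)) \<longlonglongrightarrow> 2 * \<gamma> * exp (?k * z)" by simp
  then have "(\<lambda>n. ennreal ((2 * \<gamma> + W / 2 ^ n) * exp (?k * z))) \<longlonglongrightarrow> ennreal (2 * \<gamma> * exp (?k * z))"
    by (rule tendsto_ennrealI)
  then show ?thesis
    by (rule LIMSEQ_le_const) (intro exI allI impI approx z)
qed

section \<open>The amplitude A\<close>

text \<open>The weight \<open>alpha\<close> is the nonnegative integrable density of the jumps \<open>k\<close> of the moment equation, and
  \<open>lam\<close> is its total mass.\<close>
locale random_medium = stationary_covariance C for C +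
  fixes k0 :: real
  assumes k0: "0 < k0"
begin

definition lam :: real where "lam = k0\<^sup>2 / 4 * C 0"

definition alpha :: "vec2 \<Rightarrow> real" where "alpha k = k0\<^sup>2 / (4 * (2 * pi)\<^sup>2) * c_hat k"

lemma lam_nonneg: "0 \<le> lam" using C_0_nonneg by (simp add: lam_def)

lemma alpha_nonneg: "0 \<le> alpha k" using c_hat_nonneg by (simp add: alpha_def)

lemma alpha_continuous: "continuous_on UNIV alpha"
  unfolding alpha_def by (intro continuous_intros c_hat_continuous)

lemma alpha_measurable [measurable]: "alpha \<in> borel_measurable borel"
  unfolding alpha_def by measurable

lemma alpha_integrable: "integrable lborel alpha"
  unfolding alpha_def by (intro integrable_mult_right integrable_c_hat)

lemma alpha_cis: "(LINT k|lborel. alpha k *\<^sub>R cis (k \<bullet> x)) = complex_of_real (k0\<^sup>2 / 4 * C x)"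
proof -
  have "(LINT k|lborel. alpha k *\<^sub>R cis (k \<bullet> x)) = (LINT k|lborel. (k0\<^sup>2 / (4 * (2 * pi)\<^sup>2)) *\<^sub>R (c_hat k *\<^sub>R cis (k \<bullet> x)))"
    by (simp add: alpha_def)
  also have "\<dots> = (k0\<^sup>2 / (4 * (2 * pi)\<^sup>2)) *\<^sub>R complex_of_real ((2 * pi)\<^sup>2 * C x)"
    by (subst integral_scaleR_right) (simp only: integral_c_hat_cis)
  also have "\<dots> = complex_of_real (k0\<^sup>2 / (4 * (2 * pi)\<^sup>2) * ((2 * pi)\<^sup>2 * C x))"
    by (simp only: scaleR_conv_of_real of_real_mult)
  also have "k0\<^sup>2 / (4 * (2 * pi)\<^sup>2) * ((2 * pi)\<^sup>2 * C x) = k0\<^sup>2 / 4 * C x" by (simp add: field_simps)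
  finally show ?thesis .
qed

lemma alpha_integral: "(LINT k|lborel. alpha k) = lam"
proof -
  have "complex_of_real (LINT k|lborel. alpha k) = complex_of_real lam"
    using alpha_cis[of 0] by (simp add: lam_def scaleR_conv_of_real flip: integral_complex_of_real)
  then show ?thesis by (simp only: of_real_eq_iff)
qed

lemma alpha_nn_integral: "(NNINT k. ennreal (alpha k)) = ennreal lam"
  using nn_integral_eq_integral[OF alpha_integrable] alpha_nonneg by (simp add: alpha_integral)

definition alpha_max :: real where "alpha_max = k0\<^sup>2 / (4 * (2 * pi)\<^sup>2) * (LINT x|lborel. \<bar>C x\<bar>)"

lemma alpha_bound: "alpha k \<le> alpha_max"
  unfolding alpha_def alpha_max_def by (intro mult_left_mono c_hat_bound) auto

definition expo :: "real \<Rightarrow> vec2 \<Rightarrow> vec2 \<Rightarrow> real" where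
  "expo z x \<eta> = k0\<^sup>2 / 4 * (LINT s:{0..z}|lborel. C (x + (s / k0) *\<^sub>R \<eta>))"

lemma C_line_continuous: "continuous_on S (\<lambda>s. C (x + (s / k0) *\<^sub>R \<eta>))"
  by (rule continuous_on_compose2[OF C_continuous]) (use k0 in \<open>auto intro!: continuous_intros\<close>)

lemma expo_measurable [measurable]:
  assumes [measurable]: "f \<in> borel_measurable N" "g \<in> borel_measurable N" "h \<in> borel_measurable N"
  shows "(\<lambda>y. expo (f y) (g y) (h y)) \<in> borel_measurable N"
proof -
  have [measurable]: "Measurable.pred (N \<Otimes>\<^sub>M lborel) (\<lambda>y. snd y \<in> {0..f (fst y)})"
    unfolding atLeastAtMost_iff by measurable
  have "(\<lambda>(y, s). indicator {0..f y} s *\<^sub>R C (g y + (s / k0) *\<^sub>R h y)) \<in> borel_measurable (N \<Otimes>\<^sub>M lborel)"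
    unfolding indicator_def split_beta' by measurable
  then show ?thesis unfolding expo_def set_lebesgue_integral_def by measurable
qed

lemma expo_bound: assumes "0 \<le> z" shows "\<bar>expo z x \<eta>\<bar> \<le> lam * z"
proof -
  have "\<bar>LINT s:{0..z}|lborel. C (x + (s / k0) *\<^sub>R \<eta>)\<bar> \<le> (LINT s|lborel. C 0 * indicator {0..z} s)"
    unfolding set_lebesgue_integral_def real_norm_def[symmetric]
  proof (rule norm_lebesgue_integral_le)
    show "norm (indicator {0..z} s *\<^sub>R C (x + (s / k0) *\<^sub>R \<eta>)) \<le> C 0 * indicator {0..z} s" for s
      using C_bound[of "x + (s / k0) *\<^sub>R \<eta>"] by (auto simp: indicator_def)
    have "integrable lborel (indicat_real {0..z})" by (rule integrable_real_indicator) (simp_all add: emeasure_lborel_Icc_eq)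
    then show "integrable lborel (\<lambda>s. C 0 * indicator {0..z} s)" by (rule integrable_mult_right)
  qed
  also have "\<dots> = C 0 * z" using assms by simp
  finally have "k0\<^sup>2 / 4 * \<bar>LINT s:{0..z}|lborel. C (x + (s / k0) *\<^sub>R \<eta>)\<bar> \<le> k0\<^sup>2 / 4 * (C 0 * z)"
    by (intro mult_left_mono) auto
  then show ?thesis by (simp add: expo_def lam_def abs_mult mult.assoc)
qed

lemma expo_L1:
  assumes "0 \<le> z"
  shows "(NNINT x. ennreal \<bar>expo z x \<eta>\<bar>) \<le> ennreal (k0\<^sup>2 / 4 * (z * (LINT x|lborel. \<bar>C x\<bar>)))"
proof -
  let ?n = "LINT x|lborel. \<bar>C x\<bar>"
  have n: "(NNINT x. ennreal \<bar>C x\<bar>) = ennreal ?n"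
    using integrable_C by (intro nn_integral_eq_integral) auto
  have "(NNINT x. ennreal \<bar>expo z x \<eta>\<bar>) \<le> (NNINT x. ennreal (k0\<^sup>2 / 4) * (NNINT s. ennreal \<bar>C (x + (s / k0) *\<^sub>R \<eta>)\<bar> * indicator {0..z} s))"
  proof (rule nn_integral_mono)
    fix x
    have "ennreal \<bar>LINT s:{0..z}|lborel. C (x + (s / k0) *\<^sub>R \<eta>)\<bar> \<le> (NNINT s. ennreal (norm (indicator {0..z} s *\<^sub>R C (x + (s / k0) *\<^sub>R \<eta>))))"
      unfolding set_lebesgue_integral_def real_norm_def[symmetric] by (rule norm_integral_le_nn_integral)
    also have "\<dots> = (NNINT s. ennreal \<bar>C (x + (s / k0) *\<^sub>R \<eta>)\<bar> * indicator {0..z} s)"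
      by (intro nn_integral_cong) (auto simp: indicator_def)
    finally have "ennreal (k0\<^sup>2 / 4) * ennreal \<bar>LINT s:{0..z}|lborel. C (x + (s / k0) *\<^sub>R \<eta>)\<bar> \<le> ennreal (k0\<^sup>2 / 4) * (NNINT s. ennreal \<bar>C (x + (s / k0) *\<^sub>R \<eta>)\<bar> * indicator {0..z} s)"
      by (rule mult_left_mono) simp
    then show "ennreal \<bar>expo z x \<eta>\<bar> \<le> ennreal (k0\<^sup>2 / 4) * (NNINT s. ennreal \<bar>C (x + (s / k0) *\<^sub>R \<eta>)\<bar> * indicator {0..z} s)"
      unfolding expo_def abs_mult by (subst ennreal_mult) auto
  qed
  also have "\<dots> = ennreal (k0\<^sup>2 / 4) * (NNINT x. (NNINT s. ennreal \<bar>C (x + (s / k0) *\<^sub>R \<eta>)\<bar> * indicator {0..z} s))"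
    by (rule nn_integral_cmult) measurable
  also have "(NNINT x. (NNINT s. ennreal \<bar>C (x + (s / k0) *\<^sub>R \<eta>)\<bar> * indicator {0..z} s))
      = (NNINT s. (NNINT x. ennreal \<bar>C (x + (s / k0) *\<^sub>R \<eta>)\<bar> * indicator {0..z} s))"
    by (rule lborel_pair.Fubini') measurable
  also have "\<dots> = (NNINT s. (NNINT x. ennreal \<bar>C (x + (s / k0) *\<^sub>R \<eta>)\<bar>) * indicator {0..z} s)"
    by (intro nn_integral_cong nn_integral_multc) measurable
  also have "\<dots> = (NNINT s. ennreal ?n * indicator {0..z} s)"
    using nn_integral_lborel_translate(1)[of "\<lambda>x. ennreal \<bar>C x\<bar>"] by (simp add: n)
  also have "\<dots> = ennreal ?n * ennreal z" using assms by (subst nn_integral_cmult_indicator) auto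
  finally show ?thesis using assms by (simp add: ennreal_mult[symmetric] mult.commute)
qed

lemma expo_derivative:
  assumes "0 \<le> s" "s \<le> z"
  shows "((\<lambda>s. expo s x \<eta>) has_real_derivative k0\<^sup>2 / 4 * C (x + (s / k0) *\<^sub>R \<eta>)) (at s within {0..z})"
proof -
  have eq: "expo s x \<eta> = k0\<^sup>2 / 4 * integral {0..s} (\<lambda>s. C (x + (s / k0) *\<^sub>R \<eta>))" for s
    unfolding expo_def
    by (subst set_borel_integral_eq_integral(2)) (auto intro!: borel_integrable_atLeastAtMost' C_line_continuous)
  show ?thesis unfolding eq
    by (intro DERIV_cmult integral_has_real_derivative C_line_continuous) (use assms in auto)
qed

text \<open>The function whose Fourier transform is \<open>A\<close>, up to normalization.\<close>
definition hfun :: "real \<Rightarrow> vec2 \<Rightarrow> vec2 \<Rightarrow> real" where "hfun z x \<eta> = exp (expo z x \<eta>) - 1"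

lemma hfun_measurable [measurable]:
  assumes [measurable]: "f \<in> borel_measurable N" "g \<in> borel_measurable N" "h \<in> borel_measurable N"
  shows "(\<lambda>y. hfun (f y) (g y) (h y)) \<in> borel_measurable N"
  unfolding hfun_def by measurable

text \<open>Convexity of the exponential, once at \<open>t\<close> and once at \<open>- t\<close>.\<close>
lemma abs_exp_minus_1_le: "\<bar>exp t - 1\<bar> \<le> exp \<bar>t\<bar> * \<bar>t\<bar>" for t :: real
proof -
  have "exp t * (1 - t) \<le> 1"
    using mult_left_mono[OF exp_ge_add_one_self[of "- t"], of "exp t"] by (simp add: exp_minus)
  then have 1: "exp t - 1 \<le> exp t * t" by (simp add: algebra_simps)
  have 2: "t \<le> exp t - 1" using exp_ge_add_one_self[of t] by linarith
  show ?thesis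
  proof (cases "0 \<le> t")
    case True
    then show ?thesis using 1 2 by simp
  next
    case False
    have "(- t) * 1 \<le> (- t) * exp (- t)" using False by (intro mult_left_mono) auto
    moreover have "\<bar>exp t - 1\<bar> = 1 - exp t" using False by simp
    ultimately have "\<bar>exp t - 1\<bar> \<le> (- t) * exp (- t)" using 2 by linarith
    also have "(- t) * exp (- t) = exp \<bar>t\<bar> * \<bar>t\<bar>" using False by simp
    finally show ?thesis .
  qed
qed

lemma hfun_le: assumes "0 \<le> z" shows "\<bar>hfun z x \<eta>\<bar> \<le> exp (lam * z) * \<bar>expo z x \<eta>\<bar>"
  unfolding hfun_def
  by (rule order_trans[OF abs_exp_minus_1_le]) (use expo_bound[OF assms] in \<open>auto intro!: mult_right_mono\<close>)

lemma exp_expo_le: assumes "0 \<le> z" shows "exp (expo z x \<eta>) \<le> exp (lam * z)"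
  using expo_bound[OF assms, of x \<eta>] by simp

definition h_mass :: "real \<Rightarrow> real" where "h_mass z = exp (lam * z) * (k0\<^sup>2 / 4 * (z * (LINT x|lborel. \<bar>C x\<bar>)))"

lemma h_mass_nonneg: "0 \<le> z \<Longrightarrow> 0 \<le> h_mass z" by (simp add: h_mass_def)

lemma h_mass_mono: "0 \<le> s \<Longrightarrow> s \<le> z \<Longrightarrow> h_mass s \<le> h_mass z"
  unfolding h_mass_def using lam_nonneg by (intro mult_mono mult_left_mono mult_right_mono) (auto intro: mult_left_mono)

lemma hfun_L1:
  assumes "0 \<le> z"
  shows "(NNINT x. ennreal \<bar>hfun z x \<eta>\<bar>) \<le> ennreal (h_mass z)"
proof -
  have "(NNINT x. ennreal \<bar>hfun z x \<eta>\<bar>) \<le> (NNINT x. ennreal (exp (lam * z)) * ennreal \<bar>expo z x \<eta>\<bar>)"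
    by (intro nn_integral_mono) (simp add: ennreal_mult[symmetric] ennreal_leI hfun_le[OF assms])
  also have "\<dots> = ennreal (exp (lam * z)) * (NNINT x. ennreal \<bar>expo z x \<eta>\<bar>)"
    by (rule nn_integral_cmult) measurable
  also have "\<dots> \<le> ennreal (exp (lam * z)) * ennreal (k0\<^sup>2 / 4 * (z * (LINT x|lborel. \<bar>C x\<bar>)))"
    by (intro mult_left_mono expo_L1 assms) auto
  finally show ?thesis using assms by (simp add: h_mass_def ennreal_mult[symmetric])
qed

lemma hfun_integrable: "0 \<le> z \<Longrightarrow> integrable lborel (\<lambda>x. hfun z x \<eta>)"
  using hfun_L1[of z \<eta>] by (intro integrableI_bounded) (auto intro: order.strict_trans1[OF _ ennreal_less_top])

definition kap :: real where "kap = 1 / (2 * (2 * pi)\<^sup>2)"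

lemma A_eq: "A k0 C z \<xi> \<eta> = complex_of_real kap * (LINT x|lborel. complex_of_real (hfun z x \<eta>) * cis (- (\<xi> \<bullet> x)))"
  unfolding A_def hfun_def expo_def kap_def ..

lemma A_measurable [measurable]:
  assumes [measurable]: "f \<in> borel_measurable N" "g \<in> borel_measurable N" "h \<in> borel_measurable N"
  shows "(\<lambda>y. A k0 C (f y) (g y) (h y)) \<in> borel_measurable N"
  unfolding A_eq by measurable

definition A_max :: "real \<Rightarrow> real" where "A_max z = kap * h_mass z"

lemma A_max_nonneg: "0 \<le> z \<Longrightarrow> 0 \<le> A_max z" using h_mass_nonneg by (simp add: A_max_def kap_def)

lemma A_max_mono: "0 \<le> s \<Longrightarrow> s \<le> z \<Longrightarrow> A_max s \<le> A_max z"
  unfolding A_max_def by (intro mult_left_mono h_mass_mono) (auto simp: kap_def)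

lemma A_bound: assumes "0 \<le> z" shows "cmod (A k0 C z \<xi> \<eta>) \<le> A_max z"
proof -
  have "ennreal (cmod (LINT x|lborel. complex_of_real (hfun z x \<eta>) * cis (- (\<xi> \<bullet> x)))) \<le> (NNINT x. ennreal \<bar>hfun z x \<eta>\<bar>)"
    by (rule order_trans[OF norm_integral_le_nn_integral]) (simp add: norm_mult)
  also have "\<dots> \<le> ennreal (h_mass z)" by (rule hfun_L1[OF assms])
  finally have "cmod (LINT x|lborel. complex_of_real (hfun z x \<eta>) * cis (- (\<xi> \<bullet> x))) \<le> h_mass z"
    using h_mass_nonneg[OF assms] by (simp add: ennreal_le_iff)
  moreover have "cmod (complex_of_real kap) = kap" "0 \<le> kap" unfolding norm_of_real by (simp_all add: kap_def)
  ultimately show ?thesis unfolding A_eq A_max_def norm_mult by (simp only: mult_left_mono)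
qed

text \<open>The source: the transform of the translate of \<open>C\<close> that enters \<open>A\<close> at time \<open>s\<close>, up to normalization.\<close>
definition f_src :: "real \<Rightarrow> vec2 \<Rightarrow> vec2 \<Rightarrow> complex" where
  "f_src s \<eta> k = alpha k *\<^sub>R cis (s / k0 * (k \<bullet> \<eta>))"

lemma f_src_measurable [measurable]:
  assumes [measurable]: "f \<in> borel_measurable N" "g \<in> borel_measurable N" "h \<in> borel_measurable N"
  shows "(\<lambda>y. f_src (f y) (g y) (h y)) \<in> borel_measurable N"
  unfolding f_src_def by measurable

lemma norm_f_src: "cmod (f_src s \<eta> k) = alpha k" using alpha_nonneg by (simp add: f_src_def)

text \<open>The convolution of the source with \<open>A\<close> plus half a Dirac mass at the origin; the Dirac mass is the
  constant 1 that is subtracted in the definition of \<open>A\<close>.\<close>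
definition A_rate :: "real \<Rightarrow> vec2 \<Rightarrow> vec2 \<Rightarrow> complex" where
  "A_rate s \<xi> \<eta> = (1/2) *\<^sub>R f_src s \<eta> \<xi> + (LINT k|lborel. f_src s \<eta> k * A k0 C s (\<xi> - k) \<eta>)"

lemma A_rate_measurable [measurable]:
  assumes [measurable]: "f \<in> borel_measurable N" "g \<in> borel_measurable N" "h \<in> borel_measurable N"
  shows "(\<lambda>y. A_rate (f y) (g y) (h y)) \<in> borel_measurable N"
  unfolding A_rate_def by measurable

lemma mult_mult_regroup: "(a * b) * (c * d) = (a * c) * (b * d)" for a b c d :: complex by simp

lemma hfun_integral_equation:
  assumes "0 \<le> z"
  shows "hfun z x \<eta> = (LINT s|lborel. indicator {0..z} s * (k0\<^sup>2 / 4 * C (x + (s / k0) *\<^sub>R \<eta>) * exp (expo s x \<eta>)))"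
proof -
  have "has_bochner_integral lborel (\<lambda>s. indicator {0..z} s *\<^sub>R (k0\<^sup>2 / 4 * C (x + (s / k0) *\<^sub>R \<eta>) * exp (expo s x \<eta>)))
     (exp (expo z x \<eta>) - exp (expo 0 x \<eta>))"
  proof (rule has_bochner_integral_FTC_Icc[OF assms])
    fix s assume s: "0 \<le> s" "s \<le> z"
    show "((\<lambda>s. exp (expo s x \<eta>)) has_vector_derivative k0\<^sup>2 / 4 * C (x + (s / k0) *\<^sub>R \<eta>) * exp (expo s x \<eta>)) (at s within {0..z})"
      using expo_derivative[OF s, of x \<eta>]
      unfolding has_real_derivative_iff_has_vector_derivative[symmetric]
      by (auto intro!: derivative_eq_intros)
  next
    have "continuous_on {0..z} (\<lambda>s. expo s x \<eta>)"
      by (rule DERIV_continuous_on[OF expo_derivative]) auto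
    then show "continuous_on {0..z} (\<lambda>s. k0\<^sup>2 / 4 * C (x + (s / k0) *\<^sub>R \<eta>) * exp (expo s x \<eta>))"
      by (intro continuous_intros C_line_continuous)
  qed
  moreover have "expo 0 x \<eta> = 0" using expo_bound[of 0 x \<eta>] by simp
  ultimately show ?thesis by (simp add: has_bochner_integral_iff hfun_def)
qed

text \<open>On the Fourier side multiplication by \<open>C\<close> is convolution with \<open>c_hat\<close>, and \<open>exp (expo s x \<eta>)\<close> is
  \<open>hfun s x \<eta> + 1\<close>.\<close>
lemma A_rate_eq:
  assumes s: "0 \<le> s"
  shows "complex_of_real kap * (LINT x|lborel. complex_of_real (k0\<^sup>2 / 4 * C (x + (s / k0) *\<^sub>R \<eta>) * exp (expo s x \<eta>)) * cis (- (\<xi> \<bullet> x)))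
     = A_rate s \<xi> \<eta>"
proof -
  let ?y = "(s / k0) *\<^sub>R \<eta>" and ?c = "k0\<^sup>2 / 4"
  have iC: "integrable lborel (\<lambda>x. complex_of_real (C (x + ?y)) * cis (- (\<xi> \<bullet> x)))"
    by (rule Bochner_Integration.integrable_bound[OF integrable_lborel_translate(1)[OF integrable_C, of ?y]]) (auto simp: norm_mult)
  have ih: "integrable lborel (\<lambda>x. complex_of_real (C (x + ?y) * hfun s x \<eta>) * cis (- (\<xi> \<bullet> x)))"
  proof (rule Bochner_Integration.integrable_bound[OF integrable_mult_right[OF hfun_integrable[OF s, of \<eta>], of "C 0"]])
    show "AE x in lborel. norm (complex_of_real (C (x + ?y) * hfun s x \<eta>) * cis (- (\<xi> \<bullet> x))) \<le> norm (C 0 * hfun s x \<eta>)"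
      using C_bound C_0_nonneg by (auto simp: norm_mult abs_mult intro!: mult_right_mono always_eventually)
  qed measurable
  have split: "(LINT x|lborel. complex_of_real (?c * C (x + ?y) * exp (expo s x \<eta>)) * cis (- (\<xi> \<bullet> x)))
     = complex_of_real ?c * (LINT x|lborel. complex_of_real (C (x + ?y)) * cis (- (\<xi> \<bullet> x)))
     + complex_of_real ?c * (LINT x|lborel. complex_of_real (C (x + ?y) * hfun s x \<eta>) * cis (- (\<xi> \<bullet> x)))"
  proof -
    have "(LINT x|lborel. complex_of_real (?c * C (x + ?y) * exp (expo s x \<eta>)) * cis (- (\<xi> \<bullet> x)))
       = (LINT x|lborel. complex_of_real ?c * (complex_of_real (C (x + ?y)) * cis (- (\<xi> \<bullet> x)) + complex_of_real (C (x + ?y) * hfun s x \<eta>) * cis (- (\<xi> \<bullet> x))))"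
      by (intro Bochner_Integration.integral_cong refl) (simp add: hfun_def algebra_simps)
    also have "\<dots> = complex_of_real ?c * (LINT x|lborel. complex_of_real (C (x + ?y)) * cis (- (\<xi> \<bullet> x)) + complex_of_real (C (x + ?y) * hfun s x \<eta>) * cis (- (\<xi> \<bullet> x)))"
      by (rule integral_mult_right_zero)
    also have "\<dots> = complex_of_real ?c * ((LINT x|lborel. complex_of_real (C (x + ?y)) * cis (- (\<xi> \<bullet> x))) + (LINT x|lborel. complex_of_real (C (x + ?y) * hfun s x \<eta>) * cis (- (\<xi> \<bullet> x))))"
      by (simp only: Bochner_Integration.integral_add[OF iC ih])
    finally show ?thesis by (simp only: distrib_left)
  qed
  have first: "(LINT x|lborel. complex_of_real (C (x + ?y)) * cis (- (\<xi> \<bullet> x))) = cis (\<xi> \<bullet> ?y) * C_hat C \<xi>"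
  proof -
    have "complex_of_real (C (x + ?y)) * cis (- (\<xi> \<bullet> x)) = cis (\<xi> \<bullet> ?y) * (complex_of_real (C (x + ?y)) * cis (- (\<xi> \<bullet> (x + ?y))))" for x
    proof -
      have "cis (- (\<xi> \<bullet> x)) = cis (\<xi> \<bullet> ?y) * cis (- (\<xi> \<bullet> (x + ?y)))" unfolding cis_mult by (simp add: inner_add_right)
      then show ?thesis by (simp only: mult_ac)
    qed
    then have "(LINT x|lborel. complex_of_real (C (x + ?y)) * cis (- (\<xi> \<bullet> x))) = cis (\<xi> \<bullet> ?y) * (LINT x|lborel. complex_of_real (C (x + ?y)) * cis (- (\<xi> \<bullet> (x + ?y))))"
      by (simp only: integral_mult_right_zero)
    also have "(LINT x|lborel. complex_of_real (C (x + ?y)) * cis (- (\<xi> \<bullet> (x + ?y)))) = C_hat C \<xi>"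
      unfolding C_hat_def by (rule integral_lborel_translate(1)[of "\<lambda>x. complex_of_real (C x) * cis (- (\<xi> \<bullet> x))"])
    finally show ?thesis .
  qed
  have second: "complex_of_real ?c * (LINT x|lborel. complex_of_real (C (x + ?y) * hfun s x \<eta>) * cis (- (\<xi> \<bullet> x)))
     = (LINT k|lborel. f_src s \<eta> k * (LINT x|lborel. complex_of_real (hfun s x \<eta>) * cis (- ((\<xi> - k) \<bullet> x))))"
  proof -
    have "complex_of_real ?c * (LINT x|lborel. complex_of_real (C (x + ?y) * hfun s x \<eta>) * cis (- (\<xi> \<bullet> x)))
       = (LINT x|lborel. complex_of_real ?c * (complex_of_real (C (x + ?y) * hfun s x \<eta>) * cis (- (\<xi> \<bullet> x))))"
      by (rule integral_mult_right_zero[symmetric])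
    also have "\<dots> = (LINT x|lborel. LINT k|lborel. f_src s \<eta> k * (complex_of_real (hfun s x \<eta>) * cis (- ((\<xi> - k) \<bullet> x))))"
    proof (rule Bochner_Integration.integral_cong[OF refl])
      fix x
      have "complex_of_real ?c * (complex_of_real (C (x + ?y) * hfun s x \<eta>) * cis (- (\<xi> \<bullet> x)))
         = (LINT k|lborel. alpha k *\<^sub>R cis (k \<bullet> (x + ?y))) * (complex_of_real (hfun s x \<eta>) * cis (- (\<xi> \<bullet> x)))"
        unfolding alpha_cis by (simp add: mult_ac)
      also have "\<dots> = (LINT k|lborel. (alpha k *\<^sub>R cis (k \<bullet> (x + ?y))) * (complex_of_real (hfun s x \<eta>) * cis (- (\<xi> \<bullet> x))))"
        by (rule integral_mult_left_zero[symmetric])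
      also have "\<dots> = (LINT k|lborel. f_src s \<eta> k * (complex_of_real (hfun s x \<eta>) * cis (- ((\<xi> - k) \<bullet> x))))"
      proof (rule Bochner_Integration.integral_cong[OF refl])
        fix k
        have "cis (k \<bullet> (x + ?y)) * cis (- (\<xi> \<bullet> x)) = cis (s / k0 * (k \<bullet> \<eta>)) * cis (- ((\<xi> - k) \<bullet> x))"
          unfolding cis_mult by (simp add: inner_add_right inner_diff_left algebra_simps)
        then show "(alpha k *\<^sub>R cis (k \<bullet> (x + ?y))) * (complex_of_real (hfun s x \<eta>) * cis (- (\<xi> \<bullet> x)))
            = f_src s \<eta> k * (complex_of_real (hfun s x \<eta>) * cis (- ((\<xi> - k) \<bullet> x)))"
          unfolding f_src_def scaleR_conv_of_real mult_mult_regroup by (simp only:)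
      qed
      finally show "complex_of_real ?c * (complex_of_real (C (x + ?y) * hfun s x \<eta>) * cis (- (\<xi> \<bullet> x)))
         = (LINT k|lborel. f_src s \<eta> k * (complex_of_real (hfun s x \<eta>) * cis (- ((\<xi> - k) \<bullet> x))))" .
    qed
    also have "\<dots> = (LINT k|lborel. LINT x|lborel. f_src s \<eta> k * (complex_of_real (hfun s x \<eta>) * cis (- ((\<xi> - k) \<bullet> x))))"
    proof (rule lborel_pair.Fubini_integral)
      show "integrable (lborel \<Otimes>\<^sub>M lborel) (\<lambda>(k, x). f_src s \<eta> k * (complex_of_real (hfun s x \<eta>) * cis (- ((\<xi> - k) \<bullet> x))))"
      proof (rule Bochner_Integration.integrable_bound[where f="\<lambda>(k, x). alpha k * hfun s x \<eta>"])
        show "integrable (lborel \<Otimes>\<^sub>M lborel) (\<lambda>(k, x). alpha k * hfun s x \<eta>)"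
          using alpha_integrable hfun_integrable[OF s, of \<eta>] by (intro lborel_pair.Fubini_integrable) (auto simp: abs_mult)
      qed (auto simp: norm_mult norm_f_src abs_mult alpha_nonneg)
    qed
    also have "\<dots> = (LINT k|lborel. f_src s \<eta> k * (LINT x|lborel. complex_of_real (hfun s x \<eta>) * cis (- ((\<xi> - k) \<bullet> x))))"
      by (simp only: integral_mult_right_zero)
    finally show ?thesis .
  qed
  have "complex_of_real kap * (LINT k|lborel. f_src s \<eta> k * (LINT x|lborel. complex_of_real (hfun s x \<eta>) * cis (- ((\<xi> - k) \<bullet> x))))
      = (LINT k|lborel. f_src s \<eta> k * A k0 C s (\<xi> - k) \<eta>)"
    unfolding A_eq by (subst integral_mult_right_zero[symmetric]) (simp only: mult.left_commute)
  moreover have "complex_of_real kap * (complex_of_real ?c * (cis (\<xi> \<bullet> ?y) * C_hat C \<xi>)) = (1/2) *\<^sub>R f_src s \<eta> \<xi>"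
  proof -
    have "kap * (?c * c_hat \<xi>) = (1/2) * alpha \<xi>" by (simp add: kap_def alpha_def field_simps)
    then have "complex_of_real kap * (complex_of_real ?c * complex_of_real (c_hat \<xi>)) = complex_of_real (1/2) * complex_of_real (alpha \<xi>)"
      by (simp only: of_real_mult[symmetric])
    then have "(complex_of_real kap * (complex_of_real ?c * complex_of_real (c_hat \<xi>))) * cis (\<xi> \<bullet> ?y)
        = (complex_of_real (1/2) * complex_of_real (alpha \<xi>)) * cis (s / k0 * (\<xi> \<bullet> \<eta>))"
      by (simp only: inner_scaleR_right)
    then show ?thesis unfolding f_src_def C_hat_eq scaleR_conv_of_real by (simp only: mult_ac)
  qed
  ultimately show ?thesis
    unfolding split first second A_rate_def distrib_left by simp
qed

text \<open>Differentiating the exponential in \<open>z\<close> brings down a factor \<open>C\<close>; Fubini then moves the time integral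
  outside the Fourier integral.\<close>
lemma A_integral_equation:
  assumes z: "0 \<le> z"
  shows "A k0 C z \<xi> \<eta> = (LINT s|lborel. indicator {0..z} s *\<^sub>R A_rate s \<xi> \<eta>)"
proof -
  let ?I = "\<lambda>s x. indicator {0..z} s * (k0\<^sup>2 / 4 * C (x + (s / k0) *\<^sub>R \<eta>) * exp (expo s x \<eta>))"
  have "A k0 C z \<xi> \<eta> = complex_of_real kap * (LINT x|lborel. LINT s|lborel. complex_of_real (?I s x) * cis (- (\<xi> \<bullet> x)))"
    unfolding A_eq hfun_integral_equation[OF z] integral_complex_of_real[symmetric] by (simp only: integral_mult_left_zero)
  also have "(LINT x|lborel. LINT s|lborel. complex_of_real (?I s x) * cis (- (\<xi> \<bullet> x)))
     = (LINT s|lborel. LINT x|lborel. complex_of_real (?I s x) * cis (- (\<xi> \<bullet> x)))"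
  proof (rule lborel_pair.Fubini_integral)
    show "integrable (lborel \<Otimes>\<^sub>M lborel) (\<lambda>(s, x). complex_of_real (?I s x) * cis (- (\<xi> \<bullet> x)))"
    proof (rule integrableI_bounded)
      have [measurable]: "(\<lambda>y::real \<times> vec2. indicat_real {0..z} (fst y)) \<in> borel_measurable (lborel \<Otimes>\<^sub>M lborel)" by measurable
      show m: "(\<lambda>(s, x). complex_of_real (?I s x) * cis (- (\<xi> \<bullet> x))) \<in> borel_measurable (lborel \<Otimes>\<^sub>M lborel)"
        unfolding split_beta' by measurable
      let ?k = "k0\<^sup>2 / 4 * exp (lam * z)"
      have "(\<integral>\<^sup>+y. ennreal (norm (case y of (s, x) \<Rightarrow> complex_of_real (?I s x) * cis (- (\<xi> \<bullet> x)))) \<partial>(lborel \<Otimes>\<^sub>M lborel))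
         = (NNINT s. (NNINT x. ennreal (norm (case (s, x) of (s, x) \<Rightarrow> complex_of_real (?I s x) * cis (- (\<xi> \<bullet> x))))))"
        by (rule lborel.nn_integral_fst[symmetric]) (use m in measurable)
      also have "\<dots> = (NNINT s. (NNINT x. ennreal \<bar>?I s x\<bar>))"
        by (simp only: prod.case norm_mult norm_cis norm_of_real mult_1_right)
      also have "\<dots> \<le> (NNINT s. (NNINT x. ennreal (?k * indicator {0..z} s) * ennreal \<bar>C (x + (s / k0) *\<^sub>R \<eta>)\<bar>))"
      proof (intro nn_integral_mono)
        fix s x
        have "\<bar>?I s x\<bar> \<le> ?k * indicator {0..z} s * \<bar>C (x + (s / k0) *\<^sub>R \<eta>)\<bar>"
        proof (cases "s \<in> {0..z}")
          case True
          have "exp (expo s x \<eta>) \<le> exp (lam * s)" using True by (intro exp_expo_le) auto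
          also have "\<dots> \<le> exp (lam * z)" using True lam_nonneg by (auto intro: mult_left_mono)
          finally have "k0\<^sup>2 / 4 * \<bar>C (x + (s / k0) *\<^sub>R \<eta>)\<bar> * exp (expo s x \<eta>) \<le> k0\<^sup>2 / 4 * \<bar>C (x + (s / k0) *\<^sub>R \<eta>)\<bar> * exp (lam * z)"
            by (intro mult_left_mono) auto
          then show ?thesis using True by (simp add: abs_mult mult_ac)
        qed simp
        then show "ennreal \<bar>?I s x\<bar> \<le> ennreal (?k * indicator {0..z} s) * ennreal \<bar>C (x + (s / k0) *\<^sub>R \<eta>)\<bar>"
          by (subst ennreal_mult[symmetric]) (auto intro: ennreal_leI)
      qed
      also have "\<dots> = (NNINT s. ennreal (?k * indicator {0..z} s) * (NNINT x. ennreal \<bar>C x\<bar>))"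
        using nn_integral_lborel_translate(1)[of "\<lambda>x. ennreal \<bar>C x\<bar>"] by (simp add: nn_integral_cmult)
      also have "\<dots> = (NNINT s. ennreal ?k * indicator {0..z} s) * (NNINT x. ennreal \<bar>C x\<bar>)"
        by (subst nn_integral_multc[symmetric]) (auto intro!: nn_integral_cong simp: indicator_def)
      also have "\<dots> < \<infinity>"
        using integrable_C z by (subst nn_integral_cmult_indicator) (auto simp: integrable_iff_bounded ennreal_mult_less_top)
      finally show "(\<integral>\<^sup>+y. ennreal (norm (case y of (s, x) \<Rightarrow> complex_of_real (?I s x) * cis (- (\<xi> \<bullet> x)))) \<partial>(lborel \<Otimes>\<^sub>M lborel)) < \<infinity>" .
    qed
  qed
  also have "complex_of_real kap * \<dots> = (LINT s|lborel. complex_of_real kap * (LINT x|lborel. complex_of_real (?I s x) * cis (- (\<xi> \<bullet> x))))"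
    by (rule integral_mult_right_zero[symmetric])
  also have "\<dots> = (LINT s|lborel. indicator {0..z} s *\<^sub>R A_rate s \<xi> \<eta>)"
  proof (rule Bochner_Integration.integral_cong[OF refl])
    fix s
    show "complex_of_real kap * (LINT x|lborel. complex_of_real (?I s x) * cis (- (\<xi> \<bullet> x))) = indicator {0..z} s *\<^sub>R A_rate s \<xi> \<eta>"
      using A_rate_eq[of s \<eta> \<xi>] by (cases "s \<in> {0..z}") auto
  qed
  finally show ?thesis .
qed

lemma A_0: "A k0 C 0 \<xi> \<eta> = 0"
  using A_bound[of 0 \<xi> \<eta>] by (simp add: A_max_def h_mass_def)

lemma A_rate_bound:
  assumes "0 \<le> s" "s \<le> z"
  shows "cmod (A_rate s \<xi> \<eta>) \<le> alpha_max + lam * A_max z"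
proof -
  have "cmod (LINT k|lborel. f_src s \<eta> k * A k0 C s (\<xi> - k) \<eta>) \<le> (LINT k|lborel. alpha k * A_max z)"
  proof (rule norm_lebesgue_integral_le)
    show "integrable lborel (\<lambda>k. alpha k * A_max z)" by (intro integrable_mult_left alpha_integrable)
    show "cmod (f_src s \<eta> k * A k0 C s (\<xi> - k) \<eta>) \<le> alpha k * A_max z" for k
      unfolding norm_mult norm_f_src
      by (intro mult_left_mono order_trans[OF A_bound[OF assms(1)] A_max_mono[OF assms]] alpha_nonneg)
  qed
  also have "\<dots> = lam * A_max z" by (simp add: alpha_integral)
  finally have 1: "cmod (LINT k|lborel. f_src s \<eta> k * A k0 C s (\<xi> - k) \<eta>) \<le> lam * A_max z" .
  have "cmod ((1/2) *\<^sub>R f_src s \<eta> \<xi>) \<le> alpha_max"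
    using alpha_bound[of \<xi>] alpha_nonneg[of \<xi>] by (simp add: norm_f_src)
  with 1 show ?thesis unfolding A_rate_def by (intro order_trans[OF norm_triangle_ineq] add_mono)
qed

lemma A_continuous: "continuous_on {0..z} (\<lambda>s. A k0 C s \<xi> \<eta>)"
proof (cases "0 \<le> z")
  case True
  have int: "set_integrable lborel {0..z} (\<lambda>s. A_rate s \<xi> \<eta>)"
    unfolding set_integrable_def
  proof (rule Bochner_Integration.integrable_bound[where f="\<lambda>s. (alpha_max + lam * A_max z) * indicat_real {0..z} s"])
    have "integrable lborel (indicat_real {0..z})" by (rule integrable_real_indicator) (simp_all add: emeasure_lborel_Icc_eq)
    then show "integrable lborel (\<lambda>s. (alpha_max + lam * A_max z) * indicat_real {0..z} s)" by (rule integrable_mult_right)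
    show "AE s in lborel. norm (indicat_real {0..z} s *\<^sub>R A_rate s \<xi> \<eta>) \<le> norm ((alpha_max + lam * A_max z) * indicat_real {0..z} s)"
      using A_rate_bound[of _ z \<xi> \<eta>] by (intro always_eventually allI) (auto simp: indicator_def intro: order_trans[OF _ abs_ge_self])
  qed measurable
  have eq: "A k0 C s \<xi> \<eta> = integral {0..s} (\<lambda>s. A_rate s \<xi> \<eta>)" if "s \<in> {0..z}" for s
  proof -
    have "set_integrable lborel {0..s} (\<lambda>s. A_rate s \<xi> \<eta>)" by (rule set_integrable_subset[OF int]) (use that in auto)
    then show ?thesis using A_integral_equation[of s \<xi> \<eta>] that
      by (simp add: set_borel_integral_eq_integral(2)[symmetric] set_lebesgue_integral_def)
  qed
  have "continuous_on {0..z} (\<lambda>s. integral {0..s} (\<lambda>s. A_rate s \<xi> \<eta>))"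
    by (rule indefinite_integral_continuous_1) (rule set_borel_integral_eq_integral(1)[OF int])
  then show ?thesis by (rule continuous_on_eq) (use eq in auto)
qed simp

lemma A_rate_continuous: "continuous_on {0..z} (\<lambda>s. A_rate s \<xi> \<eta>)"
proof (cases "0 \<le> z")
  case True
  have "continuous_on {0..z} (\<lambda>s. LINT k|lborel. f_src s \<eta> k * A k0 C s (\<xi> - k) \<eta>)"
    unfolding continuous_on_sequentially
  proof safe
    fix u a assume u: "\<forall>n. u n \<in> {0..z}" "u \<longlonglongrightarrow> a" and a: "a \<in> {0..z}"
    have "(\<lambda>n. LINT k|lborel. f_src (u n) \<eta> k * A k0 C (u n) (\<xi> - k) \<eta>) \<longlonglongrightarrow> (LINT k|lborel. f_src a \<eta> k * A k0 C a (\<xi> - k) \<eta>)"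
    proof (rule integral_dominated_convergence[where w="\<lambda>k. alpha k * A_max z"])
      show "integrable lborel (\<lambda>k. alpha k * A_max z)" by (intro integrable_mult_left alpha_integrable)
      show "AE k in lborel. cmod (f_src (u n) \<eta> k * A k0 C (u n) (\<xi> - k) \<eta>) \<le> alpha k * A_max z" for n
      proof (intro always_eventually allI)
        fix k
        have "cmod (A k0 C (u n) (\<xi> - k) \<eta>) \<le> A_max z"
          using u(1) by (intro order_trans[OF A_bound A_max_mono]) auto
        then show "cmod (f_src (u n) \<eta> k * A k0 C (u n) (\<xi> - k) \<eta>) \<le> alpha k * A_max z"
          unfolding norm_mult norm_f_src by (intro mult_left_mono alpha_nonneg)
      qed
      show "AE k in lborel. (\<lambda>n. f_src (u n) \<eta> k * A k0 C (u n) (\<xi> - k) \<eta>) \<longlonglongrightarrow> f_src a \<eta> k * A k0 C a (\<xi> - k) \<eta>"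
      proof (intro always_eventually allI tendsto_mult)
        fix k
        show "(\<lambda>n. f_src (u n) \<eta> k) \<longlonglongrightarrow> f_src a \<eta> k"
          unfolding f_src_def using k0 by (intro tendsto_intros u(2)) auto
        show "(\<lambda>n. A k0 C (u n) (\<xi> - k) \<eta>) \<longlonglongrightarrow> A k0 C a (\<xi> - k) \<eta>"
          by (rule continuous_on_tendsto_compose[OF A_continuous[of z] u(2) a]) (use u(1) in auto)
      qed
    qed measurable
    then show "((\<lambda>s. LINT k|lborel. f_src s \<eta> k * A k0 C s (\<xi> - k) \<eta>) \<circ> u) \<longlonglongrightarrow> (LINT k|lborel. f_src a \<eta> k * A k0 C a (\<xi> - k) \<eta>)"
      by (simp add: o_def)
  qed
  then show ?thesis unfolding A_rate_def f_src_def using k0 by (intro continuous_intros) auto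
qed simp

lemma A_derivative:
  assumes "0 \<le> s" "s \<le> z"
  shows "((\<lambda>s. A k0 C s \<xi> \<eta>) has_vector_derivative A_rate s \<xi> \<eta>) (at s within {0..z})"
proof -
  have eq: "A k0 C s \<xi> \<eta> = integral {0..s} (\<lambda>s. A_rate s \<xi> \<eta>)" if "s \<in> {0..z}" for s
    using A_integral_equation[of s \<xi> \<eta>] that
    by (simp add: set_borel_integral_eq_integral(2)[OF borel_integrable_atLeastAtMost'[OF A_rate_continuous], symmetric] set_lebesgue_integral_def)
  have "((\<lambda>s. integral {0..s} (\<lambda>s. A_rate s \<xi> \<eta>)) has_vector_derivative A_rate s \<xi> \<eta>) (at s within {0..z})"
    by (rule integral_has_vector_derivative[OF A_rate_continuous]) (use assms in auto)
  then show ?thesis by (rule has_vector_derivative_transform[rotated 2]) (use assms eq in auto)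
qed

definition A_mass :: "real \<Rightarrow> real" where "A_mass z = lam * z * exp ((2 * lam + 1) * z)"

lemma A_mass_nonneg: "0 \<le> z \<Longrightarrow> 0 \<le> A_mass z" using lam_nonneg by (simp add: A_mass_def)

text \<open>\<open>A\<close> is the Fourier transform of a function that is merely integrable, so that its integrability is not
  automatic. Its integral equation, whose source has \<open>L1\<close> norm \<open>lam\<close>, bounds the norm by Gronwall once it
  is known to be finite. Finiteness is clear on balls; the convolution moves the ball, hence the
  inequality is closed over the family of all translates of a ball before its radius tends to infinity.\<close>
lemma A_L1:
  assumes z: "0 \<le> z"
  shows "(NNINT \<xi>. ennreal (cmod (A k0 C z \<xi> \<eta>))) \<le> ennreal (A_mass z)"
proof -
  have ball: "(NNINT \<xi>. ennreal (cmod (A k0 C z (\<xi> + y) \<eta>)) * indicator (cball 0 (real n)) \<xi>) \<le> ennreal (2 * (lam * z / 2) * exp ((2 * lam + 1) * z))" for n y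
  proof (rule gronwall_family[where w="\<lambda>y s. NNINT \<xi>. ennreal (cmod (A k0 C s (\<xi> + y) \<eta>)) * indicator (cball 0 (real n)) \<xi>"
        and Z=z and W="A_max z * measure lborel (cball (0::vec2) (real n))"])
    show "0 \<le> lam" by (rule lam_nonneg)
    show "0 \<le> lam * z / 2" using lam_nonneg z by simp
    show "0 \<le> A_max z * measure lborel (cball (0::vec2) (real n))" using A_max_nonneg[OF z] by simp
    fix y s assume s: "0 \<le> s" "s \<le> z"
    have "(NNINT \<xi>. ennreal (cmod (A k0 C s (\<xi> + y) \<eta>)) * indicator (cball 0 (real n)) \<xi>) \<le> (NNINT \<xi>. ennreal (A_max z) * indicator (cball (0::vec2) (real n)) \<xi>)"
      using order_trans[OF A_bound[OF s(1)] A_max_mono[OF s]] by (intro nn_integral_mono mult_right_mono ennreal_leI) auto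
    also have "\<dots> = ennreal (A_max z * measure lborel (cball (0::vec2) (real n)))"
    proof -
      have "emeasure lborel (cball (0::vec2) (real n)) = ennreal (measure lborel (cball (0::vec2) (real n)))"
        using emeasure_lborel_cball_finite[of "0::vec2" "real n"] by (intro emeasure_eq_ennreal_measure) auto
      then show ?thesis using A_max_nonneg[OF z] by (subst nn_integral_cmult_indicator) (auto simp: ennreal_mult)
    qed
    finally show "(NNINT \<xi>. ennreal (cmod (A k0 C s (\<xi> + y) \<eta>)) * indicator (cball 0 (real n)) \<xi>) \<le> ennreal (A_max z * measure lborel (cball (0::vec2) (real n)))" .
  next
    fix D y s assume D: "0 \<le> (D::real)" and s: "0 \<le> s" "s \<le> z"
    let ?e = "\<lambda>s. ennreal (D * exp ((2 * lam + 1) * s))"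
    let ?B = "indicator (cball (0::vec2) (real n)) :: vec2 \<Rightarrow> ennreal"
    have [measurable]: "cball (0::vec2) (real n) \<in> sets borel" by simp
    assume IH: "\<And>y s. 0 \<le> s \<Longrightarrow> s \<le> z \<Longrightarrow> (NNINT \<xi>. ennreal (cmod (A k0 C s (\<xi> + y) \<eta>)) * ?B \<xi>) \<le> ?e s"
    have rate: "(NNINT \<xi>. ennreal (cmod (A_rate t (\<xi> + y) \<eta>)) * ?B \<xi>) \<le> ennreal (lam / 2) + ennreal lam * ?e t"
      if t: "0 \<le> t" "t \<le> z" for t
    proof -
      have "(NNINT \<xi>. ennreal (cmod (A_rate t (\<xi> + y) \<eta>)) * ?B \<xi>)
        \<le> (NNINT \<xi>. ennreal (1/2) * ennreal (alpha (\<xi> + y)) + (NNINT k. ennreal (alpha k) * (ennreal (cmod (A k0 C t (\<xi> + (y - k)) \<eta>)) * ?B \<xi>)))"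
      proof (rule nn_integral_mono)
        fix \<xi>
        have i1: "ennreal (cmod (LINT k|lborel. f_src t \<eta> k * A k0 C t (\<xi> + y - k) \<eta>)) \<le> (NNINT k. ennreal (alpha k) * ennreal (cmod (A k0 C t (\<xi> + (y - k)) \<eta>)))"
          by (rule order_trans[OF norm_integral_le_nn_integral])
             (simp add: norm_mult norm_f_src ennreal_mult alpha_nonneg add_diff_eq)
        have i2: "ennreal (cmod ((1/2) *\<^sub>R f_src t \<eta> (\<xi> + y))) = ennreal (1/2) * ennreal (alpha (\<xi> + y))"
          by (subst ennreal_mult[symmetric]) (simp_all add: norm_f_src alpha_nonneg)
        have i3: "ennreal (cmod (A_rate t (\<xi> + y) \<eta>)) \<le> ennreal (cmod ((1/2) *\<^sub>R f_src t \<eta> (\<xi> + y))) + ennreal (cmod (LINT k|lborel. f_src t \<eta> k * A k0 C t (\<xi> + y - k) \<eta>))"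
          unfolding A_rate_def ennreal_plus[OF norm_ge_zero norm_ge_zero, symmetric] by (intro ennreal_leI norm_triangle_ineq)
        have "ennreal (cmod (A_rate t (\<xi> + y) \<eta>)) \<le> ennreal (1/2) * ennreal (alpha (\<xi> + y)) + (NNINT k. ennreal (alpha k) * ennreal (cmod (A k0 C t (\<xi> + (y - k)) \<eta>)))"
          by (rule order_trans[OF i3[unfolded i2] add_left_mono[OF i1]])
        then show "ennreal (cmod (A_rate t (\<xi> + y) \<eta>)) * ?B \<xi> \<le> ennreal (1/2) * ennreal (alpha (\<xi> + y)) + (NNINT k. ennreal (alpha k) * (ennreal (cmod (A k0 C t (\<xi> + (y - k)) \<eta>)) * ?B \<xi>))"
          by (cases "\<xi> \<in> cball 0 (real n)") auto
      qed
      also have "\<dots> = (NNINT \<xi>. ennreal (1/2) * ennreal (alpha (\<xi> + y))) + (NNINT \<xi>. (NNINT k. ennreal (alpha k) * (ennreal (cmod (A k0 C t (\<xi> + (y - k)) \<eta>)) * ?B \<xi>)))"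
        by (rule nn_integral_add) measurable
      also have "(NNINT \<xi>. ennreal (1/2) * ennreal (alpha (\<xi> + y))) = ennreal (lam / 2)"
      proof -
        have "(NNINT \<xi>. ennreal (1/2) * ennreal (alpha (\<xi> + y))) = ennreal (1/2) * (NNINT \<xi>. ennreal (alpha (\<xi> + y)))"
          by (rule nn_integral_cmult) measurable
        also have "\<dots> = ennreal (1/2) * ennreal lam"
          using nn_integral_lborel_translate(1)[of "\<lambda>x. ennreal (alpha x)" y] by (simp add: alpha_nn_integral)
        also have "\<dots> = ennreal (1/2 * lam)" by (rule ennreal_mult[symmetric]) (use lam_nonneg in auto)
        finally show ?thesis by simp
      qed
      also have "(NNINT \<xi>. (NNINT k. ennreal (alpha k) * (ennreal (cmod (A k0 C t (\<xi> + (y - k)) \<eta>)) * ?B \<xi>)))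
         = (NNINT k. (NNINT \<xi>. ennreal (alpha k) * (ennreal (cmod (A k0 C t (\<xi> + (y - k)) \<eta>)) * ?B \<xi>)))"
        by (rule lborel_pair.Fubini') measurable
      also have "\<dots> = (NNINT k. ennreal (alpha k) * (NNINT \<xi>. ennreal (cmod (A k0 C t (\<xi> + (y - k)) \<eta>)) * ?B \<xi>))"
        by (intro nn_integral_cong nn_integral_cmult) measurable
      also have "\<dots> \<le> (NNINT k. ennreal (alpha k) * ?e t)"
        by (intro nn_integral_mono mult_left_mono IH t) auto
      also have "\<dots> = ennreal lam * ?e t" by (subst nn_integral_multc) (auto simp: alpha_nn_integral)
      finally show ?thesis by simp
    qed
    have "(NNINT \<xi>. ennreal (cmod (A k0 C s (\<xi> + y) \<eta>)) * ?B \<xi>)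
       \<le> (NNINT \<xi>. (NNINT t. ennreal (cmod (A_rate t (\<xi> + y) \<eta>)) * ?B \<xi> * indicator {0..s} t))"
    proof (rule nn_integral_mono)
      fix \<xi>
      have "ennreal (cmod (A k0 C s (\<xi> + y) \<eta>)) \<le> (NNINT t. ennreal (cmod (indicator {0..s} t *\<^sub>R A_rate t (\<xi> + y) \<eta>)))"
        unfolding A_integral_equation[OF s(1)] by (rule norm_integral_le_nn_integral)
      then have "ennreal (cmod (A k0 C s (\<xi> + y) \<eta>)) * ?B \<xi> \<le> (NNINT t. ennreal (cmod (indicator {0..s} t *\<^sub>R A_rate t (\<xi> + y) \<eta>))) * ?B \<xi>"
        by (rule mult_right_mono) simp
      also have "\<dots> = (NNINT t. ennreal (cmod (indicator {0..s} t *\<^sub>R A_rate t (\<xi> + y) \<eta>)) * ?B \<xi>)"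
        by (rule nn_integral_multc[symmetric]) measurable
      also have "\<dots> = (NNINT t. ennreal (cmod (A_rate t (\<xi> + y) \<eta>)) * ?B \<xi> * indicator {0..s} t)"
        by (intro nn_integral_cong) (auto simp: indicator_def)
      finally show "ennreal (cmod (A k0 C s (\<xi> + y) \<eta>)) * ?B \<xi> \<le> (NNINT t. ennreal (cmod (A_rate t (\<xi> + y) \<eta>)) * ?B \<xi> * indicator {0..s} t)" .
    qed
    also have "\<dots> = (NNINT t. (NNINT \<xi>. ennreal (cmod (A_rate t (\<xi> + y) \<eta>)) * ?B \<xi> * indicator {0..s} t))"
      by (rule lborel_pair.Fubini') measurable
    also have "\<dots> = (NNINT t. (NNINT \<xi>. ennreal (cmod (A_rate t (\<xi> + y) \<eta>)) * ?B \<xi>) * indicator {0..s} t)"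
      by (intro nn_integral_cong nn_integral_multc) measurable
    also have "\<dots> \<le> (NNINT t. ennreal (lam / 2) * indicator {0..s} t + ennreal lam * (?e t * indicator {0..s} t))"
    proof (rule nn_integral_mono)
      fix t show "(NNINT \<xi>. ennreal (cmod (A_rate t (\<xi> + y) \<eta>)) * ?B \<xi>) * indicator {0..s} t \<le> ennreal (lam / 2) * indicator {0..s} t + ennreal lam * (?e t * indicator {0..s} t)"
        using rate[of t] s by (cases "t \<in> {0..s}") auto
    qed
    also have "\<dots> = (NNINT t. ennreal (lam / 2) * indicator {0..s} t) + (NNINT t. ennreal lam * (?e t * indicator {0..s} t))"
      by (rule nn_integral_add) measurable
    also have "(NNINT t. ennreal (lam / 2) * indicator {0..s} t) = ennreal (lam / 2 * s)"
      using s lam_nonneg by (subst nn_integral_cmult_indicator) (simp_all add: ennreal_mult[symmetric])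
    also have "(NNINT t. ennreal lam * (?e t * indicator {0..s} t)) = ennreal lam * (NNINT t. ?e t * indicator {0..s} t)"
      by (rule nn_integral_cmult) measurable
    also have "ennreal (lam / 2 * s) + \<dots> \<le> ennreal (lam * z / 2) + \<dots>"
      using s lam_nonneg by (intro add_right_mono ennreal_leI) (simp add: mult_left_mono)
    finally show "(NNINT \<xi>. ennreal (cmod (A k0 C s (\<xi> + y) \<eta>)) * ?B \<xi>) \<le> ennreal (lam * z / 2) + ennreal lam * (NNINT t. ?e t * indicator {0..s} t)" .
  qed (use z in auto)
  have "(NNINT \<xi>. ennreal (cmod (A k0 C z \<xi> \<eta>))) = (NNINT \<xi>. (SUP n. ennreal (cmod (A k0 C z \<xi> \<eta>)) * indicator (cball 0 (real n)) \<xi>))"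
  proof (rule nn_integral_cong)
    fix \<xi> :: vec2
    obtain n :: nat where n: "norm \<xi> \<le> real n" using real_arch_simple by blast
    have "(SUP n. ennreal (cmod (A k0 C z \<xi> \<eta>)) * indicator (cball 0 (real n)) \<xi>) = ennreal (cmod (A k0 C z \<xi> \<eta>))"
    proof (rule antisym)
      show "(SUP n. ennreal (cmod (A k0 C z \<xi> \<eta>)) * indicator (cball 0 (real n)) \<xi>) \<le> ennreal (cmod (A k0 C z \<xi> \<eta>))"
        by (intro SUP_least) (auto simp: indicator_def)
      show "ennreal (cmod (A k0 C z \<xi> \<eta>)) \<le> (SUP n. ennreal (cmod (A k0 C z \<xi> \<eta>)) * indicator (cball 0 (real n)) \<xi>)"
        by (rule SUP_upper2[of n]) (use n in auto)
    qed
    then show "ennreal (cmod (A k0 C z \<xi> \<eta>)) = (SUP n. ennreal (cmod (A k0 C z \<xi> \<eta>)) * indicator (cball 0 (real n)) \<xi>)" by simp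
  qed
  also have "\<dots> = (SUP n. NNINT \<xi>. ennreal (cmod (A k0 C z \<xi> \<eta>)) * indicator (cball 0 (real n)) \<xi>)"
  proof (rule nn_integral_monotone_convergence_SUP)
    have [measurable]: "cball (0::vec2) (real n) \<in> sets borel" for n by simp
    show "(\<lambda>\<xi>. ennreal (cmod (A k0 C z \<xi> \<eta>)) * indicator (cball 0 (real n)) \<xi>) \<in> borel_measurable lborel" for n
      by measurable
    show "incseq (\<lambda>n \<xi>. ennreal (cmod (A k0 C z \<xi> \<eta>)) * indicator (cball 0 (real n)) \<xi>)"
      by (intro incseq_SucI le_funI mult_left_mono) (auto simp: indicator_def)
  qed
  also have "\<dots> \<le> ennreal (A_mass z)"
    using ball[of 0] by (intro SUP_least) (simp add: A_mass_def)
  finally show ?thesis .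
qed

end

section \<open>Oscillatory integrals\<close>

text \<open>Shifting the variable by half a period changes the sign of the exponential, so twice the
  integral is an integral of differences of the amplitude.\<close>
lemma riemann_lebesgue:
  fixes g :: "real \<Rightarrow> complex"
  assumes cont: "continuous_on {0..z} g" and om: "filterlim (\<lambda>n. \<bar>\<omega> n\<bar>) at_top sequentially"
  shows "(\<lambda>n. LINT s|lborel. indicator {0..z} s *\<^sub>R (g s * cis (s * \<omega> n))) \<longlonglongrightarrow> 0"
proof -
  define G where "G s = indicator {0..z} s *\<^sub>R g s" for s
  define h where "h n = pi / \<omega> n" for n
  have h0: "h \<longlonglongrightarrow> 0"
  proof -
    have "(\<lambda>n. pi / \<bar>\<omega> n\<bar>) \<longlonglongrightarrow> 0"
      by (rule tendsto_divide_0[OF tendsto_const filterlim_at_top_imp_at_infinity[OF om]])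
    then have "(\<lambda>n. \<bar>h n\<bar>) \<longlonglongrightarrow> 0" by (simp add: h_def abs_divide)
    then show ?thesis by (rule tendsto_rabs_zero_cancel)
  qed
  have Gm [measurable]: "G \<in> borel_measurable borel"
    unfolding G_def using borel_measurable_continuous_on_indicator[OF _ cont] by simp
  have "compact (g ` {0..z})" by (intro compact_continuous_image cont) auto
  then have "bounded (g ` {0..z})" by (rule compact_imp_bounded)
  then obtain B where B: "0 < B" "\<forall>x\<in>g ` {0..z}. cmod x \<le> B" by (auto simp: bounded_pos)
  have GB: "cmod (G s) \<le> B" for s using B by (auto simp: G_def indicator_def)
  have G0: "G s = 0" if "s \<notin> {0..z}" for s using that by (simp add: G_def)
  have ind: "integrable lborel (\<lambda>s. k * indicat_real {a..b} s)" for k a b :: real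
  proof -
    have "integrable lborel (indicat_real {a..b})" by (rule integrable_real_indicator) (simp_all add: emeasure_lborel_Icc_eq)
    then show ?thesis by (rule integrable_mult_right)
  qed
  have iG: "integrable lborel (\<lambda>s. G (s + t) * cis (s * w))" for t w
  proof (rule Bochner_Integration.integrable_bound[OF ind[of B "-t" "z - t"]])
    show "AE s in lborel. norm (G (s + t) * cis (s * w)) \<le> norm (B * indicat_real {-t..z - t} s)"
    proof (intro always_eventually allI)
      fix s show "norm (G (s + t) * cis (s * w)) \<le> norm (B * indicat_real {-t..z - t} s)"
        using GB[of "s + t"] G0[of "s + t"] B(1) by (auto simp: norm_mult indicator_def)
    qed
  qed measurable
  have conv: "(\<lambda>n. LINT s|lborel. cmod (G s - G (s + h n))) \<longlonglongrightarrow> 0"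
  proof -
    obtain n0 where n0: "\<And>n. n0 \<le> n \<Longrightarrow> \<bar>h n\<bar> < 1"
      using LIMSEQ_D[OF h0, of 1] by auto
    have "(\<lambda>n. LINT s|lborel. cmod (G s - G (s + h (n + n0)))) \<longlonglongrightarrow> (LINT s|(lborel :: real measure). 0)"
    proof (rule integral_dominated_convergence[OF _ _ ind[of "2 * B" "-1" "z + 1"]])
      show "AE s in lborel. (\<lambda>n. cmod (G s - G (s + h (n + n0)))) \<longlonglongrightarrow> 0"
        using AE_lborel_singleton[of "0::real"] AE_lborel_singleton[of z]
      proof eventually_elim
        case (elim s)
        have "isCont G s"
        proof (cases "s \<in> {0..z}")
          case True
          then have s: "s \<in> {0<..<z}" using elim by auto
          have "continuous_on {0<..<z} g" by (rule continuous_on_subset[OF cont]) auto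
          then have "isCont g s" using s by (simp add: continuous_on_eq_continuous_at)
          moreover have "eventually (\<lambda>x. g x = G x) (nhds s)"
            using eventually_nhds_in_open[of "{0<..<z}" s] s by (auto elim!: eventually_mono simp: G_def)
          ultimately show ?thesis by (simp add: isCont_cong)
        next
          case False
          have "eventually (\<lambda>x. x \<in> - {0..z}) (nhds s)"
            by (rule eventually_nhds_in_open) (use False in auto)
          then have "eventually (\<lambda>x. 0 = G x) (nhds s)"
            by (rule eventually_mono) (simp add: G0)
          then show ?thesis using isCont_cong[of "\<lambda>_. 0" G s] by simp
        qed
        moreover have "(\<lambda>n. s + h (n + n0)) \<longlonglongrightarrow> s + 0" by (intro tendsto_intros LIMSEQ_ignore_initial_segment h0)
        ultimately have "(\<lambda>n. G (s + h (n + n0))) \<longlonglongrightarrow> G s" by (intro isCont_tendsto_compose[of s G]) auto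
        then have "(\<lambda>n. cmod (G s - G (s + h (n + n0)))) \<longlonglongrightarrow> cmod (G s - G s)" by (intro tendsto_norm tendsto_diff tendsto_const)
        then show ?case by simp
      qed
      show "AE s in lborel. norm (cmod (G s - G (s + h (n + n0)))) \<le> 2 * B * indicat_real {-1..z + 1} s" for n
      proof (intro always_eventually allI)
        fix s
        have "cmod (G s - G (s + h (n + n0))) \<le> B + B"
          by (rule order_trans[OF norm_triangle_ineq4 add_mono[OF GB GB]])
        moreover have "G s = 0 \<and> G (s + h (n + n0)) = 0" if "s \<notin> {-1..z + 1}"
          using n0[of "n + n0"] that by (auto intro!: G0)
        ultimately show "norm (cmod (G s - G (s + h (n + n0)))) \<le> 2 * B * indicat_real {-1..z + 1} s"
          by (auto simp: indicator_def)
      qed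
    qed measurable
    then show ?thesis by (simp add: LIMSEQ_offset)
  qed
  have "eventually (\<lambda>n. 0 < \<bar>\<omega> n\<bar>) sequentially"
    using om unfolding filterlim_at_top_dense by blast
  then have bound: "eventually (\<lambda>n. norm (LINT s|lborel. indicator {0..z} s *\<^sub>R (g s * cis (s * \<omega> n))) \<le> (LINT s|lborel. cmod (G s - G (s + h n)))) sequentially"
  proof eventually_elim
    case (elim n)
    let ?I = "LINT s|lborel. G s * cis (s * \<omega> n)"
    have "?I = (LINT s|lborel. G (s + h n) * cis ((s + h n) * \<omega> n))"
      by (rule integral_lborel_translate(1)[of "\<lambda>s. G s * cis (s * \<omega> n)", symmetric])
    also have "\<dots> = (LINT s|lborel. - (G (s + h n) * cis (s * \<omega> n)))"
    proof (rule Bochner_Integration.integral_cong[OF refl])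
      fix s
      have "cis ((s + h n) * \<omega> n) = cis (s * \<omega> n) * cis pi"
      proof -
        have "(s + h n) * \<omega> n = s * \<omega> n + pi" using elim by (simp add: h_def distrib_right)
        then show ?thesis by (simp only: cis_mult)
      qed
      then show "G (s + h n) * cis ((s + h n) * \<omega> n) = - (G (s + h n) * cis (s * \<omega> n))" by simp
    qed
    also have "\<dots> = - (LINT s|lborel. G (s + h n) * cis (s * \<omega> n))" by (rule Bochner_Integration.integral_minus)
    finally have "2 * ?I = ?I - (LINT s|lborel. G (s + h n) * cis (s * \<omega> n))" by simp
    also have "\<dots> = (LINT s|lborel. G s * cis (s * \<omega> n) - G (s + h n) * cis (s * \<omega> n))"
      using iG[of 0 "\<omega> n"] by (intro Bochner_Integration.integral_diff[symmetric] iG) simp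
    finally have eq: "2 * ?I = (LINT s|lborel. G s * cis (s * \<omega> n) - G (s + h n) * cis (s * \<omega> n))" .
    have "cmod (2 * ?I) \<le> (LINT s|lborel. cmod (G s - G (s + h n)))"
      unfolding eq
    proof (rule norm_lebesgue_integral_le)
      have "integrable lborel (\<lambda>s. G (s + 0) * cis (s * 0) - G (s + h n) * cis (s * 0))"
        by (intro Bochner_Integration.integrable_diff iG)
      then show "integrable lborel (\<lambda>s. cmod (G s - G (s + h n)))" by simp
      show "cmod (G s * cis (s * \<omega> n) - G (s + h n) * cis (s * \<omega> n)) \<le> cmod (G s - G (s + h n))" for s
        by (simp add: left_diff_distrib[symmetric] norm_mult)
    qed
    moreover have I_eq: "?I = (LINT s|lborel. indicator {0..z} s *\<^sub>R (g s * cis (s * \<omega> n)))" by (simp add: G_def)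
    moreover have "cmod (2 * ?I) = 2 * cmod ?I" by (simp add: norm_mult)
    ultimately have "cmod ?I \<le> (LINT s|lborel. cmod (G s - G (s + h n)))" using norm_ge_zero[of ?I] by linarith
    with I_eq show ?case by (simp only:)
  qed
  show ?thesis by (rule Lim_null_comparison[OF bound conv])
qed

lemma AE_hyperplane_lborel:
  fixes a :: "'a::euclidean_space" assumes "a \<noteq> 0"
  shows "AE x in lborel. a \<bullet> x \<noteq> b"
proof -
  have m: "{x. a \<bullet> x = b} \<in> sets lborel" by simp
  have "negligible {x. a \<bullet> x = b}" using negligible_hyperplane[of a b] assms by blast
  then have "{x. a \<bullet> x = b} \<in> null_sets lebesgue" by (simp add: negligible_iff_null_sets)
  then have "{x. a \<bullet> x = b} \<in> null_sets lborel" using m null_sets_completion_iff by blast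
  then show ?thesis by (rule AE_I') auto
qed

section \<open>Centred coordinates on phase space\<close>

lemma nn_integral_phase:
  fixes F :: "phase \<Rightarrow> ennreal"
  assumes [measurable]: "F \<in> borel_measurable borel"
  shows "(NNINT p. F p)
    = (NNINT \<zeta>1. (NNINT \<zeta>2. (NNINT \<xi>1. (NNINT \<xi>2. F (\<xi>1, \<xi>2, \<zeta>1, \<zeta>2)))))"
proof -
  have prod: "(NNINT x. G x) = (NNINT a. (NNINT b. G (a, b)))"
    if "G \<in> borel_measurable borel" for G :: "'x::euclidean_space \<times> 'y::euclidean_space \<Rightarrow> ennreal"
  proof -
    have "G \<in> borel_measurable (lborel \<Otimes>\<^sub>M lborel)" using that by (simp add: lborel_prod)
    then show ?thesis using lborel.nn_integral_fst[of G lborel] by (simp add: lborel_prod)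
  qed
  have "(NNINT p. F p) = (NNINT \<xi>1. (NNINT r. F (\<xi>1, r)))" by (rule prod) measurable
  also have "\<dots> = (NNINT \<xi>1. (NNINT \<xi>2. (NNINT r. F (\<xi>1, \<xi>2, r))))"
    by (rule nn_integral_cong, rule prod) measurable
  also have "\<dots> = (NNINT \<xi>1. (NNINT r. (NNINT \<xi>2. F (\<xi>1, \<xi>2, r))))"
    by (rule nn_integral_cong, rule lborel_pair.Fubini') measurable
  also have "\<dots> = (NNINT r. (NNINT \<xi>1. (NNINT \<xi>2. F (\<xi>1, \<xi>2, r))))"
    by (rule lborel_pair.Fubini') measurable
  also have "\<dots> = (NNINT \<zeta>1. (NNINT \<zeta>2. (NNINT \<xi>1. (NNINT \<xi>2. F (\<xi>1, \<xi>2, \<zeta>1, \<zeta>2)))))"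
    by (rule prod) measurable
  finally show ?thesis .
qed

text \<open>The substitution \<open>(x, y) \<mapsto> (x - y, x + y)\<close> of the plane, in two coordinates, has Jacobian 4.\<close>
lemma nn_integral_centred:
  fixes G :: "vec2 \<Rightarrow> vec2 \<Rightarrow> ennreal"
  assumes [measurable]: "(\<lambda>(x, y). G x y) \<in> borel_measurable borel"
  shows "(NNINT \<xi>1. (NNINT \<xi>2. G \<xi>1 \<xi>2)) = 4 * (NNINT x. (NNINT y. G (x - y) (x + y)))"
proof -
  have m [measurable]: "(\<lambda>t. G (f t) (g t)) \<in> borel_measurable N"
    if "f \<in> borel_measurable N" "g \<in> borel_measurable N" for f g and N :: "'n measure"
  proof -
    have "(\<lambda>t. (f t, g t)) \<in> borel_measurable N" using that by measurable
    from measurable_compose[OF this assms] show ?thesis by simp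
  qed
  have "(NNINT \<xi>1. (NNINT \<xi>2. G \<xi>1 \<xi>2)) = (NNINT \<xi>1. 4 * (NNINT x. G \<xi>1 (- \<xi>1 + 2 *\<^sub>R x)))"
  proof (rule nn_integral_cong)
    fix \<xi>1 :: vec2
    have "4 * (NNINT x. G \<xi>1 (- \<xi>1 + 2 *\<^sub>R x)) = 4 * (ennreal ((1 / \<bar>2\<bar>) ^ DIM(vec2)) * (NNINT \<xi>2. G \<xi>1 \<xi>2))"
      by (subst nn_integral_lborel_affine) auto
    also have "\<dots> = (ennreal 4 * ennreal ((1 / \<bar>2\<bar>) ^ DIM(vec2))) * (NNINT \<xi>2. G \<xi>1 \<xi>2)"
      by (simp add: mult.assoc)
    also have "ennreal 4 * ennreal ((1 / \<bar>2\<bar>) ^ DIM(vec2)) = 1"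
      by (subst ennreal_mult[symmetric]) (auto simp: power2_eq_square)
    finally show "(NNINT \<xi>2. G \<xi>1 \<xi>2) = 4 * (NNINT x. G \<xi>1 (- \<xi>1 + 2 *\<^sub>R x))" by simp
  qed
  also have "\<dots> = 4 * (NNINT \<xi>1. (NNINT x. G \<xi>1 (- \<xi>1 + 2 *\<^sub>R x)))"
    by (rule nn_integral_cmult) measurable
  also have "(NNINT \<xi>1. (NNINT x. G \<xi>1 (- \<xi>1 + 2 *\<^sub>R x))) = (NNINT x. (NNINT \<xi>1. G \<xi>1 (- \<xi>1 + 2 *\<^sub>R x)))"
    by (rule lborel_pair.Fubini') measurable
  also have "\<dots> = (NNINT x. (NNINT y. G (x - y) (x + y)))"
  proof (rule nn_integral_cong)
    fix x :: vec2
    have "(NNINT y. G (x - y) (- (x - y) + 2 *\<^sub>R x)) = (NNINT \<xi>1. G \<xi>1 (- \<xi>1 + 2 *\<^sub>R x))"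
      by (rule nn_integral_lborel_translate(3)) measurable
    moreover have "- (x - y) + 2 *\<^sub>R x = x + y" for y by (simp add: scaleR_2)
    ultimately show "(NNINT \<xi>1. G \<xi>1 (- \<xi>1 + 2 *\<^sub>R x)) = (NNINT y. G (x - y) (x + y))" by simp
  qed
  finally show ?thesis .
qed

lemma nn_integral_phase_centred:
  fixes F :: "phase \<Rightarrow> ennreal"
  assumes [measurable]: "F \<in> borel_measurable borel"
  shows "(NNINT p. F p)
    = 4 * (NNINT \<zeta>1. (NNINT \<zeta>2. (NNINT x. (NNINT y. F (x - y, x + y, \<zeta>1, \<zeta>2)))))"
proof -
  have m: "(\<lambda>(x, y). F (x, y, \<zeta>1, \<zeta>2)) \<in> borel_measurable borel" for \<zeta>1 \<zeta>2
  proof -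
    have "(\<lambda>z::vec2\<times>vec2. (fst z, snd z, \<zeta>1, \<zeta>2)) \<in> borel_measurable borel"
      by (intro borel_measurable_continuous_onI continuous_intros)
    from measurable_compose[OF this assms] show ?thesis by (simp add: split_beta')
  qed
  show ?thesis
    unfolding nn_integral_phase[OF assms] nn_integral_centred[OF m]
    by (simp add: nn_integral_cmult)
qed

lemma nn_integral_scale_vec2:
  fixes f :: "vec2 \<Rightarrow> ennreal"
  assumes "f \<in> borel_measurable borel" "0 < c"
  shows "(NNINT x. f x) = ennreal (c\<^sup>2) * (NNINT u. f (c *\<^sub>R u))"
proof -
  have "ennreal (c\<^sup>2) * (NNINT u. f (0 + c *\<^sub>R u)) = (ennreal (c\<^sup>2) * ennreal ((1 / \<bar>c\<bar>) ^ DIM(vec2))) * (NNINT x. f x)"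
    by (subst nn_integral_lborel_affine) (use assms in \<open>auto simp: mult.assoc\<close>)
  also have "ennreal (c\<^sup>2) * ennreal ((1 / \<bar>c\<bar>) ^ DIM(vec2)) = 1"
    using assms by (subst ennreal_mult[symmetric]) (auto simp: power_divide)
  finally show ?thesis by simp
qed

lemma nn_integral_phase_rescaled:
  fixes F :: "phase \<Rightarrow> ennreal"
  assumes [measurable]: "F \<in> borel_measurable borel" and c: "0 < a" "0 < b" "0 < \<epsilon>"
  shows "(NNINT p. F p)
    = ennreal (4 * (a * b * \<epsilon> * \<epsilon>)\<^sup>2) * (NNINT \<eta>1. (NNINT \<eta>2. (NNINT u. (\<integral>\<^sup>+v.
         F (a *\<^sub>R u - b *\<^sub>R v, a *\<^sub>R u + b *\<^sub>R v, \<epsilon> *\<^sub>R \<eta>1, \<epsilon> *\<^sub>R \<eta>2) \<partial>lborel))))"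
proof -
  let ?I4 = "\<lambda>x \<zeta>1 \<zeta>2. NNINT y. F (x - y, x + y, \<zeta>1, \<zeta>2)"
  let ?I3 = "\<lambda>\<zeta>1 \<zeta>2. NNINT x. ?I4 x \<zeta>1 \<zeta>2"
  let ?J4 = "\<lambda>u \<zeta>1 \<zeta>2. NNINT v. F (a *\<^sub>R u - b *\<^sub>R v, a *\<^sub>R u + b *\<^sub>R v, \<zeta>1, \<zeta>2)"
  let ?J3 = "\<lambda>\<zeta>1 \<zeta>2. NNINT u. ?J4 u \<zeta>1 \<zeta>2"
  have 4: "?I4 x \<zeta>1 \<zeta>2 = ennreal (b\<^sup>2) * (NNINT v. F (x - b *\<^sub>R v, x + b *\<^sub>R v, \<zeta>1, \<zeta>2))" for x \<zeta>1 \<zeta>2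
    by (rule nn_integral_scale_vec2[OF _ c(2)]) measurable
  have 3: "?I3 \<zeta>1 \<zeta>2 = ennreal (a\<^sup>2) * (ennreal (b\<^sup>2) * ?J3 \<zeta>1 \<zeta>2)" for \<zeta>1 \<zeta>2
  proof -
    have "?I3 \<zeta>1 \<zeta>2 = ennreal (a\<^sup>2) * (NNINT u. ?I4 (a *\<^sub>R u) \<zeta>1 \<zeta>2)"
      by (rule nn_integral_scale_vec2[OF _ c(1)]) measurable
    also have "(NNINT u. ?I4 (a *\<^sub>R u) \<zeta>1 \<zeta>2) = ennreal (b\<^sup>2) * ?J3 \<zeta>1 \<zeta>2"
      unfolding 4 by (rule nn_integral_cmult) measurable
    finally show ?thesis .
  qed
  have 2: "(NNINT \<zeta>2. ?I3 \<zeta>1 \<zeta>2) = ennreal (\<epsilon>\<^sup>2) * (ennreal (a\<^sup>2) * (ennreal (b\<^sup>2) * (NNINT \<eta>2. ?J3 \<zeta>1 (\<epsilon> *\<^sub>R \<eta>2))))" for \<zeta>1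
  proof -
    have "(NNINT \<zeta>2. ?I3 \<zeta>1 \<zeta>2) = ennreal (\<epsilon>\<^sup>2) * (NNINT \<eta>2. ?I3 \<zeta>1 (\<epsilon> *\<^sub>R \<eta>2))"
      by (rule nn_integral_scale_vec2[OF _ c(3)]) measurable
    also have "(NNINT \<eta>2. ?I3 \<zeta>1 (\<epsilon> *\<^sub>R \<eta>2)) = (ennreal (a\<^sup>2) * (ennreal (b\<^sup>2) * (NNINT \<eta>2. ?J3 \<zeta>1 (\<epsilon> *\<^sub>R \<eta>2))))"
      unfolding 3 by (subst nn_integral_cmult, measurable, subst nn_integral_cmult, measurable)
    finally show ?thesis .
  qed
  have 1: "(NNINT \<zeta>1. (NNINT \<zeta>2. ?I3 \<zeta>1 \<zeta>2))
     = ennreal (\<epsilon>\<^sup>2) * (ennreal (\<epsilon>\<^sup>2) * (ennreal (a\<^sup>2) * (ennreal (b\<^sup>2) * (NNINT \<eta>1. (NNINT \<eta>2. ?J3 (\<epsilon> *\<^sub>R \<eta>1) (\<epsilon> *\<^sub>R \<eta>2))))))"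
  proof -
    have "(NNINT \<zeta>1. (NNINT \<zeta>2. ?I3 \<zeta>1 \<zeta>2)) = ennreal (\<epsilon>\<^sup>2) * (NNINT \<eta>1. (NNINT \<zeta>2. ?I3 (\<epsilon> *\<^sub>R \<eta>1) \<zeta>2))"
      by (rule nn_integral_scale_vec2[OF _ c(3)]) measurable
    also have "(NNINT \<eta>1. (NNINT \<zeta>2. ?I3 (\<epsilon> *\<^sub>R \<eta>1) \<zeta>2))
       = (ennreal (\<epsilon>\<^sup>2) * (ennreal (a\<^sup>2) * (ennreal (b\<^sup>2) * (NNINT \<eta>1. (NNINT \<eta>2. ?J3 (\<epsilon> *\<^sub>R \<eta>1) (\<epsilon> *\<^sub>R \<eta>2))))))"
      unfolding 2 by (subst nn_integral_cmult, measurable, subst nn_integral_cmult, measurable, subst nn_integral_cmult, measurable)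
    finally show ?thesis .
  qed
  have "4 * (ennreal (\<epsilon>\<^sup>2) * (ennreal (\<epsilon>\<^sup>2) * (ennreal (a\<^sup>2) * (ennreal (b\<^sup>2) * X)))) = ennreal (4 * (a * b * \<epsilon> * \<epsilon>)\<^sup>2) * X" for X
  proof -
    have "4 * (ennreal (\<epsilon>\<^sup>2) * (ennreal (\<epsilon>\<^sup>2) * (ennreal (a\<^sup>2) * (ennreal (b\<^sup>2) * X))))
       = (ennreal 4 * (ennreal (\<epsilon>\<^sup>2) * (ennreal (\<epsilon>\<^sup>2) * (ennreal (a\<^sup>2) * ennreal (b\<^sup>2))))) * X"
      by (simp add: mult.assoc)
    also have "(ennreal 4 * (ennreal (\<epsilon>\<^sup>2) * (ennreal (\<epsilon>\<^sup>2) * (ennreal (a\<^sup>2) * ennreal (b\<^sup>2))))) = ennreal (4 * (\<epsilon>\<^sup>2 * (\<epsilon>\<^sup>2 * (a\<^sup>2 * b\<^sup>2))))"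
      by (simp only: ennreal_mult zero_le_power2 mult_nonneg_nonneg zero_le_numeral)
    also have "4 * (\<epsilon>\<^sup>2 * (\<epsilon>\<^sup>2 * (a\<^sup>2 * b\<^sup>2))) = 4 * (a * b * \<epsilon> * \<epsilon>)\<^sup>2" by (simp add: power_mult_distrib mult_ac)
    finally show ?thesis .
  qed
  then show ?thesis unfolding nn_integral_phase_centred[OF assms(1)] 1 by simp
qed

section \<open>Vanishing of the rapidly oscillating terms\<close>

lemma nn_integral_lborel_pair:
  fixes G :: "'x::euclidean_space \<times> 'y::euclidean_space \<Rightarrow> ennreal"
  assumes "G \<in> borel_measurable borel"
  shows "(NNINT x. G x) = (NNINT a. (NNINT b. G (a, b)))"
proof -
  have "G \<in> borel_measurable (lborel \<Otimes>\<^sub>M lborel)" using assms by (simp add: lborel_prod)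
  then show ?thesis using lborel.nn_integral_fst[of G lborel] by (simp add: lborel_prod)
qed

lemma AE_lborel_pair:
  fixes P :: "'x::euclidean_space \<times> 'y::euclidean_space \<Rightarrow> bool"
  assumes "{x. P x} \<in> sets borel" "AE x in lborel. AE y in lborel. P (x, y)"
  shows "AE p in lborel. P p"
proof -
  have eq: "(lborel :: 'x measure) \<Otimes>\<^sub>M (lborel :: 'y measure) = lborel" by (rule lborel_prod)
  have "AE p in (lborel :: 'x measure) \<Otimes>\<^sub>M (lborel :: 'y measure). P p"
  proof (rule lborel_pair.AE_pair_measure)
    show "{x \<in> space (lborel \<Otimes>\<^sub>M lborel). P x} \<in> sets ((lborel :: 'x measure) \<Otimes>\<^sub>M (lborel :: 'y measure))"
      unfolding eq using assms(1) by simp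
  qed (use assms(2) in auto)
  then show ?thesis unfolding eq .
qed

lemma phase_measurable_components:
  fixes f :: "'z \<Rightarrow> phase"
  assumes "f \<in> borel_measurable N"
  shows "f \<in> N \<rightarrow>\<^sub>M borel \<Otimes>\<^sub>M (borel \<Otimes>\<^sub>M (borel \<Otimes>\<^sub>M borel))"
  using assms by (simp add: borel_prod)

type_synonym quintuple = "vec2 \<times> vec2 \<times> vec2 \<times> vec2 \<times> vec2"

lemma nn_integral_const_Ioc:
  fixes a b z z' :: real
  assumes "0 \<le> a" "0 \<le> b" "z' \<le> z"
  shows "(NNINT s. ennreal a * ennreal b * indicator {z'<..z} s) = ennreal (a * b * (z - z'))"
  using assms by (subst nn_integral_cmult_indicator) (auto simp: ennreal_mult)

lemma quintuple_measurable_components: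
  fixes f :: "'z \<Rightarrow> quintuple"
  assumes "f \<in> borel_measurable N"
  shows "f \<in> N \<rightarrow>\<^sub>M borel \<Otimes>\<^sub>M (borel \<Otimes>\<^sub>M (borel \<Otimes>\<^sub>M (borel \<Otimes>\<^sub>M borel)))"
  using assms by (simp add: borel_prod)

lemma nonzero_set_borel:
  fixes f :: "'z::topological_space \<Rightarrow> real"
  assumes [measurable]: "f \<in> borel_measurable borel"
  shows "{y. f y \<noteq> 0} \<in> sets borel"
proof -
  have "{y \<in> space borel. f y \<noteq> 0} \<in> sets borel" by measurable
  then show ?thesis by simp
qed

lemma nn_integral_quintuple:
  fixes G :: "quintuple \<Rightarrow> ennreal"
  assumes [measurable]: "G \<in> borel_measurable borel"
  shows "(NNINT y. G y) = (NNINT k. (NNINT \<eta>1. (NNINT \<eta>2. (NNINT u. (NNINT v. G (k, \<eta>1, \<eta>2, u, v))))))"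
proof -
  have "(NNINT y. G y) = (NNINT k. (NNINT r. G (k, r)))"
    by (rule nn_integral_lborel_pair) measurable
  also have "\<dots> = (NNINT k. (NNINT \<eta>1. (NNINT r. G (k, \<eta>1, r))))"
    by (rule nn_integral_cong, rule nn_integral_lborel_pair) measurable
  also have "\<dots> = (NNINT k. (NNINT \<eta>1. (NNINT \<eta>2. (NNINT r. G (k, \<eta>1, \<eta>2, r)))))"
    by (rule nn_integral_cong, rule nn_integral_cong, rule nn_integral_lborel_pair) measurable
  also have "\<dots> = (NNINT k. (NNINT \<eta>1. (NNINT \<eta>2. (NNINT u. (NNINT v. G (k, \<eta>1, \<eta>2, u, v))))))"
    by (rule nn_integral_cong, rule nn_integral_cong, rule nn_integral_cong, rule nn_integral_lborel_pair) measurable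
  finally show ?thesis .
qed

text \<open>Pointwise convergence and a uniform Lipschitz bound give uniform convergence on an interval.\<close>
lemma uniform_limit_of_lipschitz:
  fixes w :: "real \<Rightarrow> real \<Rightarrow> ennreal"
  assumes Z: "0 < Z" and L: "0 \<le> L"
    and lim: "\<And>z. 0 \<le> z \<Longrightarrow> z \<le> Z \<Longrightarrow> ((\<lambda>\<epsilon>. w \<epsilon> z) \<longlongrightarrow> 0) (at_right 0)"
    and lip: "\<And>\<epsilon> z z'. 0 < \<epsilon> \<Longrightarrow> 0 \<le> z' \<Longrightarrow> z' \<le> z \<Longrightarrow> z \<le> Z \<Longrightarrow> w \<epsilon> z \<le> w \<epsilon> z' + ennreal (L * (z - z'))"
  shows "((\<lambda>\<epsilon>. SUP z\<in>{0..Z}. w \<epsilon> z) \<longlongrightarrow> 0) (at_right 0)"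
proof (rule tendsto_0_ennrealI)
  fix e :: real assume e: "0 < e"
  obtain n :: nat where n: "2 * L * Z / e < real n" using reals_Archimedean2 by blast
  have "0 \<le> 2 * L * Z / e" using L Z e by simp
  then have n0: "0 < real n" using n by linarith
  have small: "L * (Z / real n) \<le> e / 2" using n n0 e by (simp add: field_simps)
  have "eventually (\<lambda>\<epsilon>. w \<epsilon> (real i * (Z / real n)) < ennreal (e / 2)) (at_right 0)" if "i \<le> n" for i
  proof (rule order_tendstoD(2)[OF lim])
    show "0 \<le> real i * (Z / real n)" using Z by simp
    have "real i * (Z / real n) \<le> real n * (Z / real n)" using that Z by (intro mult_right_mono) auto
    then show "real i * (Z / real n) \<le> Z" using n0 by simp
    show "0 < ennreal (e / 2)" using e by simp
  qed
  then have "eventually (\<lambda>\<epsilon>. \<forall>i\<in>{..n}. w \<epsilon> (real i * (Z / real n)) < ennreal (e / 2)) (at_right 0)"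
    by (intro eventually_ball_finite) auto
  moreover have "eventually (\<lambda>\<epsilon>::real. 0 < \<epsilon>) (at_right 0)" by (rule eventually_at_right_less)
  ultimately show "eventually (\<lambda>\<epsilon>. (SUP z\<in>{0..Z}. w \<epsilon> z) \<le> ennreal e) (at_right 0)"
  proof eventually_elim
    case (elim \<epsilon>)
    show ?case
    proof (rule SUP_least)
      fix z assume z: "z \<in> {0..Z}"
      define i where "i = nat \<lfloor>z / (Z / real n)\<rfloor>"
      have q: "0 \<le> z / (Z / real n)" using z Z n0 by simp
      have i1: "real i \<le> z / (Z / real n)" unfolding i_def using q by simp
      have i2: "z / (Z / real n) < real i + 1" unfolding i_def using q by linarith
      have Zn: "0 < Z / real n" using Z n0 by simp
      have i1': "real i * (Z / real n) \<le> z" using i1 unfolding pos_le_divide_eq[OF Zn] .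
      have i2': "z - real i * (Z / real n) \<le> Z / real n" using i2 unfolding pos_divide_less_eq[OF Zn] distrib_right mult_1_left by linarith
      have "real i * (Z / real n) \<le> real n * (Z / real n)" using i1' z n0 by simp
      then have "i \<le> n" unfolding mult_le_cancel_right_pos[OF Zn] of_nat_le_iff .
      then have "w \<epsilon> (real i * (Z / real n)) \<le> ennreal (e / 2)" using elim(1) by (auto intro: less_imp_le)
      moreover have "ennreal (L * (z - real i * (Z / real n))) \<le> ennreal (e / 2)"
        by (rule ennreal_leI[OF order_trans[OF mult_left_mono[OF i2' L] small]])
      moreover have "w \<epsilon> z \<le> w \<epsilon> (real i * (Z / real n)) + ennreal (L * (z - real i * (Z / real n)))"
        using elim(2) z i1' Z by (intro lip) auto
      ultimately have "w \<epsilon> z \<le> ennreal (e / 2) + ennreal (e / 2)"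
        using add_mono order_trans by blast
      also have "\<dots> = ennreal e" using e by (simp add: ennreal_plus[symmetric] del: ennreal_plus)
      finally show "w \<epsilon> z \<le> ennreal e" .
    qed
  qed
qed

text \<open>The initial Gaussian in the coordinates \<open>x = (\<xi>2 + \<xi>1) / 2\<close>, \<open>y = (\<xi>2 - \<xi>1) / 2\<close> is a product of two
  Gaussians \<open>gg\<close>, each of mass one half: this one half is the weight of the Dirac mass in \<open>A_rate\<close>.\<close>
locale scintillation = random_medium C k0 for C k0 +
  fixes r0 :: real
  assumes r0: "0 < r0"
begin

lemma phi_measurable [measurable]: "phi r0 \<epsilon> \<in> borel_measurable borel"
  unfolding phi_def[abs_def] by measurable

lemma phi_nonneg: "0 \<le> phi r0 \<epsilon> x" by (simp add: phi_def)

lemma phi_bound: "phi r0 \<epsilon> x \<le> r0\<^sup>2 / (2 * pi * \<epsilon>\<^sup>2)"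
  unfolding phi_def by (intro mult_left_le) auto

lemma phi_scale: assumes "0 < \<epsilon>" shows "\<epsilon>\<^sup>2 * phi r0 \<epsilon> (\<epsilon> *\<^sub>R x) = phi r0 1 x"
  using assms by (simp add: phi_def power_mult_distrib)

lemma phi_mass: assumes "0 < \<epsilon>" shows "(NNINT x. ennreal (phi r0 \<epsilon> x)) = 1"
proof -
  let ?a = "r0\<^sup>2 / (2 * \<epsilon>\<^sup>2)"
  have a: "0 < ?a" using assms r0 by simp
  have h: "has_bochner_integral lborel (\<lambda>x::vec2. exp (- ?a * (norm x)\<^sup>2)) (pi / ?a)"
    using has_bochner_integral_gaussian[OF a, where 'a=vec2] a by simp
  have "has_bochner_integral lborel (\<lambda>x::vec2. r0\<^sup>2 / (2 * pi * \<epsilon>\<^sup>2) * exp (- ?a * (norm x)\<^sup>2)) (r0\<^sup>2 / (2 * pi * \<epsilon>\<^sup>2) * (pi / ?a))"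
    by (rule has_bochner_integral_mult_right) (use h in auto)
  moreover have "r0\<^sup>2 / (2 * pi * \<epsilon>\<^sup>2) * (pi / ?a) = 1" using assms r0 by (simp add: field_simps)
  ultimately have "has_bochner_integral lborel (phi r0 \<epsilon>) 1" by (simp add: phi_def[abs_def])
  then show ?thesis
    using nn_integral_eq_integral[of lborel "phi r0 \<epsilon>"] phi_nonneg by (simp add: has_bochner_integral_iff)
qed

definition gg :: "real \<Rightarrow> vec2 \<Rightarrow> real" where "gg \<epsilon> x = phi r0 \<epsilon> (sqrt 2 *\<^sub>R x)"

lemma gg_measurable [measurable]: "gg \<epsilon> \<in> borel_measurable borel"
  unfolding gg_def[abs_def] by measurable

lemma gg_nonneg: "0 \<le> gg \<epsilon> x" by (simp add: gg_def phi_nonneg)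

lemma gg_bound: "gg \<epsilon> x \<le> r0\<^sup>2 / (2 * pi * \<epsilon>\<^sup>2)" unfolding gg_def by (rule phi_bound)

lemma gg_scale: "0 < \<epsilon> \<Longrightarrow> \<epsilon>\<^sup>2 * gg \<epsilon> (\<epsilon> *\<^sub>R x) = gg 1 x"
  using phi_scale[of \<epsilon> "sqrt 2 *\<^sub>R x"] by (simp add: gg_def mult.commute)

lemma gg_mass: assumes "0 < \<epsilon>" shows "(NNINT x. ennreal (gg \<epsilon> x)) = ennreal (1 / 2)"
proof -
  have "(NNINT x. ennreal (phi r0 \<epsilon> (0 + sqrt 2 *\<^sub>R x))) = ennreal ((1 / \<bar>sqrt 2\<bar>) ^ DIM(vec2)) * (NNINT x. ennreal (phi r0 \<epsilon> x))"
    by (rule nn_integral_lborel_affine) auto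
  then show ?thesis using assms by (simp add: gg_def phi_mass power_divide)
qed

text \<open>The product of the two Gaussians in the variables \<open>\<xi>1\<close>, \<open>\<xi>2\<close> is rotation invariant, hence again a
  product in the centred coordinates.\<close>
lemma phi_product: "phi r0 \<epsilon> (x - y) * phi r0 \<epsilon> (x + y) = gg \<epsilon> x * gg \<epsilon> y"
proof -
  have "(norm (x - y))\<^sup>2 + (norm (x + y))\<^sup>2 = (norm (sqrt 2 *\<^sub>R x))\<^sup>2 + (norm (sqrt 2 *\<^sub>R y))\<^sup>2"
    by (simp add: power_mult_distrib, simp add: power2_norm_eq_inner inner_add_left inner_add_right inner_diff_left inner_diff_right)
  then have "exp (- (r0\<^sup>2 / (2 * \<epsilon>\<^sup>2)) * (norm (x - y))\<^sup>2) * exp (- (r0\<^sup>2 / (2 * \<epsilon>\<^sup>2)) * (norm (x + y))\<^sup>2)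
     = exp (- (r0\<^sup>2 / (2 * \<epsilon>\<^sup>2)) * (norm (sqrt 2 *\<^sub>R x))\<^sup>2) * exp (- (r0\<^sup>2 / (2 * \<epsilon>\<^sup>2)) * (norm (sqrt 2 *\<^sub>R y))\<^sup>2)"
    unfolding exp_add[symmetric] distrib_left[symmetric] by (simp only:)
  moreover have "(c * a) * (c * b) = (c * d) * (c * e)" if "a * b = d * e" for a b c d e :: real
  proof -
    have "(c * a) * (c * b) = (c * c) * (a * b)" by (simp only: mult_ac)
    also have "\<dots> = (c * d) * (c * e)" unfolding that by (simp only: mult_ac)
    finally show ?thesis .
  qed
  ultimately show ?thesis unfolding gg_def phi_def by blast
qed

text \<open>The two kinds of factor in the expansion: the amplitude \<open>A\<close> and the initial Gaussian.\<close>
definition XF :: "bool \<Rightarrow> real \<Rightarrow> real \<Rightarrow> vec2 \<Rightarrow> vec2 \<Rightarrow> complex" where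
  "XF b \<epsilon> s x \<eta> = (if b then A k0 C s x \<eta> else complex_of_real (gg \<epsilon> x))"

text \<open>The length on which a factor varies: the amplitude \<open>A\<close> on the scale 1, the Gaussian on the
  scale \<open>\<epsilon>\<close>.\<close>
definition sc :: "bool \<Rightarrow> real \<Rightarrow> real" where "sc b \<epsilon> = (if b then 1 else \<epsilon>)"

lemma sc_pos: "0 < \<epsilon> \<Longrightarrow> 0 < sc b \<epsilon>" by (simp add: sc_def)

lemma XF_measurable [measurable]:
  assumes [measurable]: "f \<in> borel_measurable N" "g \<in> borel_measurable N" "h \<in> borel_measurable N"
  shows "(\<lambda>y. XF b \<epsilon> (f y) (g y) (h y)) \<in> borel_measurable N"
  unfolding XF_def by (cases b) simp_all

lemma XF_scale: "0 < \<epsilon> \<Longrightarrow> (sc b \<epsilon>)\<^sup>2 *\<^sub>R XF b \<epsilon> s (sc b \<epsilon> *\<^sub>R u) \<eta> = XF b 1 s u \<eta>"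
  using gg_scale[of \<epsilon> u] by (simp add: XF_def sc_def scaleR_conv_of_real del: of_real_power flip: of_real_mult)

definition X_mass :: "real \<Rightarrow> real" where "X_mass Z = 1 + A_mass Z"

lemma A_mass_mono: "0 \<le> s \<Longrightarrow> s \<le> Z \<Longrightarrow> A_mass s \<le> A_mass Z"
  unfolding A_mass_def using lam_nonneg by (intro mult_mono) (auto intro: mult_left_mono)

lemma X_mass_nonneg: "0 \<le> Z \<Longrightarrow> 0 \<le> X_mass Z" using A_mass_nonneg[of Z] by (simp add: X_mass_def)

lemma XF_L1:
  assumes "0 < \<epsilon>" "0 \<le> s" "s \<le> Z"
  shows "(NNINT x. ennreal (cmod (XF b \<epsilon> s x \<eta>))) \<le> ennreal (X_mass Z)"
proof (cases b)
  case True
  have "(NNINT x. ennreal (cmod (XF b \<epsilon> s x \<eta>))) \<le> ennreal (A_mass s)"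
    using True A_L1[OF assms(2)] by (simp add: XF_def)
  also have "\<dots> \<le> ennreal (X_mass Z)"
    using A_mass_mono[OF assms(2,3)] by (intro ennreal_leI) (simp add: X_mass_def)
  finally show ?thesis .
next
  case False
  then have "(NNINT x. ennreal (cmod (XF b \<epsilon> s x \<eta>))) = ennreal (1/2)"
    using gg_mass[OF assms(1)] gg_nonneg by (simp add: XF_def)
  also have "\<dots> \<le> ennreal (X_mass Z)"
    using A_mass_nonneg[of Z] assms by (intro ennreal_leI) (simp add: X_mass_def)
  finally show ?thesis .
qed

definition X_max :: "real \<Rightarrow> real \<Rightarrow> real" where "X_max \<epsilon> Z = r0\<^sup>2 / (2 * pi * \<epsilon>\<^sup>2) + A_max Z"

lemma X_max_nonneg: "0 \<le> Z \<Longrightarrow> 0 \<le> X_max \<epsilon> Z" using A_max_nonneg by (simp add: X_max_def)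

lemma XF_bound: assumes "0 \<le> s" "s \<le> Z" shows "cmod (XF b \<epsilon> s x \<eta>) \<le> X_max \<epsilon> Z"
proof (cases b)
  case True
  then show ?thesis
    using order_trans[OF A_bound[OF assms(1), of x \<eta>] A_max_mono[OF assms]] by (simp add: XF_def X_max_def add_increasing)
next
  case False
  then show ?thesis using gg_bound[of \<epsilon> x] gg_nonneg[of \<epsilon> x] A_max_nonneg[of Z] assms by (simp add: XF_def X_max_def add_increasing2)
qed

lemma XF_continuous: "continuous_on {0..z} (\<lambda>s. XF b \<epsilon> s x \<eta>)"
  unfolding XF_def using A_continuous by (cases b) auto

text \<open>The four products arising from \<open>(A + gg) (A + gg)\<close>; a factor is \<open>A\<close> where the flag is true.\<close>
definition amp :: "bool \<Rightarrow> bool \<Rightarrow> real \<Rightarrow> real \<Rightarrow> phase \<Rightarrow> complex" where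
  "amp b1 b2 \<epsilon> s = (\<lambda>(\<xi>1, \<xi>2, \<zeta>1, \<zeta>2).
     complex_of_real (phi r0 \<epsilon> \<zeta>1 * phi r0 \<epsilon> \<zeta>2)
      * XF b1 \<epsilon> s ((\<xi>2 + \<xi>1) /\<^sub>R 2) ((\<zeta>2 + \<zeta>1) /\<^sub>R \<epsilon>)
      * XF b2 \<epsilon> s ((\<xi>2 - \<xi>1) /\<^sub>R 2) ((\<zeta>2 - \<zeta>1) /\<^sub>R \<epsilon>))"

lemma amp_measurable [measurable]:
  assumes [measurable]: "f \<in> borel_measurable N" "g \<in> borel_measurable N"
  shows "(\<lambda>y. amp b1 b2 \<epsilon> (f y) (g y)) \<in> borel_measurable N"
  supply phase_measurable_components[OF assms(2), measurable]
  unfolding amp_def split_beta' by measurable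

lemma amp_centred:
  "amp b1 b2 \<epsilon> s (x - y, x + y, \<zeta>1, \<zeta>2) = complex_of_real (phi r0 \<epsilon> \<zeta>1 * phi r0 \<epsilon> \<zeta>2)
     * XF b1 \<epsilon> s x ((\<zeta>2 + \<zeta>1) /\<^sub>R \<epsilon>) * XF b2 \<epsilon> s y ((\<zeta>2 - \<zeta>1) /\<^sub>R \<epsilon>)"
proof -
  have "(x + y + (x - y)) /\<^sub>R 2 = x" "(x + y - (x - y)) /\<^sub>R 2 = y"
    by (simp_all add: scaleR_2[symmetric])
  then show ?thesis by (simp add: amp_def)
qed

lemma nn_integral_gaussian_pair:
  assumes "0 < \<epsilon>"
  shows "(NNINT \<zeta>1. (NNINT \<zeta>2. ennreal (phi r0 \<epsilon> \<zeta>1 * phi r0 \<epsilon> \<zeta>2) * c)) = c"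
proof -
  have "(NNINT \<zeta>1. (NNINT \<zeta>2. ennreal (phi r0 \<epsilon> \<zeta>1 * phi r0 \<epsilon> \<zeta>2) * c))
     = (NNINT \<zeta>1. (NNINT \<zeta>2. ennreal (phi r0 \<epsilon> \<zeta>2) * (ennreal (phi r0 \<epsilon> \<zeta>1) * c)))"
    by (simp add: ennreal_mult phi_nonneg mult_ac)
  also have "\<dots> = (NNINT \<zeta>1. ennreal (phi r0 \<epsilon> \<zeta>1) * c)"
    by (subst nn_integral_multc) (auto simp: phi_mass[OF assms])
  also have "\<dots> = c" by (subst nn_integral_multc) (auto simp: phi_mass[OF assms])
  finally show ?thesis .
qed

lemma amp_L1:
  assumes "0 < \<epsilon>" "0 \<le> s" "s \<le> Z"
  shows "(NNINT p. ennreal (cmod (amp b1 b2 \<epsilon> s p))) \<le> ennreal (4 * (X_mass Z)\<^sup>2)"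
proof -
  have m: "0 \<le> X_mass Z" using X_mass_nonneg assms by simp
  have "(NNINT p. ennreal (cmod (amp b1 b2 \<epsilon> s p)))
     = 4 * (NNINT \<zeta>1. (NNINT \<zeta>2. (NNINT x. (NNINT y. ennreal (cmod (amp b1 b2 \<epsilon> s (x - y, x + y, \<zeta>1, \<zeta>2)))))))"
    by (rule nn_integral_phase_centred) measurable
  also have "\<dots> \<le> 4 * (NNINT \<zeta>1. (NNINT \<zeta>2. ennreal (phi r0 \<epsilon> \<zeta>1 * phi r0 \<epsilon> \<zeta>2) * ennreal ((X_mass Z)\<^sup>2)))"
  proof (intro mult_left_mono nn_integral_mono)
    fix \<zeta>1 \<zeta>2
    let ?X = "\<lambda>x. ennreal (cmod (XF b1 \<epsilon> s x ((\<zeta>2 + \<zeta>1) /\<^sub>R \<epsilon>)))" and ?Y = "\<lambda>y. ennreal (cmod (XF b2 \<epsilon> s y ((\<zeta>2 - \<zeta>1) /\<^sub>R \<epsilon>)))"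
    let ?D = "ennreal (phi r0 \<epsilon> \<zeta>1 * phi r0 \<epsilon> \<zeta>2)"
    have "(NNINT x. (NNINT y. ennreal (cmod (amp b1 b2 \<epsilon> s (x - y, x + y, \<zeta>1, \<zeta>2)))))
       = (NNINT x. (NNINT y. (?D * ?X x) * ?Y y))"
      unfolding amp_centred by (simp add: norm_mult abs_mult phi_nonneg ennreal_mult)
    also have "\<dots> = (NNINT x. ?D * (?X x * (NNINT y. ?Y y)))"
      by (subst nn_integral_cmult) (auto simp: mult.assoc)
    also have "\<dots> = ?D * ((NNINT x. ?X x) * (NNINT y. ?Y y))"
      by (subst nn_integral_cmult, measurable, subst nn_integral_multc, measurable)
    also have "\<dots> \<le> ?D * (ennreal (X_mass Z) * ennreal (X_mass Z))"
      by (intro mult_left_mono mult_mono XF_L1 assms) auto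
    finally show "(NNINT x. (NNINT y. ennreal (cmod (amp b1 b2 \<epsilon> s (x - y, x + y, \<zeta>1, \<zeta>2))))) \<le> ?D * ennreal ((X_mass Z)\<^sup>2)"
      using m by (simp add: ennreal_mult power2_eq_square)
  qed simp
  also have "\<dots> = 4 * ennreal ((X_mass Z)\<^sup>2)" by (simp only: nn_integral_gaussian_pair[OF assms(1)])
  also have "\<dots> = ennreal (4 * (X_mass Z)\<^sup>2)" by (simp add: ennreal_mult)
  finally show ?thesis .
qed

definition amp_max :: "real \<Rightarrow> real \<Rightarrow> real" where "amp_max \<epsilon> Z = (r0\<^sup>2 / (2 * pi * \<epsilon>\<^sup>2))\<^sup>2 * (X_max \<epsilon> Z)\<^sup>2"

lemma amp_bound: assumes "0 \<le> s" "s \<le> Z" shows "cmod (amp b1 b2 \<epsilon> s p) \<le> amp_max \<epsilon> Z"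
proof -
  obtain \<xi>1 \<xi>2 \<zeta>1 \<zeta>2 where p: "p = (\<xi>1, \<xi>2, \<zeta>1, \<zeta>2)" by (cases p)
  have "cmod (amp b1 b2 \<epsilon> s p) = (phi r0 \<epsilon> \<zeta>1 * phi r0 \<epsilon> \<zeta>2) * (cmod (XF b1 \<epsilon> s ((\<xi>2 + \<xi>1) /\<^sub>R 2) ((\<zeta>2 + \<zeta>1) /\<^sub>R \<epsilon>)) * cmod (XF b2 \<epsilon> s ((\<xi>2 - \<xi>1) /\<^sub>R 2) ((\<zeta>2 - \<zeta>1) /\<^sub>R \<epsilon>)))"
    unfolding p amp_def by (simp add: norm_mult abs_mult phi_nonneg mult.assoc)
  also have "\<dots> \<le> (r0\<^sup>2 / (2 * pi * \<epsilon>\<^sup>2) * (r0\<^sup>2 / (2 * pi * \<epsilon>\<^sup>2))) * (X_max \<epsilon> Z * X_max \<epsilon> Z)"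
    by (intro mult_mono phi_bound XF_bound assms mult_nonneg_nonneg phi_nonneg norm_ge_zero X_max_nonneg) (use assms in auto)
  finally show ?thesis by (simp only: amp_max_def power2_eq_square)
qed

lemma amp_continuous: "continuous_on {0..z} (\<lambda>s. amp b1 b2 \<epsilon> s p)"
  unfolding amp_def split_beta' by (intro continuous_intros XF_continuous)

lemma K_continuous: "continuous_on S (K k0 C)"
  unfolding K_def[abs_def] by (intro continuous_intros)

lemma K_measurable [measurable]: "K k0 C \<in> borel_measurable borel"
  by (rule borel_measurable_continuous_onI[OF K_continuous])

lemma K_nonneg: "0 \<le> K k0 C s" by (simp add: K_def)

lemma K_bound: "0 \<le> s \<Longrightarrow> K k0 C s \<le> (2 * pi) ^ 8"
  unfolding K_def using C_0_nonneg by (intro mult_left_le) (auto intro!: mult_nonneg_nonneg)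

definition osc :: "real \<Rightarrow> real \<Rightarrow> (real \<Rightarrow> phase \<Rightarrow> complex) \<Rightarrow> (phase \<Rightarrow> vec2 \<Rightarrow> real) \<Rightarrow> phase \<Rightarrow> vec2 \<Rightarrow> complex" where
  "osc \<epsilon> z X \<theta> p k = (LINT s|lborel. indicator {0..z} s *\<^sub>R (K k0 C s *\<^sub>R (X s p * cis (s * (\<theta> p k / (\<epsilon> * k0))))))"

text \<open>The size, averaged over the jumps \<open>k\<close>, of the time integral of an amplitude with oscillating phase.
  The modulus is taken after the integration in time, so that oscillation in time makes \<open>W\<close> small.\<close>
definition W :: "real \<Rightarrow> real \<Rightarrow> (real \<Rightarrow> phase \<Rightarrow> complex) \<Rightarrow> (phase \<Rightarrow> vec2 \<Rightarrow> real) \<Rightarrow> ennreal" where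
  "W \<epsilon> z X \<theta> = (NNINT k. ennreal (alpha k) * (NNINT p. ennreal (cmod (osc \<epsilon> z X \<theta> p k))))"

text \<open>The general form of the phases that do not cancel. The coefficient \<open>\<tau>\<close> of \<open>\<xi>2\<close> is what makes a phase
  oscillate: \<open>\<xi>2\<close> is of order 1 where a factor \<open>A\<close> is present, whereas the Gaussians confine
  \<open>\<zeta>1\<close> and \<open>\<zeta>2\<close> to the scale \<open>\<epsilon>\<close>, so that their
  contribution to the frequency stays bounded. Without a factor \<open>A\<close> the oscillation comes from \<open>\<delta> |k|\<^sup>2\<close>.\<close>
definition ph :: "real \<Rightarrow> real \<Rightarrow> real \<Rightarrow> real \<Rightarrow> phase \<Rightarrow> vec2 \<Rightarrow> real" where
  "ph \<tau> a b \<delta> = (\<lambda>(\<xi>1, \<xi>2, \<zeta>1, \<zeta>2) k. \<tau> * (k \<bullet> \<xi>2) + k \<bullet> (a *\<^sub>R \<zeta>1 + b *\<^sub>R \<zeta>2) + \<delta> * (norm k)\<^sup>2)"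

lemma ph_measurable [measurable]:
  assumes [measurable]: "f \<in> borel_measurable N" "g \<in> borel_measurable N"
  shows "(\<lambda>y. ph \<tau> a b \<delta> (f y) (g y)) \<in> borel_measurable N"
  supply phase_measurable_components[OF assms(1), measurable]
  unfolding ph_def split_beta' by measurable

lemma indicator_Icc_measurable [measurable]: "(\<lambda>y. indicat_real {0..z::real} (snd y)) \<in> borel_measurable (N \<Otimes>\<^sub>M lborel)"
proof -
  have "indicat_real {0..z::real} \<in> borel_measurable lborel" by (rule borel_measurable_indicator) simp
  from measurable_compose[OF measurable_snd this] show ?thesis .
qed

lemma osc_measurable [measurable]:
  assumes [measurable]: "f \<in> borel_measurable N" "g \<in> borel_measurable N"
  shows "(\<lambda>y. osc \<epsilon> z (amp b1 b2 \<epsilon>) (ph \<tau> a b \<delta>) (f y) (g y)) \<in> borel_measurable N"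
proof -
  have "(\<lambda>(y, s). indicator {0..z} s *\<^sub>R (K k0 C s *\<^sub>R (amp b1 b2 \<epsilon> s (f y) * cis (s * (ph \<tau> a b \<delta> (f y) (g y) / (\<epsilon> * k0)))))) \<in> borel_measurable (N \<Otimes>\<^sub>M lborel)"
    unfolding split_beta' by measurable
  then show ?thesis unfolding osc_def by (rule lborel.borel_measurable_lebesgue_integral)
qed

text \<open>The amplitude in coordinates adapted to the scales of its factors, including the Jacobian. It does not
  depend on \<open>\<epsilon>\<close>, so all dependence on \<open>\<epsilon>\<close> sits in the frequency.\<close>
definition Amp1 :: "bool \<Rightarrow> bool \<Rightarrow> real \<Rightarrow> quintuple \<Rightarrow> complex" where
  "Amp1 b1 b2 s = (\<lambda>(k, \<eta>1, \<eta>2, u, v). complex_of_real (phi r0 1 \<eta>1 * phi r0 1 \<eta>2)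
     * XF b1 1 s u (\<eta>2 + \<eta>1) * XF b2 1 s v (\<eta>2 - \<eta>1))"

lemma Amp1_measurable [measurable]:
  assumes [measurable]: "f \<in> borel_measurable N" "g \<in> borel_measurable N"
  shows "(\<lambda>y. Amp1 b1 b2 (f y) (g y)) \<in> borel_measurable N"
  supply quintuple_measurable_components[OF assms(2), measurable]
  unfolding Amp1_def split_beta' by measurable

lemma amp_rescaled:
  assumes e: "0 < \<epsilon>"
  shows "(sc b1 \<epsilon> * sc b2 \<epsilon> * \<epsilon> * \<epsilon>)\<^sup>2 *\<^sub>R amp b1 b2 \<epsilon> s (sc b1 \<epsilon> *\<^sub>R u - sc b2 \<epsilon> *\<^sub>R v, sc b1 \<epsilon> *\<^sub>R u + sc b2 \<epsilon> *\<^sub>R v, \<epsilon> *\<^sub>R \<eta>1, \<epsilon> *\<^sub>R \<eta>2)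
    = Amp1 b1 b2 s (k, \<eta>1, \<eta>2, u, v)"
proof -
  have 1: "(\<epsilon> *\<^sub>R \<eta>2 + \<epsilon> *\<^sub>R \<eta>1) /\<^sub>R \<epsilon> = \<eta>2 + \<eta>1" "(\<epsilon> *\<^sub>R \<eta>2 - \<epsilon> *\<^sub>R \<eta>1) /\<^sub>R \<epsilon> = \<eta>2 - \<eta>1"
    using e by (simp_all add: scaleR_add_right[symmetric] scaleR_diff_right[symmetric] del: scaleR_add_right scaleR_diff_right)
  have "complex_of_real (phi r0 1 \<eta>1 * phi r0 1 \<eta>2) = (\<epsilon>\<^sup>2 * \<epsilon>\<^sup>2) *\<^sub>R complex_of_real (phi r0 \<epsilon> (\<epsilon> *\<^sub>R \<eta>1) * phi r0 \<epsilon> (\<epsilon> *\<^sub>R \<eta>2))"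
    unfolding phi_scale[OF e, symmetric] by (simp add: scaleR_conv_of_real mult_ac)
  then show ?thesis
    unfolding amp_centred 1 Amp1_def prod.case XF_scale[OF e, of _ s, symmetric]
    by (simp add: scaleR_conv_of_real power_mult_distrib power2_eq_square mult_ac)
qed

definition freq :: "bool \<Rightarrow> bool \<Rightarrow> real \<Rightarrow> real \<Rightarrow> real \<Rightarrow> real \<Rightarrow> real \<Rightarrow> quintuple \<Rightarrow> real" where
  "freq b1 b2 \<tau> a b \<delta> \<epsilon> = (\<lambda>(k, \<eta>1, \<eta>2, u, v).
     ph \<tau> a b \<delta> (sc b1 \<epsilon> *\<^sub>R u - sc b2 \<epsilon> *\<^sub>R v, sc b1 \<epsilon> *\<^sub>R u + sc b2 \<epsilon> *\<^sub>R v, \<epsilon> *\<^sub>R \<eta>1, \<epsilon> *\<^sub>R \<eta>2) k / (\<epsilon> * k0))"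

lemma freq_measurable [measurable]:
  assumes [measurable]: "f \<in> borel_measurable N"
  shows "(\<lambda>y. freq b1 b2 \<tau> a b \<delta> \<epsilon> (f y)) \<in> borel_measurable N"
  supply quintuple_measurable_components[OF assms(1), measurable]
  unfolding freq_def split_beta' by measurable

definition osc1 :: "bool \<Rightarrow> bool \<Rightarrow> real \<Rightarrow> real \<Rightarrow> quintuple \<Rightarrow> complex" where
  "osc1 b1 b2 z \<omega> y = (LINT s|lborel. indicator {0..z} s *\<^sub>R (K k0 C s *\<^sub>R (Amp1 b1 b2 s y * cis (s * \<omega>))))"

lemma osc1_measurable [measurable]:
  assumes [measurable]: "f \<in> borel_measurable N" "g \<in> borel_measurable N"
  shows "(\<lambda>y. osc1 b1 b2 z (f y) (g y)) \<in> borel_measurable N"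
proof -
  have "(\<lambda>(y, s). indicator {0..z} s *\<^sub>R (K k0 C s *\<^sub>R (Amp1 b1 b2 s (g y) * cis (s * f y)))) \<in> borel_measurable (N \<Otimes>\<^sub>M lborel)"
    unfolding split_beta' by measurable
  then show ?thesis unfolding osc1_def by (rule lborel.borel_measurable_lebesgue_integral)
qed

lemma alpha_fst_measurable: "(\<lambda>y::quintuple. alpha (fst y)) \<in> borel_measurable borel"
  by (rule measurable_compose[OF borel_measurable_continuous_onI[OF continuous_on_fst[OF continuous_on_id]] alpha_measurable])

lemma W_rescaled:
  assumes e: "0 < \<epsilon>"
  shows "W \<epsilon> z (amp b1 b2 \<epsilon>) (ph \<tau> a b \<delta>) =
    4 * (NNINT y. ennreal (alpha (fst y)) * ennreal (cmod (osc1 b1 b2 z (freq b1 b2 \<tau> a b \<delta> \<epsilon> y) y)))"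
proof -
  let ?J = "(sc b1 \<epsilon> * sc b2 \<epsilon> * \<epsilon> * \<epsilon>)\<^sup>2"
  let ?p = "\<lambda>\<eta>1 \<eta>2 u v. (sc b1 \<epsilon> *\<^sub>R u - sc b2 \<epsilon> *\<^sub>R v, sc b1 \<epsilon> *\<^sub>R u + sc b2 \<epsilon> *\<^sub>R v, \<epsilon> *\<^sub>R \<eta>1, \<epsilon> *\<^sub>R \<eta>2)"
  let ?G = "\<lambda>y. ennreal (cmod (osc1 b1 b2 z (freq b1 b2 \<tau> a b \<delta> \<epsilon> y) y))"
  have eq: "ennreal ?J * ennreal (cmod (osc \<epsilon> z (amp b1 b2 \<epsilon>) (ph \<tau> a b \<delta>) (?p \<eta>1 \<eta>2 u v) k)) = ?G (k, \<eta>1, \<eta>2, u, v)" for k \<eta>1 \<eta>2 u v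
  proof -
    have "?J *\<^sub>R osc \<epsilon> z (amp b1 b2 \<epsilon>) (ph \<tau> a b \<delta>) (?p \<eta>1 \<eta>2 u v) k = osc1 b1 b2 z (freq b1 b2 \<tau> a b \<delta> \<epsilon> (k, \<eta>1, \<eta>2, u, v)) (k, \<eta>1, \<eta>2, u, v)"
      unfolding osc_def osc1_def freq_def prod.case amp_rescaled[OF e, of b1 b2 _ u v \<eta>1 \<eta>2 k, symmetric] integral_scaleR_right[symmetric]
      by (intro Bochner_Integration.integral_cong refl) (simp add: scaleR_conv_of_real mult_ac)
    from arg_cong[OF this, of cmod, symmetric] have "cmod (osc1 b1 b2 z (freq b1 b2 \<tau> a b \<delta> \<epsilon> (k, \<eta>1, \<eta>2, u, v)) (k, \<eta>1, \<eta>2, u, v)) = ?J * cmod (osc \<epsilon> z (amp b1 b2 \<epsilon>) (ph \<tau> a b \<delta>) (?p \<eta>1 \<eta>2 u v) k)"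
      unfolding norm_scaleR abs_power2 .
    then show ?thesis by (simp add: ennreal_mult)
  qed
  have inner: "(NNINT p. ennreal (cmod (osc \<epsilon> z (amp b1 b2 \<epsilon>) (ph \<tau> a b \<delta>) p k)))
     = 4 * (NNINT \<eta>1. (NNINT \<eta>2. (NNINT u. (NNINT v. ?G (k, \<eta>1, \<eta>2, u, v)))))" for k
  proof -
    have "(NNINT p. ennreal (cmod (osc \<epsilon> z (amp b1 b2 \<epsilon>) (ph \<tau> a b \<delta>) p k)))
       = ennreal (4 * ?J) * (NNINT \<eta>1. (NNINT \<eta>2. (NNINT u. (NNINT v. ennreal (cmod (osc \<epsilon> z (amp b1 b2 \<epsilon>) (ph \<tau> a b \<delta>) (?p \<eta>1 \<eta>2 u v) k))))))"
      by (rule nn_integral_phase_rescaled) (use e sc_pos in auto)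
    also have "ennreal (4 * ?J) = 4 * ennreal ?J" by (simp add: ennreal_mult)
    also have "4 * ennreal ?J * (NNINT \<eta>1. (NNINT \<eta>2. (NNINT u. (NNINT v. ennreal (cmod (osc \<epsilon> z (amp b1 b2 \<epsilon>) (ph \<tau> a b \<delta>) (?p \<eta>1 \<eta>2 u v) k))))))
      = 4 * (NNINT \<eta>1. (NNINT \<eta>2. (NNINT u. (NNINT v. ennreal ?J * ennreal (cmod (osc \<epsilon> z (amp b1 b2 \<epsilon>) (ph \<tau> a b \<delta>) (?p \<eta>1 \<eta>2 u v) k))))))"
      by (simp add: nn_integral_cmult mult.assoc)
    finally show ?thesis unfolding eq .
  qed
  have "W \<epsilon> z (amp b1 b2 \<epsilon>) (ph \<tau> a b \<delta>) = (NNINT k. 4 * (NNINT \<eta>1. (NNINT \<eta>2. (NNINT u. (NNINT v. ennreal (alpha k) * ?G (k, \<eta>1, \<eta>2, u, v))))))"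
    unfolding W_def inner by (simp add: nn_integral_cmult mult.left_commute)
  also have "\<dots> = 4 * (NNINT k. (NNINT \<eta>1. (NNINT \<eta>2. (NNINT u. (NNINT v. ennreal (alpha k) * ?G (k, \<eta>1, \<eta>2, u, v))))))"
    by (rule nn_integral_cmult) measurable
  also have "\<dots> = 4 * (NNINT y. ennreal (alpha (fst y)) * ?G y)"
  proof -
    have G: "(\<lambda>y. ?G y) \<in> borel_measurable borel" by measurable
    show ?thesis
      unfolding nn_integral_quintuple[OF borel_measurable_times_ennreal[OF measurable_compose[OF alpha_fst_measurable measurable_ennreal] G]] fst_conv ..
  qed
  finally show ?thesis .
qed

lemma Amp1_L1:
  assumes "0 \<le> s" "s \<le> Z"
  shows "(NNINT y. ennreal (alpha (fst y)) * ennreal (cmod (Amp1 b1 b2 s y))) \<le> ennreal (lam * (X_mass Z)\<^sup>2)"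
proof -
  have Am: "(\<lambda>y. ennreal (cmod (Amp1 b1 b2 s y))) \<in> borel_measurable borel" by measurable
  have m: "0 \<le> X_mass Z" using X_mass_nonneg assms by simp
  have "(NNINT y. ennreal (alpha (fst y)) * ennreal (cmod (Amp1 b1 b2 s y)))
    = (NNINT k. (NNINT \<eta>1. (NNINT \<eta>2. (NNINT u. (NNINT v. ennreal (alpha k) * ennreal (cmod (Amp1 b1 b2 s (k, \<eta>1, \<eta>2, u, v))))))))"
    by (subst nn_integral_quintuple[OF borel_measurable_times_ennreal[OF measurable_compose[OF alpha_fst_measurable measurable_ennreal] Am]]) simp
  also have "\<dots> \<le> (NNINT k. (NNINT \<eta>1. (NNINT \<eta>2. ennreal (phi r0 1 \<eta>1 * phi r0 1 \<eta>2) * (ennreal (alpha k) * ennreal ((X_mass Z)\<^sup>2)))))"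
  proof (intro nn_integral_mono)
    fix k \<eta>1 \<eta>2
    let ?X = "\<lambda>x. ennreal (cmod (XF b1 1 s x (\<eta>2 + \<eta>1)))" and ?Y = "\<lambda>y. ennreal (cmod (XF b2 1 s y (\<eta>2 - \<eta>1)))"
    let ?D = "ennreal (phi r0 1 \<eta>1 * phi r0 1 \<eta>2)"
    have "(NNINT u. (NNINT v. ennreal (alpha k) * ennreal (cmod (Amp1 b1 b2 s (k, \<eta>1, \<eta>2, u, v)))))
       = (NNINT x. (NNINT y. (?D * ennreal (alpha k) * ?X x) * ?Y y))"
      unfolding Amp1_def by (simp add: norm_mult abs_mult phi_nonneg ennreal_mult mult_ac)
    also have "\<dots> = (NNINT x. (?D * ennreal (alpha k)) * (?X x * (NNINT y. ?Y y)))"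
      by (subst nn_integral_cmult) (auto simp: mult.assoc)
    also have "\<dots> = (?D * ennreal (alpha k)) * ((NNINT x. ?X x) * (NNINT y. ?Y y))"
      by (subst nn_integral_cmult, measurable, subst nn_integral_multc, measurable)
    also have "\<dots> \<le> (?D * ennreal (alpha k)) * (ennreal (X_mass Z) * ennreal (X_mass Z))"
      by (intro mult_left_mono mult_mono XF_L1 assms) auto
    finally show "(NNINT u. (NNINT v. ennreal (alpha k) * ennreal (cmod (Amp1 b1 b2 s (k, \<eta>1, \<eta>2, u, v))))) \<le> ?D * (ennreal (alpha k) * ennreal ((X_mass Z)\<^sup>2))"
      using m by (simp add: ennreal_mult power2_eq_square mult.assoc)
  qed
  also have "\<dots> = (NNINT k. ennreal (alpha k) * ennreal ((X_mass Z)\<^sup>2))"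
    by (simp only: nn_integral_gaussian_pair[OF zero_less_one])
  also have "\<dots> = ennreal (lam * (X_mass Z)\<^sup>2)"
    using lam_nonneg by (subst nn_integral_multc) (auto simp: alpha_nn_integral ennreal_mult)
  finally show ?thesis .
qed

text \<open>In the rescaled coordinates the frequency is \<open>(\<rho> / \<epsilon> + \<kappa>) / k0\<close>, with \<open>\<rho>\<close> and \<open>\<kappa>\<close> independent of \<open>\<epsilon>\<close>.
  The function \<open>\<rho>\<close> vanishes only on a null set: it is a nonconstant affine function of the variable of a
  factor \<open>A\<close>, or equal to \<open>\<delta> |k|\<^sup>2\<close> if there is no such factor. Hence Riemann--Lebesgue applies at almost
  every point, and dominated convergence gives the limit.\<close>
lemma W_limit:
  assumes tau: "\<tau> \<noteq> 0" and nondeg: "b1 \<or> b2 \<or> \<delta> \<noteq> 0" and z: "0 \<le> z"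
  shows "((\<lambda>\<epsilon>. W \<epsilon> z (amp b1 b2 \<epsilon>) (ph \<tau> a b \<delta>)) \<longlongrightarrow> 0) (at_right 0)"
  unfolding tendsto_at_iff_sequentially
proof safe
  fix e :: "nat \<Rightarrow> real" assume e: "\<forall>n. e n \<in> {0<..} - {0}" "e \<longlonglongrightarrow> 0"
  then have e0: "0 < e n" for n by auto
  let ?H = "\<lambda>n y. ennreal (alpha (fst y)) * ennreal (cmod (osc1 b1 b2 z (freq b1 b2 \<tau> a b \<delta> (e n) y) y))"
  define \<beta> where "\<beta> c = (if c then 1 else 0 :: real)" for c
  define \<rho> :: "quintuple \<Rightarrow> real" where
    "\<rho> = (\<lambda>(k, \<eta>1, \<eta>2, u, v). \<tau> * (k \<bullet> (\<beta> b1 *\<^sub>R u + \<beta> b2 *\<^sub>R v)) + \<delta> * (norm k)\<^sup>2)"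
  define \<kappa> :: "quintuple \<Rightarrow> real" where
    "\<kappa> = (\<lambda>(k, \<eta>1, \<eta>2, u, v). \<tau> * (k \<bullet> ((1 - \<beta> b1) *\<^sub>R u + (1 - \<beta> b2) *\<^sub>R v)) + k \<bullet> (a *\<^sub>R \<eta>1 + b *\<^sub>R \<eta>2))"
  have freq: "freq b1 b2 \<tau> a b \<delta> \<epsilon> y = (\<rho> y * inverse \<epsilon> + \<kappa> y) / k0" if "0 < \<epsilon>" for \<epsilon> y
  proof -
    obtain k \<eta>1 \<eta>2 u v where y: "y = (k, \<eta>1, \<eta>2, u, v)" by (cases y)
    have sc: "sc c \<epsilon> = \<beta> c + (1 - \<beta> c) * \<epsilon>" for c by (simp add: sc_def \<beta>_def)
    have "ph \<tau> a b \<delta> (sc b1 \<epsilon> *\<^sub>R u - sc b2 \<epsilon> *\<^sub>R v, sc b1 \<epsilon> *\<^sub>R u + sc b2 \<epsilon> *\<^sub>R v, \<epsilon> *\<^sub>R \<eta>1, \<epsilon> *\<^sub>R \<eta>2) k = \<rho> y + \<epsilon> * \<kappa> y"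
      unfolding y ph_def \<rho>_def \<kappa>_def prod.case sc by (simp add: inner_add_right algebra_simps)
    then show ?thesis using that k0 unfolding y freq_def prod.case by (simp add: field_simps)
  qed
  have rho_m [measurable]: "(\<lambda>y. \<rho> (f y)) \<in> borel_measurable N" if "f \<in> borel_measurable N" for N and f :: "'z \<Rightarrow> quintuple"
    supply quintuple_measurable_components[OF that, measurable]
    unfolding \<rho>_def split_beta' by measurable
  have rho_AE: "AE y in lborel. \<rho> y \<noteq> 0"
  proof (rule AE_lborel_pair)
    show "{y. \<rho> y \<noteq> 0} \<in> sets borel" by (intro nonzero_set_borel rho_m) measurable
    show "AE k in lborel. AE y in lborel. \<rho> (k, y) \<noteq> 0"
      using AE_lborel_singleton[of "0::vec2"]
    proof eventually_elim
      case (elim k)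
      have line: "AE x in lborel. (c * \<tau>) * (k \<bullet> x) + d \<noteq> 0" if "c \<noteq> 0" for c d
        using AE_hyperplane_lborel[OF elim, of "- d / (c * \<tau>)"]
        by eventually_elim (use that tau in \<open>auto simp: field_simps\<close>)
      have uv: "AE u in lborel. AE v in lborel. \<tau> * (k \<bullet> (\<beta> b1 *\<^sub>R u + \<beta> b2 *\<^sub>R v)) + \<delta> * (norm k)\<^sup>2 \<noteq> 0"
      proof (cases b2)
        case True
        have "AE v in lborel. \<tau> * (k \<bullet> (\<beta> b1 *\<^sub>R u + \<beta> b2 *\<^sub>R v)) + \<delta> * (norm k)\<^sup>2 \<noteq> 0" for u
          using line[of 1 "\<tau> * (k \<bullet> (\<beta> b1 *\<^sub>R u)) + \<delta> * (norm k)\<^sup>2"] True by (simp add: \<beta>_def inner_add_right algebra_simps)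
        then show ?thesis by simp
      next
        case False
        show ?thesis
        proof (cases b1)
          case True
          have "AE u in lborel. \<tau> * (k \<bullet> u) + \<delta> * (norm k)\<^sup>2 \<noteq> 0" using line[of 1 "\<delta> * (norm k)\<^sup>2"] by simp
          then show ?thesis by eventually_elim (use True False in \<open>simp add: \<beta>_def\<close>)
        next
          case b1: False
          then have "\<delta> \<noteq> 0" using nondeg False by simp
          then show ?thesis using b1 False elim by (simp add: \<beta>_def)
        qed
      qed
      have m1: "{y. \<rho> (k, \<eta>1, y) \<noteq> 0} \<in> sets borel" and m0: "{y. \<rho> (k, y) \<noteq> 0} \<in> sets borel" and m2: "{y. \<rho> (k, \<eta>1, \<eta>2, y) \<noteq> 0} \<in> sets borel" for \<eta>1 \<eta>2
        by (intro nonzero_set_borel rho_m, measurable)+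
      have "AE y in lborel. \<rho> (k, \<eta>1, \<eta>2, y) \<noteq> 0" for \<eta>1 \<eta>2
        by (rule AE_lborel_pair[OF m2]) (use uv in \<open>simp add: \<rho>_def\<close>)
      then have "AE y in lborel. \<rho> (k, \<eta>1, y) \<noteq> 0" for \<eta>1
        by (intro AE_lborel_pair[OF m1]) simp
      then show ?case by (intro AE_lborel_pair[OF m0]) simp
    qed
  qed
  have mal: "(\<lambda>y::quintuple. ennreal (alpha (fst y))) \<in> borel_measurable lborel"
    using measurable_compose[OF alpha_fst_measurable measurable_ennreal] by simp
  have "(\<lambda>n. NNINT y. ?H n y) \<longlonglongrightarrow> (\<integral>\<^sup>+y. 0 \<partial>(lborel :: quintuple measure))"
  proof (rule nn_integral_dominated_convergence[where w="\<lambda>y. ennreal (alpha (fst y)) * (NNINT s. ennreal ((2 * pi) ^ 8) * ennreal (cmod (Amp1 b1 b2 s y)) * indicator {0..z} s)"])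
    show "AE y in lborel. ?H n y \<le> ennreal (alpha (fst y)) * (NNINT s. ennreal ((2 * pi) ^ 8) * ennreal (cmod (Amp1 b1 b2 s y)) * indicator {0..z} s)" for n
    proof (intro always_eventually allI mult_left_mono)
      fix y
      show "ennreal (cmod (osc1 b1 b2 z (freq b1 b2 \<tau> a b \<delta> (e n) y) y)) \<le> (NNINT s. ennreal ((2 * pi) ^ 8) * ennreal (cmod (Amp1 b1 b2 s y)) * indicator {0..z} s)"
        unfolding osc1_def
      proof (rule order_trans[OF norm_integral_le_nn_integral], rule nn_integral_mono)
        fix s
        show "ennreal (norm (indicat_real {0..z} s *\<^sub>R (K k0 C s *\<^sub>R (Amp1 b1 b2 s y * cis (s * freq b1 b2 \<tau> a b \<delta> (e n) y)))))
          \<le> ennreal ((2 * pi) ^ 8) * ennreal (cmod (Amp1 b1 b2 s y)) * indicator {0..z} s"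
          using K_bound[of s] K_nonneg[of s]
          by (auto simp: indicator_def norm_mult ennreal_mult[symmetric] intro!: ennreal_leI mult_right_mono)
      qed
    qed simp
    show "(\<integral>\<^sup>+y. ennreal (alpha (fst y)) * (NNINT s. ennreal ((2 * pi) ^ 8) * ennreal (cmod (Amp1 b1 b2 s y)) * indicator {0..z} s) \<partial>(lborel :: quintuple measure)) < \<infinity>"
    proof -
      define al where "al y = alpha (fst y)" for y :: quintuple
      have [measurable]: "al \<in> borel_measurable borel" unfolding al_def by (rule alpha_fst_measurable)
      have "(\<integral>\<^sup>+y. ennreal (al y) * (NNINT s. ennreal ((2 * pi) ^ 8) * ennreal (cmod (Amp1 b1 b2 s y)) * indicator {0..z} s) \<partial>(lborel :: quintuple measure))
         = (\<integral>\<^sup>+y. (NNINT s. ennreal ((2 * pi) ^ 8) * (ennreal (al y) * ennreal (cmod (Amp1 b1 b2 s y))) * indicator {0..z} s) \<partial>(lborel :: quintuple measure))"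
        by (subst nn_integral_cmult[symmetric]) (auto simp: mult_ac)
      also have "\<dots> = (NNINT s. (\<integral>\<^sup>+y. ennreal ((2 * pi) ^ 8) * (ennreal (al y) * ennreal (cmod (Amp1 b1 b2 s y))) * indicator {0..z} s \<partial>(lborel :: quintuple measure)))"
        by (rule lborel_pair.Fubini') measurable
      also have "\<dots> = (NNINT s. ennreal ((2 * pi) ^ 8) * (\<integral>\<^sup>+y. ennreal (al y) * ennreal (cmod (Amp1 b1 b2 s y)) \<partial>(lborel :: quintuple measure)) * indicator {0..z} s)"
        by (intro nn_integral_cong) (simp add: nn_integral_cmult nn_integral_multc)
      also have "\<dots> \<le> (NNINT s. ennreal ((2 * pi) ^ 8) * ennreal (lam * (X_mass z)\<^sup>2) * indicator {0..z} s)"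
      proof (rule nn_integral_mono)
        fix s
        show "ennreal ((2 * pi) ^ 8) * (\<integral>\<^sup>+y. ennreal (al y) * ennreal (cmod (Amp1 b1 b2 s y)) \<partial>(lborel :: quintuple measure)) * indicator {0..z} s
           \<le> ennreal ((2 * pi) ^ 8) * ennreal (lam * (X_mass z)\<^sup>2) * indicator {0..z} s"
          using Amp1_L1[of s z b1 b2, folded al_def] by (cases "s \<in> {0..z}") (auto intro!: mult_left_mono)
      qed
      also have "\<dots> < \<infinity>" using z by (subst nn_integral_cmult_indicator) (auto simp: ennreal_mult_less_top)
      finally show ?thesis unfolding al_def .
    qed
    show "AE y in lborel. (\<lambda>n. ?H n y) \<longlonglongrightarrow> 0"
      using rho_AE
    proof eventually_elim
      case (elim y)
      have om: "filterlim (\<lambda>n. \<bar>freq b1 b2 \<tau> a b \<delta> (e n) y\<bar>) at_top sequentially"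
      proof (rule filterlim_at_top_mono)
        have inv: "filterlim (\<lambda>n. inverse (e n)) at_top sequentially"
          by (rule filterlim_inverse_at_top[OF e(2)]) (use e0 in auto)
        have "filterlim (\<lambda>n. (\<bar>\<rho> y\<bar> / k0) * inverse (e n)) at_top sequentially"
          using elim k0 by (intro filterlim_tendsto_pos_mult_at_top[OF tendsto_const _ inv]) simp
        from filterlim_tendsto_add_at_top[OF tendsto_const[of "- (\<bar>\<kappa> y\<bar> / k0)"] this]
        show "filterlim (\<lambda>n. - (\<bar>\<kappa> y\<bar> / k0) + (\<bar>\<rho> y\<bar> / k0) * inverse (e n)) at_top sequentially" .
        show "\<forall>\<^sub>F n in sequentially. - (\<bar>\<kappa> y\<bar> / k0) + (\<bar>\<rho> y\<bar> / k0) * inverse (e n) \<le> \<bar>freq b1 b2 \<tau> a b \<delta> (e n) y\<bar>"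
        proof (intro always_eventually allI)
          fix n
          have "\<bar>\<rho> y * inverse (e n)\<bar> - \<bar>\<kappa> y\<bar> \<le> \<bar>\<rho> y * inverse (e n) + \<kappa> y\<bar>" by linarith
          moreover have "\<bar>\<rho> y * inverse (e n)\<bar> = \<bar>\<rho> y\<bar> * inverse (e n)" using e0[of n] by (simp add: abs_mult)
          ultimately have "(\<bar>\<rho> y\<bar> * inverse (e n) - \<bar>\<kappa> y\<bar>) / k0 \<le> \<bar>\<rho> y * inverse (e n) + \<kappa> y\<bar> / k0"
            using k0 by (intro divide_right_mono) auto
          then show "- (\<bar>\<kappa> y\<bar> / k0) + (\<bar>\<rho> y\<bar> / k0) * inverse (e n) \<le> \<bar>freq b1 b2 \<tau> a b \<delta> (e n) y\<bar>"
            unfolding freq[OF e0] using k0 by (simp add: abs_divide diff_divide_distrib)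
        qed
      qed
      have "continuous_on {0..z} (\<lambda>s. K k0 C s *\<^sub>R Amp1 b1 b2 s y)"
        unfolding Amp1_def split_beta' by (intro continuous_intros XF_continuous K_continuous)
      from riemann_lebesgue[OF this om]
      have "(\<lambda>n. osc1 b1 b2 z (freq b1 b2 \<tau> a b \<delta> (e n) y) y) \<longlonglongrightarrow> 0"
        unfolding osc1_def by (simp only: mult_scaleR_left)
      then have "(\<lambda>n. alpha (fst y) * cmod (osc1 b1 b2 z (freq b1 b2 \<tau> a b \<delta> (e n) y) y)) \<longlonglongrightarrow> alpha (fst y) * cmod 0"
        by (intro tendsto_mult tendsto_const tendsto_norm)
      then have "(\<lambda>n. ennreal (alpha (fst y) * cmod (osc1 b1 b2 z (freq b1 b2 \<tau> a b \<delta> (e n) y) y))) \<longlonglongrightarrow> ennreal (alpha (fst y) * cmod 0)"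
        by (rule tendsto_ennrealI)
      then show ?case by (simp add: ennreal_mult alpha_nonneg)
    qed
    show "(\<lambda>y. ?H n y) \<in> borel_measurable lborel" for n
      by (intro borel_measurable_times_ennreal mal) measurable
    show "(\<lambda>y. ennreal (alpha (fst y)) * (NNINT s. ennreal ((2 * pi) ^ 8) * ennreal (cmod (Amp1 b1 b2 s y)) * indicator {0..z} s)) \<in> borel_measurable (lborel :: quintuple measure)"
      by (intro borel_measurable_times_ennreal mal) measurable
  qed simp
  then have lim0: "(\<lambda>n. NNINT y. ?H n y) \<longlonglongrightarrow> 0" unfolding nn_integral_const mult_zero_left .
  have four: "(4::ennreal) < top" by simp
  from ennreal_tendsto_cmult[OF four lim0]
  show "((\<lambda>\<epsilon>. W \<epsilon> z (amp b1 b2 \<epsilon>) (ph \<tau> a b \<delta>)) \<circ> e) \<longlonglongrightarrow> 0"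
    unfolding o_def W_rescaled[OF e0] mult_zero_right .
qed

lemma amp_osc_integrable:
  assumes "0 \<le> z"
  shows "integrable lborel (\<lambda>s. indicator {0..z} s *\<^sub>R (K k0 C s *\<^sub>R (amp b1 b2 \<epsilon> s p * cis (s * w))))"
proof -
  have "continuous_on {0..z} (\<lambda>s. K k0 C s *\<^sub>R (amp b1 b2 \<epsilon> s p * cis (s * w)))"
    by (intro continuous_intros K_continuous amp_continuous)
  from borel_integrable_atLeastAtMost'[OF this] show ?thesis unfolding set_integrable_def .
qed

text \<open>The time integrals up to \<open>z'\<close> and \<open>z\<close> differ by an integral over an interval of length \<open>z - z'\<close>.\<close>
lemma W_lipschitz:
  assumes e: "0 < \<epsilon>" and z: "0 \<le> z'" "z' \<le> z" "z \<le> Z"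
  shows "W \<epsilon> z (amp b1 b2 \<epsilon>) (ph \<tau> a b \<delta>) \<le> W \<epsilon> z' (amp b1 b2 \<epsilon>) (ph \<tau> a b \<delta>)
      + ennreal (lam * ((2 * pi) ^ 8 * (4 * (X_mass Z)\<^sup>2)) * (z - z'))"
proof -
  let ?D = "\<lambda>p. NNINT s. ennreal ((2 * pi) ^ 8) * ennreal (cmod (amp b1 b2 \<epsilon> s p)) * indicator {z'<..z} s"
  have osc: "ennreal (cmod (osc \<epsilon> z (amp b1 b2 \<epsilon>) (ph \<tau> a b \<delta>) p k)) \<le> ennreal (cmod (osc \<epsilon> z' (amp b1 b2 \<epsilon>) (ph \<tau> a b \<delta>) p k)) + ?D p" for p k
  proof -
    let ?f = "\<lambda>s. K k0 C s *\<^sub>R (amp b1 b2 \<epsilon> s p * cis (s * (ph \<tau> a b \<delta> p k / (\<epsilon> * k0))))"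
    have "osc \<epsilon> z (amp b1 b2 \<epsilon>) (ph \<tau> a b \<delta>) p k - osc \<epsilon> z' (amp b1 b2 \<epsilon>) (ph \<tau> a b \<delta>) p k
       = (LINT s|lborel. indicator {0..z} s *\<^sub>R ?f s - indicator {0..z'} s *\<^sub>R ?f s)"
      unfolding osc_def using z by (intro Bochner_Integration.integral_diff[symmetric] amp_osc_integrable) auto
    also have "\<dots> = (LINT s|lborel. indicator {z'<..z} s *\<^sub>R ?f s)"
      using z by (intro Bochner_Integration.integral_cong refl) (auto simp: indicator_def)
    finally have eq: "osc \<epsilon> z (amp b1 b2 \<epsilon>) (ph \<tau> a b \<delta>) p k = osc \<epsilon> z' (amp b1 b2 \<epsilon>) (ph \<tau> a b \<delta>) p k + (LINT s|lborel. indicator {z'<..z} s *\<^sub>R ?f s)"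
      by (simp add: algebra_simps)
    have "ennreal (cmod (LINT s|lborel. indicator {z'<..z} s *\<^sub>R ?f s)) \<le> ?D p"
    proof (rule order_trans[OF norm_integral_le_nn_integral], rule nn_integral_mono)
      fix s
      show "ennreal (norm (indicat_real {z'<..z} s *\<^sub>R ?f s)) \<le> ennreal ((2 * pi) ^ 8) * ennreal (cmod (amp b1 b2 \<epsilon> s p)) * indicator {z'<..z} s"
        using K_bound[of s] K_nonneg[of s] z
        by (auto simp: indicator_def norm_mult ennreal_mult[symmetric] intro!: ennreal_leI mult_right_mono)
    qed
    then have "ennreal (cmod (osc \<epsilon> z' (amp b1 b2 \<epsilon>) (ph \<tau> a b \<delta>) p k)) + ennreal (cmod (LINT s|lborel. indicator {z'<..z} s *\<^sub>R ?f s))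
      \<le> ennreal (cmod (osc \<epsilon> z' (amp b1 b2 \<epsilon>) (ph \<tau> a b \<delta>) p k)) + ?D p" by (rule add_left_mono)
    moreover have "ennreal (cmod (osc \<epsilon> z (amp b1 b2 \<epsilon>) (ph \<tau> a b \<delta>) p k)) \<le> ennreal (cmod (osc \<epsilon> z' (amp b1 b2 \<epsilon>) (ph \<tau> a b \<delta>) p k)) + ennreal (cmod (LINT s|lborel. indicator {z'<..z} s *\<^sub>R ?f s))"
      unfolding eq ennreal_plus[OF norm_ge_zero norm_ge_zero, symmetric] by (intro ennreal_leI norm_triangle_ineq)
    ultimately show ?thesis by (rule order_trans[rotated])
  qed
  have mass: "(NNINT p. ?D p) \<le> ennreal ((2 * pi) ^ 8 * (4 * (X_mass Z)\<^sup>2) * (z - z'))"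
  proof -
    have "(NNINT p. ?D p) = (NNINT s. (NNINT p. ennreal ((2 * pi) ^ 8) * ennreal (cmod (amp b1 b2 \<epsilon> s p)) * indicator {z'<..z} s))"
      by (rule lborel_pair.Fubini') measurable
    also have "\<dots> = (NNINT s. ennreal ((2 * pi) ^ 8) * (NNINT p. ennreal (cmod (amp b1 b2 \<epsilon> s p))) * indicator {z'<..z} s)"
      by (intro nn_integral_cong) (simp add: nn_integral_cmult nn_integral_multc)
    also have "\<dots> \<le> (NNINT s. ennreal ((2 * pi) ^ 8) * ennreal (4 * (X_mass Z)\<^sup>2) * indicator {z'<..z} s)"
    proof (rule nn_integral_mono)
      fix s
      show "ennreal ((2 * pi) ^ 8) * (NNINT p. ennreal (cmod (amp b1 b2 \<epsilon> s p))) * indicator {z'<..z} s \<le> ennreal ((2 * pi) ^ 8) * ennreal (4 * (X_mass Z)\<^sup>2) * indicator {z'<..z} s"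
        using amp_L1[OF e, of s Z b1 b2] z by (cases "s \<in> {z'<..z}") (auto intro!: mult_left_mono)
    qed
    also have "\<dots> = ennreal ((2 * pi) ^ 8 * (4 * (X_mass Z)\<^sup>2) * (z - z'))"
      using z by (intro nn_integral_const_Ioc) auto
    finally show ?thesis .
  qed
  have "W \<epsilon> z (amp b1 b2 \<epsilon>) (ph \<tau> a b \<delta>) \<le> (NNINT k. ennreal (alpha k) * (NNINT p. ennreal (cmod (osc \<epsilon> z' (amp b1 b2 \<epsilon>) (ph \<tau> a b \<delta>) p k))) + ennreal (alpha k) * (NNINT p. ?D p))"
    unfolding W_def
  proof (rule nn_integral_mono)
    fix k
    have "(NNINT p. ennreal (cmod (osc \<epsilon> z (amp b1 b2 \<epsilon>) (ph \<tau> a b \<delta>) p k)))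
      \<le> (NNINT p. ennreal (cmod (osc \<epsilon> z' (amp b1 b2 \<epsilon>) (ph \<tau> a b \<delta>) p k)) + ?D p)"
      by (intro nn_integral_mono osc)
    also have "\<dots> = (NNINT p. ennreal (cmod (osc \<epsilon> z' (amp b1 b2 \<epsilon>) (ph \<tau> a b \<delta>) p k))) + (NNINT p. ?D p)"
      by (rule nn_integral_add) measurable
    finally show "ennreal (alpha k) * (NNINT p. ennreal (cmod (osc \<epsilon> z (amp b1 b2 \<epsilon>) (ph \<tau> a b \<delta>) p k)))
      \<le> ennreal (alpha k) * (NNINT p. ennreal (cmod (osc \<epsilon> z' (amp b1 b2 \<epsilon>) (ph \<tau> a b \<delta>) p k))) + ennreal (alpha k) * (NNINT p. ?D p)"
      unfolding distrib_left[symmetric] by (rule mult_left_mono) simp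
  qed
  also have "\<dots> = W \<epsilon> z' (amp b1 b2 \<epsilon>) (ph \<tau> a b \<delta>) + (NNINT k. ennreal (alpha k) * (NNINT p. ?D p))"
    unfolding W_def by (rule nn_integral_add) measurable
  also have "(NNINT k. ennreal (alpha k) * (NNINT p. ?D p)) = ennreal lam * (NNINT p. ?D p)"
    by (subst nn_integral_multc) (auto simp: alpha_nn_integral)
  also have "\<dots> \<le> ennreal lam * ennreal ((2 * pi) ^ 8 * (4 * (X_mass Z)\<^sup>2) * (z - z'))"
    by (intro mult_left_mono mass) auto
  also have "\<dots> = ennreal (lam * ((2 * pi) ^ 8 * (4 * (X_mass Z)\<^sup>2)) * (z - z'))"
    using lam_nonneg z by (simp add: ennreal_mult[symmetric] mult.assoc)
  finally show ?thesis by (simp add: add_left_mono)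
qed

lemma W_uniform_limit:
  assumes tau: "\<tau> \<noteq> 0" and nondeg: "b1 \<or> b2 \<or> \<delta> \<noteq> 0" and Z: "0 < Z"
  shows "((\<lambda>\<epsilon>. SUP z\<in>{0..Z}. W \<epsilon> z (amp b1 b2 \<epsilon>) (ph \<tau> a b \<delta>)) \<longlongrightarrow> 0) (at_right 0)"
proof (rule uniform_limit_of_lipschitz[OF Z])
  show "0 \<le> lam * ((2 * pi) ^ 8 * (4 * (X_mass Z)\<^sup>2))" using lam_nonneg by simp
qed (use W_limit[OF tau nondeg] W_lipschitz in auto)

end

section \<open>The smoothing error\<close>

lemma cmod_cis_diff_le: "cmod (cis a - cis b) \<le> min 2 \<bar>a - b\<bar>"
proof -
  have "cis a - cis b = cis b * (cis (a - b) - 1)" by (simp add: right_diff_distrib cis_mult)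
  then have "cmod (cis a - cis b) = cmod (cis (a - b) - 1)" by (simp add: norm_mult)
  also have "\<dots> = 2 * \<bar>sin ((a - b) / 2)\<bar>" unfolding cis_conv_exp by (rule dist_exp_i_1)
  finally have eq: "cmod (cis a - cis b) = 2 * \<bar>sin ((a - b) / 2)\<bar>" .
  have "\<bar>sin ((a - b) / 2)\<bar> \<le> \<bar>(a - b) / 2\<bar>" by (rule abs_sin_x_le_abs_x)
  moreover have "\<bar>sin ((a - b) / 2)\<bar> \<le> 1" by (rule abs_sin_le_one)
  ultimately show ?thesis unfolding eq by (simp add: abs_divide)
qed

context scintillation begin

definition modulus :: "vec2 \<Rightarrow> ennreal" where
  "modulus y = (NNINT x. ennreal \<bar>alpha (x - y) - alpha x\<bar>)"

lemma modulus_measurable [measurable]: "modulus \<in> borel_measurable borel"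
  unfolding modulus_def[abs_def] by measurable

lemma modulus_le: "modulus y \<le> ennreal (2 * lam)"
proof -
  have "modulus y \<le> (NNINT x. ennreal (alpha (x - y)) + ennreal (alpha x))"
    unfolding modulus_def
    by (intro nn_integral_mono) (use alpha_nonneg in \<open>auto simp: ennreal_plus[symmetric] abs_le_iff intro!: ennreal_leI add_increasing add_increasing2 simp del: ennreal_plus\<close>)
  also have "\<dots> = (NNINT x. ennreal (alpha (x - y))) + (NNINT x. ennreal (alpha x))"
    by (rule nn_integral_add) measurable
  also have "(NNINT x. ennreal (alpha (x - y))) = (NNINT x. ennreal (alpha x))"
    by (rule nn_integral_lborel_translate(2)) measurable
  finally show ?thesis using lam_nonneg by (simp add: alpha_nn_integral ennreal_plus[symmetric] del: ennreal_plus)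
qed

lemma modulus_limit:
  assumes "y \<longlonglongrightarrow> 0"
  shows "(\<lambda>n. modulus (y n)) \<longlonglongrightarrow> 0"
proof -
  have "(\<lambda>n. NNINT x. ennreal (norm (alpha (x - y n) - alpha x))) \<longlonglongrightarrow> 0"
  proof (rule Scheffe_lemma2)
    show "(\<lambda>x. alpha (x - y n)) \<in> borel_measurable lborel" for n by measurable
    show "integrable lborel alpha" by (rule alpha_integrable)
    show "AE x in lborel. (\<lambda>n. alpha (x - y n)) \<longlonglongrightarrow> alpha x"
    proof (intro always_eventually allI)
      fix x :: vec2
      have "(\<lambda>n. x - y n) \<longlonglongrightarrow> x - 0" by (intro tendsto_intros assms)
      then show "(\<lambda>n. alpha (x - y n)) \<longlonglongrightarrow> alpha x"
        using continuous_on_tendsto_compose[OF alpha_continuous, of "\<lambda>n. x - y n" x sequentially] by simp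
    qed
    show "(NNINT x. ennreal (norm (alpha (x - y n)))) \<le> (NNINT x. ennreal (norm (alpha x)))" for n
      using nn_integral_lborel_translate(2)[of "\<lambda>x. ennreal (norm (alpha x))" "y n"] by simp
  qed
  then show ?thesis by (simp add: modulus_def)
qed

text \<open>The effect of replacing half a Dirac mass by the Gaussian \<open>gg\<close> of mass one half and width \<open>\<epsilon>\<close> in the
  convolution with the source.\<close>
definition smoothing_error :: "real \<Rightarrow> real \<Rightarrow> vec2 \<Rightarrow> vec2 \<Rightarrow> complex" where
  "smoothing_error \<epsilon> s x \<eta> = (LINT k|lborel. f_src s \<eta> k * complex_of_real (gg \<epsilon> (x - k))) - (1/2) *\<^sub>R f_src s \<eta> x"

lemma smoothing_error_measurable [measurable]:
  assumes [measurable]: "f \<in> borel_measurable N" "g \<in> borel_measurable N" "h \<in> borel_measurable N"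
  shows "(\<lambda>y. smoothing_error \<epsilon> (f y) (g y) (h y)) \<in> borel_measurable N"
  unfolding smoothing_error_def by measurable

lemma gg_integrable: assumes "0 < \<epsilon>" shows "integrable lborel (gg \<epsilon>)" "(LINT u|lborel. gg \<epsilon> u) = 1 / 2"
proof -
  show i: "integrable lborel (gg \<epsilon>)"
  proof (rule integrableI_nonneg)
    show "(NNINT x. ennreal (gg \<epsilon> x)) < \<infinity>"
      unfolding gg_mass[OF assms] by (simp only: infinity_ennreal_def ennreal_less_top)
  qed (auto simp: gg_nonneg)
  have nn: "0 \<le> (LINT u|lborel. gg \<epsilon> u)" by (rule Bochner_Integration.integral_nonneg) (rule gg_nonneg)
  have eq: "ennreal (LINT u|lborel. gg \<epsilon> u) = ennreal (1 / 2)"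
    using nn_integral_eq_integral[OF i] gg_nonneg gg_mass[OF assms] by simp
  show "(LINT u|lborel. gg \<epsilon> u) = 1 / 2" by (rule iffD1[OF ennreal_inj[OF nn] eq]) simp
qed

lemma smoothing_error_eq:
  assumes e: "0 < \<epsilon>"
  shows "smoothing_error \<epsilon> s x \<eta> = (LINT u|lborel. complex_of_real (gg \<epsilon> u) * (f_src s \<eta> (x - u) - f_src s \<eta> x))"
proof -
  have i: "integrable lborel (\<lambda>u. complex_of_real (gg \<epsilon> u) * f_src s \<eta> (g u))" if [measurable]: "g \<in> borel_measurable borel" for g
  proof (rule Bochner_Integration.integrable_bound[OF integrable_mult_left[OF gg_integrable(1)[OF e], of alpha_max]])
    show "AE u in lborel. norm (complex_of_real (gg \<epsilon> u) * f_src s \<eta> (g u)) \<le> norm (gg \<epsilon> u * alpha_max)"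
    proof (intro always_eventually allI)
      fix u
      have "gg \<epsilon> u * alpha (g u) \<le> gg \<epsilon> u * alpha_max" by (intro mult_left_mono alpha_bound gg_nonneg)
      then show "norm (complex_of_real (gg \<epsilon> u) * f_src s \<eta> (g u)) \<le> norm (gg \<epsilon> u * alpha_max)"
        using gg_nonneg[of \<epsilon> u] by (simp add: norm_mult norm_f_src)
    qed
  qed measurable
  have "(LINT k|lborel. f_src s \<eta> k * complex_of_real (gg \<epsilon> (x - k))) = (LINT u|lborel. complex_of_real (gg \<epsilon> u) * f_src s \<eta> (x - u))"
    using integral_lborel_translate(3)[of "\<lambda>k. f_src s \<eta> k * complex_of_real (gg \<epsilon> (x - k))" x] by (simp add: mult.commute)
  moreover have "(LINT u|lborel. complex_of_real (gg \<epsilon> u) * f_src s \<eta> x) = (1/2) *\<^sub>R f_src s \<eta> x"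
    by (simp add: gg_integrable[OF e] scaleR_conv_of_real)
  moreover have "(LINT u|lborel. complex_of_real (gg \<epsilon> u) * (f_src s \<eta> (x - u) - f_src s \<eta> x))
     = (LINT u|lborel. complex_of_real (gg \<epsilon> u) * f_src s \<eta> (x - u)) - (LINT u|lborel. complex_of_real (gg \<epsilon> u) * f_src s \<eta> x)"
    unfolding right_diff_distrib by (intro Bochner_Integration.integral_diff i) measurable
  ultimately show ?thesis unfolding smoothing_error_def by simp
qed

text \<open>A bound on the \<open>L1\<close> distance between the source and its translate by \<open>y\<close>: the first term comes from the
  modulus of the source, the second one from its phase.\<close>
definition shift_bound :: "real \<Rightarrow> vec2 \<Rightarrow> vec2 \<Rightarrow> ennreal" where
  "shift_bound Z y \<eta> = modulus y + ennreal (lam * min 2 (Z / k0 * (norm y * norm \<eta>)))"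

lemma shift_bound_measurable [measurable]:
  assumes [measurable]: "f \<in> borel_measurable N" "g \<in> borel_measurable N"
  shows "(\<lambda>y. shift_bound Z (f y) (g y)) \<in> borel_measurable N"
  unfolding shift_bound_def by measurable

lemma f_src_shift_L1:
  assumes s: "0 \<le> s" "s \<le> Z"
  shows "(NNINT x. ennreal (cmod (f_src s \<eta> (x - y) - f_src s \<eta> x))) \<le> shift_bound Z y \<eta>"
proof -
  let ?m = "min 2 (Z / k0 * (norm y * norm \<eta>))"
  have m: "0 \<le> ?m" using s k0 by simp
  have "cmod (f_src s \<eta> (x - y) - f_src s \<eta> x) \<le> \<bar>alpha (x - y) - alpha x\<bar> + alpha x * ?m" for x
  proof -
    have eq: "f_src s \<eta> (x - y) - f_src s \<eta> x = (alpha (x - y) - alpha x) *\<^sub>R cis (s / k0 * ((x - y) \<bullet> \<eta>)) + alpha x *\<^sub>R (cis (s / k0 * ((x - y) \<bullet> \<eta>)) - cis (s / k0 * (x \<bullet> \<eta>)))"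
      by (simp add: f_src_def algebra_simps)
    have "cmod (cis (s / k0 * ((x - y) \<bullet> \<eta>)) - cis (s / k0 * (x \<bullet> \<eta>))) \<le> ?m"
    proof -
      have d: "s / k0 * ((x - y) \<bullet> \<eta>) - s / k0 * (x \<bullet> \<eta>) = - (s / k0 * (y \<bullet> \<eta>))"
        by (simp only: inner_diff_left right_diff_distrib)
      have "\<bar>s / k0 * ((x - y) \<bullet> \<eta>) - s / k0 * (x \<bullet> \<eta>)\<bar> = s / k0 * \<bar>y \<bullet> \<eta>\<bar>"
        unfolding d abs_minus_cancel abs_mult using s k0 by simp
      also have "\<dots> \<le> Z / k0 * (norm y * norm \<eta>)"
        using s k0 by (intro mult_mono Cauchy_Schwarz_ineq2 divide_right_mono) auto
      finally show ?thesis using cmod_cis_diff_le[of "s / k0 * ((x - y) \<bullet> \<eta>)" "s / k0 * (x \<bullet> \<eta>)"] by linarith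
    qed
    then have "alpha x * cmod (cis (s / k0 * ((x - y) \<bullet> \<eta>)) - cis (s / k0 * (x \<bullet> \<eta>))) \<le> alpha x * ?m"
      by (rule mult_left_mono[OF _ alpha_nonneg])
    then show ?thesis unfolding eq using norm_triangle_ineq[of "(alpha (x - y) - alpha x) *\<^sub>R cis (s / k0 * ((x - y) \<bullet> \<eta>))" "alpha x *\<^sub>R (cis (s / k0 * ((x - y) \<bullet> \<eta>)) - cis (s / k0 * (x \<bullet> \<eta>)))"]
      alpha_nonneg[of x] by simp
  qed
  then have "(NNINT x. ennreal (cmod (f_src s \<eta> (x - y) - f_src s \<eta> x)))
     \<le> (NNINT x. ennreal \<bar>alpha (x - y) - alpha x\<bar> + ennreal (alpha x) * ennreal ?m)"
    using alpha_nonneg m by (intro nn_integral_mono) (simp add: ennreal_mult[symmetric] ennreal_plus[symmetric] ennreal_leI del: ennreal_plus)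
  also have "\<dots> = modulus y + (NNINT x. ennreal (alpha x) * ennreal ?m)"
    unfolding modulus_def by (rule nn_integral_add) measurable
  also have "(NNINT x. ennreal (alpha x) * ennreal ?m) = ennreal (lam * ?m)"
    using lam_nonneg m by (subst nn_integral_multc) (auto simp: alpha_nn_integral ennreal_mult)
  finally show ?thesis unfolding shift_bound_def .
qed

lemma smoothing_error_L1:
  assumes e: "0 < \<epsilon>" and s: "0 \<le> s" "s \<le> Z"
  shows "(NNINT x. ennreal (cmod (smoothing_error \<epsilon> s x \<eta>))) \<le> (NNINT u. ennreal (gg 1 u) * shift_bound Z (\<epsilon> *\<^sub>R u) \<eta>)"
proof -
  have "(NNINT x. ennreal (cmod (smoothing_error \<epsilon> s x \<eta>))) \<le> (NNINT x. (NNINT u. ennreal (gg \<epsilon> u) * ennreal (cmod (f_src s \<eta> (x - u) - f_src s \<eta> x))))"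
    unfolding smoothing_error_eq[OF e]
  proof (intro nn_integral_mono order_trans[OF norm_integral_le_nn_integral])
    fix x u
    show "ennreal (norm (complex_of_real (gg \<epsilon> u) * (f_src s \<eta> (x - u) - f_src s \<eta> x))) \<le> ennreal (gg \<epsilon> u) * ennreal (cmod (f_src s \<eta> (x - u) - f_src s \<eta> x))"
      by (simp add: norm_mult gg_nonneg ennreal_mult)
  qed
  also have "\<dots> = (NNINT u. (NNINT x. ennreal (gg \<epsilon> u) * ennreal (cmod (f_src s \<eta> (x - u) - f_src s \<eta> x))))"
    by (rule lborel_pair.Fubini') measurable
  also have "\<dots> \<le> (NNINT u. ennreal (gg \<epsilon> u) * shift_bound Z u \<eta>)"
    using f_src_shift_L1[OF s] by (intro nn_integral_mono) (auto simp: nn_integral_cmult intro!: mult_left_mono)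
  also have "\<dots> = ennreal (\<epsilon>\<^sup>2) * (NNINT u. ennreal (gg \<epsilon> (\<epsilon> *\<^sub>R u)) * shift_bound Z (\<epsilon> *\<^sub>R u) \<eta>)"
    by (rule nn_integral_scale_vec2[OF _ e]) measurable
  also have "\<dots> = (NNINT u. (ennreal (\<epsilon>\<^sup>2) * ennreal (gg \<epsilon> (\<epsilon> *\<^sub>R u))) * shift_bound Z (\<epsilon> *\<^sub>R u) \<eta>)"
    by (subst nn_integral_cmult[symmetric]) (auto simp: mult.assoc)
  also have "\<dots> = (NNINT u. ennreal (gg 1 u) * shift_bound Z (\<epsilon> *\<^sub>R u) \<eta>)"
    using gg_scale[OF e] gg_nonneg by (simp add: ennreal_mult[symmetric])
  finally show ?thesis .
qed

text \<open>The parameter \<open>\<eta>\<close> of the source is \<open>(\<zeta>2 \<plusminus> \<zeta>1) / \<epsilon>\<close>. It is unbounded, and the error is only small after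
  averaging over it; in the rescaled variables \<open>\<zeta> / \<epsilon>\<close> this average is against fixed Gaussians.\<close>
definition smoothing_bound :: "real \<Rightarrow> real \<Rightarrow> real \<Rightarrow> ennreal" where
  "smoothing_bound c Z \<epsilon> = (NNINT \<eta>1. (NNINT \<eta>2. (NNINT u. ennreal (phi r0 1 \<eta>1 * phi r0 1 \<eta>2) *
      (ennreal (gg 1 u) * shift_bound Z (\<epsilon> *\<^sub>R u) (\<eta>2 + c *\<^sub>R \<eta>1)))))"

lemma smoothing_bound_limit:
  assumes Z: "0 < Z"
  shows "((\<lambda>\<epsilon>. smoothing_bound c Z \<epsilon>) \<longlongrightarrow> 0) (at_right 0)"
  unfolding tendsto_at_iff_sequentially
proof safe
  fix e :: "nat \<Rightarrow> real" assume e: "\<forall>n. e n \<in> {0<..} - {0}" "e \<longlonglongrightarrow> 0"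
  let ?D = "\<lambda>y::vec2 \<times> vec2 \<times> vec2. ennreal (phi r0 1 (fst y) * phi r0 1 (fst (snd y))) * ennreal (gg 1 (snd (snd y)))"
  let ?H = "\<lambda>n y. ?D y * shift_bound Z (e n *\<^sub>R snd (snd y)) (fst (snd y) + c *\<^sub>R fst y)"
  have triple: "(NNINT y. G y) = (NNINT \<eta>1. (NNINT \<eta>2. (NNINT u. G (\<eta>1, \<eta>2, u))))"
    if [measurable]: "G \<in> borel_measurable borel" for G :: "vec2 \<times> vec2 \<times> vec2 \<Rightarrow> ennreal"
  proof -
    have "(NNINT y. G y) = (NNINT \<eta>1. (NNINT r. G (\<eta>1, r)))"
      by (rule nn_integral_lborel_pair) measurable
    also have "\<dots> = (NNINT \<eta>1. (NNINT \<eta>2. (NNINT u. G (\<eta>1, \<eta>2, u))))"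
      by (rule nn_integral_cong, rule nn_integral_lborel_pair) measurable
    finally show ?thesis .
  qed
  have comp: "f \<in> N \<rightarrow>\<^sub>M borel \<Otimes>\<^sub>M (borel \<Otimes>\<^sub>M borel)" if "f \<in> borel_measurable N" for f :: "'z \<Rightarrow> vec2 \<times> vec2 \<times> vec2" and N
    using that by (simp add: borel_prod)
  have mD': "(\<lambda>y. ?D (f y)) \<in> borel_measurable N" and ms': "(\<lambda>y. shift_bound Z (a *\<^sub>R snd (snd (f y))) (fst (snd (f y)) + c *\<^sub>R fst (f y))) \<in> borel_measurable N"
    if "f \<in> borel_measurable N" for f :: "'z \<Rightarrow> vec2 \<times> vec2 \<times> vec2" and N a
    supply comp[OF that, measurable] by measurable
  have mD: "?D \<in> borel_measurable borel" by (rule mD') simp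
  have ms: "(\<lambda>y. shift_bound Z (a *\<^sub>R snd (snd y)) (fst (snd y) + c *\<^sub>R fst y)) \<in> borel_measurable borel" for a
    by (rule ms') simp
  have eq: "smoothing_bound c Z (e n) = (NNINT y. ?H n y)" for n
    unfolding smoothing_bound_def triple[OF borel_measurable_times_ennreal[OF mD ms]] fst_conv snd_conv by (simp only: mult.assoc)
  have "(\<lambda>n. NNINT y. ?H n y) \<longlonglongrightarrow> (\<integral>\<^sup>+y. 0 \<partial>(lborel :: (vec2 \<times> vec2 \<times> vec2) measure))"
  proof (rule nn_integral_dominated_convergence[where w="\<lambda>y. ?D y * ennreal (4 * lam)"])
    show "AE y in lborel. ?H n y \<le> ?D y * ennreal (4 * lam)" for n
    proof (intro always_eventually allI mult_left_mono)
      fix y :: "vec2 \<times> vec2 \<times> vec2"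
      have "shift_bound Z (e n *\<^sub>R snd (snd y)) (fst (snd y) + c *\<^sub>R fst y) \<le> ennreal (2 * lam) + ennreal (lam * 2)"
        unfolding shift_bound_def using lam_nonneg
        by (intro add_mono modulus_le ennreal_leI mult_left_mono) auto
      also have "\<dots> = ennreal (4 * lam)" using lam_nonneg by (simp add: ennreal_plus[symmetric] del: ennreal_plus)
      finally show "shift_bound Z (e n *\<^sub>R snd (snd y)) (fst (snd y) + c *\<^sub>R fst y) \<le> ennreal (4 * lam)" .
    qed simp
    show "(NNINT y. ?D y * ennreal (4 * lam)) < \<infinity>"
    proof -
      have "(NNINT y. ?D y * ennreal (4 * lam)) = (NNINT \<eta>1. (NNINT \<eta>2. (NNINT u. ennreal (gg 1 u) * (ennreal (phi r0 1 \<eta>1 * phi r0 1 \<eta>2) * ennreal (4 * lam)))))"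
        unfolding triple[OF borel_measurable_times_ennreal[OF mD borel_measurable_const]] by (simp only: fst_conv snd_conv mult_ac)
      also have "\<dots> = (NNINT \<eta>1. (NNINT \<eta>2. ennreal (phi r0 1 \<eta>1 * phi r0 1 \<eta>2) * (ennreal (1 / 2) * ennreal (4 * lam))))"
        by (subst nn_integral_multc) (auto simp: gg_mass mult_ac)
      also have "\<dots> = ennreal (1 / 2) * ennreal (4 * lam)" by (rule nn_integral_gaussian_pair) simp
      also have "\<dots> < \<infinity>" by (simp only: infinity_ennreal_def ennreal_mult_less_top ennreal_less_top simp_thms)
      finally show ?thesis .
    qed
    show "AE y in lborel. (\<lambda>n. ?H n y) \<longlonglongrightarrow> 0"
    proof (intro always_eventually allI)
      fix y :: "vec2 \<times> vec2 \<times> vec2"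
      have "(\<lambda>n. e n *\<^sub>R snd (snd y)) \<longlonglongrightarrow> 0 *\<^sub>R snd (snd y)" by (intro tendsto_intros e(2))
      then have u: "(\<lambda>n. e n *\<^sub>R snd (snd y)) \<longlonglongrightarrow> 0" by simp
      have "(\<lambda>n. lam * min 2 (Z / k0 * (norm (e n *\<^sub>R snd (snd y)) * norm (fst (snd y) + c *\<^sub>R fst y)))) \<longlonglongrightarrow> lam * min 2 (Z / k0 * (norm (0::vec2) * norm (fst (snd y) + c *\<^sub>R fst y)))"
        by (intro tendsto_mult tendsto_min tendsto_const tendsto_norm u)
      then have "(\<lambda>n. ennreal (lam * min 2 (Z / k0 * (norm (e n *\<^sub>R snd (snd y)) * norm (fst (snd y) + c *\<^sub>R fst y))))) \<longlonglongrightarrow> ennreal (lam * min 2 (Z / k0 * (norm (0::vec2) * norm (fst (snd y) + c *\<^sub>R fst y))))"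
        by (rule tendsto_ennrealI)
      from tendsto_add[OF modulus_limit[OF u] this]
      have "(\<lambda>n. shift_bound Z (e n *\<^sub>R snd (snd y)) (fst (snd y) + c *\<^sub>R fst y)) \<longlonglongrightarrow> 0"
        unfolding shift_bound_def by simp
      from ennreal_tendsto_cmult[OF _ this, of "?D y"]
      show "(\<lambda>n. ?H n y) \<longlonglongrightarrow> 0" by (simp add: ennreal_mult_less_top)
    qed
    show "(\<lambda>y. ?H n y) \<in> borel_measurable lborel" for n
      unfolding measurable_lborel2 by (rule borel_measurable_times_ennreal[OF mD ms])
    show "(\<lambda>y. ?D y * ennreal (4 * lam)) \<in> borel_measurable lborel"
      unfolding measurable_lborel2 by (rule borel_measurable_times_ennreal[OF mD borel_measurable_const])
  qed simp
  then have "(\<lambda>n. NNINT y. ?H n y) \<longlonglongrightarrow> 0" unfolding nn_integral_const mult_zero_left .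
  then show "((\<lambda>\<epsilon>. smoothing_bound c Z \<epsilon>) \<circ> e) \<longlonglongrightarrow> 0" unfolding o_def eq .
qed

text \<open>The sum of the Gaussian and of the amplitude solves the equation for \<open>A\<close> with the Gaussian in place of
  half a Dirac mass, that is, it solves the convolution equation up to the smoothing error.\<close>
definition XB :: "real \<Rightarrow> real \<Rightarrow> vec2 \<Rightarrow> vec2 \<Rightarrow> complex" where
  "XB \<epsilon> s x \<eta> = XF True \<epsilon> s x \<eta> + XF False \<epsilon> s x \<eta>"

lemma XB_measurable [measurable]:
  assumes [measurable]: "f \<in> borel_measurable N" "g \<in> borel_measurable N" "h \<in> borel_measurable N"
  shows "(\<lambda>y. XB \<epsilon> (f y) (g y) (h y)) \<in> borel_measurable N"
  unfolding XB_def by measurable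

lemma XB_L1:
  assumes "0 < \<epsilon>" "0 \<le> s" "s \<le> Z"
  shows "(NNINT x. ennreal (cmod (XB \<epsilon> s x \<eta>))) \<le> ennreal (2 * X_mass Z)"
proof -
  have "(NNINT x. ennreal (cmod (XB \<epsilon> s x \<eta>))) \<le> (NNINT x. ennreal (cmod (XF True \<epsilon> s x \<eta>)) + ennreal (cmod (XF False \<epsilon> s x \<eta>)))"
    unfolding XB_def ennreal_plus[OF norm_ge_zero norm_ge_zero, symmetric] by (intro nn_integral_mono ennreal_leI norm_triangle_ineq)
  also have "\<dots> = (NNINT x. ennreal (cmod (XF True \<epsilon> s x \<eta>))) + (NNINT x. ennreal (cmod (XF False \<epsilon> s x \<eta>)))"
    by (rule nn_integral_add) measurable
  also have "\<dots> \<le> ennreal (X_mass Z) + ennreal (X_mass Z)" by (intro add_mono XF_L1 assms)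
  also have "\<dots> = ennreal (2 * X_mass Z)" using X_mass_nonneg[of Z] assms by (simp add: ennreal_plus[symmetric] del: ennreal_plus)
  finally show ?thesis .
qed

lemma f_src_XB_convolution:
  assumes e: "0 < \<epsilon>" and s: "0 \<le> s"
  shows "(LINT k|lborel. f_src s \<eta> k * XB \<epsilon> s (x - k) \<eta>) = A_rate s x \<eta> + smoothing_error \<epsilon> s x \<eta>"
proof -
  have i: "integrable lborel (\<lambda>k. f_src s \<eta> k * XF b \<epsilon> s (x - k) \<eta>)" for b
  proof (rule Bochner_Integration.integrable_bound[OF integrable_mult_left[OF alpha_integrable, of "X_max \<epsilon> s"]])
    show "AE k in lborel. norm (f_src s \<eta> k * XF b \<epsilon> s (x - k) \<eta>) \<le> norm (alpha k * X_max \<epsilon> s)"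
      using XF_bound[OF s order_refl, of b \<epsilon>] alpha_nonneg X_max_nonneg[OF s, of \<epsilon>]
      by (intro always_eventually allI) (auto simp: norm_mult norm_f_src abs_mult intro!: mult_left_mono)
  qed measurable
  have "(LINT k|lborel. f_src s \<eta> k * XB \<epsilon> s (x - k) \<eta>) = (LINT k|lborel. f_src s \<eta> k * XF True \<epsilon> s (x - k) \<eta>) + (LINT k|lborel. f_src s \<eta> k * XF False \<epsilon> s (x - k) \<eta>)"
    unfolding XB_def distrib_left by (rule Bochner_Integration.integral_add[OF i i])
  then show ?thesis by (simp add: A_rate_def smoothing_error_def XF_def)
qed

text \<open>The error that the product of the two sums \<open>XB\<close> makes under the jumps 1 and 3.\<close>
definition E_half :: "real \<Rightarrow> real \<Rightarrow> phase \<Rightarrow> complex" where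
  "E_half \<epsilon> s = (\<lambda>(\<xi>1, \<xi>2, \<zeta>1, \<zeta>2). complex_of_real (phi r0 \<epsilon> \<zeta>1 * phi r0 \<epsilon> \<zeta>2) *
     (smoothing_error \<epsilon> s ((\<xi>2 + \<xi>1) /\<^sub>R 2) ((\<zeta>2 + \<zeta>1) /\<^sub>R \<epsilon>) * XB \<epsilon> s ((\<xi>2 - \<xi>1) /\<^sub>R 2) ((\<zeta>2 - \<zeta>1) /\<^sub>R \<epsilon>)
      + XB \<epsilon> s ((\<xi>2 + \<xi>1) /\<^sub>R 2) ((\<zeta>2 + \<zeta>1) /\<^sub>R \<epsilon>) * smoothing_error \<epsilon> s ((\<xi>2 - \<xi>1) /\<^sub>R 2) ((\<zeta>2 - \<zeta>1) /\<^sub>R \<epsilon>)))"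

lemma E_half_measurable [measurable]:
  assumes [measurable]: "f \<in> borel_measurable N" "g \<in> borel_measurable N"
  shows "(\<lambda>y. E_half \<epsilon> (f y) (g y)) \<in> borel_measurable N"
  supply phase_measurable_components[OF assms(2), measurable]
  unfolding E_half_def split_beta' by measurable

lemma smoothing_bound_rescaled:
  assumes e: "0 < \<epsilon>"
  shows "(NNINT \<zeta>1. (NNINT \<zeta>2. ennreal (phi r0 \<epsilon> \<zeta>1 * phi r0 \<epsilon> \<zeta>2) *
      (NNINT u. ennreal (gg 1 u) * shift_bound Z (\<epsilon> *\<^sub>R u) ((\<zeta>2 + c *\<^sub>R \<zeta>1) /\<^sub>R \<epsilon>)))) = smoothing_bound c Z \<epsilon>"
proof -
  let ?I = "\<lambda>\<eta>. NNINT u. ennreal (gg 1 u) * shift_bound Z (\<epsilon> *\<^sub>R u) \<eta>"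
  let ?F = "\<lambda>\<zeta>1 \<zeta>2. ennreal (phi r0 \<epsilon> \<zeta>1 * phi r0 \<epsilon> \<zeta>2) * ?I ((\<zeta>2 + c *\<^sub>R \<zeta>1) /\<^sub>R \<epsilon>)"
  have arg: "(\<epsilon> *\<^sub>R \<eta>2 + c *\<^sub>R (\<epsilon> *\<^sub>R \<eta>1)) /\<^sub>R \<epsilon> = \<eta>2 + c *\<^sub>R \<eta>1" for \<eta>1 \<eta>2 :: vec2
    using e by (simp add: scaleR_add_right)
  have "(NNINT \<zeta>1. (NNINT \<zeta>2. ?F \<zeta>1 \<zeta>2)) = ennreal (\<epsilon>\<^sup>2) * (NNINT \<eta>1. (NNINT \<zeta>2. ?F (\<epsilon> *\<^sub>R \<eta>1) \<zeta>2))"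
    by (rule nn_integral_scale_vec2[OF _ e]) measurable
  also have "\<dots> = ennreal (\<epsilon>\<^sup>2) * (NNINT \<eta>1. ennreal (\<epsilon>\<^sup>2) * (NNINT \<eta>2. ?F (\<epsilon> *\<^sub>R \<eta>1) (\<epsilon> *\<^sub>R \<eta>2)))"
    by (intro arg_cong[where f="\<lambda>x. ennreal (\<epsilon>\<^sup>2) * x"] nn_integral_cong nn_integral_scale_vec2[OF _ e]) measurable
  also have "\<dots> = (NNINT \<eta>1. (NNINT \<eta>2. ennreal (\<epsilon>\<^sup>2) * (ennreal (\<epsilon>\<^sup>2) * ?F (\<epsilon> *\<^sub>R \<eta>1) (\<epsilon> *\<^sub>R \<eta>2))))"
    by (simp add: nn_integral_cmult)
  also have "\<dots> = (NNINT \<eta>1. (NNINT \<eta>2. ennreal (phi r0 1 \<eta>1 * phi r0 1 \<eta>2) * ?I (\<eta>2 + c *\<^sub>R \<eta>1)))"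
  proof (intro nn_integral_cong)
    fix \<eta>1 \<eta>2
    have "ennreal (\<epsilon>\<^sup>2) * (ennreal (\<epsilon>\<^sup>2) * ennreal (phi r0 \<epsilon> (\<epsilon> *\<^sub>R \<eta>1) * phi r0 \<epsilon> (\<epsilon> *\<^sub>R \<eta>2))) = ennreal (phi r0 1 \<eta>1 * phi r0 1 \<eta>2)"
      unfolding phi_scale[OF e, symmetric] using phi_nonneg by (simp add: ennreal_mult[symmetric] mult_ac)
    then show "ennreal (\<epsilon>\<^sup>2) * (ennreal (\<epsilon>\<^sup>2) * ?F (\<epsilon> *\<^sub>R \<eta>1) (\<epsilon> *\<^sub>R \<eta>2)) = ennreal (phi r0 1 \<eta>1 * phi r0 1 \<eta>2) * ?I (\<eta>2 + c *\<^sub>R \<eta>1)"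
      unfolding arg by (simp add: mult.assoc[symmetric])
  qed
  also have "\<dots> = smoothing_bound c Z \<epsilon>"
    unfolding smoothing_bound_def by (simp add: nn_integral_cmult)
  finally show ?thesis .
qed

lemma E_half_L1:
  assumes e: "0 < \<epsilon>" and s: "0 \<le> s" "s \<le> Z"
  shows "(NNINT p. ennreal (cmod (E_half \<epsilon> s p)))
    \<le> ennreal (8 * X_mass Z) * (smoothing_bound 1 Z \<epsilon> + smoothing_bound (-1) Z \<epsilon>)"
proof -
  have m: "0 \<le> X_mass Z" using X_mass_nonneg s by simp
  let ?I = "\<lambda>\<eta>. NNINT u. ennreal (gg 1 u) * shift_bound Z (\<epsilon> *\<^sub>R u) \<eta>"
  let ?D = "\<lambda>\<zeta>1 \<zeta>2. ennreal (phi r0 \<epsilon> \<zeta>1 * phi r0 \<epsilon> \<zeta>2)"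
  have "(NNINT p. ennreal (cmod (E_half \<epsilon> s p)))
     = 4 * (NNINT \<zeta>1. (NNINT \<zeta>2. (NNINT x. (NNINT y. ennreal (cmod (E_half \<epsilon> s (x - y, x + y, \<zeta>1, \<zeta>2)))))))"
    by (rule nn_integral_phase_centred) measurable
  also have "\<dots> \<le> 4 * (NNINT \<zeta>1. (NNINT \<zeta>2. ennreal (2 * X_mass Z) * (?D \<zeta>1 \<zeta>2 * ?I ((\<zeta>2 + 1 *\<^sub>R \<zeta>1) /\<^sub>R \<epsilon>) + ?D \<zeta>1 \<zeta>2 * ?I ((\<zeta>2 + (-1) *\<^sub>R \<zeta>1) /\<^sub>R \<epsilon>))))"
  proof (intro mult_left_mono nn_integral_mono)
    fix \<zeta>1 \<zeta>2 :: vec2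
    let ?p = "(\<zeta>2 + \<zeta>1) /\<^sub>R \<epsilon>" and ?m = "(\<zeta>2 - \<zeta>1) /\<^sub>R \<epsilon>"
    let ?E = "\<lambda>x \<eta>. ennreal (cmod (smoothing_error \<epsilon> s x \<eta>))" and ?B = "\<lambda>x \<eta>. ennreal (cmod (XB \<epsilon> s x \<eta>))"
    have xy: "(x + y + (x - y)) /\<^sub>R 2 = x" "(x + y - (x - y)) /\<^sub>R 2 = y" for x y :: vec2
      by (simp_all add: scaleR_2[symmetric])
    have "(NNINT x. (NNINT y. ennreal (cmod (E_half \<epsilon> s (x - y, x + y, \<zeta>1, \<zeta>2)))))
       \<le> (NNINT x. (NNINT y. (?D \<zeta>1 \<zeta>2 * ?E x ?p) * ?B y ?m + (?D \<zeta>1 \<zeta>2 * ?B x ?p) * ?E y ?m))"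
    proof (intro nn_integral_mono)
      fix x y
      have "cmod (E_half \<epsilon> s (x - y, x + y, \<zeta>1, \<zeta>2)) \<le> (phi r0 \<epsilon> \<zeta>1 * phi r0 \<epsilon> \<zeta>2) * (cmod (smoothing_error \<epsilon> s x ?p) * cmod (XB \<epsilon> s y ?m) + cmod (XB \<epsilon> s x ?p) * cmod (smoothing_error \<epsilon> s y ?m))"
        unfolding E_half_def prod.case xy norm_mult norm_of_real
        using norm_triangle_ineq[of "smoothing_error \<epsilon> s x ?p * XB \<epsilon> s y ?m" "XB \<epsilon> s x ?p * smoothing_error \<epsilon> s y ?m"] phi_nonneg
        by (simp add: norm_mult abs_mult mult_left_mono)
      then have "ennreal (cmod (E_half \<epsilon> s (x - y, x + y, \<zeta>1, \<zeta>2))) \<le> ennreal ((phi r0 \<epsilon> \<zeta>1 * phi r0 \<epsilon> \<zeta>2) * (cmod (smoothing_error \<epsilon> s x ?p) * cmod (XB \<epsilon> s y ?m) + cmod (XB \<epsilon> s x ?p) * cmod (smoothing_error \<epsilon> s y ?m)))"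
        by (rule ennreal_leI)
      also have "\<dots> = (?D \<zeta>1 \<zeta>2 * ?E x ?p) * ?B y ?m + (?D \<zeta>1 \<zeta>2 * ?B x ?p) * ?E y ?m"
        using phi_nonneg by (simp add: ennreal_mult distrib_left mult.assoc)
      finally show "ennreal (cmod (E_half \<epsilon> s (x - y, x + y, \<zeta>1, \<zeta>2))) \<le> (?D \<zeta>1 \<zeta>2 * ?E x ?p) * ?B y ?m + (?D \<zeta>1 \<zeta>2 * ?B x ?p) * ?E y ?m" .
    qed
    also have "\<dots> = ?D \<zeta>1 \<zeta>2 * ((NNINT x. ?E x ?p) * (NNINT y. ?B y ?m)) + ?D \<zeta>1 \<zeta>2 * ((NNINT x. ?B x ?p) * (NNINT y. ?E y ?m))"
      by (simp add: nn_integral_add nn_integral_cmult nn_integral_multc mult.assoc)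
    also have "\<dots> \<le> ?D \<zeta>1 \<zeta>2 * (?I ?p * ennreal (2 * X_mass Z)) + ?D \<zeta>1 \<zeta>2 * (ennreal (2 * X_mass Z) * ?I ?m)"
      by (intro add_mono mult_left_mono mult_mono smoothing_error_L1 XB_L1 e s) auto
    finally show "(NNINT x. (NNINT y. ennreal (cmod (E_half \<epsilon> s (x - y, x + y, \<zeta>1, \<zeta>2)))))
      \<le> ennreal (2 * X_mass Z) * (?D \<zeta>1 \<zeta>2 * ?I ((\<zeta>2 + 1 *\<^sub>R \<zeta>1) /\<^sub>R \<epsilon>) + ?D \<zeta>1 \<zeta>2 * ?I ((\<zeta>2 + (-1) *\<^sub>R \<zeta>1) /\<^sub>R \<epsilon>))"
      by (simp add: distrib_left mult_ac)
  qed simp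
  also have "(NNINT \<zeta>1. (NNINT \<zeta>2. ennreal (2 * X_mass Z) * (?D \<zeta>1 \<zeta>2 * ?I ((\<zeta>2 + 1 *\<^sub>R \<zeta>1) /\<^sub>R \<epsilon>) + ?D \<zeta>1 \<zeta>2 * ?I ((\<zeta>2 + (-1) *\<^sub>R \<zeta>1) /\<^sub>R \<epsilon>))))
     = ennreal (2 * X_mass Z) * ((NNINT \<zeta>1. (NNINT \<zeta>2. ?D \<zeta>1 \<zeta>2 * ?I ((\<zeta>2 + 1 *\<^sub>R \<zeta>1) /\<^sub>R \<epsilon>))) + (NNINT \<zeta>1. (NNINT \<zeta>2. ?D \<zeta>1 \<zeta>2 * ?I ((\<zeta>2 + (-1) *\<^sub>R \<zeta>1) /\<^sub>R \<epsilon>))))"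
  proof -
    let ?c = "ennreal (2 * X_mass Z)"
    let ?P = "\<lambda>\<zeta>1 \<zeta>2. ?D \<zeta>1 \<zeta>2 * ?I ((\<zeta>2 + 1 *\<^sub>R \<zeta>1) /\<^sub>R \<epsilon>)" and ?M = "\<lambda>\<zeta>1 \<zeta>2. ?D \<zeta>1 \<zeta>2 * ?I ((\<zeta>2 + (-1) *\<^sub>R \<zeta>1) /\<^sub>R \<epsilon>)"
    have inner: "(NNINT \<zeta>2. ?c * (?P \<zeta>1 \<zeta>2 + ?M \<zeta>1 \<zeta>2)) = ?c * ((NNINT \<zeta>2. ?P \<zeta>1 \<zeta>2) + (NNINT \<zeta>2. ?M \<zeta>1 \<zeta>2))" for \<zeta>1
    proof -
      have "(NNINT \<zeta>2. ?c * (?P \<zeta>1 \<zeta>2 + ?M \<zeta>1 \<zeta>2)) = ?c * (NNINT \<zeta>2. ?P \<zeta>1 \<zeta>2 + ?M \<zeta>1 \<zeta>2)"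
        by (rule nn_integral_cmult) measurable
      also have "(NNINT \<zeta>2. ?P \<zeta>1 \<zeta>2 + ?M \<zeta>1 \<zeta>2) = (NNINT \<zeta>2. ?P \<zeta>1 \<zeta>2) + (NNINT \<zeta>2. ?M \<zeta>1 \<zeta>2)"
        by (rule nn_integral_add) measurable
      finally show ?thesis .
    qed
    have "(NNINT \<zeta>1. ?c * ((NNINT \<zeta>2. ?P \<zeta>1 \<zeta>2) + (NNINT \<zeta>2. ?M \<zeta>1 \<zeta>2)))
       = ?c * (NNINT \<zeta>1. (NNINT \<zeta>2. ?P \<zeta>1 \<zeta>2) + (NNINT \<zeta>2. ?M \<zeta>1 \<zeta>2))"
      by (rule nn_integral_cmult) measurable
    also have "(NNINT \<zeta>1. (NNINT \<zeta>2. ?P \<zeta>1 \<zeta>2) + (NNINT \<zeta>2. ?M \<zeta>1 \<zeta>2))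
       = (NNINT \<zeta>1. (NNINT \<zeta>2. ?P \<zeta>1 \<zeta>2)) + (NNINT \<zeta>1. (NNINT \<zeta>2. ?M \<zeta>1 \<zeta>2))"
      by (rule nn_integral_add) measurable
    finally show ?thesis unfolding inner .
  qed
  also have "4 * (ennreal (2 * X_mass Z) * ((NNINT \<zeta>1. (NNINT \<zeta>2. ?D \<zeta>1 \<zeta>2 * ?I ((\<zeta>2 + 1 *\<^sub>R \<zeta>1) /\<^sub>R \<epsilon>))) + (NNINT \<zeta>1. (NNINT \<zeta>2. ?D \<zeta>1 \<zeta>2 * ?I ((\<zeta>2 + (-1) *\<^sub>R \<zeta>1) /\<^sub>R \<epsilon>)))))
     = (4 * ennreal (2 * X_mass Z)) * (smoothing_bound 1 Z \<epsilon> + smoothing_bound (-1) Z \<epsilon>)"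
    by (simp only: smoothing_bound_rescaled[OF e] mult.assoc)
  also have "4 * ennreal (2 * X_mass Z) = ennreal (8 * X_mass Z)"
    using m ennreal_mult[of 4 "2 * X_mass Z"] by simp
  finally show ?thesis .
qed

end

section \<open>The moment operator as a jump operator\<close>

text \<open>Every jump has the form below, and its phase is determined by its coefficients \<open>a1\<close>, \<open>a2\<close>,
  \<open>a4\<close>; index 0 is the trivial jump, which carries the term \<open>-2 \<psi>\<close>, and the
  indices 1 to 6 follow the order of the terms of the operator.\<close>
definition a1 :: "nat \<Rightarrow> real" where "a1 i = [0, 1, 1, -1, -1, 0, 0] ! i"
definition a2 :: "nat \<Rightarrow> real" where "a2 i = [0, 1, 0, 1, 0, 1, 1] ! i"
definition a4 :: "nat \<Rightarrow> real" where "a4 i = [0, 0, 1, 0, 1, 1, -1] ! i"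
definition wt :: "nat \<Rightarrow> real" where "wt i = (if i = 0 then 2 else 1)"
definition sg :: "nat \<Rightarrow> real" where "sg i = (if i \<in> {0, 5, 6} then -1 else 1)"

lemmas coeff_defs = a1_def a2_def a4_def wt_def sg_def

definition jump :: "nat \<Rightarrow> vec2 \<Rightarrow> phase" where
  "jump i k = (a1 i *\<^sub>R k, a2 i *\<^sub>R k, 0, a4 i *\<^sub>R k)"

definition jph :: "nat \<Rightarrow> phase \<Rightarrow> vec2 \<Rightarrow> real" where
  "jph i = (\<lambda>(\<xi>1, \<xi>2, \<zeta>1, \<zeta>2) k. k \<bullet> (a1 i *\<^sub>R \<zeta>1 + a2 i *\<^sub>R \<zeta>2 + a4 i *\<^sub>R \<xi>2) - a2 i * a4 i * (norm k)\<^sup>2)"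

definition swap :: "phase \<Rightarrow> phase" where "swap = (\<lambda>(\<xi>1, \<xi>2, \<zeta>1, \<zeta>2). (\<xi>1, \<zeta>2, \<zeta>1, \<xi>2))"

lemma swap_measurable [measurable]: "swap \<in> borel_measurable borel"
  unfolding swap_def split_beta' by (intro borel_measurable_continuous_onI continuous_intros)

lemma coeff_measurable [measurable]:
  "a1 \<in> borel_measurable (count_space I)" "a2 \<in> borel_measurable (count_space I)" "a4 \<in> borel_measurable (count_space I)"
  "wt \<in> borel_measurable (count_space I)" "sg \<in> borel_measurable (count_space I)"
  by simp_all

lemma jump_measurable [measurable]: "jump i \<in> borel_measurable borel"
  unfolding jump_def[abs_def] by measurable

lemma jph_measurable [measurable]:
  assumes [measurable]: "f \<in> borel_measurable N" "g \<in> borel_measurable N"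
  shows "(\<lambda>y. jph i (f y) (g y)) \<in> borel_measurable N"
  supply phase_measurable_components[OF assms(1), measurable]
  unfolding jph_def split_beta' by measurable

lemma nn_integral_swap:
  fixes F :: "phase \<Rightarrow> ennreal"
  assumes [measurable]: "F \<in> borel_measurable borel"
  shows "(NNINT p. F (swap p)) = (NNINT p. F p)"
proof -
  have "(NNINT p. F (swap p)) = (NNINT \<zeta>1. (NNINT \<zeta>2. (NNINT \<xi>1. (NNINT \<xi>2. F (\<xi>1, \<zeta>2, \<zeta>1, \<xi>2)))))"
    by (subst nn_integral_phase[OF measurable_compose[OF swap_measurable assms]]) (simp only: swap_def prod.case)
  also have "\<dots> = (NNINT \<zeta>1. (NNINT \<xi>1. (NNINT \<zeta>2. (NNINT \<xi>2. F (\<xi>1, \<zeta>2, \<zeta>1, \<xi>2)))))"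
    by (rule nn_integral_cong, rule lborel_pair.Fubini') measurable
  also have "\<dots> = (NNINT \<zeta>1. (NNINT \<xi>1. (NNINT \<zeta>2. (NNINT \<xi>2. F (\<xi>1, \<xi>2, \<zeta>1, \<zeta>2)))))"
    by (rule nn_integral_cong, rule nn_integral_cong, rule lborel_pair.Fubini') measurable
  also have "\<dots> = (NNINT \<zeta>1. (NNINT \<zeta>2. (NNINT \<xi>1. (NNINT \<xi>2. F (\<xi>1, \<xi>2, \<zeta>1, \<zeta>2)))))"
    by (rule nn_integral_cong, rule lborel_pair.Fubini') measurable
  also have "\<dots> = (NNINT p. F p)" by (rule nn_integral_phase[symmetric]) measurable
  finally show ?thesis .
qed

context scintillation begin

definition jump_term :: "real \<Rightarrow> nat \<Rightarrow> real \<Rightarrow> (phase \<Rightarrow> complex) \<Rightarrow> phase \<Rightarrow> complex" where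
  "jump_term \<epsilon> i s \<psi> p = (LINT k|lborel. alpha k *\<^sub>R (\<psi> (p - jump i k) * cis (s * (jph i p k / (\<epsilon> * k0)))))"

lemma jump_term_measurable [measurable]:
  assumes [measurable]: "(\<lambda>(x, p). \<psi> x p) \<in> borel_measurable (N \<Otimes>\<^sub>M borel)" "s \<in> borel_measurable N" "f \<in> borel_measurable N"
  shows "(\<lambda>x. jump_term \<epsilon> i (s x) (\<psi> x) (f x)) \<in> borel_measurable N"
proof -
  have [measurable]: "(\<lambda>y. \<psi> (fst y) (f (fst y) - jump i (snd y))) \<in> borel_measurable (N \<Otimes>\<^sub>M lborel)"
  proof -
    have "(\<lambda>y. (fst y, f (fst y) - jump i (snd y))) \<in> measurable (N \<Otimes>\<^sub>M lborel) (N \<Otimes>\<^sub>M borel)" by measurable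
    from measurable_compose[OF this assms(1)] show ?thesis by (simp add: split_beta')
  qed
  have "(\<lambda>(x, k). alpha k *\<^sub>R (\<psi> x (f x - jump i k) * cis (s x * (jph i (f x) k / (\<epsilon> * k0))))) \<in> borel_measurable (N \<Otimes>\<^sub>M lborel)"
    unfolding split_beta' by measurable
  then show ?thesis unfolding jump_term_def by (rule lborel.borel_measurable_lebesgue_integral)
qed

lemma jump_term_integrable:
  assumes [measurable]: "\<psi> \<in> borel_measurable borel" and b: "\<And>p. cmod (\<psi> p) \<le> B"
  shows "integrable lborel (\<lambda>k. alpha k *\<^sub>R (\<psi> (p - jump i k) * cis (s * (jph i p k / (\<epsilon> * k0)))))"
proof (rule Bochner_Integration.integrable_bound[OF integrable_mult_left[OF alpha_integrable, of B]])
  show "AE k in lborel. norm (alpha k *\<^sub>R (\<psi> (p - jump i k) * cis (s * (jph i p k / (\<epsilon> * k0))))) \<le> norm (alpha k * B)"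
  proof (intro always_eventually allI)
    fix k
    have "alpha k * cmod (\<psi> (p - jump i k)) \<le> alpha k * B" by (intro mult_left_mono b alpha_nonneg)
    then show "norm (alpha k *\<^sub>R (\<psi> (p - jump i k) * cis (s * (jph i p k / (\<epsilon> * k0))))) \<le> norm (alpha k * B)"
      using alpha_nonneg[of k] by (simp add: norm_mult)
  qed
qed measurable

lemma jump_term_bound:
  assumes "\<And>p. cmod (\<psi> p) \<le> B"
  shows "cmod (jump_term \<epsilon> i s \<psi> p) \<le> lam * B"
proof -
  have "cmod (jump_term \<epsilon> i s \<psi> p) \<le> (LINT k|lborel. alpha k * B)"
    unfolding jump_term_def
  proof (rule norm_lebesgue_integral_le)
    show "integrable lborel (\<lambda>k. alpha k * B)" by (intro integrable_mult_left alpha_integrable)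
    show "cmod (alpha k *\<^sub>R (\<psi> (p - jump i k) * cis (s * (jph i p k / (\<epsilon> * k0))))) \<le> alpha k * B" for k
      using mult_left_mono[OF assms alpha_nonneg[of k]] alpha_nonneg[of k] by (simp add: norm_mult)
  qed
  then show ?thesis by (simp add: alpha_integral)
qed

lemma jump_term_add:
  assumes "\<psi> \<in> borel_measurable borel" "\<And>p. cmod (\<psi> p) \<le> B" "\<rho> \<in> borel_measurable borel" "\<And>p. cmod (\<rho> p) \<le> B'"
  shows "jump_term \<epsilon> i s (\<lambda>p. \<psi> p + \<rho> p) p = jump_term \<epsilon> i s \<psi> p + jump_term \<epsilon> i s \<rho> p"
  unfolding jump_term_def distrib_right scaleR_add_right
  by (rule Bochner_Integration.integral_add; rule jump_term_integrable; fact)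

lemma jump_term_scaleR: "jump_term \<epsilon> i s (\<lambda>p. r *\<^sub>R \<psi> p) p = r *\<^sub>R jump_term \<epsilon> i s \<psi> p"
  unfolding jump_term_def by (subst integral_scaleR_right[symmetric]) (simp add: mult.commute)

lemma jump_term_sum:
  assumes "finite I" "\<And>c. c \<in> I \<Longrightarrow> \<psi> c \<in> borel_measurable borel" "\<And>c p. c \<in> I \<Longrightarrow> cmod (\<psi> c p) \<le> B"
  shows "jump_term \<epsilon> i s (\<lambda>p. \<Sum>c\<in>I. \<psi> c p) p = (\<Sum>c\<in>I. jump_term \<epsilon> i s (\<psi> c) p)"
  unfolding jump_term_def sum_distrib_right scaleR_sum_right
  by (rule Bochner_Integration.integral_sum; rule jump_term_integrable; use assms in auto)

lemma jump_term_0: "jump_term \<epsilon> 0 s \<psi> p = lam *\<^sub>R \<psi> p"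
proof -
  have "jump 0 k = 0" for k by (simp add: jump_def coeff_defs zero_prod_def)
  moreover have "jph 0 p k = 0" for k by (simp add: jph_def coeff_defs split: prod.split)
  ultimately have "jump_term \<epsilon> 0 s \<psi> p = (LINT k|lborel. alpha k *\<^sub>R \<psi> p)" by (simp add: jump_term_def)
  also have "\<dots> = (LINT k|lborel. alpha k) *\<^sub>R \<psi> p" by (rule integral_scaleR_left) (use alpha_integrable in auto)
  finally show ?thesis by (simp add: alpha_integral)
qed

definition perm :: "bool \<Rightarrow> phase \<Rightarrow> phase" where "perm b = (if b then swap else (\<lambda>p. p))"

lemma perm_measurable [measurable]: "perm b \<in> borel_measurable borel"
  by (cases b) (simp_all add: perm_def)

lemma nn_integral_perm:
  fixes F :: "phase \<Rightarrow> ennreal"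
  assumes "F \<in> borel_measurable borel"
  shows "(NNINT p. F (perm b p)) = (NNINT p. F p)"
  using nn_integral_swap[OF assms] by (simp add: perm_def)

definition tau :: "nat \<Rightarrow> bool \<Rightarrow> real" where "tau i b = (if b then a2 i else a4 i)"

text \<open>After undoing the jump, the phase of a jump is a quadratic phase in the variables before the jump.\<close>
lemma jph_unshift: "jph i p k = ph (tau i b) (a1 i) (if b then a4 i else a2 i) (a2 i * a4 i) (perm b (p - jump i k)) k"
proof -
  obtain \<xi>1 \<xi>2 \<zeta>1 \<zeta>2 where p: "p = (\<xi>1, \<xi>2, \<zeta>1, \<zeta>2)" by (cases p)
  show ?thesis unfolding p
    by (simp add: jph_def ph_def jump_def perm_def swap_def tau_def inner_add_right inner_diff_right power2_norm_eq_inner algebra_simps)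
qed

lemma integrable_indicator_Icc: "integrable lborel (\<lambda>s. k * indicat_real {a..b::real} s)"
proof -
  have "integrable lborel (indicat_real {a..b})" by (rule integrable_real_indicator) (simp_all add: emeasure_lborel_Icc_eq)
  then show ?thesis by (rule integrable_mult_right)
qed

lemma integrable_Icc_bounded:
  fixes f :: "real \<Rightarrow> complex"
  assumes "f \<in> borel_measurable borel" and b: "\<And>s. 0 \<le> s \<Longrightarrow> s \<le> z \<Longrightarrow> cmod (f s) \<le> B"
  shows "integrable lborel (\<lambda>s. indicator {0..z} s *\<^sub>R f s)"
proof (rule Bochner_Integration.integrable_bound[OF integrable_indicator_Icc[of B 0 z]])
  show "(\<lambda>s. indicator {0..z} s *\<^sub>R f s) \<in> borel_measurable lborel" using assms(1) by measurable
  show "AE s in lborel. norm (indicator {0..z} s *\<^sub>R f s) \<le> norm (B * indicator {0..z} s)"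
    using b by (intro always_eventually allI) (auto simp: indicator_def intro: order_trans[OF _ abs_ge_self])
qed

text \<open>The contribution of the jump \<open>i\<close> acting on one product \<open>amp b1 b2\<close>, or on its image under the exchange of
  \<open>\<xi>2\<close> and \<open>\<zeta>2\<close> if the last flag is true.\<close>
definition cross :: "real \<Rightarrow> nat \<times> (bool \<times> bool) \<times> bool \<Rightarrow> real \<Rightarrow> phase \<Rightarrow> complex" where
  "cross \<epsilon> = (\<lambda>(i, (b1, b2), b) s p. K k0 C s *\<^sub>R jump_term \<epsilon> i s (\<lambda>q. amp b1 b2 \<epsilon> s (perm b q)) p)"

lemma cross_measurable [measurable]:
  assumes [measurable]: "f \<in> borel_measurable N" "g \<in> borel_measurable N"
  shows "(\<lambda>y. cross \<epsilon> l (f y) (g y)) \<in> borel_measurable N"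
proof -
  obtain i b1 b2 b where l: "l = (i, (b1, b2), b)" by (cases l) auto
  have [measurable]: "(\<lambda>x. jump_term \<epsilon> i (f x) (\<lambda>q. amp b1 b2 \<epsilon> (f x) (perm b q)) (g x)) \<in> borel_measurable N"
    by (rule jump_term_measurable) measurable
  show ?thesis unfolding l cross_def prod.case by measurable
qed

lemma amp_max_nonneg: "0 \<le> amp_max \<epsilon> Z" by (simp add: amp_max_def)

lemma cross_bound:
  assumes "0 \<le> s" "s \<le> Z"
  shows "cmod (cross \<epsilon> l s p) \<le> (2 * pi) ^ 8 * (lam * amp_max \<epsilon> Z)"
proof -
  obtain i b1 b2 b where l: "l = (i, (b1, b2), b)" by (cases l) auto
  have "cmod (jump_term \<epsilon> i s (\<lambda>q. amp b1 b2 \<epsilon> s (perm b q)) p) \<le> lam * amp_max \<epsilon> Z"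
    by (rule jump_term_bound) (rule amp_bound[OF assms])
  then show ?thesis unfolding l cross_def prod.case norm_scaleR
    using K_bound[OF assms(1)] K_nonneg[of s] by (intro mult_mono) auto
qed

text \<open>The shift \<open>p - jump i k\<close> preserves Lebesgue measure and can be undone once the integral over \<open>k\<close> is taken
  outside; \<open>jph_unshift\<close> then shows a phase of the form covered by \<open>W\<close>.\<close>
lemma cross_L1:
  assumes z: "0 \<le> z"
  shows "(NNINT p. ennreal (cmod (LINT s|lborel. indicator {0..z} s *\<^sub>R cross \<epsilon> (i, (b1, b2), b) s p)))
    \<le> W \<epsilon> z (amp b1 b2 \<epsilon>) (ph (tau i b) (a1 i) (if b then a4 i else a2 i) (a2 i * a4 i))"
proof -
  let ?ph = "ph (tau i b) (a1 i) (if b then a4 i else a2 i) (a2 i * a4 i)"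
  let ?q = "\<lambda>p k. perm b (p - jump i k)"
  have eq: "(LINT s|lborel. indicator {0..z} s *\<^sub>R cross \<epsilon> (i, (b1, b2), b) s p)
     = (LINT k|lborel. alpha k *\<^sub>R osc \<epsilon> z (amp b1 b2 \<epsilon>) ?ph (?q p k) k)" for p
  proof -
    let ?F = "\<lambda>s k. alpha k *\<^sub>R (indicator {0..z} s *\<^sub>R (K k0 C s *\<^sub>R (amp b1 b2 \<epsilon> s (?q p k) * cis (s * (?ph (?q p k) k / (\<epsilon> * k0))))))"
    have "(LINT s|lborel. indicator {0..z} s *\<^sub>R cross \<epsilon> (i, (b1, b2), b) s p) = (LINT s|lborel. LINT k|lborel. ?F s k)"
    proof (rule Bochner_Integration.integral_cong[OF refl])
      fix s
      have "indicat_real {0..z} s *\<^sub>R cross \<epsilon> (i, (b1, b2), b) s p = (indicat_real {0..z} s * K k0 C s) *\<^sub>R (LINT k|lborel. alpha k *\<^sub>R (amp b1 b2 \<epsilon> s (?q p k) * cis (s * (?ph (?q p k) k / (\<epsilon> * k0)))))"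
        unfolding cross_def prod.case jump_term_def jph_unshift[of i p _ b] by simp
      also have "\<dots> = (LINT k|lborel. (indicat_real {0..z} s * K k0 C s) *\<^sub>R (alpha k *\<^sub>R (amp b1 b2 \<epsilon> s (?q p k) * cis (s * (?ph (?q p k) k / (\<epsilon> * k0))))))"
        by (rule integral_scaleR_right[symmetric])
      also have "\<dots> = (LINT k|lborel. ?F s k)"
        by (intro Bochner_Integration.integral_cong refl) (simp add: scaleR_left_commute mult_ac)
      finally show "indicat_real {0..z} s *\<^sub>R cross \<epsilon> (i, (b1, b2), b) s p = (LINT k|lborel. ?F s k)" .
    qed
    also have "\<dots> = (LINT k|lborel. LINT s|lborel. ?F s k)"
    proof (rule lborel_pair.Fubini_integral[symmetric])
      show "integrable (lborel \<Otimes>\<^sub>M lborel) (\<lambda>(s, k). ?F s k)"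
      proof (rule Bochner_Integration.integrable_bound[where f="\<lambda>(s, k). ((2 * pi) ^ 8 * amp_max \<epsilon> z * indicat_real {0..z} s) * alpha k"])
        show "integrable (lborel \<Otimes>\<^sub>M lborel) (\<lambda>(s, k). ((2 * pi) ^ 8 * amp_max \<epsilon> z * indicat_real {0..z} s) * alpha k)"
          using integrable_indicator_Icc[of "(2 * pi) ^ 8 * amp_max \<epsilon> z" 0 z] alpha_integrable
          by (intro lborel_pair.Fubini_integrable) (auto simp: abs_mult)
        show "(\<lambda>(s, k). ?F s k) \<in> borel_measurable (lborel \<Otimes>\<^sub>M lborel)" unfolding split_beta' by measurable
        show "AE x in lborel \<Otimes>\<^sub>M lborel. norm (case x of (s, k) \<Rightarrow> ?F s k) \<le> norm (case x of (s, k) \<Rightarrow> ((2 * pi) ^ 8 * amp_max \<epsilon> z * indicat_real {0..z} s) * alpha k)"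
        proof (intro always_eventually allI)
          fix x :: "real \<times> vec2"
          obtain s k where x: "x = (s, k)" by (cases x)
          have "K k0 C s * cmod (amp b1 b2 \<epsilon> s (?q p k)) \<le> (2 * pi) ^ 8 * amp_max \<epsilon> z" if "0 \<le> s" "s \<le> z"
            using that by (intro mult_mono K_bound amp_bound) auto
          then have "alpha k * (K k0 C s * cmod (amp b1 b2 \<epsilon> s (?q p k))) \<le> alpha k * ((2 * pi) ^ 8 * amp_max \<epsilon> z)" if "0 \<le> s" "s \<le> z"
            using that by (intro mult_left_mono alpha_nonneg)
          then show "norm (case x of (s, k) \<Rightarrow> ?F s k) \<le> norm (case x of (s, k) \<Rightarrow> ((2 * pi) ^ 8 * amp_max \<epsilon> z * indicat_real {0..z} s) * alpha k)"
            unfolding x prod.case using alpha_nonneg[of k] K_nonneg[of s] amp_max_nonneg[of \<epsilon> z]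
            by (cases "s \<in> {0..z}") (auto simp: norm_mult abs_mult mult_ac)
        qed
      qed
    qed
    also have "\<dots> = (LINT k|lborel. alpha k *\<^sub>R osc \<epsilon> z (amp b1 b2 \<epsilon>) ?ph (?q p k) k)"
      unfolding osc_def by (simp only: integral_scaleR_right)
    finally show ?thesis .
  qed
  have "(NNINT p. ennreal (cmod (LINT s|lborel. indicator {0..z} s *\<^sub>R cross \<epsilon> (i, (b1, b2), b) s p)))
     \<le> (NNINT p. (NNINT k. ennreal (alpha k) * ennreal (cmod (osc \<epsilon> z (amp b1 b2 \<epsilon>) ?ph (?q p k) k))))"
    unfolding eq
    by (intro nn_integral_mono order_trans[OF norm_integral_le_nn_integral]) (simp add: alpha_nonneg ennreal_mult)
  also have "\<dots> = (NNINT k. (NNINT p. ennreal (alpha k) * ennreal (cmod (osc \<epsilon> z (amp b1 b2 \<epsilon>) ?ph (?q p k) k))))"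
    by (rule lborel_pair.Fubini') measurable
  also have "\<dots> = W \<epsilon> z (amp b1 b2 \<epsilon>) ?ph"
    unfolding W_def
  proof (rule nn_integral_cong)
    fix k
    let ?G = "\<lambda>p. ennreal (cmod (osc \<epsilon> z (amp b1 b2 \<epsilon>) ?ph p k))"
    have "(NNINT p. ennreal (alpha k) * ?G (?q p k)) = ennreal (alpha k) * (NNINT p. ?G (?q p k))"
      by (rule nn_integral_cmult) measurable
    also have "(NNINT p. ?G (?q p k)) = (NNINT p. ?G (perm b p))"
      by (rule nn_integral_lborel_translate(2)[of "\<lambda>p. ?G (perm b p)"]) measurable
    also have "\<dots> = (NNINT p. ?G p)" by (rule nn_integral_perm) measurable
    finally show "(NNINT p. ennreal (alpha k) * ?G (?q p k)) = ennreal (alpha k) * (NNINT p. ?G p)" .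
  qed
  finally show ?thesis .
qed

section \<open>The explicit approximation\<close>

text \<open>The product of the two sums \<open>XB\<close>, multiplied out.\<close>
definition Pf :: "real \<Rightarrow> real \<Rightarrow> phase \<Rightarrow> complex" where
  "Pf \<epsilon> s p = (\<Sum>c\<in>UNIV. amp (fst c) (snd c) \<epsilon> s p)"

definition Y_set :: "(bool \<times> bool) set" where "Y_set = {(True, True), (True, False), (False, True)}"

lemma sum_bool_pairs: "(\<Sum>c\<in>UNIV. f c) = (\<Sum>c\<in>Y_set. f c) + f (False, False)" for f :: "bool \<times> bool \<Rightarrow> complex"
proof -
  have U: "(UNIV :: (bool \<times> bool) set) = insert (False, False) Y_set" by (auto simp: Y_set_def)
  have "(False, False) \<notin> Y_set" "finite Y_set" by (auto simp: Y_set_def)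
  then show ?thesis unfolding U by (simp add: add.commute)
qed

lemma Pf_split: "Pf \<epsilon> s p = (\<Sum>c\<in>Y_set. amp (fst c) (snd c) \<epsilon> s p) + amp False False \<epsilon> s p"
  unfolding Pf_def sum_bool_pairs by simp

lemma Pf_eq: "Pf \<epsilon> s (\<xi>1, \<xi>2, \<zeta>1, \<zeta>2) = complex_of_real (phi r0 \<epsilon> \<zeta>1 * phi r0 \<epsilon> \<zeta>2)
   * XB \<epsilon> s ((\<xi>2 + \<xi>1) /\<^sub>R 2) ((\<zeta>2 + \<zeta>1) /\<^sub>R \<epsilon>) * XB \<epsilon> s ((\<xi>2 - \<xi>1) /\<^sub>R 2) ((\<zeta>2 - \<zeta>1) /\<^sub>R \<epsilon>)"
  unfolding Pf_split Y_set_def by (simp add: amp_def XB_def algebra_simps)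

lemma amp_FF: "amp False False \<epsilon> s (\<xi>1, \<xi>2, \<zeta>1, \<zeta>2)
   = complex_of_real (phi r0 \<epsilon> \<xi>1 * phi r0 \<epsilon> \<xi>2 * phi r0 \<epsilon> \<zeta>1 * phi r0 \<epsilon> \<zeta>2)"
proof -
  let ?x = "(\<xi>2 + \<xi>1) /\<^sub>R 2" and ?y = "(\<xi>2 - \<xi>1) /\<^sub>R 2"
  have xy: "?x - ?y = \<xi>1" "?x + ?y = \<xi>2"
    by (simp_all add: scaleR_diff_right[symmetric] scaleR_add_right[symmetric] scaleR_2[symmetric] del: scaleR_diff_right scaleR_add_right)
  have "gg \<epsilon> ?x * gg \<epsilon> ?y = phi r0 \<epsilon> \<xi>1 * phi r0 \<epsilon> \<xi>2"
    using phi_product[of \<epsilon> ?x ?y] unfolding xy by simp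
  then have "complex_of_real (phi r0 \<epsilon> \<zeta>1 * phi r0 \<epsilon> \<zeta>2) * complex_of_real (gg \<epsilon> ?x * gg \<epsilon> ?y)
     = complex_of_real (phi r0 \<epsilon> \<zeta>1 * phi r0 \<epsilon> \<zeta>2) * complex_of_real (phi r0 \<epsilon> \<xi>1 * phi r0 \<epsilon> \<xi>2)" by simp
  then show ?thesis by (simp add: amp_def XF_def mult_ac)
qed

lemma amp_FF_swap: "amp False False \<epsilon> s (swap p) = amp False False \<epsilon> s' p"
  by (cases p) (simp add: swap_def amp_FF mult_ac)

definition P_rate :: "real \<Rightarrow> real \<Rightarrow> phase \<Rightarrow> complex" where
  "P_rate \<epsilon> s = (\<lambda>(\<xi>1, \<xi>2, \<zeta>1, \<zeta>2). complex_of_real (phi r0 \<epsilon> \<zeta>1 * phi r0 \<epsilon> \<zeta>2) *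
     (A_rate s ((\<xi>2 + \<xi>1) /\<^sub>R 2) ((\<zeta>2 + \<zeta>1) /\<^sub>R \<epsilon>) * XB \<epsilon> s ((\<xi>2 - \<xi>1) /\<^sub>R 2) ((\<zeta>2 - \<zeta>1) /\<^sub>R \<epsilon>)
      + XB \<epsilon> s ((\<xi>2 + \<xi>1) /\<^sub>R 2) ((\<zeta>2 + \<zeta>1) /\<^sub>R \<epsilon>) * A_rate s ((\<xi>2 - \<xi>1) /\<^sub>R 2) ((\<zeta>2 - \<zeta>1) /\<^sub>R \<epsilon>)))"

lemma Pf_measurable [measurable]:
  assumes [measurable]: "f \<in> borel_measurable N" "g \<in> borel_measurable N"
  shows "(\<lambda>y. Pf \<epsilon> (f y) (g y)) \<in> borel_measurable N"
  unfolding Pf_def by measurable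

lemma P_rate_measurable [measurable]:
  assumes [measurable]: "f \<in> borel_measurable N" "g \<in> borel_measurable N"
  shows "(\<lambda>y. P_rate \<epsilon> (f y) (g y)) \<in> borel_measurable N"
  supply phase_measurable_components[OF assms(2), measurable]
  unfolding P_rate_def split_beta' by measurable

lemma XB_derivative:
  assumes "0 \<le> s" "s \<le> z"
  shows "((\<lambda>s. XB \<epsilon> s x \<eta>) has_vector_derivative A_rate s x \<eta>) (at s within {0..z})"
proof -
  have "((\<lambda>s. A k0 C s x \<eta> + complex_of_real (gg \<epsilon> x)) has_vector_derivative A_rate s x \<eta> + 0) (at s within {0..z})"
    by (intro has_vector_derivative_add A_derivative assms has_vector_derivative_const)
  then show ?thesis by (simp add: XB_def XF_def)
qed

lemma XB_continuous: "continuous_on {0..z} (\<lambda>s. XB \<epsilon> s x \<eta>)"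
  unfolding XB_def by (intro continuous_intros XF_continuous)

lemma Pf_derivative:
  assumes "0 \<le> s" "s \<le> z"
  shows "((\<lambda>s. Pf \<epsilon> s p) has_vector_derivative P_rate \<epsilon> s p) (at s within {0..z})"
proof -
  obtain \<xi>1 \<xi>2 \<zeta>1 \<zeta>2 where p: "p = (\<xi>1, \<xi>2, \<zeta>1, \<zeta>2)" by (cases p)
  let ?D = "complex_of_real (phi r0 \<epsilon> \<zeta>1 * phi r0 \<epsilon> \<zeta>2)"
  let ?X = "\<lambda>s. XB \<epsilon> s ((\<xi>2 + \<xi>1) /\<^sub>R 2) ((\<zeta>2 + \<zeta>1) /\<^sub>R \<epsilon>)" and ?Y = "\<lambda>s. XB \<epsilon> s ((\<xi>2 - \<xi>1) /\<^sub>R 2) ((\<zeta>2 - \<zeta>1) /\<^sub>R \<epsilon>)"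
  have "((\<lambda>s. ?D * (?X s * ?Y s)) has_vector_derivative
      ?D * (?X s * A_rate s ((\<xi>2 - \<xi>1) /\<^sub>R 2) ((\<zeta>2 - \<zeta>1) /\<^sub>R \<epsilon>) + A_rate s ((\<xi>2 + \<xi>1) /\<^sub>R 2) ((\<zeta>2 + \<zeta>1) /\<^sub>R \<epsilon>) * ?Y s)) (at s within {0..z})"
    by (intro has_vector_derivative_mult_right has_vector_derivative_mult XB_derivative assms)
  then show ?thesis unfolding p Pf_eq P_rate_def prod.case by (simp only: mult.assoc add.commute)
qed

lemma P_rate_continuous: "continuous_on {0..z} (\<lambda>s. P_rate \<epsilon> s p)"
  unfolding P_rate_def split_beta' by (intro continuous_intros XB_continuous A_rate_continuous)

text \<open>In the centred coordinates the jump 1 moves only \<open>x\<close> and the jump 3 moves only \<open>y\<close>, and their phases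
  involve only \<open>(\<zeta>2 + \<zeta>1) / \<epsilon>\<close> and \<open>(\<zeta>2 - \<zeta>1) / \<epsilon>\<close>. So each of them is a convolution acting on one of the
  two factors, as in the product rule for the derivative.\<close>
lemma jump_term_1_Pf:
  assumes e: "0 < \<epsilon>" and s: "0 \<le> s"
  shows "jump_term \<epsilon> 1 s (Pf \<epsilon> s) p + jump_term \<epsilon> 3 s (Pf \<epsilon> s) p = P_rate \<epsilon> s p + E_half \<epsilon> s p"
proof -
  obtain \<xi>1 \<xi>2 \<zeta>1 \<zeta>2 where p: "p = (\<xi>1, \<xi>2, \<zeta>1, \<zeta>2)" by (cases p)
  let ?D = "complex_of_real (phi r0 \<epsilon> \<zeta>1 * phi r0 \<epsilon> \<zeta>2)"
  let ?x = "(\<xi>2 + \<xi>1) /\<^sub>R 2" and ?y = "(\<xi>2 - \<xi>1) /\<^sub>R 2" and ?p = "(\<zeta>2 + \<zeta>1) /\<^sub>R \<epsilon>" and ?m = "(\<zeta>2 - \<zeta>1) /\<^sub>R \<epsilon>"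
  have x1: "(\<xi>2 - k + (\<xi>1 - k)) /\<^sub>R 2 = ?x - k" "(\<xi>2 - k - (\<xi>1 - k)) /\<^sub>R 2 = ?y"
    and x3: "(\<xi>2 - k + (\<xi>1 + k)) /\<^sub>R 2 = ?x" "(\<xi>2 - k - (\<xi>1 + k)) /\<^sub>R 2 = ?y - k" for k :: vec2
    by (simp_all add: vec_eq_iff field_simps)
  have th: "s * (x / (\<epsilon> * k0)) = s / k0 * (inverse \<epsilon> * x)" for x using e k0 by (simp add: field_simps)
  have c1: "alpha k *\<^sub>R cis (s * (k \<bullet> (\<zeta>1 + \<zeta>2) / (\<epsilon> * k0))) = f_src s ?p k" for k
    by (simp only: th f_src_def inner_scaleR_right add.commute)
  have c3: "alpha k *\<^sub>R cis (s * (k \<bullet> (\<zeta>2 - \<zeta>1) / (\<epsilon> * k0))) = f_src s ?m k" for k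
    by (simp only: th f_src_def inner_scaleR_right)
  have "jump_term \<epsilon> 1 s (Pf \<epsilon> s) p = (LINT k|lborel. (?D * XB \<epsilon> s ?y ?m) * (f_src s ?p k * XB \<epsilon> s (?x - k) ?p))"
    unfolding jump_term_def
  proof (rule Bochner_Integration.integral_cong[OF refl])
    fix k
    have j: "p - jump 1 k = (\<xi>1 - k, \<xi>2 - k, \<zeta>1, \<zeta>2)" "jph 1 p k = k \<bullet> (\<zeta>1 + \<zeta>2)"
      unfolding p by (simp_all add: jump_def jph_def coeff_defs)
    show "alpha k *\<^sub>R (Pf \<epsilon> s (p - jump 1 k) * cis (s * (jph 1 p k / (\<epsilon> * k0)))) = (?D * XB \<epsilon> s ?y ?m) * (f_src s ?p k * XB \<epsilon> s (?x - k) ?p)"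
      unfolding c1[symmetric] j Pf_eq x1 by (simp only: mult_scaleR_left mult_scaleR_right mult_ac)
  qed
  also have "\<dots> = (?D * XB \<epsilon> s ?y ?m) * (A_rate s ?x ?p + smoothing_error \<epsilon> s ?x ?p)"
    by (simp only: integral_mult_right_zero f_src_XB_convolution[OF e s])
  finally have t1: "jump_term \<epsilon> 1 s (Pf \<epsilon> s) p = (?D * XB \<epsilon> s ?y ?m) * (A_rate s ?x ?p + smoothing_error \<epsilon> s ?x ?p)" .
  have "jump_term \<epsilon> 3 s (Pf \<epsilon> s) p = (LINT k|lborel. (?D * XB \<epsilon> s ?x ?p) * (f_src s ?m k * XB \<epsilon> s (?y - k) ?m))"
    unfolding jump_term_def
  proof (rule Bochner_Integration.integral_cong[OF refl])
    fix k
    have j: "p - jump 3 k = (\<xi>1 + k, \<xi>2 - k, \<zeta>1, \<zeta>2)" "jph 3 p k = k \<bullet> (\<zeta>2 - \<zeta>1)"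
      unfolding p by (simp_all add: jump_def jph_def coeff_defs)
    show "alpha k *\<^sub>R (Pf \<epsilon> s (p - jump 3 k) * cis (s * (jph 3 p k / (\<epsilon> * k0)))) = (?D * XB \<epsilon> s ?x ?p) * (f_src s ?m k * XB \<epsilon> s (?y - k) ?m)"
      unfolding c3[symmetric] j Pf_eq x3 by (simp only: mult_scaleR_left mult_scaleR_right mult_ac)
  qed
  also have "\<dots> = (?D * XB \<epsilon> s ?x ?p) * (A_rate s ?y ?m + smoothing_error \<epsilon> s ?y ?m)"
    by (simp only: integral_mult_right_zero f_src_XB_convolution[OF e s])
  finally show ?thesis unfolding t1 unfolding p P_rate_def E_half_def prod.case by (simp add: algebra_simps)
qed

text \<open>The operator is symmetric under the exchange of \<open>\<xi>2\<close> and \<open>\<zeta>2\<close>, which carries the jumps 1 and 3 to the jumps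
  2 and 4.\<close>
lemma jump_term_swap:
  "jump_term \<epsilon> 2 s (\<lambda>q. \<psi> (swap q)) p = jump_term \<epsilon> 1 s \<psi> (swap p)"
  "jump_term \<epsilon> 4 s (\<lambda>q. \<psi> (swap q)) p = jump_term \<epsilon> 3 s \<psi> (swap p)"
proof -
  obtain \<xi>1 \<xi>2 \<zeta>1 \<zeta>2 where p: "p = (\<xi>1, \<xi>2, \<zeta>1, \<zeta>2)" by (cases p)
  have "swap (p - jump 2 k) = swap p - jump 1 k" "jph 2 p k = jph 1 (swap p) k"
    "swap (p - jump 4 k) = swap p - jump 3 k" "jph 4 p k = jph 3 (swap p) k" for k
    unfolding p by (simp_all add: swap_def jump_def jph_def coeff_defs)
  then show "jump_term \<epsilon> 2 s (\<lambda>q. \<psi> (swap q)) p = jump_term \<epsilon> 1 s \<psi> (swap p)"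
    "jump_term \<epsilon> 4 s (\<lambda>q. \<psi> (swap q)) p = jump_term \<epsilon> 3 s \<psi> (swap p)"
    by (simp_all add: jump_term_def)
qed

end

context scintillation begin

lemma Pf_bound: assumes "0 \<le> s" "s \<le> Z" shows "cmod (Pf \<epsilon> s p) \<le> 4 * amp_max \<epsilon> Z"
proof -
  have "cmod (Pf \<epsilon> s p) \<le> (\<Sum>c\<in>(UNIV :: (bool \<times> bool) set). amp_max \<epsilon> Z)"
    unfolding Pf_def by (rule order_trans[OF norm_sum]) (intro sum_mono amp_bound assms)
  also have "\<dots> = 4 * amp_max \<epsilon> Z" by (simp add: card_UNIV_bool UNIV_Times_UNIV[symmetric] card_cartesian_product del: UNIV_Times_UNIV)
  finally show ?thesis .
qed

lemma Pf_L1: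
  assumes "0 < \<epsilon>" "0 \<le> s" "s \<le> Z"
  shows "(NNINT p. ennreal (cmod (Pf \<epsilon> s p))) \<le> ennreal (16 * (X_mass Z)\<^sup>2)"
proof -
  have "(NNINT p. ennreal (cmod (Pf \<epsilon> s p))) \<le> (NNINT p. (\<Sum>c\<in>UNIV. ennreal (cmod (amp (fst c) (snd c) \<epsilon> s p))))"
    unfolding Pf_def by (intro nn_integral_mono) (simp add: sum_ennreal ennreal_leI norm_sum)
  also have "\<dots> = (\<Sum>c\<in>UNIV. NNINT p. ennreal (cmod (amp (fst c) (snd c) \<epsilon> s p)))"
    by (rule nn_integral_sum) measurable
  also have "\<dots> \<le> (\<Sum>c\<in>(UNIV :: (bool \<times> bool) set). ennreal (4 * (X_mass Z)\<^sup>2))"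
    by (intro sum_mono amp_L1 assms)
  also have "\<dots> = ennreal (16 * (X_mass Z)\<^sup>2)"
    by (subst sum_ennreal) (simp_all add: card_UNIV_bool UNIV_Times_UNIV[symmetric] card_cartesian_product del: UNIV_Times_UNIV)
  finally show ?thesis .
qed

text \<open>The pairing of \<open>\<xi>1\<close> with \<open>\<xi>2\<close> and the pairing of \<open>\<xi>1\<close> with \<open>\<zeta>2\<close> contribute equally; the product of the four
  initial Gaussians belongs to both and is subtracted once.\<close>
definition approx :: "real \<Rightarrow> real \<Rightarrow> phase \<Rightarrow> complex" where
  "approx \<epsilon> s p = K k0 C s *\<^sub>R (Pf \<epsilon> s p + Pf \<epsilon> s (swap p) - amp False False \<epsilon> s p)"

definition approx_rate :: "real \<Rightarrow> real \<Rightarrow> phase \<Rightarrow> complex" where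
  "approx_rate \<epsilon> s p = (- 2 * lam) *\<^sub>R approx \<epsilon> s p + K k0 C s *\<^sub>R (P_rate \<epsilon> s p + P_rate \<epsilon> s (swap p))"

lemma approx_measurable [measurable]:
  assumes [measurable]: "f \<in> borel_measurable N" "g \<in> borel_measurable N"
  shows "(\<lambda>y. approx \<epsilon> (f y) (g y)) \<in> borel_measurable N"
  unfolding approx_def by measurable

lemma approx_rate_measurable [measurable]:
  assumes [measurable]: "f \<in> borel_measurable N" "g \<in> borel_measurable N"
  shows "(\<lambda>y. approx_rate \<epsilon> (f y) (g y)) \<in> borel_measurable N"
  unfolding approx_rate_def by measurable

lemma norm3: "cmod (a + b - c) \<le> cmod a + cmod b + cmod c"
  using norm_triangle_ineq4[of "a + b" c] norm_triangle_ineq[of a b] by linarith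

lemma approx_bound:
  assumes "0 \<le> s" "s \<le> Z"
  shows "cmod (approx \<epsilon> s p) \<le> (2 * pi) ^ 8 * (9 * amp_max \<epsilon> Z)"
proof -
  have "cmod (Pf \<epsilon> s p + Pf \<epsilon> s (swap p) - amp False False \<epsilon> s p) \<le> 9 * amp_max \<epsilon> Z"
    using norm3[of "Pf \<epsilon> s p" "Pf \<epsilon> s (swap p)" "amp False False \<epsilon> s p"] Pf_bound[OF assms, of \<epsilon> p] Pf_bound[OF assms, of \<epsilon> "swap p"]
      amp_bound[OF assms, of False False \<epsilon> p] by linarith
  then show ?thesis unfolding approx_def norm_scaleR
    using K_bound[OF assms(1)] K_nonneg[of s] by (intro mult_mono) auto
qed

lemma approx_L1:
  assumes "0 < \<epsilon>" "0 \<le> s" "s \<le> Z"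
  shows "(NNINT p. ennreal (cmod (approx \<epsilon> s p))) \<le> ennreal ((2 * pi) ^ 8 * (36 * (X_mass Z)\<^sup>2))"
proof -
  let ?n = "\<lambda>f. \<integral>\<^sup>+p. ennreal (cmod (f p)) \<partial>(lborel :: phase measure)"
  have "?n (approx \<epsilon> s) \<le> (NNINT p. ennreal ((2 * pi) ^ 8) * (ennreal (cmod (Pf \<epsilon> s p)) + ennreal (cmod (Pf \<epsilon> s (swap p))) + ennreal (cmod (amp False False \<epsilon> s p))))"
  proof (rule nn_integral_mono)
    fix p
    have "cmod (approx \<epsilon> s p) \<le> (2 * pi) ^ 8 * (cmod (Pf \<epsilon> s p) + cmod (Pf \<epsilon> s (swap p)) + cmod (amp False False \<epsilon> s p))"
      unfolding approx_def norm_scaleR using K_bound[OF assms(2)] K_nonneg[of s] norm3 by (intro mult_mono) auto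
    then have "ennreal (cmod (approx \<epsilon> s p)) \<le> ennreal ((2 * pi) ^ 8 * (cmod (Pf \<epsilon> s p) + cmod (Pf \<epsilon> s (swap p)) + cmod (amp False False \<epsilon> s p)))"
      by (rule ennreal_leI)
    then show "ennreal (cmod (approx \<epsilon> s p)) \<le> ennreal ((2 * pi) ^ 8) * (ennreal (cmod (Pf \<epsilon> s p)) + ennreal (cmod (Pf \<epsilon> s (swap p))) + ennreal (cmod (amp False False \<epsilon> s p)))"
      by (simp add: ennreal_mult)
  qed
  also have "\<dots> = ennreal ((2 * pi) ^ 8) * (?n (Pf \<epsilon> s) + ?n (\<lambda>p. Pf \<epsilon> s (swap p)) + ?n (amp False False \<epsilon> s))"
    by (subst nn_integral_cmult, measurable, subst nn_integral_add, measurable, subst nn_integral_add, measurable)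
  also have "?n (\<lambda>p. Pf \<epsilon> s (swap p)) = ?n (Pf \<epsilon> s)" by (rule nn_integral_swap) measurable
  also have "ennreal ((2 * pi) ^ 8) * (?n (Pf \<epsilon> s) + ?n (Pf \<epsilon> s) + ?n (amp False False \<epsilon> s))
     \<le> ennreal ((2 * pi) ^ 8) * (ennreal (16 * (X_mass Z)\<^sup>2) + ennreal (16 * (X_mass Z)\<^sup>2) + ennreal (4 * (X_mass Z)\<^sup>2))"
    by (intro mult_left_mono add_mono Pf_L1 amp_L1 assms) auto
  also have "\<dots> = ennreal ((2 * pi) ^ 8 * (36 * (X_mass Z)\<^sup>2))"
    by (simp add: ennreal_mult[symmetric] ennreal_plus[symmetric] del: ennreal_plus)
  finally show ?thesis .
qed

lemma K_derivative: "(K k0 C has_vector_derivative (- 2 * lam) * K k0 C s) (at s within S)"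
  unfolding has_real_derivative_iff_has_vector_derivative[symmetric] K_def[abs_def] lam_def
  by (auto intro!: derivative_eq_intros)

lemma approx_derivative:
  assumes "0 \<le> s" "s \<le> z"
  shows "((\<lambda>s. approx \<epsilon> s p) has_vector_derivative approx_rate \<epsilon> s p) (at s within {0..z})"
proof -
  have FF: "((\<lambda>s. amp False False \<epsilon> s p) has_vector_derivative 0) (at s within {0..z})"
    unfolding amp_def XF_def split_beta' by simp
  have "((\<lambda>s. K k0 C s *\<^sub>R (Pf \<epsilon> s p + Pf \<epsilon> s (swap p) - amp False False \<epsilon> s p)) has_vector_derivative
      K k0 C s *\<^sub>R (P_rate \<epsilon> s p + P_rate \<epsilon> s (swap p) - 0) + ((- 2 * lam) * K k0 C s) *\<^sub>R (Pf \<epsilon> s p + Pf \<epsilon> s (swap p) - amp False False \<epsilon> s p)) (at s within {0..z})"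
    by (intro has_vector_derivative_scaleR K_derivative[unfolded has_real_derivative_iff_has_vector_derivative[symmetric]]
       has_vector_derivative_diff has_vector_derivative_add Pf_derivative assms FF)
  then show ?thesis unfolding approx_def approx_rate_def by (simp add: add.commute)
qed

lemma approx_continuous: "continuous_on {0..z} (\<lambda>s. approx \<epsilon> s p)"
  by (rule continuous_on_vector_derivative[OF approx_derivative]) auto

lemma approx_rate_continuous: "continuous_on {0..z} (\<lambda>s. approx_rate \<epsilon> s p)"
  unfolding approx_rate_def by (intro continuous_intros approx_continuous K_continuous P_rate_continuous)

lemma approx_increment:
  assumes "0 \<le> z"
  shows "integrable lborel (\<lambda>s. indicator {0..z} s *\<^sub>R approx_rate \<epsilon> s p)"
    and "approx \<epsilon> z p - approx \<epsilon> 0 p = (LINT s|lborel. indicator {0..z} s *\<^sub>R approx_rate \<epsilon> s p)"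
proof -
  have "has_bochner_integral lborel (\<lambda>s. indicator {0..z} s *\<^sub>R approx_rate \<epsilon> s p) (approx \<epsilon> z p - approx \<epsilon> 0 p)"
    by (rule has_bochner_integral_FTC_Icc[OF assms approx_derivative approx_rate_continuous])
  then show "integrable lborel (\<lambda>s. indicator {0..z} s *\<^sub>R approx_rate \<epsilon> s p)"
    "approx \<epsilon> z p - approx \<epsilon> 0 p = (LINT s|lborel. indicator {0..z} s *\<^sub>R approx_rate \<epsilon> s p)"
    by (auto simp: has_bochner_integral_iff)
qed

lemma approx_0: "approx \<epsilon> 0 p = (2 * pi) ^ 8 *\<^sub>R amp False False \<epsilon> 0 p"
proof -
  have "Pf \<epsilon> 0 q = amp False False \<epsilon> 0 q" for q
    unfolding Pf_split Y_set_def by (simp add: amp_def XF_def A_0 split: prod.split)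
  then show ?thesis unfolding approx_def by (simp add: amp_FF_swap[of \<epsilon> 0 p 0] K_def)
qed

section \<open>The defect of the approximation\<close>

definition gen_sum :: "real \<Rightarrow> real \<Rightarrow> (phase \<Rightarrow> complex) \<Rightarrow> phase \<Rightarrow> complex" where
  "gen_sum \<epsilon> s \<psi> p = (\<Sum>i<7. (sg i * wt i) *\<^sub>R jump_term \<epsilon> i s \<psi> p)"

definition defect :: "real \<Rightarrow> real \<Rightarrow> phase \<Rightarrow> complex" where
  "defect \<epsilon> s p = gen_sum \<epsilon> s (approx \<epsilon> s) p - approx_rate \<epsilon> s p"

lemma gen_sum_expand: "gen_sum \<epsilon> s \<psi> p = (-2 * lam) *\<^sub>R \<psi> p + jump_term \<epsilon> 1 s \<psi> p + jump_term \<epsilon> 2 s \<psi> p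
    + jump_term \<epsilon> 3 s \<psi> p + jump_term \<epsilon> 4 s \<psi> p - jump_term \<epsilon> 5 s \<psi> p - jump_term \<epsilon> 6 s \<psi> p"
proof -
  have "{..<7::nat} = {0, 1, 2, 3, 4, 5, 6}" by auto
  then show ?thesis unfolding gen_sum_def by (simp add: coeff_defs jump_term_0)
qed

text \<open>The pairs of a jump and a product that do not contribute in the limit: the jumps 1 and 3 on products of
  the second pairing, the jumps 2 and 4 on products of the first one, and the jumps 5 and 6 on everything.
  The product of Gaussians alone is common to both pairings. Under the jumps 1 to 4 it contributes to
  the limit and is excluded; under 5 and 6 it is counted with the first pairing.\<close>
definition cross_set :: "(nat \<times> (bool \<times> bool) \<times> bool) set" where
  "cross_set = {1, 3} \<times> Y_set \<times> {True} \<union> {2, 4} \<times> Y_set \<times> {False} \<union> {5, 6} \<times> UNIV \<times> {False} \<union> {5, 6} \<times> Y_set \<times> {True}"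

lemma finite_Y_set: "finite Y_set" by (simp add: Y_set_def)

lemma sum_cross_set:
  fixes f :: "nat \<Rightarrow> bool \<times> bool \<Rightarrow> bool \<Rightarrow> complex"
  shows "(\<Sum>(i, c, b)\<in>cross_set. f i c b)
    = (\<Sum>c\<in>Y_set. f 1 c True) + (\<Sum>c\<in>Y_set. f 3 c True) + (\<Sum>c\<in>Y_set. f 2 c False) + (\<Sum>c\<in>Y_set. f 4 c False)
      + (\<Sum>c\<in>UNIV. f 5 c False) + (\<Sum>c\<in>UNIV. f 6 c False) + (\<Sum>c\<in>Y_set. f 5 c True) + (\<Sum>c\<in>Y_set. f 6 c True)"
proof -
  have prod: "(\<Sum>(i, c, b)\<in>{x, y} \<times> Y \<times> {d}. f i c b) = (\<Sum>c\<in>Y. f x c d) + (\<Sum>c\<in>Y. f y c d)" if "x \<noteq> y" for x y Y d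
    using that by (simp add: sum.cartesian_product[symmetric])
  show ?thesis unfolding cross_set_def
    by (subst sum.union_disjoint, simp add: finite_Y_set, simp add: finite_Y_set, force,
        subst sum.union_disjoint, simp add: finite_Y_set, simp, force,
        subst sum.union_disjoint, simp add: finite_Y_set, simp add: finite_Y_set, force)
       (simp add: prod)
qed

text \<open>The trivial jump matches the derivative of \<open>K\<close>, and the jumps 1 and 3 (2 and 4) match the derivative of the
  first (second) product up to the smoothing error. What is left over is the sum over \<open>cross_set\<close>.\<close>
lemma defect_eq:
  assumes e: "0 < \<epsilon>" and s: "0 \<le> s"
  shows "defect \<epsilon> s p = K k0 C s *\<^sub>R (E_half \<epsilon> s p + E_half \<epsilon> s (swap p))
     + (\<Sum>l\<in>cross_set. sg (fst l) *\<^sub>R cross \<epsilon> l s p)"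
proof -
  define Y where "Y q = (\<Sum>c\<in>Y_set. amp (fst c) (snd c) \<epsilon> s q)" for q
  let ?F = "amp False False \<epsilon> s"
  let ?M = "amp_max \<epsilon> s"
  define y where "y i = jump_term \<epsilon> i s Y p" for i
  define y' where "y' i = jump_term \<epsilon> i s (\<lambda>q. Y (swap q)) p" for i
  define n where "n i = jump_term \<epsilon> i s ?F p" for i
  have [measurable]: "Y \<in> borel_measurable borel" unfolding Y_def by measurable
  have ab: "cmod (amp b1 b2 \<epsilon> s q) \<le> ?M" for b1 b2 q by (rule amp_bound[OF s order_refl])
  have Yb: "cmod (Y q) \<le> (\<Sum>c\<in>Y_set. ?M)" for q
    unfolding Y_def by (rule order_trans[OF norm_sum]) (intro sum_mono ab)
  have PY: "Pf \<epsilon> s q = Y q + ?F q" for q by (simp add: Pf_split Y_def)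
  have jP: "jump_term \<epsilon> i s (Pf \<epsilon> s) p = y i + n i" for i
    unfolding PY[abs_def] y_def n_def by (rule jump_term_add[OF _ Yb _ ab]) measurable
  have jP': "jump_term \<epsilon> i s (\<lambda>q. Pf \<epsilon> s (swap q)) p = y' i + n i" for i
    unfolding PY y'_def n_def amp_FF_swap[of \<epsilon> s _ s] by (rule jump_term_add[OF _ Yb _ ab]) measurable
  have japp: "jump_term \<epsilon> i s (approx \<epsilon> s) p = K k0 C s *\<^sub>R (y i + y' i + n i)" for i
  proof -
    have "approx \<epsilon> s = (\<lambda>q. K k0 C s *\<^sub>R (Y q + (Y (swap q) + ?F q)))"
      unfolding approx_def PY amp_FF_swap[of \<epsilon> s _ s] by (simp add: fun_eq_iff algebra_simps)
    moreover have "jump_term \<epsilon> i s (\<lambda>q. Y q + (Y (swap q) + ?F q)) p = y i + jump_term \<epsilon> i s (\<lambda>q. Y (swap q) + ?F q) p"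
      unfolding y_def
    proof (rule jump_term_add[OF _ Yb])
      show "cmod (Y (swap q) + ?F q) \<le> (\<Sum>c\<in>Y_set. ?M) + ?M" for q
        by (intro order_trans[OF norm_triangle_ineq] add_mono Yb ab)
    qed measurable
    moreover have "jump_term \<epsilon> i s (\<lambda>q. Y (swap q) + ?F q) p = y' i + n i"
      unfolding y'_def n_def by (rule jump_term_add[OF _ Yb _ ab]) measurable
    ultimately show ?thesis by (simp add: jump_term_scaleR add.assoc)
  qed
  have main: "y 1 + n 1 + (y 3 + n 3) = P_rate \<epsilon> s p + E_half \<epsilon> s p"
    using jump_term_1_Pf[OF e s, of p] unfolding jP .
  have main': "y' 2 + n 2 + (y' 4 + n 4) = P_rate \<epsilon> s (swap p) + E_half \<epsilon> s (swap p)"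
    using jump_term_1_Pf[OF e s, of "swap p"] unfolding jump_term_swap[symmetric] jP' .
  have cY: "(\<Sum>c\<in>Y_set. cross \<epsilon> (i, c, b) s p) = K k0 C s *\<^sub>R (if b then y' i else y i)" for i b
  proof -
    have "(\<Sum>c\<in>Y_set. cross \<epsilon> (i, c, b) s p) = K k0 C s *\<^sub>R (\<Sum>c\<in>Y_set. jump_term \<epsilon> i s (\<lambda>q. amp (fst c) (snd c) \<epsilon> s (perm b q)) p)"
      unfolding scaleR_sum_right by (intro sum.cong refl) (simp add: cross_def split_beta')
    also have "(\<Sum>c\<in>Y_set. jump_term \<epsilon> i s (\<lambda>q. amp (fst c) (snd c) \<epsilon> s (perm b q)) p) = jump_term \<epsilon> i s (\<lambda>q. Y (perm b q)) p"
      unfolding Y_def by (rule jump_term_sum[symmetric, OF finite_Y_set _ ab]) measurable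
    also have "\<dots> = (if b then y' i else y i)" by (simp add: y_def y'_def perm_def)
    finally show ?thesis .
  qed
  have cU: "(\<Sum>c\<in>UNIV. cross \<epsilon> (i, c, False) s p) = K k0 C s *\<^sub>R (y i + n i)" for i
    unfolding sum_bool_pairs cY by (simp add: cross_def perm_def n_def scaleR_add_right)
  have "(\<Sum>l\<in>cross_set. sg (fst l) *\<^sub>R cross \<epsilon> l s p) = (\<Sum>(i, c, b)\<in>cross_set. sg i *\<^sub>R cross \<epsilon> (i, c, b) s p)"
    by (simp add: split_beta')
  also have "\<dots> = K k0 C s *\<^sub>R (y' 1 + y' 3 + y 2 + y 4 - (y 5 + n 5) - (y 6 + n 6) - y' 5 - y' 6)"
    unfolding sum_cross_set scaleR_sum_right[symmetric] cY cU
    by (simp add: coeff_defs scaleR_add_right scaleR_diff_right)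
  finally have crosses: "(\<Sum>l\<in>cross_set. sg (fst l) *\<^sub>R cross \<epsilon> l s p) = K k0 C s *\<^sub>R (y' 1 + y' 3 + y 2 + y 4 - (y 5 + n 5) - (y 6 + n 6) - y' 5 - y' 6)" .
  have "y' 1 + y' 3 + y 2 + y 4 - (y 5 + n 5) - (y 6 + n 6) - y' 5 - y' 6 + (E_half \<epsilon> s p + E_half \<epsilon> s (swap p))
     = (y 1 + y' 1 + n 1) + (y 2 + y' 2 + n 2) + (y 3 + y' 3 + n 3) + (y 4 + y' 4 + n 4) - (y 5 + y' 5 + n 5) - (y 6 + y' 6 + n 6)
       - (P_rate \<epsilon> s p + P_rate \<epsilon> s (swap p))"
  proof -
    have "E_half \<epsilon> s p = y 1 + n 1 + (y 3 + n 3) - P_rate \<epsilon> s p" "E_half \<epsilon> s (swap p) = y' 2 + n 2 + (y' 4 + n 4) - P_rate \<epsilon> s (swap p)"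
      using main main' by simp_all
    then show ?thesis by simp
  qed
  then have "K k0 C s *\<^sub>R (y' 1 + y' 3 + y 2 + y 4 - (y 5 + n 5) - (y 6 + n 6) - y' 5 - y' 6 + (E_half \<epsilon> s p + E_half \<epsilon> s (swap p)))
     = defect \<epsilon> s p"
    unfolding defect_def gen_sum_expand approx_rate_def japp
    by (simp only:) (simp add: scaleR_add_right scaleR_diff_right)
  then show ?thesis unfolding crosses by (simp add: scaleR_add_right add.commute)
qed

definition cross_size :: "real \<Rightarrow> real \<Rightarrow> nat \<times> (bool \<times> bool) \<times> bool \<Rightarrow> ennreal" where
  "cross_size Z \<epsilon> = (\<lambda>(i, (b1, b2), b). SUP z\<in>{0..Z}. W \<epsilon> z (amp b1 b2 \<epsilon>) (ph (tau i b) (a1 i) (if b then a4 i else a2 i) (a2 i * a4 i)))"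

definition defect_bound :: "real \<Rightarrow> real \<Rightarrow> ennreal" where
  "defect_bound Z \<epsilon> = ennreal ((2 * pi) ^ 8 * Z) * (2 * (ennreal (8 * X_mass Z) * (smoothing_bound 1 Z \<epsilon> + smoothing_bound (-1) Z \<epsilon>)))
     + (\<Sum>l\<in>cross_set. cross_size Z \<epsilon> l)"

lemma defect_bound_limit:
  assumes Z: "0 < Z"
  shows "((\<lambda>\<epsilon>. defect_bound Z \<epsilon>) \<longlongrightarrow> 0) (at_right 0)"
proof -
  have sb: "((\<lambda>\<epsilon>. ennreal ((2 * pi) ^ 8 * Z) * (2 * (ennreal (8 * X_mass Z) * (smoothing_bound 1 Z \<epsilon> + smoothing_bound (-1) Z \<epsilon>))))
     \<longlongrightarrow> ennreal ((2 * pi) ^ 8 * Z) * (2 * (ennreal (8 * X_mass Z) * (0 + 0)))) (at_right 0)"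
    by (intro ennreal_tendsto_cmult tendsto_add smoothing_bound_limit Z) auto
  have "((\<lambda>\<epsilon>. \<Sum>l\<in>cross_set. cross_size Z \<epsilon> l)
     \<longlongrightarrow> (\<Sum>l\<in>cross_set. 0)) (at_right 0)"
  proof (rule tendsto_sum)
    fix l assume l: "l \<in> cross_set"
    obtain i b1 b2 b where leq: "l = (i, (b1, b2), b)" by (cases l) auto
    have "tau i b \<noteq> 0" "b1 \<or> b2 \<or> a2 i * a4 i \<noteq> 0"
      using l unfolding leq cross_set_def Y_set_def by (auto simp: tau_def coeff_defs)
    from W_uniform_limit[OF this Z]
    show "((\<lambda>\<epsilon>. cross_size Z \<epsilon> l) \<longlongrightarrow> 0) (at_right 0)"
      unfolding leq cross_size_def prod.case .
  qed
  from tendsto_add[OF sb this] show ?thesis unfolding defect_bound_def by simp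
qed

lemma cross_integrable:
  "integrable lborel (\<lambda>s. indicator {0..z} s *\<^sub>R cross \<epsilon> l s p)"
proof (rule integrable_Icc_bounded)
  show "(\<lambda>s. cross \<epsilon> l s p) \<in> borel_measurable borel" by (rule cross_measurable) simp_all
qed (rule cross_bound)

lemma jump_term_Pf_integrable:
  "integrable lborel (\<lambda>s. indicator {0..z} s *\<^sub>R (K k0 C s *\<^sub>R jump_term \<epsilon> i s (Pf \<epsilon> s) p))"
proof (rule integrable_Icc_bounded)
  have "(\<lambda>s. jump_term \<epsilon> i s (Pf \<epsilon> s) p) \<in> borel_measurable borel" by (rule jump_term_measurable) measurable
  then show "(\<lambda>s. K k0 C s *\<^sub>R jump_term \<epsilon> i s (Pf \<epsilon> s) p) \<in> borel_measurable borel" by measurable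
  fix s assume s: "0 \<le> s" "s \<le> z"
  have "cmod (jump_term \<epsilon> i s (Pf \<epsilon> s) p) \<le> lam * (4 * amp_max \<epsilon> z)"
    by (rule jump_term_bound[OF Pf_bound[OF s]])
  then show "cmod (K k0 C s *\<^sub>R jump_term \<epsilon> i s (Pf \<epsilon> s) p) \<le> (2 * pi) ^ 8 * (lam * (4 * amp_max \<epsilon> z))"
    unfolding norm_scaleR using K_bound[OF s(1)] K_nonneg[of s] by (intro mult_mono) auto
qed

lemma E_half_integrable:
  assumes e: "0 < \<epsilon>"
  shows "integrable lborel (\<lambda>s. indicator {0..z} s *\<^sub>R (K k0 C s *\<^sub>R E_half \<epsilon> s p))"
proof -
  have "continuous_on {0..z} (\<lambda>s. K k0 C s *\<^sub>R P_rate \<epsilon> s p)"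
    by (intro continuous_intros K_continuous P_rate_continuous)
  from borel_integrable_atLeastAtMost'[OF this]
  have P: "integrable lborel (\<lambda>s. indicator {0..z} s *\<^sub>R (K k0 C s *\<^sub>R P_rate \<epsilon> s p))"
    unfolding set_integrable_def .
  have "integrable lborel (\<lambda>s. indicator {0..z} s *\<^sub>R (K k0 C s *\<^sub>R jump_term \<epsilon> 1 s (Pf \<epsilon> s) p)
     + indicator {0..z} s *\<^sub>R (K k0 C s *\<^sub>R jump_term \<epsilon> 3 s (Pf \<epsilon> s) p) - indicator {0..z} s *\<^sub>R (K k0 C s *\<^sub>R P_rate \<epsilon> s p))"
    by (intro Bochner_Integration.integrable_diff Bochner_Integration.integrable_add jump_term_Pf_integrable P)
  also have "(\<lambda>s. indicator {0..z} s *\<^sub>R (K k0 C s *\<^sub>R jump_term \<epsilon> 1 s (Pf \<epsilon> s) p)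
     + indicator {0..z} s *\<^sub>R (K k0 C s *\<^sub>R jump_term \<epsilon> 3 s (Pf \<epsilon> s) p) - indicator {0..z} s *\<^sub>R (K k0 C s *\<^sub>R P_rate \<epsilon> s p))
     = (\<lambda>s. indicator {0..z} s *\<^sub>R (K k0 C s *\<^sub>R E_half \<epsilon> s p))"
  proof
    fix s
    show "indicat_real {0..z} s *\<^sub>R (K k0 C s *\<^sub>R jump_term \<epsilon> 1 s (Pf \<epsilon> s) p)
     + indicator {0..z} s *\<^sub>R (K k0 C s *\<^sub>R jump_term \<epsilon> 3 s (Pf \<epsilon> s) p) - indicator {0..z} s *\<^sub>R (K k0 C s *\<^sub>R P_rate \<epsilon> s p)
     = indicator {0..z} s *\<^sub>R (K k0 C s *\<^sub>R E_half \<epsilon> s p)"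
    proof (cases "s \<in> {0..z}")
      case True
      then have "E_half \<epsilon> s p = jump_term \<epsilon> 1 s (Pf \<epsilon> s) p + jump_term \<epsilon> 3 s (Pf \<epsilon> s) p - P_rate \<epsilon> s p"
        using jump_term_1_Pf[OF e, of s p] by simp
      then show ?thesis using True by (simp add: scaleR_add_right scaleR_diff_right)
    qed simp
  qed
  finally show ?thesis .
qed

lemma defect_integrable:
  assumes e: "0 < \<epsilon>"
  shows "integrable lborel (\<lambda>s. indicator {0..z} s *\<^sub>R defect \<epsilon> s p)"
    and "(LINT s|lborel. indicator {0..z} s *\<^sub>R defect \<epsilon> s p)
      = (LINT s|lborel. indicator {0..z} s *\<^sub>R (K k0 C s *\<^sub>R E_half \<epsilon> s p)) + (LINT s|lborel. indicator {0..z} s *\<^sub>R (K k0 C s *\<^sub>R E_half \<epsilon> s (swap p)))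
        + (\<Sum>l\<in>cross_set. sg (fst l) *\<^sub>R (LINT s|lborel. indicator {0..z} s *\<^sub>R cross \<epsilon> l s p))"
proof -
  let ?E = "\<lambda>p s. indicat_real {0..z} s *\<^sub>R (K k0 C s *\<^sub>R E_half \<epsilon> s p)"
  let ?c = "\<lambda>l s. sg (fst l) *\<^sub>R (indicat_real {0..z} s *\<^sub>R cross \<epsilon> l s p)"
  have eq: "indicat_real {0..z} s *\<^sub>R defect \<epsilon> s p = ?E p s + ?E (swap p) s + (\<Sum>l\<in>cross_set. ?c l s)" for s
  proof (cases "s \<in> {0..z}")
    case True
    then show ?thesis using defect_eq[OF e, of s p] by (simp add: scaleR_add_right)
  qed simp
  have ic: "integrable lborel (?c l)" for l by (intro integrable_scaleR_right cross_integrable)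
  have iS: "integrable lborel (\<lambda>s. \<Sum>l\<in>cross_set. ?c l s)" by (intro Bochner_Integration.integrable_sum ic)
  have ie: "integrable lborel (\<lambda>s. ?E p s + ?E (swap p) s)" by (intro Bochner_Integration.integrable_add E_half_integrable e)
  show "integrable lborel (\<lambda>s. indicator {0..z} s *\<^sub>R defect \<epsilon> s p)"
    unfolding eq by (rule Bochner_Integration.integrable_add[OF ie iS])
  have "(LINT s|lborel. indicator {0..z} s *\<^sub>R defect \<epsilon> s p) = (LINT s|lborel. ?E p s + ?E (swap p) s) + (LINT s|lborel. (\<Sum>l\<in>cross_set. ?c l s))"
    unfolding eq by (rule Bochner_Integration.integral_add[OF ie iS])
  also have "(LINT s|lborel. ?E p s + ?E (swap p) s) = (LINT s|lborel. ?E p s) + (LINT s|lborel. ?E (swap p) s)"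
    by (rule Bochner_Integration.integral_add[OF E_half_integrable[OF e] E_half_integrable[OF e]])
  also have "(LINT s|lborel. (\<Sum>l\<in>cross_set. ?c l s)) = (\<Sum>l\<in>cross_set. LINT s|lborel. ?c l s)"
    by (rule Bochner_Integration.integral_sum[OF ic])
  finally show "(LINT s|lborel. indicator {0..z} s *\<^sub>R defect \<epsilon> s p)
      = (LINT s|lborel. ?E p s) + (LINT s|lborel. ?E (swap p) s)
        + (\<Sum>l\<in>cross_set. sg (fst l) *\<^sub>R (LINT s|lborel. indicator {0..z} s *\<^sub>R cross \<epsilon> l s p))"
    by (simp only: integral_scaleR_right)
qed

lemma E_half_integral_L1:
  assumes e: "0 < \<epsilon>" and z: "0 \<le> z" "z \<le> Z"
  shows "(NNINT p. ennreal (cmod (LINT s|lborel. indicator {0..z} s *\<^sub>R (K k0 C s *\<^sub>R E_half \<epsilon> s p))))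
    \<le> ennreal ((2 * pi) ^ 8 * Z) * (ennreal (8 * X_mass Z) * (smoothing_bound 1 Z \<epsilon> + smoothing_bound (-1) Z \<epsilon>))"
proof -
  let ?b = "ennreal (8 * X_mass Z) * (smoothing_bound 1 Z \<epsilon> + smoothing_bound (-1) Z \<epsilon>)"
  have "(NNINT p. ennreal (cmod (LINT s|lborel. indicator {0..z} s *\<^sub>R (K k0 C s *\<^sub>R E_half \<epsilon> s p))))
     \<le> (NNINT p. (NNINT s. ennreal ((2 * pi) ^ 8) * ennreal (cmod (E_half \<epsilon> s p)) * indicator {0..z} s))"
  proof (intro nn_integral_mono order_trans[OF norm_integral_le_nn_integral])
    fix p s
    show "ennreal (norm (indicat_real {0..z} s *\<^sub>R (K k0 C s *\<^sub>R E_half \<epsilon> s p))) \<le> ennreal ((2 * pi) ^ 8) * ennreal (cmod (E_half \<epsilon> s p)) * indicator {0..z} s"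
      using K_bound[of s] K_nonneg[of s] by (auto simp: indicator_def ennreal_mult[symmetric] intro!: ennreal_leI mult_right_mono)
  qed
  also have "\<dots> = (NNINT s. (NNINT p. ennreal ((2 * pi) ^ 8) * ennreal (cmod (E_half \<epsilon> s p)) * indicator {0..z} s))"
    by (rule lborel_pair.Fubini') measurable
  also have "\<dots> = (NNINT s. ennreal ((2 * pi) ^ 8) * (NNINT p. ennreal (cmod (E_half \<epsilon> s p))) * indicator {0..z} s)"
    by (intro nn_integral_cong) (simp add: nn_integral_cmult nn_integral_multc)
  also have "\<dots> \<le> (NNINT s. ennreal ((2 * pi) ^ 8) * ?b * indicator {0..z} s)"
  proof (rule nn_integral_mono)
    fix s
    show "ennreal ((2 * pi) ^ 8) * (NNINT p. ennreal (cmod (E_half \<epsilon> s p))) * indicator {0..z} s \<le> ennreal ((2 * pi) ^ 8) * ?b * indicator {0..z} s"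
      using E_half_L1[OF e, of s Z] z by (cases "s \<in> {0..z}") (auto intro!: mult_left_mono)
  qed
  also have "\<dots> = ennreal ((2 * pi) ^ 8) * ?b * ennreal z" using z by (subst nn_integral_cmult_indicator) auto
  also have "\<dots> \<le> ennreal ((2 * pi) ^ 8) * ?b * ennreal Z" using z by (intro mult_left_mono ennreal_leI) auto
  also have "\<dots> = ennreal ((2 * pi) ^ 8 * Z) * ?b" using z by (simp add: ennreal_mult mult_ac)
  finally show ?thesis .
qed

text \<open>The smoothing error is small at each time, but the crossed terms are small only after integration in
  time; for this reason the defect is never estimated pointwise in time.\<close>
lemma defect_L1:
  assumes e: "0 < \<epsilon>" and z: "0 \<le> z" "z \<le> Z"
  shows "(NNINT p. ennreal (cmod (LINT s|lborel. indicator {0..z} s *\<^sub>R defect \<epsilon> s p))) \<le> defect_bound Z \<epsilon>"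
proof -
  let ?e = "\<lambda>p. LINT s|lborel. indicat_real {0..z} s *\<^sub>R (K k0 C s *\<^sub>R E_half \<epsilon> s p)"
  let ?c = "\<lambda>l p. LINT s|lborel. indicat_real {0..z} s *\<^sub>R cross \<epsilon> l s p"
  let ?b = "ennreal ((2 * pi) ^ 8 * Z) * (ennreal (8 * X_mass Z) * (smoothing_bound 1 Z \<epsilon> + smoothing_bound (-1) Z \<epsilon>))"
  have me [measurable]: "?e \<in> borel_measurable borel"
  proof -
    have "(\<lambda>(p, s). indicat_real {0..z} s *\<^sub>R (K k0 C s *\<^sub>R E_half \<epsilon> s p)) \<in> borel_measurable (borel \<Otimes>\<^sub>M lborel)"
      unfolding split_beta' by measurable
    then show ?thesis by (rule lborel.borel_measurable_lebesgue_integral)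
  qed
  have mc [measurable]: "?c l \<in> borel_measurable borel" for l
  proof -
    have "(\<lambda>(p, s). indicat_real {0..z} s *\<^sub>R cross \<epsilon> l s p) \<in> borel_measurable (borel \<Otimes>\<^sub>M lborel)"
      unfolding split_beta' by measurable
    then show ?thesis by (rule lborel.borel_measurable_lebesgue_integral)
  qed
  have sg: "\<bar>sg (fst l)\<bar> \<le> 1" if "l \<in> cross_set" for l
    using that by (auto simp: cross_set_def coeff_defs)
  have "(NNINT p. ennreal (cmod (LINT s|lborel. indicator {0..z} s *\<^sub>R defect \<epsilon> s p)))
     \<le> (NNINT p. ennreal (cmod (?e p)) + ennreal (cmod (?e (swap p))) + (\<Sum>l\<in>cross_set. ennreal (cmod (?c l p))))"
  proof (rule nn_integral_mono)
    fix p
    have "cmod (?e p + ?e (swap p) + (\<Sum>l\<in>cross_set. sg (fst l) *\<^sub>R ?c l p)) \<le> cmod (?e p) + cmod (?e (swap p)) + cmod (\<Sum>l\<in>cross_set. sg (fst l) *\<^sub>R ?c l p)"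
      using norm_triangle_ineq[of "?e p + ?e (swap p)" "\<Sum>l\<in>cross_set. sg (fst l) *\<^sub>R ?c l p"] norm_triangle_ineq[of "?e p" "?e (swap p)"] by linarith
    also have "cmod (\<Sum>l\<in>cross_set. sg (fst l) *\<^sub>R ?c l p) \<le> (\<Sum>l\<in>cross_set. cmod (?c l p))"
      by (rule order_trans[OF norm_sum]) (intro sum_mono, simp add: mult_left_le_one_le sg)
    finally have "cmod (LINT s|lborel. indicator {0..z} s *\<^sub>R defect \<epsilon> s p) \<le> cmod (?e p) + cmod (?e (swap p)) + (\<Sum>l\<in>cross_set. cmod (?c l p))"
      unfolding defect_integrable(2)[OF e] by simp
    then have "ennreal (cmod (LINT s|lborel. indicator {0..z} s *\<^sub>R defect \<epsilon> s p)) \<le> ennreal (cmod (?e p) + cmod (?e (swap p)) + (\<Sum>l\<in>cross_set. cmod (?c l p)))"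
      by (rule ennreal_leI)
    also have "\<dots> = ennreal (cmod (?e p)) + ennreal (cmod (?e (swap p))) + (\<Sum>l\<in>cross_set. ennreal (cmod (?c l p)))"
      by (simp add: sum_nonneg)
    finally show "ennreal (cmod (LINT s|lborel. indicator {0..z} s *\<^sub>R defect \<epsilon> s p)) \<le> ennreal (cmod (?e p)) + ennreal (cmod (?e (swap p))) + (\<Sum>l\<in>cross_set. ennreal (cmod (?c l p)))" .
  qed
  also have "\<dots> = (NNINT p. ennreal (cmod (?e p))) + (NNINT p. ennreal (cmod (?e (swap p)))) + (\<Sum>l\<in>cross_set. NNINT p. ennreal (cmod (?c l p)))"
    by (subst nn_integral_add, measurable, subst nn_integral_add, measurable, subst nn_integral_sum, measurable)
  also have "(NNINT p. ennreal (cmod (?e (swap p)))) = (NNINT p. ennreal (cmod (?e p)))"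
    by (rule nn_integral_swap) measurable
  also have "(NNINT p. ennreal (cmod (?e p))) + (NNINT p. ennreal (cmod (?e p))) + (\<Sum>l\<in>cross_set. NNINT p. ennreal (cmod (?c l p)))
     \<le> ?b + ?b + (\<Sum>l\<in>cross_set. cross_size Z \<epsilon> l)"
  proof (intro add_mono sum_mono E_half_integral_L1 e z)
    fix l :: "nat \<times> (bool \<times> bool) \<times> bool"
    obtain i b1 b2 b where leq: "l = (i, (b1, b2), b)" by (cases l) auto
    have "(NNINT p. ennreal (cmod (?c l p))) \<le> W \<epsilon> z (amp b1 b2 \<epsilon>) (ph (tau i b) (a1 i) (if b then a4 i else a2 i) (a2 i * a4 i))"
      unfolding leq by (rule cross_L1[OF z(1)])
    also have "\<dots> \<le> (SUP z\<in>{0..Z}. W \<epsilon> z (amp b1 b2 \<epsilon>) (ph (tau i b) (a1 i) (if b then a4 i else a2 i) (a2 i * a4 i)))"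
      by (rule SUP_upper) (use z in auto)
    finally show "(NNINT p. ennreal (cmod (?c l p))) \<le> cross_size Z \<epsilon> l"
      unfolding leq cross_size_def prod.case .
  qed
  also have "?b + ?b + (\<Sum>l\<in>cross_set. cross_size Z \<epsilon> l) = defect_bound Z \<epsilon>"
    unfolding defect_bound_def by (simp only: mult_2 distrib_left add_ac)
  finally show ?thesis .
qed

end

section \<open>The moment equation as a jump evolution\<close>

lemma integral_count_pair:
  fixes G :: "nat \<times> vec2 \<Rightarrow> complex"
  assumes "integrable (count_space {..<n} \<Otimes>\<^sub>M lborel) G"
  shows "\<And>i. i < n \<Longrightarrow> integrable lborel (\<lambda>k. G (i, k))"
    and "integral\<^sup>L (count_space {..<n} \<Otimes>\<^sub>M lborel) G = (\<Sum>i<n. LINT k|lborel. G (i, k))"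
proof -
  interpret pair_sigma_finite "count_space {..<n}" "lborel :: vec2 measure"
    by (intro pair_sigma_finite.intro sigma_finite_measure_count_space_finite lborel.sigma_finite_measure_axioms) simp
  show "\<And>i. i < n \<Longrightarrow> integrable lborel (\<lambda>k. G (i, k))"
    using AE_integrable_fst'[OF assms] by (simp add: AE_count_space)
  show "integral\<^sup>L (count_space {..<n} \<Otimes>\<^sub>M lborel) G = (\<Sum>i<n. LINT k|lborel. G (i, k))"
    using integral_fst'[OF assms] by (simp add: lebesgue_integral_count_space_finite)
qed

lemma wt_pos: "0 < wt i" by (simp add: wt_def)
lemma abs_sg: "\<bar>sg i\<bar> = 1" by (simp add: sg_def)

context scintillation begin

text \<open>The trivial jump has weight 2, so that the total mass is finite and equal to \<open>8 * lam\<close>.\<close>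
definition jump_measure :: "(nat \<times> vec2) measure" where
  "jump_measure = density (count_space {..<7} \<Otimes>\<^sub>M lborel) (\<lambda>x. ennreal (wt (fst x) * alpha (snd x)))"

lemma sets_jump_measure [measurable_cong]: "sets jump_measure = sets (count_space {..<7} \<Otimes>\<^sub>M lborel)"
  by (simp add: jump_measure_def)

lemma jump_density_measurable [measurable]: "(\<lambda>x. wt (fst x) * alpha (snd x)) \<in> borel_measurable (count_space {..<7} \<Otimes>\<^sub>M lborel)"
proof -
  have "(\<lambda>x. wt (fst x)) \<in> borel_measurable (count_space {..<7::nat} \<Otimes>\<^sub>M (lborel :: vec2 measure))"
    by (rule measurable_compose[OF measurable_fst]) simp
  moreover have "(\<lambda>x. alpha (snd x)) \<in> borel_measurable (count_space {..<7::nat} \<Otimes>\<^sub>M (lborel :: vec2 measure))"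
    by (rule measurable_compose[OF measurable_snd]) simp
  ultimately show ?thesis by (rule borel_measurable_times)
qed

lemma jump_measure_integral:
  fixes F :: "nat \<times> vec2 \<Rightarrow> complex"
  assumes "integrable jump_measure F"
  shows "\<And>i. i < 7 \<Longrightarrow> integrable lborel (\<lambda>k. (wt i * alpha k) *\<^sub>R F (i, k))"
    and "integral\<^sup>L jump_measure F = (\<Sum>i<7. LINT k|lborel. (wt i * alpha k) *\<^sub>R F (i, k))"
proof -
  have m: "F \<in> borel_measurable (count_space {..<7} \<Otimes>\<^sub>M lborel)"
    using borel_measurable_integrable[OF assms] by (simp add: jump_measure_def)
  have nn: "AE x in count_space {..<7} \<Otimes>\<^sub>M (lborel :: vec2 measure). 0 \<le> wt (fst x) * alpha (snd x)"
    by (intro always_eventually allI mult_nonneg_nonneg alpha_nonneg less_imp_le[OF wt_pos])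
  have i: "integrable (count_space {..<7} \<Otimes>\<^sub>M lborel) (\<lambda>x. (wt (fst x) * alpha (snd x)) *\<^sub>R F x)"
    using assms unfolding jump_measure_def integrable_density[OF m jump_density_measurable nn] .
  show "\<And>i. i < 7 \<Longrightarrow> integrable lborel (\<lambda>k. (wt i * alpha k) *\<^sub>R F (i, k))"
    using integral_count_pair(1)[OF i] by simp
  show "integral\<^sup>L jump_measure F = (\<Sum>i<7. LINT k|lborel. (wt i * alpha k) *\<^sub>R F (i, k))"
    unfolding jump_measure_def integral_density[OF m jump_density_measurable nn]
    using integral_count_pair(2)[OF i] by simp
qed

lemma finite_jump_measure: "finite_measure jump_measure"
proof
  have "emeasure jump_measure (space jump_measure) = (\<integral>\<^sup>+x. ennreal (wt (fst x) * alpha (snd x)) \<partial>(count_space {..<7} \<Otimes>\<^sub>M lborel))"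
    unfolding jump_measure_def by (subst emeasure_density) (auto simp: space_pair_measure intro!: nn_integral_cong split: split_indicator)
  also have "\<dots> = (\<integral>\<^sup>+i. (NNINT k. ennreal (wt (fst (i, k)) * alpha (snd (i, k)))) \<partial>count_space {..<7})"
    by (rule lborel.nn_integral_fst[symmetric]) (use measurable_compose[OF jump_density_measurable measurable_ennreal] in simp)
  also have "\<dots> = (\<Sum>i<7. (NNINT k. ennreal (wt i * alpha k)))"
    by (subst nn_integral_count_space_finite) simp_all
  also have "\<dots> = (\<Sum>i<7. ennreal (wt i) * ennreal lam)"
    using wt_pos alpha_nonneg by (simp add: ennreal_mult less_imp_le nn_integral_cmult alpha_nn_integral)
  also have "\<dots> < \<top>" by (simp add: ennreal_mult_less_top)
  finally show "emeasure jump_measure (space jump_measure) \<noteq> \<infinity>" by simp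
qed

lemma jump_pair_measurable: "(\<lambda>j. jump (fst j) (snd j)) \<in> borel_measurable jump_measure"
proof -
  have c: "(\<lambda>x. a (fst x)) \<in> borel_measurable jump_measure" for a :: "nat \<Rightarrow> real"
  proof -
    have "fst \<in> jump_measure \<rightarrow>\<^sub>M count_space {..<7}" by measurable
    from measurable_compose[OF this, of a borel] show ?thesis by simp
  qed
  have k: "snd \<in> borel_measurable jump_measure"
  proof -
    have "snd \<in> jump_measure \<rightarrow>\<^sub>M (lborel :: vec2 measure)" by measurable
    then show ?thesis by simp
  qed
  show ?thesis unfolding jump_def by (intro borel_measurable_Pair borel_measurable_scaleR c k borel_measurable_const)
qed

lemma jph_pair_measurable:
  assumes i: "i \<in> N \<rightarrow>\<^sub>M count_space {..<7}" and [measurable]: "f \<in> borel_measurable N" "g \<in> borel_measurable N"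
  shows "(\<lambda>y. jph (i y) (f y) (g y)) \<in> borel_measurable N"
proof -
  have [measurable]: "(\<lambda>x. a1 (i x)) \<in> borel_measurable N" "(\<lambda>x. a2 (i x)) \<in> borel_measurable N" "(\<lambda>x. a4 (i x)) \<in> borel_measurable N"
    by (rule measurable_compose[OF i], simp)+
  note phase_measurable_components[OF assms(2), measurable]
  show ?thesis unfolding jph_def split_beta' by measurable
qed

lemma jump_cauchy_approx:
  assumes e: "0 < \<epsilon>"
  shows "jump_cauchy jump_measure (\<lambda>j. jump (fst j) (snd j)) (\<lambda>p j. jph (fst j) p (snd j) / (\<epsilon> * k0))
    (\<lambda>j. complex_of_real (sg (fst j))) (approx \<epsilon> 0) ((2 * pi) ^ 8 * (9 * amp_max \<epsilon> 0))"
proof (intro jump_cauchy.intro jump_evolution.intro jump_cauchy_axioms.intro)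
  show "finite_measure jump_measure" by (rule finite_jump_measure)
  show "(\<lambda>j. jump (fst j) (snd j)) \<in> borel_measurable jump_measure" by (rule jump_pair_measurable)
  have "(\<lambda>x. jph (fst (snd x)) (fst x) (snd (snd x))) \<in> borel_measurable (borel \<Otimes>\<^sub>M jump_measure)"
  proof (rule jph_pair_measurable)
    have "fst \<in> jump_measure \<rightarrow>\<^sub>M count_space {..<7}" by measurable
    then show "(\<lambda>x. fst (snd x)) \<in> (borel :: phase measure) \<Otimes>\<^sub>M jump_measure \<rightarrow>\<^sub>M count_space {..<7}"
      by (rule measurable_compose[OF measurable_snd])
    have "snd \<in> jump_measure \<rightarrow>\<^sub>M (lborel :: vec2 measure)" by measurable
    then have "snd \<in> borel_measurable jump_measure" by simp
    then show "(\<lambda>x. snd (snd x)) \<in> borel_measurable ((borel :: phase measure) \<Otimes>\<^sub>M jump_measure)"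
      by (rule measurable_compose[OF measurable_snd])
  qed (rule measurable_fst)
  then show "(\<lambda>(p, j). jph (fst j) p (snd j) / (\<epsilon> * k0)) \<in> borel_measurable (borel \<Otimes>\<^sub>M jump_measure)"
    unfolding split_beta' by (rule borel_measurable_divide) simp
  have "fst \<in> jump_measure \<rightarrow>\<^sub>M count_space {..<7}" by measurable
  then have sg_m: "(\<lambda>j. sg (fst j)) \<in> borel_measurable jump_measure" by (rule measurable_compose) simp
  have "(\<lambda>x. complex_of_real x) \<in> borel_measurable borel"
    by (rule borel_measurable_continuous_onI) (intro continuous_intros)
  then show "(\<lambda>j. complex_of_real (sg (fst j))) \<in> borel_measurable jump_measure"
    by (rule measurable_compose[OF sg_m])
  show "cmod (complex_of_real (sg (fst j))) \<le> 1" for j :: "nat \<times> vec2" by (simp add: abs_sg)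
  show m: "approx \<epsilon> 0 \<in> borel_measurable borel" using approx_measurable[of "\<lambda>_. 0" borel "\<lambda>p. p" \<epsilon>] by simp
  show "cmod (approx \<epsilon> 0 p) \<le> (2 * pi) ^ 8 * (9 * amp_max \<epsilon> 0)" for p by (rule approx_bound) auto
  have "(NNINT p. ennreal (cmod (approx \<epsilon> 0 p))) < \<infinity>"
    using approx_L1[OF e, of 0 0] by (auto intro: order.strict_trans1[OF _ ennreal_less_top])
  then show "integrable lborel (approx \<epsilon> 0)" using m by (intro integrableI_bounded) auto
qed

text \<open>Splitting the integral over \<open>k\<close> into seven integrals requires the integrability of each of them; for an
  arbitrary square integrable \<open>\<psi>\<close> this holds only at almost every point.\<close>
lemma moment_operator_eq_gen_sum:
  assumes i: "\<And>i. i < 7 \<Longrightarrow> integrable lborel (\<lambda>k. alpha k *\<^sub>R (\<psi> (p - jump i k) * cis (s * (jph i p k / (\<epsilon> * k0)))))"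
  shows "moment_operator k0 C \<epsilon> s \<psi> p = gen_sum \<epsilon> s \<psi> p"
proof -
  obtain \<xi>1 \<xi>2 \<zeta>1 \<zeta>2 where p: "p = (\<xi>1, \<xi>2, \<zeta>1, \<zeta>2)" by (cases p)
  let ?a = "complex_of_real (k0\<^sup>2 / (4 * (2 * pi)\<^sup>2))"
  let ?f = "\<lambda>i k. alpha k *\<^sub>R (\<psi> (p - jump i k) * cis (s * (jph i p k / (\<epsilon> * k0))))"
  have sum7: "(\<Sum>i<7. f i) = f 0 + (f 1 + (f 2 + (f 3 + (f 4 + (f 5 + f 6)))))" for f :: "nat \<Rightarrow> complex"
  proof -
    have "{..<7::nat} = {0, 1, 2, 3, 4, 5, 6}" by auto
    then show ?thesis by simp
  qed
  have co: "sg 0 * wt 0 = -1 * 2" "sg 1 * wt 1 = 1 * 1" "sg 2 * wt 2 = 1 * 1" "sg 3 * wt 3 = 1 * 1" "sg 4 * wt 4 = 1 * 1"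
    "sg 5 * wt 5 = -1 * 1" "sg 6 * wt 6 = -1 * 1"
    by (simp_all add: sg_def wt_def)
  have c0: "cis (s / (\<epsilon> * k0) * 0) = 1" by simp
  have j: "p - jump 0 k = (\<xi>1, \<xi>2, \<zeta>1, \<zeta>2)" "p - jump 1 k = (\<xi>1 - k, \<xi>2 - k, \<zeta>1, \<zeta>2)"
    "p - jump 2 k = (\<xi>1 - k, \<xi>2, \<zeta>1, \<zeta>2 - k)" "p - jump 3 k = (\<xi>1 + k, \<xi>2 - k, \<zeta>1, \<zeta>2)"
    "p - jump 4 k = (\<xi>1 + k, \<xi>2, \<zeta>1, \<zeta>2 - k)" "p - jump 5 k = (\<xi>1, \<xi>2 - k, \<zeta>1, \<zeta>2 - k)"
    "p - jump 6 k = (\<xi>1, \<xi>2 - k, \<zeta>1, \<zeta>2 + k)" for k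
    unfolding p by (simp_all add: jump_def coeff_defs)
  have ph: "jph 0 p k = 0" "jph 1 p k = k \<bullet> (\<zeta>2 + \<zeta>1)" "jph 2 p k = k \<bullet> (\<xi>2 + \<zeta>1)" "jph 3 p k = k \<bullet> (\<zeta>2 - \<zeta>1)"
    "jph 4 p k = k \<bullet> (\<xi>2 - \<zeta>1)" "jph 5 p k = k \<bullet> (\<zeta>2 + \<xi>2) - (norm k)\<^sup>2" "jph 6 p k = k \<bullet> (\<zeta>2 - \<xi>2) + (norm k)\<^sup>2" for k
    unfolding p by (simp_all add: jph_def coeff_defs inner_add_right inner_diff_right)
  have th: "s * (x / (\<epsilon> * k0)) = s / (\<epsilon> * k0) * x" for x by simp
  have lin: "?a * (complex_of_real c * (- 2 * u0 + u1 + u2 + u3 + u4 - u5 - u6))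
     = (-1 * 2) *\<^sub>R (b *\<^sub>R (u0 * 1)) + ((1 * 1) *\<^sub>R (b *\<^sub>R u1) + ((1 * 1) *\<^sub>R (b *\<^sub>R u2) + ((1 * 1) *\<^sub>R (b *\<^sub>R u3)
       + ((1 * 1) *\<^sub>R (b *\<^sub>R u4) + ((-1 * 1) *\<^sub>R (b *\<^sub>R u5) + (-1 * 1) *\<^sub>R (b *\<^sub>R u6))))))"
    if "b = k0\<^sup>2 / (4 * (2 * pi)\<^sup>2) * c" for b c :: real and u0 u1 u2 u3 u4 u5 u6 :: complex
  proof -
    have cb: "?a * complex_of_real c = complex_of_real b" unfolding that by (rule of_real_mult[symmetric])
    have ring: "B * (- 2 * u0 + u1 + u2 + u3 + u4 - u5 - u6)
     = (-1 * 2) *\<^sub>R (B * (u0 * 1)) + ((1 * 1) *\<^sub>R (B * u1) + ((1 * 1) *\<^sub>R (B * u2) + ((1 * 1) *\<^sub>R (B * u3)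
       + ((1 * 1) *\<^sub>R (B * u4) + ((-1 * 1) *\<^sub>R (B * u5) + (-1 * 1) *\<^sub>R (B * u6))))))" for B :: complex
      by (simp add: scaleR_conv_of_real algebra_simps)
    show ?thesis using ring[of "complex_of_real b"] by (simp only: scaleR_conv_of_real[of b] cb[symmetric] mult.assoc)
  qed
  have "gen_sum \<epsilon> s \<psi> p = (\<Sum>i<7. LINT k|lborel. (sg i * wt i) *\<^sub>R ?f i k)"
    unfolding gen_sum_def jump_term_def by (simp only: integral_scaleR_right)
  also have "\<dots> = (LINT k|lborel. (\<Sum>i<7. (sg i * wt i) *\<^sub>R ?f i k))"
    by (rule Bochner_Integration.integral_sum[symmetric], rule integrable_scaleR_right, rule i, simp)
  also have "\<dots> = moment_operator k0 C \<epsilon> s \<psi> (\<xi>1, \<xi>2, \<zeta>1, \<zeta>2)"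
    unfolding moment_operator_def prod.case integral_mult_right_zero[symmetric]
  proof (rule Bochner_Integration.integral_cong[OF refl], rule sym)
    fix k
    show "?a * (C_hat C k * (- 2 * \<psi> (\<xi>1, \<xi>2, \<zeta>1, \<zeta>2)
        + \<psi> (\<xi>1 - k, \<xi>2 - k, \<zeta>1, \<zeta>2) * cis (s / (\<epsilon> * k0) * (k \<bullet> (\<zeta>2 + \<zeta>1)))
        + \<psi> (\<xi>1 - k, \<xi>2, \<zeta>1, \<zeta>2 - k) * cis (s / (\<epsilon> * k0) * (k \<bullet> (\<xi>2 + \<zeta>1)))
        + \<psi> (\<xi>1 + k, \<xi>2 - k, \<zeta>1, \<zeta>2) * cis (s / (\<epsilon> * k0) * (k \<bullet> (\<zeta>2 - \<zeta>1)))
        + \<psi> (\<xi>1 + k, \<xi>2, \<zeta>1, \<zeta>2 - k) * cis (s / (\<epsilon> * k0) * (k \<bullet> (\<xi>2 - \<zeta>1)))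
        - \<psi> (\<xi>1, \<xi>2 - k, \<zeta>1, \<zeta>2 - k) * cis (s / (\<epsilon> * k0) * (k \<bullet> (\<zeta>2 + \<xi>2) - (norm k)\<^sup>2))
        - \<psi> (\<xi>1, \<xi>2 - k, \<zeta>1, \<zeta>2 + k) * cis (s / (\<epsilon> * k0) * (k \<bullet> (\<zeta>2 - \<xi>2) + (norm k)\<^sup>2))))
      = (\<Sum>i<7. (sg i * wt i) *\<^sub>R ?f i k)"
      unfolding C_hat_eq lin[OF alpha_def] sum7 co j ph c0 th ..
  qed
  finally show ?thesis by (simp only: p[symmetric])
qed

end

locale scintillation_scaled = scintillation C k0 r0 for C k0 r0 +
  fixes \<epsilon> :: real
  assumes eps: "0 < \<epsilon>"
begin

sublocale moment: jump_cauchy jump_measure "\<lambda>j. jump (fst j) (snd j)" "\<lambda>p j. jph (fst j) p (snd j) / (\<epsilon> * k0)"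
    "\<lambda>j. complex_of_real (sg (fst j))" "approx \<epsilon> 0" "(2 * pi) ^ 8 * (9 * amp_max \<epsilon> 0)"
  by (rule jump_cauchy_approx[OF eps])

lemma gen_eq_gen_sum:
  assumes "integrable jump_measure (\<lambda>j. complex_of_real (sg (fst j)) * \<psi> (p - jump (fst j) (snd j)) * cis (s * (jph (fst j) p (snd j) / (\<epsilon> * k0))))"
  shows "moment.gen s \<psi> p = gen_sum \<epsilon> s \<psi> p"
    and "\<And>i. i < 7 \<Longrightarrow> integrable lborel (\<lambda>k. alpha k *\<^sub>R (\<psi> (p - jump i k) * cis (s * (jph i p k / (\<epsilon> * k0)))))"
proof -
  let ?f = "\<lambda>i k. alpha k *\<^sub>R (\<psi> (p - jump i k) * cis (s * (jph i p k / (\<epsilon> * k0))))"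
  have assoc: "(w * a) *\<^sub>R (complex_of_real g * x * y) = (g * w) *\<^sub>R (a *\<^sub>R (x * y))" for w a g :: real and x y :: complex
    by (simp add: scaleR_conv_of_real mult_ac)
  have eq: "(wt i * alpha k) *\<^sub>R (complex_of_real (sg (fst (i, k))) * \<psi> (p - jump (fst (i, k)) (snd (i, k))) * cis (s * (jph (fst (i, k)) p (snd (i, k)) / (\<epsilon> * k0))))
     = (sg i * wt i) *\<^sub>R ?f i k" for i k
    unfolding fst_conv snd_conv by (rule assoc)
  have "moment.gen s \<psi> p = (\<Sum>i<7. LINT k|lborel. (sg i * wt i) *\<^sub>R ?f i k)"
    unfolding moment.gen_def jump_measure_integral(2)[OF assms] eq ..
  also have "\<dots> = gen_sum \<epsilon> s \<psi> p" unfolding gen_sum_def jump_term_def integral_scaleR_right ..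
  finally show "moment.gen s \<psi> p = gen_sum \<epsilon> s \<psi> p" .
  fix i :: nat assume "i < 7"
  from jump_measure_integral(1)[OF assms this]
  have "integrable lborel (\<lambda>k. (sg i * wt i) *\<^sub>R ?f i k)" unfolding eq .
  then have int: "integrable lborel (\<lambda>k. inverse (sg i * wt i) *\<^sub>R ((sg i * wt i) *\<^sub>R ?f i k))" by (rule integrable_scaleR_right)
  have canc: "inverse w *\<^sub>R (w *\<^sub>R x) = x" if "w \<noteq> 0" for w :: real and x :: complex using that by simp
  have w0: "sg i * wt i \<noteq> 0" using wt_pos[of i] abs_sg[of i] by auto
  show "integrable lborel (?f i)" using int unfolding canc[OF w0] .
qed

lemma AE_moment_operator:
  assumes "L2 \<psi>"
  shows "AE p in lborel. moment_operator k0 C \<epsilon> s \<psi> p = moment.gen s \<psi> p"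
  using moment.AE_integrable_integrand[OF assms, of s]
proof eventually_elim
  case (elim p)
  have "moment_operator k0 C \<epsilon> s \<psi> p = gen_sum \<epsilon> s \<psi> p"
    by (rule moment_operator_eq_gen_sum) (rule gen_eq_gen_sum(2)[OF elim])
  then show ?case unfolding gen_eq_gen_sum(1)[OF elim] .
qed

lemma solution_evolves:
  assumes "fourth_moment_solution k0 r0 C \<epsilon> \<mu>"
  shows "moment.evolves \<mu>"
  unfolding moment.evolves_def
proof (intro conjI allI impI)
  fix z :: real assume z: "0 \<le> z"
  note sol = assms[unfolded fourth_moment_solution_def]
  have sq: "square_integrable (\<mu> z)" by (rule sol[THEN conjunct1, THEN spec, THEN mp, OF z])
  then show L: "L2 (\<mu> z)" by (simp add: square_integrable_def L2_def)
  have lim: "((\<lambda>s. NNINT p. ennreal ((cmod ((\<mu> s p - \<mu> z p) /\<^sub>R (s - z) - moment_operator k0 C \<epsilon> z (\<mu> z) p))\<^sup>2)) \<longlongrightarrow> 0) (at z within {0..})"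
    by (rule sol[THEN conjunct2, THEN conjunct2, THEN spec, THEN mp, OF z])
  have eq: "(NNINT p. ennreal ((cmod ((\<mu> s p - \<mu> z p) /\<^sub>R (s - z) - moment_operator k0 C \<epsilon> z (\<mu> z) p))\<^sup>2))
     = (NNINT p. ennreal ((cmod ((\<mu> s p - \<mu> z p) /\<^sub>R (s - z) - moment.gen z (\<mu> z) p))\<^sup>2))" for s
  proof (rule nn_integral_cong_AE)
    show "AE p in lborel. ennreal ((cmod ((\<mu> s p - \<mu> z p) /\<^sub>R (s - z) - moment_operator k0 C \<epsilon> z (\<mu> z) p))\<^sup>2)
       = ennreal ((cmod ((\<mu> s p - \<mu> z p) /\<^sub>R (s - z) - moment.gen z (\<mu> z) p))\<^sup>2)"
      using AE_moment_operator[OF L, of z] by eventually_elim simp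
  qed
  show "((\<lambda>s. NNINT p. ennreal ((cmod ((\<mu> s p - \<mu> z p) /\<^sub>R (s - z) - moment.gen z (\<mu> z) p))\<^sup>2)) \<longlongrightarrow> 0) (at z within {0..})"
    using lim unfolding eq .
qed

text \<open>A solution in \<open>L2\<close> is unique, so it agrees with the Picard series.\<close>
lemma solution_AE_eq:
  assumes sol: "fourth_moment_solution k0 r0 C \<epsilon> \<mu>" and z: "0 \<le> z"
  shows "AE p in lborel. \<mu> z p = moment.sol z p"
proof (rule moment.evolves_unique[OF solution_evolves[OF sol] moment.sol_evolves _ z])
  have "AE (\<xi>1, \<xi>2, \<zeta>1, \<zeta>2) in lborel. \<mu> 0 (\<xi>1, \<xi>2, \<zeta>1, \<zeta>2) =
        complex_of_real ((2 * pi) ^ 8 * phi r0 \<epsilon> \<xi>1 * phi r0 \<epsilon> \<xi>2 * phi r0 \<epsilon> \<zeta>1 * phi r0 \<epsilon> \<zeta>2)"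
    by (rule sol[unfolded fourth_moment_solution_def, THEN conjunct2, THEN conjunct1])
  then show "AE p in lborel. \<mu> 0 p = moment.sol 0 p"
  proof eventually_elim
    case (elim p)
    obtain \<xi>1 \<xi>2 \<zeta>1 \<zeta>2 where p: "p = (\<xi>1, \<xi>2, \<zeta>1, \<zeta>2)" by (cases p)
    show ?case using elim unfolding moment.sol_0 approx_0 p amp_FF prod.case
      by (simp add: scaleR_conv_of_real mult.assoc)
  qed
qed

text \<open>Both functions are integrated in time from the same initial value; the approximation satisfies the
  equation with its defect as a source.\<close>
lemma error_equation:
  assumes z: "0 \<le> z"
  shows "moment.sol z p - approx \<epsilon> z p
    = (LINT s|lborel. indicator {0..z} s *\<^sub>R moment.gen s (\<lambda>p. moment.sol s p - approx \<epsilon> s p) p)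
      + (LINT s|lborel. indicator {0..z} s *\<^sub>R defect \<epsilon> s p)"
proof -
  let ?Bs = "(2 * pi) ^ 8 * (9 * amp_max \<epsilon> 0) * exp (moment.mass * z)" and ?Ba = "(2 * pi) ^ 8 * (9 * amp_max \<epsilon> z)"
  have B0: "0 \<le> (2 * pi) ^ 8 * (9 * amp_max \<epsilon> 0)" by (rule order_trans[OF norm_ge_zero moment.u0_bound])
  have bs: "cmod (moment.sol s q) \<le> ?Bs" if "0 \<le> s" "s \<le> z" for s q
  proof -
    have "exp (moment.mass * s) \<le> exp (moment.mass * z)" using that moment.mass_nonneg by (simp add: mult_left_mono)
    then show ?thesis by (rule order_trans[OF moment.sol_bound[OF that(1)] mult_left_mono[OF _ B0]])
  qed
  have ba: "cmod (approx \<epsilon> s q) \<le> ?Ba" if "0 \<le> s" "s \<le> z" for s q by (rule approx_bound[OF that])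
  have ma: "approx \<epsilon> s \<in> borel_measurable borel" for s using approx_measurable[of "\<lambda>_. s" borel "\<lambda>p. p" \<epsilon>] by simp
  have split: "moment.gen s (\<lambda>p. moment.sol s p - approx \<epsilon> s p) p + defect \<epsilon> s p = moment.gen s (moment.sol s) p - approx_rate \<epsilon> s p"
    if s: "0 \<le> s" "s \<le> z" for s
  proof -
    have "moment.gen s (approx \<epsilon> s) p = gen_sum \<epsilon> s (approx \<epsilon> s) p"
      by (rule gen_eq_gen_sum(1)[OF moment.integrable_integrand[OF ma ba[OF s]]])
    moreover have "moment.gen s (\<lambda>p. moment.sol s p - approx \<epsilon> s p) p = moment.gen s (moment.sol s) p - moment.gen s (approx \<epsilon> s) p"
      by (rule moment.gen_diff[OF moment.sol_measurable1 bs[OF s] ma ba[OF s]])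
    ultimately show ?thesis by (simp add: defect_def)
  qed
  have igs: "integrable lborel (\<lambda>s. indicator {0..z} s *\<^sub>R moment.gen s (moment.sol s) p)"
  proof (rule integrable_Icc_bounded)
    show "(\<lambda>s. moment.gen s (moment.sol s) p) \<in> borel_measurable borel" by (rule moment.gen_sol_measurable) simp_all
    show "cmod (moment.gen s (moment.sol s) p) \<le> moment.mass * ?Bs" if "0 \<le> s" "s \<le> z" for s
      by (rule moment.gen_bound[OF bs[OF that]])
  qed
  note iar = approx_increment[OF z, of \<epsilon> p]
  have id: "integrable lborel (\<lambda>s. indicator {0..z} s *\<^sub>R defect \<epsilon> s p)" by (rule defect_integrable(1)[OF eps])
  have sum: "indicator {0..z} s *\<^sub>R moment.gen s (\<lambda>p. moment.sol s p - approx \<epsilon> s p) p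
     = indicator {0..z} s *\<^sub>R moment.gen s (moment.sol s) p - indicator {0..z} s *\<^sub>R approx_rate \<epsilon> s p - indicator {0..z} s *\<^sub>R defect \<epsilon> s p" for s
  proof (cases "s \<in> {0..z}")
    case True
    then have s: "0 \<le> s" "s \<le> z" by auto
    have "moment.gen s (\<lambda>p. moment.sol s p - approx \<epsilon> s p) p = moment.gen s (moment.sol s) p - approx_rate \<epsilon> s p - defect \<epsilon> s p"
      unfolding split[OF s, symmetric] by (rule add_diff_cancel_right'[symmetric])
    then show ?thesis using True by simp
  qed simp
  have "(LINT s|lborel. indicator {0..z} s *\<^sub>R moment.gen s (\<lambda>p. moment.sol s p - approx \<epsilon> s p) p)
    = (LINT s|lborel. indicator {0..z} s *\<^sub>R moment.gen s (moment.sol s) p) - (LINT s|lborel. indicator {0..z} s *\<^sub>R approx_rate \<epsilon> s p)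
      - (LINT s|lborel. indicator {0..z} s *\<^sub>R defect \<epsilon> s p)"
    unfolding sum
    by (simp only: Bochner_Integration.integral_diff[OF Bochner_Integration.integrable_diff[OF igs iar(1)] id] Bochner_Integration.integral_diff[OF igs iar(1)])
  then show ?thesis unfolding moment.sol_integral_equation[OF z, of p] iar(2)[symmetric] by (simp add: algebra_simps)
qed

lemma error_step:
  assumes z: "0 \<le> z" "z \<le> Z"
  shows "(NNINT p. ennreal (cmod (moment.sol z p - approx \<epsilon> z p)))
    \<le> ennreal moment.mass * (NNINT s. (NNINT p. ennreal (cmod (moment.sol s p - approx \<epsilon> s p))) * indicator {0..z} s)
      + defect_bound Z \<epsilon>"
proof -
  let ?g = "\<lambda>s p. moment.gen s (\<lambda>p. moment.sol s p - approx \<epsilon> s p) p"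
  let ?I = "\<lambda>p. LINT s|lborel. indicat_real {0..z} s *\<^sub>R ?g s p" and ?D = "\<lambda>p. LINT s|lborel. indicat_real {0..z} s *\<^sub>R defect \<epsilon> s p"
  let ?w = "\<lambda>s. NNINT p. ennreal (cmod (moment.sol s p - approx \<epsilon> s p))"
  have mg: "(\<lambda>x. ?g (snd x) (fst x)) \<in> borel_measurable ((borel :: phase measure) \<Otimes>\<^sub>M lborel)"
    by (rule moment.gen_measurable) measurable
  have mg': "(\<lambda>x. ?g (fst x) (snd x)) \<in> borel_measurable (lborel \<Otimes>\<^sub>M (borel :: phase measure))"
    by (rule moment.gen_measurable) measurable
  have mi: "(\<lambda>x. indicat_real {0..z} (snd x)) \<in> borel_measurable ((borel :: phase measure) \<Otimes>\<^sub>M lborel)"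
    by (rule indicator_Icc_measurable)
  have [measurable]: "?I \<in> borel_measurable borel"
  proof -
    have "(\<lambda>(p, s). indicat_real {0..z} s *\<^sub>R ?g s p) \<in> borel_measurable ((borel :: phase measure) \<Otimes>\<^sub>M lborel)"
      unfolding split_beta' by (intro borel_measurable_scaleR mg mi)
    then show ?thesis by (rule lborel.borel_measurable_lebesgue_integral)
  qed
  have e: "moment.sol z p - approx \<epsilon> z p = ?I p + ?D p" for p by (rule error_equation[OF z(1)])
  have [measurable]: "?D \<in> borel_measurable borel"
  proof -
    have D: "?D = (\<lambda>p. (moment.sol z p - approx \<epsilon> z p) - ?I p)" unfolding e by simp
    show ?thesis unfolding D by measurable
  qed
  have "?w z \<le> (NNINT p. ennreal (cmod (?I p)) + ennreal (cmod (?D p)))"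
    unfolding e by (intro nn_integral_mono) (simp add: ennreal_plus[symmetric] ennreal_leI norm_triangle_ineq del: ennreal_plus)
  also have "\<dots> = (NNINT p. ennreal (cmod (?I p))) + (NNINT p. ennreal (cmod (?D p)))"
    by (rule nn_integral_add) measurable
  also have "\<dots> \<le> ennreal moment.mass * (NNINT s. ?w s * indicator {0..z} s) + defect_bound Z \<epsilon>"
  proof (rule add_mono[OF _ defect_L1[OF eps z]])
    have "(NNINT p. ennreal (cmod (?I p))) \<le> (NNINT p. (NNINT s. ennreal (cmod (?g s p)) * indicator {0..z} s))"
    proof (intro nn_integral_mono order_trans[OF norm_integral_le_nn_integral])
      fix p s
      show "ennreal (norm (indicat_real {0..z} s *\<^sub>R ?g s p)) \<le> ennreal (cmod (?g s p)) * indicator {0..z} s"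
        by (simp add: indicator_def)
    qed
    also have "\<dots> = (NNINT s. (NNINT p. ennreal (cmod (?g s p)) * indicator {0..z} s))"
    proof (rule lborel_pair.Fubini')
      have "(\<lambda>x. ennreal (cmod (?g (fst x) (snd x)))) \<in> borel_measurable (lborel \<Otimes>\<^sub>M (lborel :: phase measure))"
        using mg' by (intro measurable_compose[OF _ measurable_ennreal] borel_measurable_norm) simp
      moreover have "(\<lambda>x. indicator {0..z} (fst x) :: ennreal) \<in> borel_measurable (lborel \<Otimes>\<^sub>M (lborel :: phase measure))"
        by (rule measurable_compose[OF measurable_fst borel_measurable_indicator]) simp
      ultimately show "(\<lambda>(s, p). ennreal (cmod (?g s p)) * indicator {0..z} s) \<in> borel_measurable (lborel \<Otimes>\<^sub>M (lborel :: phase measure))"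
        unfolding split_beta' by (rule borel_measurable_times_ennreal)
    qed
    also have "\<dots> \<le> (NNINT s. ennreal moment.mass * (?w s * indicator {0..z} s))"
    proof (rule nn_integral_mono)
      fix s :: real
      have [measurable]: "(\<lambda>p. moment.sol s p - approx \<epsilon> s p) \<in> borel_measurable borel" by measurable
      have [measurable]: "?g s \<in> borel_measurable borel" by (rule moment.gen_measurable1) measurable
      have "(NNINT p. ennreal (cmod (?g s p)) * indicator {0..z} s) = (NNINT p. ennreal (cmod (?g s p))) * indicator {0..z} s"
        by (rule nn_integral_multc) measurable
      also have "\<dots> \<le> (ennreal moment.mass * ?w s) * indicator {0..z} s"
        by (intro mult_right_mono moment.gen_L1) auto
      finally show "(NNINT p. ennreal (cmod (?g s p)) * indicator {0..z} s) \<le> ennreal moment.mass * (?w s * indicator {0..z} s)"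
        by (simp only: mult.assoc)
    qed
    also have "\<dots> = ennreal moment.mass * (NNINT s. ?w s * indicator {0..z} s)"
      by (rule nn_integral_cmult) measurable
    finally show "(NNINT p. ennreal (cmod (?I p))) \<le> ennreal moment.mass * (NNINT s. ?w s * indicator {0..z} s)" .
  qed
  finally show ?thesis .
qed

text \<open>Gronwall in \<open>L1\<close>: the generator is bounded by its mass, and the integrated defect by \<open>defect_bound\<close>.\<close>
lemma error_L1:
  assumes z: "0 \<le> z" "z \<le> Z" and g: "0 \<le> \<gamma>" "defect_bound Z \<epsilon> \<le> ennreal \<gamma>"
  shows "(NNINT p. ennreal (cmod (moment.sol z p - approx \<epsilon> z p))) \<le> ennreal (2 * \<gamma> * exp ((2 * moment.mass + 1) * z))"
proof -
  define w :: "unit \<Rightarrow> real \<Rightarrow> ennreal" where "w i s = (NNINT p. ennreal (cmod (moment.sol s p - approx \<epsilon> s p)))" for i s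
  have Z: "0 \<le> Z" using z by simp
  have "w () z \<le> ennreal (2 * \<gamma> * exp ((2 * moment.mass + 1) * z))"
  proof (rule gronwall_family[where w=w and i="()" and W="exp (moment.mass * Z) * moment.u0_norm + (2 * pi) ^ 8 * (36 * (X_mass Z)\<^sup>2)",
        OF moment.mass_nonneg g(1) _ _ _ z])
    let ?W = "exp (moment.mass * Z) * moment.u0_norm + (2 * pi) ^ 8 * (36 * (X_mass Z)\<^sup>2)"
    show "0 \<le> ?W" using moment.u0_norm(2) by simp
    fix i s assume s: "0 \<le> s" "s \<le> Z"
    have "w i s \<le> (NNINT p. ennreal (cmod (moment.sol s p)) + ennreal (cmod (approx \<epsilon> s p)))"
      unfolding w_def by (intro nn_integral_mono) (simp add: ennreal_plus[symmetric] ennreal_leI norm_triangle_ineq4 del: ennreal_plus)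
    also have "\<dots> = (NNINT p. ennreal (cmod (moment.sol s p))) + (NNINT p. ennreal (cmod (approx \<epsilon> s p)))"
      by (rule nn_integral_add) measurable
    also have "\<dots> \<le> ennreal (exp (moment.mass * Z) * moment.u0_norm) + ennreal ((2 * pi) ^ 8 * (36 * (X_mass Z)\<^sup>2))"
    proof (rule add_mono[OF _ approx_L1[OF eps s]])
      have "exp (moment.mass * s) \<le> exp (moment.mass * Z)" using s moment.mass_nonneg by (simp add: mult_left_mono)
      then show "(NNINT p. ennreal (cmod (moment.sol s p))) \<le> ennreal (exp (moment.mass * Z) * moment.u0_norm)"
        by (rule order_trans[OF moment.sol_L1'[OF s(1)] ennreal_leI[OF mult_right_mono[OF _ moment.u0_norm(2)]]])
    qed
    also have "\<dots> = ennreal ?W" using moment.u0_norm(2) by (intro ennreal_plus[symmetric]) auto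
    finally show "w i s \<le> ennreal ?W" .
  next
    fix D i s
    assume D: "0 \<le> D" "\<And>(i::unit) s. 0 \<le> s \<Longrightarrow> s \<le> Z \<Longrightarrow> w i s \<le> ennreal (D * exp ((2 * moment.mass + 1) * s))" and s: "0 \<le> s" "s \<le> Z"
    have "w i s \<le> ennreal moment.mass * (NNINT t. w () t * indicator {0..s} t) + defect_bound Z \<epsilon>"
      unfolding w_def by (rule error_step[OF s])
    also have "\<dots> \<le> ennreal moment.mass * (NNINT t. ennreal (D * exp ((2 * moment.mass + 1) * t)) * indicator {0..s} t) + ennreal \<gamma>"
    proof (intro add_mono mult_left_mono nn_integral_mono g(2))
      fix t
      show "w () t * indicator {0..s} t \<le> ennreal (D * exp ((2 * moment.mass + 1) * t)) * indicator {0..s} t"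
        using D(2)[of t "()"] s by (auto simp: indicator_def)
    qed simp
    finally show "w i s \<le> ennreal \<gamma> + ennreal moment.mass * (NNINT t. ennreal (D * exp ((2 * moment.mass + 1) * t)) * indicator {0..s} t)"
      by (simp only: add.commute)
  qed
  then show ?thesis by (simp only: w_def)
qed

lemma solution_error_L1:
  assumes "fourth_moment_solution k0 r0 C \<epsilon> \<mu>" and z: "0 \<le> z" "z \<le> Z" and g: "0 \<le> \<gamma>" "defect_bound Z \<epsilon> \<le> ennreal \<gamma>"
  shows "(NNINT p. ennreal (cmod (\<mu> z p - approx \<epsilon> z p))) \<le> ennreal (2 * \<gamma> * exp ((2 * measure jump_measure (space jump_measure) + 1) * z))"
proof -
  have "(NNINT p. ennreal (cmod (\<mu> z p - approx \<epsilon> z p))) = (NNINT p. ennreal (cmod (moment.sol z p - approx \<epsilon> z p)))"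
  proof (rule nn_integral_cong_AE)
    show "AE p in lborel. ennreal (cmod (\<mu> z p - approx \<epsilon> z p)) = ennreal (cmod (moment.sol z p - approx \<epsilon> z p))"
      using solution_AE_eq[OF assms(1) z(1)] by eventually_elim simp
  qed
  also have "\<dots> \<le> ennreal (2 * \<gamma> * exp ((2 * moment.mass + 1) * z))" by (rule error_L1[OF z g])
  finally show ?thesis unfolding moment.mass_def .
qed

lemma solution_error_integrable:
  assumes sol: "fourth_moment_solution k0 r0 C \<epsilon> \<mu>" and z: "0 \<le> z"
  shows "integrable lborel (\<lambda>p. \<mu> z p - approx \<epsilon> z p)"
proof (rule integrable_cong_AE_imp)
  have m: "approx \<epsilon> z \<in> borel_measurable borel" using approx_measurable[of "\<lambda>_. z" borel "\<lambda>p. p" \<epsilon>] by simp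
  have "(NNINT p. ennreal (cmod (approx \<epsilon> z p))) < \<infinity>"
    using approx_L1[OF eps z order_refl] by (auto intro: order.strict_trans1[OF _ ennreal_less_top])
  then have "integrable lborel (approx \<epsilon> z)" using m by (intro integrableI_bounded) auto
  then show "integrable lborel (\<lambda>p. moment.sol z p - approx \<epsilon> z p)"
    by (intro Bochner_Integration.integrable_diff moment.integrable_sol z)
  have "square_integrable (\<mu> z)" by (rule sol[unfolded fourth_moment_solution_def, THEN conjunct1, THEN spec, THEN mp, OF z])
  then have "\<mu> z \<in> borel_measurable lborel" by (simp only: square_integrable_def)
  then show "(\<lambda>p. \<mu> z p - approx \<epsilon> z p) \<in> borel_measurable lborel" using m by (intro borel_measurable_diff) auto
  show "AE p in lborel. moment.sol z p - approx \<epsilon> z p = \<mu> z p - approx \<epsilon> z p"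
    using solution_AE_eq[OF sol z] by eventually_elim simp
qed

end

section \<open>The expansion of the fourth moment\<close>

context scintillation begin

lemma solution_error_limit:
  assumes sol: "\<And>\<epsilon>. 0 < \<epsilon> \<Longrightarrow> fourth_moment_solution k0 r0 C \<epsilon> (\<mu> \<epsilon>)" and Z: "0 < Z"
  shows "((\<lambda>\<epsilon>. SUP z\<in>{0..Z}. NNINT p. ennreal (cmod (\<mu> \<epsilon> z p - approx \<epsilon> z p))) \<longlongrightarrow> 0) (at_right 0)"
proof (rule tendsto_0_ennrealI)
  fix e :: real assume e: "0 < e"
  define M where "M = measure jump_measure (space jump_measure)"
  have M: "0 \<le> M" by (simp add: M_def)
  define \<gamma> where "\<gamma> = e / (2 * exp ((2 * M + 1) * Z))"
  have g: "0 < \<gamma>" using e by (simp add: \<gamma>_def)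
  have "eventually (\<lambda>\<epsilon>. defect_bound Z \<epsilon> < ennreal \<gamma>) (at_right 0)"
    by (rule order_tendstoD(2)[OF defect_bound_limit[OF Z]]) (use g in simp)
  moreover have "eventually (\<lambda>\<epsilon>::real. 0 < \<epsilon>) (at_right 0)" by (rule eventually_at_right_less)
  ultimately show "eventually (\<lambda>\<epsilon>. (SUP z\<in>{0..Z}. NNINT p. ennreal (cmod (\<mu> \<epsilon> z p - approx \<epsilon> z p))) \<le> ennreal e) (at_right 0)"
  proof eventually_elim
    case (elim \<epsilon>)
    interpret scintillation_scaled C k0 r0 \<epsilon> by unfold_locales (rule elim(2))
    show ?case
    proof (rule SUP_least)
      fix z assume z: "z \<in> {0..Z}"
      have "(NNINT p. ennreal (cmod (\<mu> \<epsilon> z p - approx \<epsilon> z p))) \<le> ennreal (2 * \<gamma> * exp ((2 * M + 1) * z))"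
        unfolding M_def using z elim g by (intro solution_error_L1 sol) auto
      also have "\<dots> \<le> ennreal e"
      proof (rule ennreal_leI)
        have "2 * \<gamma> * exp ((2 * M + 1) * z) \<le> 2 * \<gamma> * exp ((2 * M + 1) * Z)"
          using z g M by (intro mult_left_mono) (auto intro!: mult_left_mono)
        also have "\<dots> = e" by (simp add: \<gamma>_def)
        finally show "2 * \<gamma> * exp ((2 * M + 1) * z) \<le> e" .
      qed
      finally show "(NNINT p. ennreal (cmod (\<mu> \<epsilon> z p - approx \<epsilon> z p))) \<le> ennreal e" .
    qed
  qed
qed

lemma gg_half: "gg \<epsilon> (x /\<^sub>R 2) = phi r0 \<epsilon> (x /\<^sub>R sqrt 2)"
proof -
  have "sqrt 2 * inverse 2 = inverse (sqrt 2)"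
    using real_sqrt_mult_self[of 2] by (simp add: field_simps)
  then have "sqrt 2 *\<^sub>R (x /\<^sub>R 2) = x /\<^sub>R sqrt 2" by (simp only: scaleR_scaleR)
  then show ?thesis by (simp only: gg_def)
qed

lemma phi_minus: "phi r0 \<epsilon> ((x - y) /\<^sub>R t) = phi r0 \<epsilon> ((y - x) /\<^sub>R t)"
  by (simp add: phi_def norm_minus_commute)

end

context scintillation begin

text \<open>Multiplying out the products shows that the approximation consists of the seven explicit terms;
  the product of the four Gaussians is counted once.\<close>
lemma approx_expansion:
  defines "kk z \<equiv> complex_of_real (K k0 C z)" and "g \<epsilon> x \<equiv> complex_of_real (phi r0 \<epsilon> x)"
    and "AA z x y \<equiv> A k0 C z (x /\<^sub>R 2) y"
  shows "approx \<epsilon> z (\<xi>1, \<xi>2, \<zeta>1, \<zeta>2) =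
        kk z * g \<epsilon> \<xi>1 * g \<epsilon> \<xi>2 * g \<epsilon> \<zeta>1 * g \<epsilon> \<zeta>2
      + kk z * g \<epsilon> ((\<xi>1 - \<xi>2) /\<^sub>R sqrt 2) * g \<epsilon> \<zeta>1 * g \<epsilon> \<zeta>2 * AA z (\<xi>2 + \<xi>1) ((\<zeta>2 + \<zeta>1) /\<^sub>R \<epsilon>)
      + kk z * g \<epsilon> ((\<xi>1 + \<xi>2) /\<^sub>R sqrt 2) * g \<epsilon> \<zeta>1 * g \<epsilon> \<zeta>2 * AA z (\<xi>2 - \<xi>1) ((\<zeta>2 - \<zeta>1) /\<^sub>R \<epsilon>)
      + kk z * g \<epsilon> ((\<xi>1 - \<zeta>2) /\<^sub>R sqrt 2) * g \<epsilon> \<zeta>1 * g \<epsilon> \<xi>2 * AA z (\<zeta>2 + \<xi>1) ((\<xi>2 + \<zeta>1) /\<^sub>R \<epsilon>)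
      + kk z * g \<epsilon> ((\<xi>1 + \<zeta>2) /\<^sub>R sqrt 2) * g \<epsilon> \<zeta>1 * g \<epsilon> \<xi>2 * AA z (\<zeta>2 - \<xi>1) ((\<xi>2 - \<zeta>1) /\<^sub>R \<epsilon>)
      + kk z * g \<epsilon> \<zeta>1 * g \<epsilon> \<zeta>2 * AA z (\<xi>2 + \<xi>1) ((\<zeta>2 + \<zeta>1) /\<^sub>R \<epsilon>) * AA z (\<xi>2 - \<xi>1) ((\<zeta>2 - \<zeta>1) /\<^sub>R \<epsilon>)
      + kk z * g \<epsilon> \<zeta>1 * g \<epsilon> \<xi>2 * AA z (\<zeta>2 + \<xi>1) ((\<xi>2 + \<zeta>1) /\<^sub>R \<epsilon>) * AA z (\<zeta>2 - \<xi>1) ((\<xi>2 - \<zeta>1) /\<^sub>R \<epsilon>)"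
proof -
  have ring: "k * ((u * v * (a * b + a * gb + ga * b) + w * (x * (u * v))) + (u * y * (c * d + c * gd + gc * d) + w * (x * (u * v))) - w * (x * (u * v)))
     = k * w * x * u * v + k * gb * u * v * a + k * ga * u * v * b + k * gd * u * y * c + k * gc * u * y * d
       + k * u * v * a * b + k * u * y * c * d"
    for k u v w x y a b ga gb c d gc gd :: complex by (simp add: distrib_left mult_ac add_ac)
  have Pf: "Pf \<epsilon> z (x1, x2, y1, y2) = g \<epsilon> y1 * g \<epsilon> y2 * (AA z (x2 + x1) ((y2 + y1) /\<^sub>R \<epsilon>) * AA z (x2 - x1) ((y2 - y1) /\<^sub>R \<epsilon>)
       + AA z (x2 + x1) ((y2 + y1) /\<^sub>R \<epsilon>) * g \<epsilon> ((x1 - x2) /\<^sub>R sqrt 2)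
       + g \<epsilon> ((x1 + x2) /\<^sub>R sqrt 2) * AA z (x2 - x1) ((y2 - y1) /\<^sub>R \<epsilon>))
     + amp False False \<epsilon> z (x1, x2, y1, y2)" for x1 x2 y1 y2
  proof -
    have sum3: "(\<Sum>c\<in>Y_set. f c) = f (True, True) + f (True, False) + f (False, True)" for f :: "bool \<times> bool \<Rightarrow> complex"
      by (simp add: Y_set_def add.assoc)
    have D: "complex_of_real (phi r0 \<epsilon> y1 * phi r0 \<epsilon> y2) = g \<epsilon> y1 * g \<epsilon> y2" unfolding g_def by (rule of_real_mult)
    have G: "complex_of_real (gg \<epsilon> ((x2 + x1) /\<^sub>R 2)) = g \<epsilon> ((x1 + x2) /\<^sub>R sqrt 2)" "complex_of_real (gg \<epsilon> ((x2 - x1) /\<^sub>R 2)) = g \<epsilon> ((x1 - x2) /\<^sub>R sqrt 2)"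
      unfolding gg_half g_def by (simp_all only: phi_minus[where x=x2 and y=x1] add.commute[of x2 x1])
    have T: "amp True True \<epsilon> z (x1, x2, y1, y2) = g \<epsilon> y1 * g \<epsilon> y2 * AA z (x2 + x1) ((y2 + y1) /\<^sub>R \<epsilon>) * AA z (x2 - x1) ((y2 - y1) /\<^sub>R \<epsilon>)"
      "amp True False \<epsilon> z (x1, x2, y1, y2) = g \<epsilon> y1 * g \<epsilon> y2 * AA z (x2 + x1) ((y2 + y1) /\<^sub>R \<epsilon>) * g \<epsilon> ((x1 - x2) /\<^sub>R sqrt 2)"
      "amp False True \<epsilon> z (x1, x2, y1, y2) = g \<epsilon> y1 * g \<epsilon> y2 * g \<epsilon> ((x1 + x2) /\<^sub>R sqrt 2) * AA z (x2 - x1) ((y2 - y1) /\<^sub>R \<epsilon>)"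
      by (simp_all only: amp_def XF_def prod.case if_True if_False D G AA_def)
    show ?thesis unfolding Pf_split sum3 fst_conv snd_conv T by (simp only: distrib_left mult.assoc)
  qed
  have FF: "amp False False \<epsilon> z (\<xi>1, \<xi>2, \<zeta>1, \<zeta>2) = g \<epsilon> \<xi>1 * (g \<epsilon> \<xi>2 * (g \<epsilon> \<zeta>1 * g \<epsilon> \<zeta>2))"
    unfolding amp_FF g_def by (simp only: of_real_mult mult.assoc)
  have FF': "amp False False \<epsilon> z (\<xi>1, \<zeta>2, \<zeta>1, \<xi>2) = g \<epsilon> \<xi>1 * (g \<epsilon> \<xi>2 * (g \<epsilon> \<zeta>1 * g \<epsilon> \<zeta>2))"
    unfolding amp_FF g_def by (simp only: of_real_mult mult_ac)
  have sw: "swap (\<xi>1, \<xi>2, \<zeta>1, \<zeta>2) = (\<xi>1, \<zeta>2, \<zeta>1, \<xi>2)" by (simp only: swap_def prod.case)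
  have sc: "K k0 C z *\<^sub>R x = kk z * x" for x :: complex unfolding kk_def by (rule scaleR_conv_of_real)
  show ?thesis unfolding approx_def sw Pf FF FF' sc ring ..
qed

end

theorem proposition8p1:
  fixes k0 r0 :: real
    and C :: "real ^ 2 \<Rightarrow> real"
    and \<mu> :: "real \<Rightarrow> real \<Rightarrow> (real ^ 2) \<times> (real ^ 2) \<times> (real ^ 2) \<times> (real ^ 2) \<Rightarrow> complex"
  assumes "k0 > 0" and "r0 > 0"
    and "covariance_function C"
    and "integrable lborel C"
    and "\<And>\<epsilon>. \<epsilon> > 0 \<Longrightarrow> fourth_moment_solution k0 r0 C \<epsilon> (\<mu> \<epsilon>)"
  shows "\<exists>R :: real \<Rightarrow> real \<Rightarrow> (real ^ 2) \<times> (real ^ 2) \<times> (real ^ 2) \<times> (real ^ 2) \<Rightarrow> complex.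
    (\<forall>\<epsilon>>0. \<forall>z\<ge>0. \<forall>\<xi>1 \<xi>2 \<zeta>1 \<zeta>2.
      \<mu> \<epsilon> z (\<xi>1, \<xi>2, \<zeta>1, \<zeta>2) =
        K k0 C z * phi r0 \<epsilon> \<xi>1 * phi r0 \<epsilon> \<xi>2 * phi r0 \<epsilon> \<zeta>1 * phi r0 \<epsilon> \<zeta>2
      + K k0 C z * phi r0 \<epsilon> ((\<xi>1 - \<xi>2) /\<^sub>R sqrt 2) * phi r0 \<epsilon> \<zeta>1 * phi r0 \<epsilon> \<zeta>2
          * A k0 C z ((\<xi>2 + \<xi>1) /\<^sub>R 2) ((\<zeta>2 + \<zeta>1) /\<^sub>R \<epsilon>)
      + K k0 C z * phi r0 \<epsilon> ((\<xi>1 + \<xi>2) /\<^sub>R sqrt 2) * phi r0 \<epsilon> \<zeta>1 * phi r0 \<epsilon> \<zeta>2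
          * A k0 C z ((\<xi>2 - \<xi>1) /\<^sub>R 2) ((\<zeta>2 - \<zeta>1) /\<^sub>R \<epsilon>)
      + K k0 C z * phi r0 \<epsilon> ((\<xi>1 - \<zeta>2) /\<^sub>R sqrt 2) * phi r0 \<epsilon> \<zeta>1 * phi r0 \<epsilon> \<xi>2
          * A k0 C z ((\<zeta>2 + \<xi>1) /\<^sub>R 2) ((\<xi>2 + \<zeta>1) /\<^sub>R \<epsilon>)
      + K k0 C z * phi r0 \<epsilon> ((\<xi>1 + \<zeta>2) /\<^sub>R sqrt 2) * phi r0 \<epsilon> \<zeta>1 * phi r0 \<epsilon> \<xi>2
          * A k0 C z ((\<zeta>2 - \<xi>1) /\<^sub>R 2) ((\<xi>2 - \<zeta>1) /\<^sub>R \<epsilon>)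
      + K k0 C z * phi r0 \<epsilon> \<zeta>1 * phi r0 \<epsilon> \<zeta>2
          * A k0 C z ((\<xi>2 + \<xi>1) /\<^sub>R 2) ((\<zeta>2 + \<zeta>1) /\<^sub>R \<epsilon>)
          * A k0 C z ((\<xi>2 - \<xi>1) /\<^sub>R 2) ((\<zeta>2 - \<zeta>1) /\<^sub>R \<epsilon>)
      + K k0 C z * phi r0 \<epsilon> \<zeta>1 * phi r0 \<epsilon> \<xi>2
          * A k0 C z ((\<zeta>2 + \<xi>1) /\<^sub>R 2) ((\<xi>2 + \<zeta>1) /\<^sub>R \<epsilon>)
          * A k0 C z ((\<zeta>2 - \<xi>1) /\<^sub>R 2) ((\<xi>2 - \<zeta>1) /\<^sub>R \<epsilon>)
      + R \<epsilon> z (\<xi>1, \<xi>2, \<zeta>1, \<zeta>2)) \<and>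
    (\<forall>\<epsilon>>0. \<forall>z\<ge>0. integrable lborel (R \<epsilon> z)) \<and>
    (\<forall>Z>0. ((\<lambda>\<epsilon>. SUP z\<in>{0..Z}. \<integral>\<^sup>+ p. ennreal (cmod (R \<epsilon> z p)) \<partial>lborel)
              \<longlongrightarrow> 0) (at_right 0))"
proof -
  interpret scintillation C k0 r0
    by unfold_locales (use assms in auto)
  let ?R = "\<lambda>\<epsilon> z p. \<mu> \<epsilon> z p - approx \<epsilon> z p"
  show ?thesis
  proof (rule exI[of _ ?R], intro conjI allI impI)
    fix \<epsilon> z :: real assume "0 < \<epsilon>" "0 \<le> z"
    interpret scintillation_scaled C k0 r0 \<epsilon> by unfold_locales (rule \<open>0 < \<epsilon>\<close>)
    show "integrable lborel (?R \<epsilon> z)" by (rule solution_error_integrable) (use \<open>0 < \<epsilon>\<close> \<open>0 \<le> z\<close> assms(5) in auto)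
  next
    fix Z :: real assume "0 < Z"
    then show "((\<lambda>\<epsilon>. SUP z\<in>{0..Z}. NNINT p. ennreal (cmod (?R \<epsilon> z p))) \<longlongrightarrow> 0) (at_right 0)"
      by (intro solution_error_limit assms(5))
  qed (simp only: approx_expansion of_real_mult add_diff_eq add_diff_cancel_left')
qed

end
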